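(* Let $H$ and $K$ be finite-dimensional Hopf algebras over a field $\Bbbk$ with a Hopf pairing $\sigma:K^\ast\otimes H\to\Bbbk$. Consider the left $K^{\mathrm{op}}\otimes H$-comodule algebra $H$ with coaction $h\mapsto\sum(\sigma_r(S^{-1}(h_{(3)}))\otimes h_{(1)})\otimes h_{(2)}$, the right $K^{\mathrm{op}}\otimes H$-module coalgebra $K^{\mathrm{op}}$ with action $l\otimes(k\otimes h)\mapsto kl\sigma_r(h)$ (products in $K$), and the partially admissible mapping system $(\zeta,\gamma^\ast)$ for $\iota$ given by $$\iota:H\to K^{\mathrm{op}}\otimes H,\ h\mapsto\sum\sigma_r(S^{-1}(h_{(2)}))\otimes h_{(1)},\qquad\pi:K^{\mathrm{op}}\otimes H\to K^{\mathrm{op}},\ k\otimes h\mapsto k\sigma_r(h),$$ $$\zeta:K^{\mathrm{op}}\otimes H\to H,\ k\otimes h\mapsto\varepsilon(k)h,\qquad\gamma:K^{\mathrm{op}}\to K^{\mathrm{op}}\otimes H,\ k\mapsto k\otimes1.$$ Then the left partial dual $K^{\ast\mathrm{cop}}\#H$ of $K^{\mathrm{op}}\otimes H$ determined by $(\zeta,\gamma^\ast)$ is the quantum double $K^{\ast\mathrm{cop}}\bowtie_\sigma H$.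
   Context: Conventions. Vector spaces are over $\Bbbk$, $\otimes=\otimes_\Bbbk$; $\langle-,-\rangle$ is evaluation; $S$ denotes antipodes, $\varepsilon$ counits (also unit elements of dual Hopf algebras). Identify $(H^\ast)^\ast=H$, $(K^{\mathrm{op}})^\ast=K^{\ast\mathrm{cop}}$, $(H\otimes K)^\ast=H^\ast\otimes K^\ast$. Sweedler notation for elements of $H,K,H^\ast,K^\ast$ always refers to the coproducts of these Hopf algebras themselves. Hopf pairing: $\sigma(aa',h)=\sum\sigma(a,h_{(1)})\sigma(a',h_{(2)})$, $\sigma(a,hh')=\sum\sigma(a_{(1)},h)\sigma(a_{(2)},h')$, $\sigma(1,h)=\varepsilon(h)$, $\sigma(a,1)=\varepsilon(a)$. It induces the Hopf algebra map $\sigma_r:H\to K=K^{\ast\ast}$, $h\mapsto\sigma(-,h)$. Quantum double: with $\overline\sigma=\sigma\circ(\mathrm{id}\otimes S_H^{-1})$, $K^{\ast\mathrm{cop}}\bowtie_\sigma H$ is the Hopf algebra on $K^{\ast\mathrm{cop}}\otimes H$ with product $(k^\ast\bowtie h)(k'^\ast\bowtie h')=\sum\sigma(k'^\ast_{(3)},h_{(1)})k^\ast k'^\ast_{(2)}\bowtie h_{(2)}h'\overline\sigma(k'^\ast_{(1)},h_{(3)})$, unit $\varepsilon\bowtie1$, coproduct $\Delta(k^\ast\bowtie h)=\sum(k^\ast_{(2)}\bowtie h_{(1)})\otimes(k^\ast_{(1)}\bowtie h_{(2)})$, counit $k^\ast\bowtie h\mapsto\langle k^\ast,1\rangle\varepsilon(h)$,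 antipode $S(k^\ast\bowtie h)=(\varepsilon\bowtie S_H(h))(S_{K^\ast}^{-1}(k^\ast)\bowtie1)$. Partially admissible mapping system. Let $A$ be a finite-dimensional Hopf algebra, $\iota:B\rightarrowtail A$ an injection of left $A$-comodule algebras, $\pi:A\twoheadrightarrow C$ a surjection of right $A$-module coalgebras, such that $\iota(B)$ is the space of coinvariants of the right $C$-comodule $A$ with coaction $(\mathrm{id}_A\otimes\pi)\Delta$. Put $1_C=\pi(1_A)$, $\varepsilon_B=\varepsilon_A\circ\iota$. Linear maps $\zeta:A\to B$, $\gamma:C\to A$ give a partially admissible mapping system $(\zeta,\gamma^\ast)$ for $\iota$ if: both are convolution invertible; $\zeta$ is left $B$-linear ($B$ acting on $A$ through $\iota$) and $\gamma$ is right $C$-colinear; $\zeta(1_A)=1_B$, $\varepsilon_B\zeta=\varepsilon_A$, $\gamma(1_C)=1_A$, $\varepsilon_A\gamma=\varepsilon_C$; and $(\iota\circ\zeta)\ast(\gamma\circ\pi)=\mathrm{id}_A$ (convolution). Left partial dual. Write $b\mapsto\sum b_{(1)}\otimes b_{(2)}\in A\otimes B$ for the coaction on $B$ and $x^\ast\mapsto\sum x^\ast_{(1)}\otimes x^\ast_{(2)}\in C^\ast\otimes A^\ast$ for the right $A^\ast$-coaction on $C^\ast$ dual to the right $A$-action on $C$; put $a\rightharpoonup x^\ast=\sum x^\ast_{(1)}\langle x^\ast_{(2)},a\rangle$ and $a\leftharpoonup f=\sum\langle f,a_{(1)}\rangle a_{(2)}$ for $a\in A,f\in A^\ast$. Let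 $\{x_i\}$ be a basis of $C$ with dual basis $\{x_i^\ast\}$. The left partial dual $C^\ast\#B$ of $A$ determined by $(\zeta,\gamma^\ast)$ is the quasi-Hopf algebra on $C^\ast\otimes B$ with product $(x^\ast\#b)(y^\ast\#c)=\sum x^\ast(b_{(1)}\rightharpoonup y^\ast)\#b_{(2)}c$, unit $\varepsilon\#1$, comultiplication $\mathbf\Delta(x^\ast\#b)=\mathbf\Delta(x^\ast\#1)\mathbf\Delta(\varepsilon\#b)$ where $\mathbf\Delta(x^\ast\#1)=\sum_i(x^\ast_{(1)}\#\zeta[\gamma(x_i)\leftharpoonup x^\ast_{(2)}])\otimes(x_i^\ast\#1)$ and $\mathbf\Delta(\varepsilon\#b)=\sum_i(\varepsilon\#\zeta[\gamma(x_i)b_{(1)}])\otimes(x_i^\ast\#b_{(2)})$, counit $x^\ast\#b\mapsto\langle x^\ast,1_C\rangle\langle\varepsilon_B,b\rangle$, and associator the inverse of $\sum_{i,j}(\varepsilon\#\zeta[\gamma(x_i)\gamma(x_j)_{(1)}])\otimes(x_i^\ast\#\zeta[\gamma(x_j)_{(2)}])\otimes(x_j^\ast\#1)$. When the associator is trivial it is a Hopf algebra, with its unique antipode. Here $A=K^{\mathrm{op}}\otimes H$, $B=H$, $C=K^{\mathrm{op}}$, and "is" means equality of structures under $k^\ast\#h\leftrightarrow k^\ast\bowtie h$. *)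

theory Defs
  imports Complex_Main "HOL-Library.Function_Algebras"
begin

section \<open>Vector spaces, linear and bilinear maps\<close>

text \<open>
  A vector space is a subspace \<open>car\<close> of an ambient type carrying a library \<^const>\<open>vector_space\<close>
  structure.  (A space that fills its type has \<open>car = UNIV\<close>.)  Carriers cannot be avoided, since
  duals and tensor products are subspaces of function types.  The vector space structure of a
  function type is always the pointwise one.
\<close>

record ('f, 'v) vs =
  car :: "'v set"
  scl :: "'f \<Rightarrow> 'v \<Rightarrow> 'v"

definition is_vs :: "('f::field, 'v::ab_group_add, 'x) vs_scheme \<Rightarrow> bool" where
  "is_vs V \<longleftrightarrow> vector_space (scl V) \<and> module.subspace (scl V) (car V)"

definition fin_dim :: "('f::field, 'v::ab_group_add, 'x) vs_scheme \<Rightarrow> bool" where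
  "fin_dim V \<longleftrightarrow> (\<exists>X. finite X \<and> module.span (scl V) X = car V)"

definition is_basis :: "('f::field, 'v::ab_group_add, 'x) vs_scheme \<Rightarrow> 'v set \<Rightarrow> bool" where
  "is_basis V X \<longleftrightarrow> \<not> module.dependent (scl V) X \<and> module.span (scl V) X = car V"

definition field_vs :: "('f::field, 'f) vs" where
  "field_vs = \<lparr>car = UNIV, scl = (*)\<rparr>"

definition lin :: "('f::field, 'v::ab_group_add, 'x) vs_scheme \<Rightarrow>
    ('f, 'w::ab_group_add, 'y) vs_scheme \<Rightarrow> ('v \<Rightarrow> 'w) \<Rightarrow> bool" where
  "lin V W f \<longleftrightarrow> (\<forall>v\<in>car V. f v \<in> car W) \<and>
     (\<forall>v\<in>car V. \<forall>v'\<in>car V. f (v + v') = f v + f v') \<and>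
     (\<forall>c. \<forall>v\<in>car V. f (scl V c v) = scl W c (f v))"

definition bilin :: "('f::field, 'v::ab_group_add, 'x) vs_scheme \<Rightarrow>
    ('f, 'w::ab_group_add, 'y) vs_scheme \<Rightarrow> ('f, 'u::ab_group_add, 'z) vs_scheme \<Rightarrow>
    ('v \<Rightarrow> 'w \<Rightarrow> 'u) \<Rightarrow> bool" where
  "bilin V W U b \<longleftrightarrow> (\<forall>w\<in>car W. lin V U (\<lambda>v. b v w)) \<and> (\<forall>v\<in>car V. lin W U (b v))"


section \<open>Tensor products\<close>

text \<open>
  Over a field, \<open>V \<otimes> W\<close> embeds into the dual of the space of bilinear forms on \<open>V \<times> W\<close> by sending
  \<open>v \<otimes> w\<close> to evaluation at \<open>(v, w)\<close>; the tensor product is realised as the span of these evaluations.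
\<close>

type_synonym ('f, 'v, 'w) tensor = "('v \<Rightarrow> 'w \<Rightarrow> 'f) \<Rightarrow> 'f"

definition pure :: "('f::field, 'v::ab_group_add, 'x) vs_scheme \<Rightarrow>
    ('f, 'w::ab_group_add, 'y) vs_scheme \<Rightarrow> 'v \<Rightarrow> 'w \<Rightarrow> ('f, 'v, 'w) tensor" where
  "pure V W v w = (\<lambda>b. if bilin V W field_vs b then b v w else 0)"

definition tens :: "('f::field, 'v::ab_group_add, 'x) vs_scheme \<Rightarrow>
    ('f, 'w::ab_group_add, 'y) vs_scheme \<Rightarrow> ('f, ('f, 'v, 'w) tensor) vs" where
  "tens V W = \<lparr>car = module.span (\<lambda>c t b. c * t b) {pure V W v w |v w. v \<in> car V \<and> w \<in> car W},
               scl = (\<lambda>c t b. c * t b)\<rparr>"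

text \<open>
  Sweedler notation: for \<open>t \<in> V \<otimes> W\<close>, choose an expression \<open>t = \<Sum> v \<otimes> w\<close> with \<open>v \<in> V\<close>, \<open>w \<in> W\<close>; then
  \<open>tsum V W t b\<close> is \<open>\<Sum> b v w\<close>.  For bilinear \<open>b\<close> this is the linear map on \<open>V \<otimes> W\<close> induced by \<open>b\<close>,
  independently of the choice.
\<close>

definition sweedler :: "('f::field, 'v::ab_group_add, 'x) vs_scheme \<Rightarrow>
    ('f, 'w::ab_group_add, 'y) vs_scheme \<Rightarrow> ('f, 'v, 'w) tensor \<Rightarrow> ('v \<times> 'w) list" where
  "sweedler V W t = (SOME xs. set xs \<subseteq> car V \<times> car W \<and> t = (\<Sum>(v, w)\<leftarrow>xs. pure V W v w))"

definition tsum :: "('f::field, 'v::ab_group_add, 'x) vs_scheme \<Rightarrow>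
    ('f, 'w::ab_group_add, 'y) vs_scheme \<Rightarrow> ('f, 'v, 'w) tensor \<Rightarrow>
    ('v \<Rightarrow> 'w \<Rightarrow> 'u::ab_group_add) \<Rightarrow> 'u" where
  "tsum V W t b = (\<Sum>(v, w)\<leftarrow>sweedler V W t. b v w)"

lemma separating_functional:
  assumes "vector_space (s :: 'f::field \<Rightarrow> 'u::ab_group_add \<Rightarrow> 'u)" and "d \<noteq> 0"
  shows "\<exists>p. Vector_Spaces.linear s (*) p \<and> p d = 1"
proof -
  interpret vector_space s by fact
  interpret f: vector_space "(*) :: 'f \<Rightarrow> 'f \<Rightarrow> 'f" by unfold_locales (auto simp: algebra_simps)
  interpret vp: vector_space_pair s "(*)" ..
  have "independent {d}" using assms(2) by simp
  from vp.linear_independent_extend[OF this, of "\<lambda>_. 1"] show ?thesis by auto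
qed

lemma tsum_eq:
  assumes V: "is_vs V" and W: "is_vs W" and U: "is_vs U" and b: "bilin V W U b"
    and xs: "set xs \<subseteq> car V \<times> car W" "t = (\<Sum>(v, w)\<leftarrow>xs. pure V W v w)"
  shows "tsum V W t b = (\<Sum>(v, w)\<leftarrow>xs. b v w)"
proof (rule ccontr)
  define ys where "ys = sweedler V W t"
  have ys: "set ys \<subseteq> car V \<times> car W \<and> t = (\<Sum>(v, w)\<leftarrow>ys. pure V W v w)"
    unfolding ys_def sweedler_def by (rule someI[of _ xs]) (use xs in auto)
  assume "\<not> ?thesis"
  hence "(\<Sum>(v, w)\<leftarrow>ys. b v w) - (\<Sum>(v, w)\<leftarrow>xs. b v w) \<noteq> 0" by (simp add: tsum_def ys_def)
  then obtain p where p: "Vector_Spaces.linear (scl U) (*) p"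
    and p1: "p ((\<Sum>(v, w)\<leftarrow>ys. b v w) - (\<Sum>(v, w)\<leftarrow>xs. b v w)) = 1"
    using separating_functional[of "scl U"] U unfolding is_vs_def by blast
  interpret p: Vector_Spaces.linear "scl U" "(*)" p by fact
  have bl: "bilin V W field_vs (\<lambda>v w. p (b v w))"
    using b by (auto simp: bilin_def lin_def field_vs_def p.add p.scale)
  have *: "p (\<Sum>(v, w)\<leftarrow>zs. b v w) = (\<Sum>(v, w)\<leftarrow>zs. pure V W v w) (\<lambda>v w. p (b v w))" for zs
    using bl by (induction zs) (auto simp: p.add p.zero pure_def)
  show False using p1 * ys xs by (simp add: p.diff)
qed


section \<open>Algebras and coalgebras\<close>

record ('f, 'v) alg = "('f, 'v) vs" +
  mul :: "'v \<Rightarrow> 'v \<Rightarrow> 'v"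
  uni :: 'v

record ('f, 'v) coalg = "('f, 'v) vs" +
  cop :: "'v \<Rightarrow> ('f, 'v, 'v) tensor"
  cou :: "'v \<Rightarrow> 'f"

record ('f, 'v) bialg = "('f, 'v) alg" +
  bcop :: "'v \<Rightarrow> ('f, 'v, 'v) tensor"
  bcou :: "'v \<Rightarrow> 'f"

record ('f, 'v) hopf = "('f, 'v) bialg" +
  ant :: "'v \<Rightarrow> 'v"

record ('f, 'v) quasi = "('f, 'v) bialg" +
  associator :: "('f, 'v, ('f, 'v, 'v) tensor) tensor"

definition coalg_of :: "('f, 'v, 'x) bialg_scheme \<Rightarrow> ('f, 'v) coalg" where
  "coalg_of H = \<lparr>car = car H, scl = scl H, cop = bcop H, cou = bcou H\<rparr>"

text \<open>\<open>sw2 C c f\<close> is \<open>\<Sum> f c\<^sub>(\<^sub>1\<^sub>) c\<^sub>(\<^sub>2\<^sub>)\<close>, and \<open>sw3 C c f\<close> is \<open>\<Sum> f c\<^sub>(\<^sub>1\<^sub>) c\<^sub>(\<^sub>2\<^sub>) c\<^sub>(\<^sub>3\<^sub>)\<close>.\<close>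

definition sw2 :: "('f::field, 'v::ab_group_add, 'x) coalg_scheme \<Rightarrow> 'v \<Rightarrow>
    ('v \<Rightarrow> 'v \<Rightarrow> 'u::ab_group_add) \<Rightarrow> 'u" where
  "sw2 C c f = tsum C C (cop C c) f"

definition sw3 :: "('f::field, 'v::ab_group_add, 'x) coalg_scheme \<Rightarrow> 'v \<Rightarrow>
    ('v \<Rightarrow> 'v \<Rightarrow> 'v \<Rightarrow> 'u::ab_group_add) \<Rightarrow> 'u" where
  "sw3 C c f = sw2 C c (\<lambda>c' c3. sw2 C c' (\<lambda>c1 c2. f c1 c2 c3))"

definition is_alg :: "('f::field, 'v::ab_group_add, 'x) alg_scheme \<Rightarrow> bool" where
  "is_alg A \<longleftrightarrow> is_vs A \<and> bilin A A A (mul A) \<and> uni A \<in> car A \<and>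
     (\<forall>a\<in>car A. \<forall>b\<in>car A. \<forall>c\<in>car A. mul A (mul A a b) c = mul A a (mul A b c)) \<and>
     (\<forall>a\<in>car A. mul A (uni A) a = a \<and> mul A a (uni A) = a)"

definition is_coalg :: "('f::field, 'v::ab_group_add, 'x) coalg_scheme \<Rightarrow> bool" where
  "is_coalg C \<longleftrightarrow> is_vs C \<and> lin C (tens C C) (cop C) \<and> lin C field_vs (cou C) \<and>
     (\<forall>c\<in>car C. sw2 C c (\<lambda>c1 c'. sw2 C c' (\<lambda>c2 c3. pure C (tens C C) c1 (pure C C c2 c3))) =
                sw2 C c (\<lambda>c' c3. sw2 C c' (\<lambda>c1 c2. pure C (tens C C) c1 (pure C C c2 c3)))) \<and>
     (\<forall>c\<in>car C. sw2 C c (\<lambda>c1 c2. scl C (cou C c1) c2) = c \<and>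
                sw2 C c (\<lambda>c1 c2. scl C (cou C c2) c1) = c)"

definition talg :: "('f::field, 'v::ab_group_add, 'x) alg_scheme \<Rightarrow>
    ('f, 'w::ab_group_add, 'y) alg_scheme \<Rightarrow> ('f, ('f, 'v, 'w) tensor) alg" where
  "talg A B = \<lparr>car = car (tens A B), scl = scl (tens A B),
     mul = (\<lambda>s t. tsum A B s (\<lambda>a b. tsum A B t (\<lambda>a' b'. pure A B (mul A a a') (mul B b b')))),
     uni = pure A B (uni A) (uni B)\<rparr>"

definition conv :: "('f::field, 'v::ab_group_add, 'x) coalg_scheme \<Rightarrow>
    ('f, 'w::ab_group_add, 'y) alg_scheme \<Rightarrow> ('v \<Rightarrow> 'w) \<Rightarrow> ('v \<Rightarrow> 'w) \<Rightarrow> 'v \<Rightarrow> 'w" where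
  "conv C A f g = (\<lambda>c. sw2 C c (\<lambda>c1 c2. mul A (f c1) (g c2)))"

definition conv_invertible :: "('f::field, 'v::ab_group_add, 'x) coalg_scheme \<Rightarrow>
    ('f, 'w::ab_group_add, 'y) alg_scheme \<Rightarrow> ('v \<Rightarrow> 'w) \<Rightarrow> bool" where
  "conv_invertible C A f \<longleftrightarrow> (\<exists>g. lin C A g \<and>
     (\<forall>c\<in>car C. conv C A f g c = scl A (cou C c) (uni A) \<and>
                conv C A g f c = scl A (cou C c) (uni A)))"


section \<open>Hopf algebras\<close>

definition is_bialg :: "('f::field, 'v::ab_group_add, 'x) bialg_scheme \<Rightarrow> bool" where
  "is_bialg H \<longleftrightarrow> is_alg H \<and> is_coalg (coalg_of H) \<and>
     (\<forall>a\<in>car H. \<forall>b\<in>car H. bcop H (mul H a b) = mul (talg H H) (bcop H a) (bcop H b)) \<and>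
     bcop H (uni H) = uni (talg H H) \<and>
     (\<forall>a\<in>car H. \<forall>b\<in>car H. bcou H (mul H a b) = bcou H a * bcou H b) \<and>
     bcou H (uni H) = 1"

definition is_antipode :: "('f::field, 'v::ab_group_add, 'x) bialg_scheme \<Rightarrow> ('v \<Rightarrow> 'v) \<Rightarrow> bool" where
  "is_antipode H S \<longleftrightarrow> lin H H S \<and>
     (\<forall>h\<in>car H. conv (coalg_of H) H S (\<lambda>h. h) h = scl H (bcou H h) (uni H) \<and>
                conv (coalg_of H) H (\<lambda>h. h) S h = scl H (bcou H h) (uni H))"

definition is_hopf :: "('f::field, 'v::ab_group_add, 'x) hopf_scheme \<Rightarrow> bool" where
  "is_hopf H \<longleftrightarrow> is_bialg H \<and> is_antipode H (ant H)"

text \<open>Inverse of the antipode, which is bijective in finite dimension.\<close>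

definition inv_ant :: "('f, 'v, 'x) hopf_scheme \<Rightarrow> 'v \<Rightarrow> 'v" where
  "inv_ant H = inv_into (car H) (ant H)"

definition op_hopf :: "('f, 'v) hopf \<Rightarrow> ('f, 'v) hopf" where
  "op_hopf K = K\<lparr>mul := (\<lambda>x y. mul K y x), ant := inv_ant K\<rparr>"

definition thopf :: "('f::field, 'v::ab_group_add) hopf \<Rightarrow> ('f, 'w::ab_group_add) hopf \<Rightarrow>
    ('f, ('f, 'v, 'w) tensor) hopf" where
  "thopf K H = \<lparr>car = car (tens K H), scl = scl (tens K H),
     mul = mul (talg K H), uni = uni (talg K H),
     bcop = (\<lambda>t. tsum K H t (\<lambda>k h.
       sw2 (coalg_of K) k (\<lambda>k1 k2. sw2 (coalg_of H) h (\<lambda>h1 h2.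
         pure (tens K H) (tens K H) (pure K H k1 h1) (pure K H k2 h2))))),
     bcou = (\<lambda>t. tsum K H t (\<lambda>k h. bcou K k * bcou H h)),
     ant = (\<lambda>t. tsum K H t (\<lambda>k h. pure K H (ant K k) (ant H h)))\<rparr>"

text \<open>
  Linear functionals on \<open>V\<close> are normalised to vanish outside \<open>car V\<close>, so that equal functionals are
  equal functions.  Below, \<open>dual_map V f\<close> is the normalisation of a functional \<open>f\<close>.
\<close>

definition dual_vs :: "('f::field, 'v::ab_group_add, 'x) vs_scheme \<Rightarrow> ('f, 'v \<Rightarrow> 'f) vs" where
  "dual_vs V = \<lparr>car = {f. lin V field_vs f \<and> (\<forall>v. v \<notin> car V \<longrightarrow> f v = 0)}, scl = (\<lambda>c f v. c * f v)\<rparr>"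

definition dual_map :: "('f::field, 'v, 'x) vs_scheme \<Rightarrow> ('v \<Rightarrow> 'f) \<Rightarrow> 'v \<Rightarrow> 'f" where
  "dual_map V f = (\<lambda>v. if v \<in> car V then f v else 0)"

definition dual_alg :: "('f::field, 'v::ab_group_add, 'x) coalg_scheme \<Rightarrow> ('f, 'v \<Rightarrow> 'f) alg" where
  "dual_alg C = \<lparr>car = car (dual_vs C), scl = scl (dual_vs C),
     mul = (\<lambda>f g. dual_map C (\<lambda>c. sw2 C c (\<lambda>c1 c2. f c1 * g c2))),
     uni = dual_map C (cou C)\<rparr>"

text \<open>
  The coproduct of \<open>H\<^sup>*\<close> is characterised by \<open>\<langle>f, x y\<rangle> = \<Sum> \<langle>f\<^sub>(\<^sub>1\<^sub>), x\<rangle> \<langle>f\<^sub>(\<^sub>2\<^sub>), y\<rangle>\<close>; it exists for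
  finite-dimensional \<open>H\<close>.
\<close>

definition dual_hopf :: "('f::field, 'v::ab_group_add) hopf \<Rightarrow> ('f, 'v \<Rightarrow> 'f) hopf" where
  "dual_hopf H = \<lparr>car = car (dual_vs H), scl = scl (dual_vs H),
     mul = mul (dual_alg (coalg_of H)), uni = uni (dual_alg (coalg_of H)),
     bcop = (\<lambda>f. THE t. t \<in> car (tens (dual_vs H) (dual_vs H)) \<and>
       (\<forall>x\<in>car H. \<forall>y\<in>car H. f (mul H x y) = tsum (dual_vs H) (dual_vs H) t (\<lambda>f1 f2. f1 x * f2 y))),
     bcou = (\<lambda>f. f (uni H)),
     ant = (\<lambda>f. dual_map H (\<lambda>x. f (ant H x)))\<rparr>"

text \<open>Equality of Hopf algebra structures; operations are only compared on the carrier.\<close>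

definition same_hopf :: "('f::field, 'v::ab_group_add) hopf \<Rightarrow> ('f, 'v) hopf \<Rightarrow> bool" where
  "same_hopf H H' \<longleftrightarrow> car H = car H' \<and>
     (\<forall>c. \<forall>x\<in>car H. scl H c x = scl H' c x) \<and>
     (\<forall>x\<in>car H. \<forall>y\<in>car H. mul H x y = mul H' x y) \<and>
     uni H = uni H' \<and>
     (\<forall>x\<in>car H. bcop H x = bcop H' x) \<and>
     (\<forall>x\<in>car H. bcou H x = bcou H' x) \<and>
     (\<forall>x\<in>car H. ant H x = ant H' x)"


section \<open>Hopf pairings and the quantum double\<close>

definition hopf_pairing :: "('f::field, 'a::ab_group_add) hopf \<Rightarrow> ('f, 'h::ab_group_add) hopf \<Rightarrow>
    ('a \<Rightarrow> 'h \<Rightarrow> 'f) \<Rightarrow> bool" where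
  "hopf_pairing A H \<sigma> \<longleftrightarrow> bilin A H field_vs \<sigma> \<and>
     (\<forall>a\<in>car A. \<forall>a'\<in>car A. \<forall>h\<in>car H.
        \<sigma> (mul A a a') h = sw2 (coalg_of H) h (\<lambda>h1 h2. \<sigma> a h1 * \<sigma> a' h2)) \<and>
     (\<forall>a\<in>car A. \<forall>h\<in>car H. \<forall>h'\<in>car H.
        \<sigma> a (mul H h h') = sw2 (coalg_of A) a (\<lambda>a1 a2. \<sigma> a1 h * \<sigma> a2 h')) \<and>
     (\<forall>h\<in>car H. \<sigma> (uni A) h = bcou H h) \<and>
     (\<forall>a\<in>car A. \<sigma> a (uni H) = bcou A a)"

text \<open>The map \<open>H \<rightarrow> K = K\<^sup>*\<^sup>*\<close>, \<open>h \<mapsto> \<sigma>(-, h)\<close>.\<close>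

definition sigma_r :: "('f::field, 'k::ab_group_add) hopf \<Rightarrow> (('k \<Rightarrow> 'f) \<Rightarrow> 'h \<Rightarrow> 'f) \<Rightarrow> 'h \<Rightarrow> 'k" where
  "sigma_r K \<sigma> h = (THE k. k \<in> car K \<and> (\<forall>f\<in>car (dual_vs K). f k = \<sigma> f h))"

definition double_mul :: "('f::field, 'k::ab_group_add) hopf \<Rightarrow> ('f, 'h::ab_group_add) hopf \<Rightarrow>
    (('k \<Rightarrow> 'f) \<Rightarrow> 'h \<Rightarrow> 'f) \<Rightarrow>
    ('f, 'k \<Rightarrow> 'f, 'h) tensor \<Rightarrow> ('f, 'k \<Rightarrow> 'f, 'h) tensor \<Rightarrow> ('f, 'k \<Rightarrow> 'f, 'h) tensor" where
  "double_mul K H \<sigma> s t = (let Kd = dual_hopf K in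
     tsum Kd H s (\<lambda>p h. tsum Kd H t (\<lambda>q h'.
       sw3 (coalg_of Kd) q (\<lambda>q1 q2 q3. sw3 (coalg_of H) h (\<lambda>h1 h2 h3.
         scl (tens Kd H) (\<sigma> q3 h1 * \<sigma> q1 (inv_ant H h3))
           (pure Kd H (mul Kd p q2) (mul H h2 h')))))))"

definition quantum_double :: "('f::field, 'k::ab_group_add) hopf \<Rightarrow> ('f, 'h::ab_group_add) hopf \<Rightarrow>
    (('k \<Rightarrow> 'f) \<Rightarrow> 'h \<Rightarrow> 'f) \<Rightarrow> ('f, ('f, 'k \<Rightarrow> 'f, 'h) tensor) hopf" where
  "quantum_double K H \<sigma> = (let Kd = dual_hopf K in
     \<lparr>car = car (tens Kd H), scl = scl (tens Kd H),
      mul = double_mul K H \<sigma>,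
      uni = pure Kd H (uni Kd) (uni H),
      bcop = (\<lambda>t. tsum Kd H t (\<lambda>p h.
        sw2 (coalg_of Kd) p (\<lambda>p1 p2. sw2 (coalg_of H) h (\<lambda>h1 h2.
          pure (tens Kd H) (tens Kd H) (pure Kd H p2 h1) (pure Kd H p1 h2))))),
      bcou = (\<lambda>t. tsum Kd H t (\<lambda>p h. p (uni K) * bcou H h)),
      ant = (\<lambda>t. tsum Kd H t (\<lambda>p h.
        double_mul K H \<sigma> (pure Kd H (uni Kd) (ant H h)) (pure Kd H (inv_ant Kd p) (uni H))))\<rparr>)"


section \<open>Partially admissible mapping systems\<close>

definition left_comodule_algebra :: "('f::field, 'a::ab_group_add) hopf \<Rightarrow>
    ('f, 'b::ab_group_add) alg \<Rightarrow> ('b \<Rightarrow> ('f, 'a, 'b) tensor) \<Rightarrow> bool" where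
  "left_comodule_algebra A B \<delta> \<longleftrightarrow> is_alg B \<and> lin B (tens A B) \<delta> \<and>
     (\<forall>b\<in>car B.
        tsum A B (\<delta> b) (\<lambda>a b'. tsum A B (\<delta> b') (\<lambda>a' b''. pure A (tens A B) a (pure A B a' b''))) =
        tsum A B (\<delta> b) (\<lambda>a b'. sw2 (coalg_of A) a (\<lambda>a1 a2. pure A (tens A B) a1 (pure A B a2 b'))) \<and>
        tsum A B (\<delta> b) (\<lambda>a b'. scl B (bcou A a) b') = b) \<and>
     (\<forall>b\<in>car B. \<forall>c\<in>car B. \<delta> (mul B b c) = mul (talg A B) (\<delta> b) (\<delta> c)) \<and>
     \<delta> (uni B) = uni (talg A B)"

definition right_module_coalgebra :: "('f::field, 'a::ab_group_add) hopf \<Rightarrow>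
    ('f, 'c::ab_group_add) coalg \<Rightarrow> ('c \<Rightarrow> 'a \<Rightarrow> 'c) \<Rightarrow> bool" where
  "right_module_coalgebra A C act \<longleftrightarrow> is_coalg C \<and> bilin C A C act \<and>
     (\<forall>x\<in>car C. \<forall>a\<in>car A. \<forall>b\<in>car A. act (act x a) b = act x (mul A a b)) \<and>
     (\<forall>x\<in>car C. act x (uni A) = x) \<and>
     (\<forall>x\<in>car C. \<forall>a\<in>car A.
        cop C (act x a) = sw2 C x (\<lambda>x1 x2. sw2 (coalg_of A) a (\<lambda>a1 a2.
          pure C C (act x1 a1) (act x2 a2))) \<and>
        cou C (act x a) = cou C x * bcou A a)"

text \<open>\<open>A\<close> is a left comodule algebra over itself via its coproduct.\<close>

definition comodule_algebra_injection :: "('f::field, 'a::ab_group_add) hopf \<Rightarrow>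
    ('f, 'b::ab_group_add) alg \<Rightarrow> ('b \<Rightarrow> ('f, 'a, 'b) tensor) \<Rightarrow> ('b \<Rightarrow> 'a) \<Rightarrow> bool" where
  "comodule_algebra_injection A B \<delta> \<iota> \<longleftrightarrow> lin B A \<iota> \<and> inj_on \<iota> (car B) \<and>
     (\<forall>b\<in>car B. \<forall>c\<in>car B. \<iota> (mul B b c) = mul A (\<iota> b) (\<iota> c)) \<and> \<iota> (uni B) = uni A \<and>
     (\<forall>b\<in>car B. bcop A (\<iota> b) = tsum A B (\<delta> b) (\<lambda>a b'. pure A A a (\<iota> b')))"

text \<open>\<open>A\<close> is a right module coalgebra over itself via its product.\<close>

definition module_coalgebra_surjection :: "('f::field, 'a::ab_group_add) hopf \<Rightarrow>
    ('f, 'c::ab_group_add) coalg \<Rightarrow> ('c \<Rightarrow> 'a \<Rightarrow> 'c) \<Rightarrow> ('a \<Rightarrow> 'c) \<Rightarrow> bool" where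
  "module_coalgebra_surjection A C act \<pi> \<longleftrightarrow> lin A C \<pi> \<and> \<pi> ` car A = car C \<and>
     (\<forall>a\<in>car A. cop C (\<pi> a) = sw2 (coalg_of A) a (\<lambda>a1 a2. pure C C (\<pi> a1) (\<pi> a2)) \<and>
                cou C (\<pi> a) = bcou A a) \<and>
     (\<forall>a\<in>car A. \<forall>b\<in>car A. \<pi> (mul A a b) = act (\<pi> a) b)"

definition right_coinvariants :: "('f::field, 'a::ab_group_add) hopf \<Rightarrow>
    ('f, 'c::ab_group_add) coalg \<Rightarrow> ('a \<Rightarrow> 'c) \<Rightarrow> 'a set" where
  "right_coinvariants A C \<pi> =
     {a \<in> car A. sw2 (coalg_of A) a (\<lambda>a1 a2. pure A C a1 (\<pi> a2)) = pure A C a (\<pi> (uni A))}"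

text \<open>
  The system is \<open>(\<zeta>, \<gamma>\<^sup>*)\<close>, \<open>\<gamma>\<^sup>*\<close> being the transpose of \<open>\<gamma>\<close>; it is given here through \<open>\<gamma>\<close> itself.
\<close>

definition partially_admissible :: "('f::field, 'a::ab_group_add) hopf \<Rightarrow>
    ('f, 'b::ab_group_add) alg \<Rightarrow> ('b \<Rightarrow> ('f, 'a, 'b) tensor) \<Rightarrow>
    ('f, 'c::ab_group_add) coalg \<Rightarrow> ('c \<Rightarrow> 'a \<Rightarrow> 'c) \<Rightarrow>
    ('b \<Rightarrow> 'a) \<Rightarrow> ('a \<Rightarrow> 'c) \<Rightarrow> ('a \<Rightarrow> 'b) \<Rightarrow> ('c \<Rightarrow> 'a) \<Rightarrow> bool" where
  "partially_admissible A B \<delta> C act \<iota> \<pi> \<zeta> \<gamma> \<longleftrightarrow>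
     is_hopf A \<and> fin_dim A \<and>
     left_comodule_algebra A B \<delta> \<and> comodule_algebra_injection A B \<delta> \<iota> \<and>
     right_module_coalgebra A C act \<and> module_coalgebra_surjection A C act \<pi> \<and>
     \<iota> ` car B = right_coinvariants A C \<pi> \<and>
     lin A B \<zeta> \<and> conv_invertible (coalg_of A) B \<zeta> \<and>
     lin C A \<gamma> \<and> conv_invertible C A \<gamma> \<and>
     (\<forall>b\<in>car B. \<forall>a\<in>car A. \<zeta> (mul A (\<iota> b) a) = mul B b (\<zeta> a)) \<and>
     (\<forall>x\<in>car C. sw2 (coalg_of A) (\<gamma> x) (\<lambda>a1 a2. pure A C a1 (\<pi> a2)) =
                sw2 C x (\<lambda>x1 x2. pure A C (\<gamma> x1) x2)) \<and>
     \<zeta> (uni A) = uni B \<and> (\<forall>a\<in>car A. bcou A (\<iota> (\<zeta> a)) = bcou A a) \<and>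
     \<gamma> (\<pi> (uni A)) = uni A \<and> (\<forall>x\<in>car C. bcou A (\<gamma> x) = cou C x) \<and>
     (\<forall>a\<in>car A. conv (coalg_of A) A (\<lambda>a. \<iota> (\<zeta> a)) (\<lambda>a. \<gamma> (\<pi> a)) a = a)"


section \<open>Left partial duals\<close>

text \<open>
  The right \<open>A\<^sup>*\<close>-coaction on \<open>C\<^sup>*\<close> dual to the action of \<open>A\<close> on \<open>C\<close>:
  \<open>\<langle>f, x \<triangleleft> a\<rangle> = \<Sum> \<langle>f\<^sub>(\<^sub>1\<^sub>), x\<rangle> \<langle>f\<^sub>(\<^sub>2\<^sub>), a\<rangle>\<close>.
\<close>

definition dual_coaction :: "('f::field, 'a::ab_group_add) hopf \<Rightarrow>
    ('f, 'c::ab_group_add) coalg \<Rightarrow> ('c \<Rightarrow> 'a \<Rightarrow> 'c) \<Rightarrow> ('c \<Rightarrow> 'f) \<Rightarrow> ('f, 'c \<Rightarrow> 'f, 'a \<Rightarrow> 'f) tensor" where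
  "dual_coaction A C act f = (THE t. t \<in> car (tens (dual_vs C) (dual_vs A)) \<and>
     (\<forall>x\<in>car C. \<forall>a\<in>car A. f (act x a) = tsum (dual_vs C) (dual_vs A) t (\<lambda>g p. g x * p a)))"

text \<open>\<open>harpoon_r A C act a f\<close> is \<open>a \<rightharpoonup> f\<close> for \<open>f \<in> C\<^sup>*\<close>, and \<open>harpoon_l A a p\<close> is \<open>a \<leftharpoonup> p\<close> for \<open>p \<in> A\<^sup>*\<close>.\<close>

definition harpoon_r :: "('f::field, 'a::ab_group_add) hopf \<Rightarrow>
    ('f, 'c::ab_group_add) coalg \<Rightarrow> ('c \<Rightarrow> 'a \<Rightarrow> 'c) \<Rightarrow> 'a \<Rightarrow> ('c \<Rightarrow> 'f) \<Rightarrow> ('c \<Rightarrow> 'f)" where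
  "harpoon_r A C act a f =
     tsum (dual_vs C) (dual_vs A) (dual_coaction A C act f) (\<lambda>g p. scl (dual_vs C) (p a) g)"

definition harpoon_l :: "('f::field, 'a::ab_group_add) hopf \<Rightarrow> 'a \<Rightarrow> ('a \<Rightarrow> 'f) \<Rightarrow> 'a" where
  "harpoon_l A a p = sw2 (coalg_of A) a (\<lambda>a1 a2. scl A (p a1) a2)"

definition pd_alg :: "('f::field, 'a::ab_group_add) hopf \<Rightarrow>
    ('f, 'b::ab_group_add) alg \<Rightarrow> ('b \<Rightarrow> ('f, 'a, 'b) tensor) \<Rightarrow>
    ('f, 'c::ab_group_add) coalg \<Rightarrow> ('c \<Rightarrow> 'a \<Rightarrow> 'c) \<Rightarrow> ('f, ('f, 'c \<Rightarrow> 'f, 'b) tensor) alg" where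
  "pd_alg A B \<delta> C act = (let Cd = dual_alg C in
     \<lparr>car = car (tens Cd B), scl = scl (tens Cd B),
      mul = (\<lambda>s t. tsum Cd B s (\<lambda>f b. tsum Cd B t (\<lambda>g c.
        tsum A B (\<delta> b) (\<lambda>b1 b2. pure Cd B (mul Cd f (harpoon_r A C act b1 g)) (mul B b2 c))))),
      uni = pure Cd B (uni Cd) (uni B)\<rparr>)"

text \<open>
  \<open>X\<close> is the basis \<open>{x\<^sub>i}\<close> of \<open>C\<close>, and \<open>module.representation (scl C) X c x\<close> is the coordinate of
  \<open>c\<close> at \<open>x \<in> X\<close>, so that the functional \<open>xd x\<close> is the member of the dual basis belonging to \<open>x\<close>.
  \<open>copL f\<close> and \<open>copR b\<close> are the values of the comultiplication at \<open>f # 1\<close> and \<open>\<epsilon> # b\<close>.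
\<close>

definition left_partial_dual :: "('f::field, 'a::ab_group_add) hopf \<Rightarrow>
    ('f, 'b::ab_group_add) alg \<Rightarrow> ('b \<Rightarrow> ('f, 'a, 'b) tensor) \<Rightarrow>
    ('f, 'c::ab_group_add) coalg \<Rightarrow> ('c \<Rightarrow> 'a \<Rightarrow> 'c) \<Rightarrow>
    ('b \<Rightarrow> 'a) \<Rightarrow> ('a \<Rightarrow> 'c) \<Rightarrow> ('a \<Rightarrow> 'b) \<Rightarrow> ('c \<Rightarrow> 'a) \<Rightarrow> 'c set \<Rightarrow>
    ('f, ('f, 'c \<Rightarrow> 'f, 'b) tensor) quasi" where
  "left_partial_dual A B \<delta> C act \<iota> \<pi> \<zeta> \<gamma> X =
    (let Cd = dual_alg C; D = pd_alg A B \<delta> C act; D2 = talg D D; D3 = talg D D2;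
         xd = (\<lambda>x c. module.representation (scl C) X c x);
         copL = (\<lambda>f. tsum Cd (dual_vs A) (dual_coaction A C act f) (\<lambda>g p. \<Sum>x\<in>X.
           pure D D (pure Cd B g (\<zeta> (harpoon_l A (\<gamma> x) p))) (pure Cd B (xd x) (uni B))));
         copR = (\<lambda>b. tsum A B (\<delta> b) (\<lambda>b1 b2. \<Sum>x\<in>X.
           pure D D (pure Cd B (uni Cd) (\<zeta> (mul A (\<gamma> x) b1))) (pure Cd B (xd x) b2)));
         \<Phi> = (\<Sum>x\<in>X. \<Sum>y\<in>X. sw2 (coalg_of A) (\<gamma> y) (\<lambda>a1 a2.
           pure D D2 (pure Cd B (uni Cd) (\<zeta> (mul A (\<gamma> x) a1)))
             (pure D D (pure Cd B (xd x) (\<zeta> a2)) (pure Cd B (xd y) (uni B)))))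
     in \<lparr>car = car D, scl = scl D, mul = mul D, uni = uni D,
         bcop = (\<lambda>t. tsum Cd B t (\<lambda>f b. mul D2 (copL f) (copR b))),
         bcou = (\<lambda>t. tsum Cd B t (\<lambda>f b. f (\<pi> (uni A)) * bcou A (\<iota> b))),
         associator = (THE \<Psi>. \<Psi> \<in> car D3 \<and> mul D3 \<Phi> \<Psi> = uni D3 \<and> mul D3 \<Psi> \<Phi> = uni D3)\<rparr>)"

definition trivial_associator :: "('f::field, 'v::ab_group_add) quasi \<Rightarrow> bool" where
  "trivial_associator D \<longleftrightarrow> associator D = uni (talg D (talg D D))"

text \<open>
  The Hopf algebra underlying a quasi-Hopf algebra with trivial associator.  Its antipode is the
  unique one (normalised outside the carrier); no antipode needs to exist for a general argument.
\<close>

definition hopf_of_quasi :: "('f::field, 'v::ab_group_add) quasi \<Rightarrow> ('f, 'v) hopf" where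
  "hopf_of_quasi D = \<lparr>car = car D, scl = scl D, mul = mul D, uni = uni D, bcop = bcop D, bcou = bcou D,
     ant = (THE S. is_antipode D S \<and> (\<forall>x. x \<notin> car D \<longrightarrow> S x = 0))\<rparr>"


section \<open>The mapping system for \<open>K\<^sup>o\<^sup>p \<otimes> H\<close>\<close>

text \<open>Here \<open>A = K\<^sup>o\<^sup>p \<otimes> H\<close>, \<open>B = H\<close>, \<open>C = K\<^sup>o\<^sup>p\<close>; all products \<open>mul K\<close> below are those of \<open>K\<close>, not of \<open>K\<^sup>o\<^sup>p\<close>.\<close>

context
  fixes K :: "('f::field, 'k::ab_group_add) hopf"
    and H :: "('f, 'h::ab_group_add) hopf"
    and \<sigma> :: "('k \<Rightarrow> 'f) \<Rightarrow> 'h \<Rightarrow> 'f"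
begin

definition sys_A :: "('f, ('f, 'k, 'h) tensor) hopf" where
  "sys_A = thopf (op_hopf K) H"

definition sys_B :: "('f, 'h) alg" where
  "sys_B = alg.truncate H"

definition sys_C :: "('f, 'k) coalg" where
  "sys_C = coalg_of (op_hopf K)"

definition sys_coact :: "'h \<Rightarrow> ('f, ('f, 'k, 'h) tensor, 'h) tensor" where
  "sys_coact h = sw3 (coalg_of H) h (\<lambda>h1 h2 h3.
     pure sys_A H (pure (op_hopf K) H (sigma_r K \<sigma> (inv_ant H h3)) h1) h2)"

definition sys_act :: "'k \<Rightarrow> ('f, 'k, 'h) tensor \<Rightarrow> 'k" where
  "sys_act l t = tsum (op_hopf K) H t (\<lambda>k h. mul K (mul K k l) (sigma_r K \<sigma> h))"

definition sys_iota :: "'h \<Rightarrow> ('f, 'k, 'h) tensor" where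
  "sys_iota h = sw2 (coalg_of H) h (\<lambda>h1 h2. pure (op_hopf K) H (sigma_r K \<sigma> (inv_ant H h2)) h1)"

definition sys_pi :: "('f, 'k, 'h) tensor \<Rightarrow> 'k" where
  "sys_pi t = tsum (op_hopf K) H t (\<lambda>k h. mul K k (sigma_r K \<sigma> h))"

definition sys_zeta :: "('f, 'k, 'h) tensor \<Rightarrow> 'h" where
  "sys_zeta t = tsum (op_hopf K) H t (\<lambda>k h. scl H (bcou K k) h)"

definition sys_gamma :: "'k \<Rightarrow> ('f, 'k, 'h) tensor" where
  "sys_gamma k = pure (op_hopf K) H k (uni H)"

end

end

theory Submission
  imports Defs
begin

text \<open>
  The pairing gives a Hopf algebra map \<open>s = \<sigma>\<^sub>r : H \<rightarrow> K\<close>.  Put \<open>j = s \<circ> S\<^sup>-\<^sup>1\<close>, a map that reverses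
  products and coproducts.  Everything rests on the two cancellation rules
  \<open>\<Sum> s(h\<^sub>(\<^sub>2\<^sub>)) j(h\<^sub>(\<^sub>1\<^sub>)) = \<epsilon>(h) 1 = \<Sum> j(h\<^sub>(\<^sub>2\<^sub>)) s(h\<^sub>(\<^sub>1\<^sub>))\<close> (\<open>s_j_cancel\<close>), which are the axioms of \<open>S\<^sup>-\<^sup>1\<close>
  pushed forward along \<open>s\<close>.

  \<^emph>\<open>The mapping system.\<close>  Here \<open>\<iota>(h) = \<Sum> j(h\<^sub>(\<^sub>2\<^sub>)) \<otimes> h\<^sub>(\<^sub>1\<^sub>)\<close> is an algebra map into
  \<open>A = K\<^sup>o\<^sup>p \<otimes> H\<close>, because \<open>j\<close> reverses products; \<open>\<zeta>\<close> is a retraction of \<open>\<iota>\<close>; and the coproduct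
  of \<open>A\<close> maps \<open>\<iota>(H)\<close> into \<open>A \<otimes> \<iota>(H)\<close> (\<open>bcop_iota\<close>).  So the axioms of a comodule algebra for \<open>H\<close> are
  inherited from \<open>A\<close> (\<open>coideal_subalgebra\<close>).  Dually \<open>\<pi>\<close> is a surjective coalgebra map along which the
  right multiplication of \<open>A\<close> descends to \<open>K\<^sup>o\<^sup>p\<close> (\<open>quotient_module_coalgebra\<close>).  The cancellation rules
  give \<open>\<pi> \<circ> \<iota> = \<epsilon>\<close> and \<open>(\<iota> \<circ> \<zeta>) * (\<gamma> \<circ> \<pi>) = id\<close>; applied to a coinvariant \<open>a\<close>, the latter identity
  says \<open>a = \<iota>(\<zeta>(a))\<close>.  Since \<open>\<zeta>\<close> and \<open>\<gamma>\<close> are algebra maps on Hopf algebras, composition with the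
  antipode inverts them in the convolution algebra.  That \<open>K\<^sup>o\<^sup>p\<close> is a Hopf algebra follows from the
  bijectivity of the antipode in finite dimension (\<open>ant_bij\<close>).

  \<^emph>\<open>The structures coincide.\<close>  The coaction sends \<open>h\<close> to \<open>\<Sum> (j(h\<^sub>(\<^sub>3\<^sub>)) \<otimes> h\<^sub>(\<^sub>1\<^sub>)) \<otimes> h\<^sub>(\<^sub>2\<^sub>)\<close>, and
  \<open>(k \<otimes> h) \<rightharpoonup> q\<close> is the functional \<open>x \<mapsto> q(k x s(h))\<close>.  Hence in the smash product
  \<open>(\<epsilon> # h)(q # 1) = \<Sum> (x \<mapsto> q(j(h\<^sub>(\<^sub>3\<^sub>)) x s(h\<^sub>(\<^sub>1\<^sub>)))) # h\<^sub>(\<^sub>2\<^sub>)\<close>.  Splitting the functional by the coproduct of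
  \<open>K\<^sup>*\<close> turns this into the commutation rule of the quantum double (\<open>double_mul_pure\<close>).  As
  \<open>\<zeta> \<circ> \<gamma> = \<epsilon>\<close>, every sum over the dual bases that defines the comultiplication and the associator of
  the partial dual collapses (\<open>copL\<close>, \<open>copR\<close>, \<open>Phi_one\<close>).  The associator is therefore trivial, and
  the comultiplication is that of the tensor product of coalgebras \<open>K\<^sup>*\<^sup>c\<^sup>o\<^sup>p \<otimes> H\<close>, as in the double.

  \<^emph>\<open>The result is a Hopf algebra.\<close>  A smash product of this kind is associative (\<open>is_alg_D\<close>).  Because
  \<open>f # h = (f # 1)(\<epsilon> # h)\<close>, multiplicativity of the comultiplication reduces to its compatibility
  with the commutation rule (\<open>cop_commutation\<close>).  There, evaluation of the two legs in \<open>K\<^sup>*\<close> leaves a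
  single inner factor \<open>s(h\<^sub>(\<^sub>4\<^sub>)) j(h\<^sub>(\<^sub>3\<^sub>))\<close>, which cancels.  The map
  \<open>f # h \<mapsto> (\<epsilon> # S(h))(S\<^sup>-\<^sup>1(f) # 1)\<close> is an antipode by associativity, and antipodes are unique.

  \<^emph>\<open>Calculating in Sweedler notation.\<close>  Identities between tensors are proved on pure tensors
  (\<open>tens_ball_ext\<close>) or, when one factor is a dual space, after evaluation (\<open>dual_tens_ext\<close>).  A chain of
  Sweedler sums is transformed by \<open>coassoc\<close>, \<open>counit\<close>, \<open>sw2_swap\<close>, and by \<open>sw2_apply\<close>, which moves
  linear maps in and out of sums.  Their multilinearity conditions are left to the simplifier, by way of
  rules that derive \<open>lin V U (\<lambda>x. t)\<close> from the linearity of the constituents of \<open>t\<close>.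
\<close>


section \<open>Vector spaces and multilinear maps\<close>

text \<open>
  Algebras, coalgebras and their tensor products and duals are records of different types on the same
  space.  \<open>same_vs\<close> relates such records, and the congruences below, instantiated for each construction,
  rewrite all notions of linear algebra to the underlying space.
\<close>

definition same_vs :: "('f::field, 'v::ab_group_add, 'x) vs_scheme \<Rightarrow>
    ('f, 'v, 'y) vs_scheme \<Rightarrow> bool" where
  "same_vs V W \<longleftrightarrow> car V = car W \<and> scl V = scl W"

lemma same_vs_refl [simp]: "same_vs V V"
  by (simp add: same_vs_def)

lemma same_vs_basic:
  assumes "same_vs V V'"
  shows "car V = car V'" "scl V = scl V'" "is_vs V = is_vs V'" "fin_dim V = fin_dim V'"
    "is_basis V = is_basis V'"
proof -
  show *: "car V = car V'" "scl V = scl V'" using assms by (simp_all add: same_vs_def)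
  show "is_vs V = is_vs V'" "fin_dim V = fin_dim V'" by (simp_all add: is_vs_def fin_dim_def *)
  show "is_basis V = is_basis V'" by (rule ext) (simp add: is_basis_def *)
qed

lemma same_vs_lin:
  assumes "same_vs V V'"
  shows "lin V = lin V'" "lin U V = lin U V'"
  by (intro ext; simp add: lin_def same_vs_basic[OF assms])+

lemma same_vs_bilin:
  assumes "same_vs V V'"
  shows "bilin V W Z = bilin V' W Z" "bilin W V Z = bilin W V' Z" "bilin W Z V = bilin W Z V'"
  by (intro ext; simp only: bilin_def same_vs_basic(1)[OF assms] same_vs_lin[OF assms])+

lemma same_vs_pure:
  assumes "same_vs V V'"
  shows "pure V W = pure V' W" "pure W V = pure W V'"
  by (intro ext; simp add: pure_def same_vs_bilin[OF assms])+

lemma same_vs_tens: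
  assumes "same_vs V V'"
  shows "tens V W = tens V' W" "tens W V = tens W V'"
    "tsum V W = tsum V' W" "tsum W V = tsum W V'"
    "dual_vs V = dual_vs V'" "dual_map V = dual_map V'"
  by ((intro ext)?; simp add: tens_def tsum_def sweedler_def dual_vs_def dual_map_def same_vs_def
        same_vs_basic[OF assms] same_vs_pure[OF assms] same_vs_lin[OF assms])+

lemma same_vs_same_vs:
  assumes "same_vs V V'"
  shows "same_vs V W = same_vs V' W" "same_vs W V = same_vs W V'"
  using assms by (simp_all add: same_vs_def)

lemmas same_vs_cong = same_vs_basic same_vs_lin same_vs_bilin same_vs_pure same_vs_tens same_vs_same_vs

lemma field_vs_simps [simp]: "car field_vs = UNIV" "scl field_vs = (*)"
  by (simp_all add: field_vs_def)

lemma is_vs_field [simp]: "is_vs (field_vs :: ('f::field, 'f) vs)"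
proof -
  have "vector_space ((*) :: 'f \<Rightarrow> 'f \<Rightarrow> 'f)" by unfold_locales (auto simp: algebra_simps)
  then show ?thesis
    by (simp add: is_vs_def module.subspace_def vector_space_def module_def)
qed

lemma is_vs_module: "is_vs V \<Longrightarrow> module (scl V)"
  by (simp add: is_vs_def vector_space_def module_def)

lemma is_vs_vector_space: "is_vs V \<Longrightarrow> vector_space (scl V)"
  by (simp add: is_vs_def)

lemma vs_closed [simp]:
  assumes "is_vs V"
  shows "0 \<in> car V" "u \<in> car V \<Longrightarrow> v \<in> car V \<Longrightarrow> u + v \<in> car V"
    "u \<in> car V \<Longrightarrow> scl V c u \<in> car V"
  using assms is_vs_module[OF assms]
  by (auto simp: is_vs_def module.subspace_0 module.subspace_add module.subspace_scale)

lemma vs_scl [simp]: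
  assumes "is_vs V"
  shows "scl V c (u + v) = scl V c u + scl V c v" "scl V (a + b) v = scl V a v + scl V b v"
    "scl V a (scl V b v) = scl V (a * b) v" "scl V 1 v = v" "scl V 0 v = 0" "scl V c 0 = 0"
  using is_vs_module[OF assms]
  by (auto simp: module.scale_zero_left module.scale_zero_right module_def)

lemma vs_sum_closed [simp]: "is_vs V \<Longrightarrow> (\<And>i. i \<in> I \<Longrightarrow> f i \<in> car V) \<Longrightarrow> sum f I \<in> car V"
  by (induction I rule: infinite_finite_induct) auto

lemma vs_sum_list_closed: "is_vs V \<Longrightarrow> (\<And>i. i \<in> set xs \<Longrightarrow> f i \<in> car V) \<Longrightarrow> (\<Sum>i\<leftarrow>xs. f i) \<in> car V"
  by (induction xs) auto

lemma lin_closed: "lin V W f \<Longrightarrow> v \<in> car V \<Longrightarrow> f v \<in> car W"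
  and lin_add: "lin V W f \<Longrightarrow> v \<in> car V \<Longrightarrow> v' \<in> car V \<Longrightarrow> f (v + v') = f v + f v'"
  and lin_scl: "lin V W f \<Longrightarrow> v \<in> car V \<Longrightarrow> f (scl V c v) = scl W c (f v)"
  by (auto simp: lin_def)

lemma lin_zero: "is_vs V \<Longrightarrow> lin V W f \<Longrightarrow> f 0 = 0"
  using lin_add[of V W f 0 0] by simp

lemma lin_sum: "is_vs V \<Longrightarrow> lin V W f \<Longrightarrow> (\<And>i. i \<in> I \<Longrightarrow> g i \<in> car V) \<Longrightarrow> f (sum g I) = (\<Sum>i\<in>I. f (g i))"
proof (induction I rule: infinite_finite_induct)
  case (insert x F)
  then show ?case by (simp add: lin_add[of V W])
qed (auto simp: lin_zero)

lemma lin_sum_list: "is_vs V \<Longrightarrow> lin V W f \<Longrightarrow> (\<And>i. i \<in> set xs \<Longrightarrow> g i \<in> car V) \<Longrightarrow>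
    f (\<Sum>i\<leftarrow>xs. g i) = (\<Sum>i\<leftarrow>xs. f (g i))"
  by (induction xs) (auto simp: lin_zero lin_add[of V W] vs_sum_list_closed)

text \<open>
  As a rewrite rule this reduces bilinearity to linearity in each variable, for which there are
  syntax-directed rules below.
\<close>

lemma bilinI [simp]: "(\<And>w. w \<in> car W \<Longrightarrow> lin V U (\<lambda>v. b v w)) \<Longrightarrow> (\<And>v. v \<in> car V \<Longrightarrow> lin W U (\<lambda>w. b v w)) \<Longrightarrow>
    bilin V W U b"
  by (simp add: bilin_def)

lemma bilinD: "bilin V W U b \<Longrightarrow> w \<in> car W \<Longrightarrow> lin V U (\<lambda>v. b v w)"
  "bilin V W U b \<Longrightarrow> v \<in> car V \<Longrightarrow> lin W U (b v)"
  by (simp_all add: bilin_def)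

lemma bilin_closed: "bilin V W U b \<Longrightarrow> v \<in> car V \<Longrightarrow> w \<in> car W \<Longrightarrow> b v w \<in> car U"
  by (auto simp: bilin_def lin_def)

lemma lin_cong: "(\<And>v. v \<in> car V \<Longrightarrow> f v = g v) \<Longrightarrow> is_vs V \<Longrightarrow> lin V W f = lin V W g"
  by (simp add: lin_def)

lemma lin_cong':
  assumes "lin V W f" "\<And>v. v \<in> car V \<Longrightarrow> f v = g v" "is_vs V"
  shows "lin V W g"
  using assms lin_cong[of V f g W] by simp


section \<open>Tensor products\<close>

lemma vector_space_funs: "vector_space (\<lambda>(c::'f::field) (t :: 'b \<Rightarrow> 'f) b. c * t b)"
  by unfold_locales (auto simp: algebra_simps fun_eq_iff)

lemma scl_tens: "scl (tens V W) = (\<lambda>c t b. c * t b)"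
  by (simp add: tens_def)

lemma is_vs_tens [simp]:
  fixes V :: "('f::field, 'v::ab_group_add, 'x) vs_scheme" and W :: "('f, 'w::ab_group_add, 'y) vs_scheme"
  shows "is_vs (tens V W)"
proof -
  interpret vector_space "\<lambda>(c::'f) (t :: ('v \<Rightarrow> 'w \<Rightarrow> 'f) \<Rightarrow> 'f) b. c * t b"
    by (rule vector_space_funs)
  show ?thesis by (simp add: is_vs_def tens_def vector_space_axioms)
qed

lemma pure_closed [simp]:
  fixes V :: "('f::field, 'v::ab_group_add, 'x) vs_scheme" and W :: "('f, 'w::ab_group_add, 'y) vs_scheme"
  shows "v \<in> car V \<Longrightarrow> w \<in> car W \<Longrightarrow> pure V W v w \<in> car (tens V W)"
proof -
  interpret vector_space "\<lambda>(c::'f) (t :: ('v \<Rightarrow> 'w \<Rightarrow> 'f) \<Rightarrow> 'f) b. c * t b"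
    by (rule vector_space_funs)
  show "v \<in> car V \<Longrightarrow> w \<in> car W \<Longrightarrow> pure V W v w \<in> car (tens V W)"
    by (auto simp: tens_def intro!: span_base)
qed

lemma bilin_pure: "bilin V W (tens V W) (pure V W)"
  unfolding bilin_def lin_def
  by (intro conjI ballI allI pure_closed; simp add: fun_eq_iff pure_def bilin_def lin_def scl_tens)

lemma tens_rep:
  fixes V :: "('f::field, 'v::ab_group_add, 'x) vs_scheme" and W :: "('f, 'w::ab_group_add, 'y) vs_scheme"
  assumes V: "is_vs V" and t: "t \<in> car (tens V W)"
  shows "\<exists>xs. set xs \<subseteq> car V \<times> car W \<and> t = (\<Sum>(v, w)\<leftarrow>xs. pure V W v w)"
proof -
  interpret F: vector_space "\<lambda>(c::'f) (t :: ('v \<Rightarrow> 'w \<Rightarrow> 'f) \<Rightarrow> 'f) b. c * t b"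
    by (rule vector_space_funs)
  have "t \<in> F.span {pure V W v w |v w. v \<in> car V \<and> w \<in> car W}" using t by (simp add: tens_def)
  then show ?thesis
  proof (induction rule: F.span_induct_alt)
    case base
    show ?case by (rule exI[of _ "[]"]) simp
  next
    case (step c x y)
    then obtain v w xs where "x = pure V W v w" "v \<in> car V" "w \<in> car W"
      "set xs \<subseteq> car V \<times> car W" "y = (\<Sum>(v, w)\<leftarrow>xs. pure V W v w)" by blast
    then show ?case using V lin_scl[OF bilinD(1)[OF bilin_pure], of w W v V c, symmetric]
      by (intro exI[of _ "(scl V c v, w) # xs"]) (simp add: scl_tens)
  qed
qed

lemma sweedler:
  assumes "is_vs V" "t \<in> car (tens V W)"
  shows "set (sweedler V W t) \<subseteq> car V \<times> car W" "t = (\<Sum>(v, w)\<leftarrow>sweedler V W t. pure V W v w)"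
  using someI_ex[OF tens_rep[OF assms]] by (auto simp: sweedler_def)

lemma tsum_pure:
  assumes "is_vs V" "is_vs W" "is_vs U" "bilin V W U b" "v \<in> car V" "w \<in> car W"
  shows "tsum V W (pure V W v w) b = b v w"
  using tsum_eq[OF assms(1-4), of "[(v, w)]"] assms by simp

lemma tsum_cong:
  assumes "is_vs V" "t \<in> car (tens V W)" "\<And>v w. v \<in> car V \<Longrightarrow> w \<in> car W \<Longrightarrow> f v w = g v w"
  shows "tsum V W t f = tsum V W t g"
  unfolding tsum_def using sweedler(1)[OF assms(1,2)] assms(3)
  by (intro arg_cong[of _ _ sum_list] map_cong) auto

lemma tsum_closed [simp]:
  assumes "is_vs V" "t \<in> car (tens V W)" "is_vs U" "\<And>v w. v \<in> car V \<Longrightarrow> w \<in> car W \<Longrightarrow> f v w \<in> car U"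
  shows "tsum V W t f \<in> car U"
  unfolding tsum_def using sweedler(1)[OF assms(1,2)] assms(3,4)
  by (intro vs_sum_list_closed) auto

lemma tsum_lin_left:
  fixes V :: "('f::field, 'v::ab_group_add, 'x) vs_scheme" and W :: "('f, 'w::ab_group_add, 'y) vs_scheme"
    and U :: "('f, 'u::ab_group_add, 'z) vs_scheme"
  assumes "is_vs V" "is_vs W" "is_vs U" "bilin V W U b"
  shows "lin (tens V W) U (\<lambda>t. tsum V W t b)"
proof -
  have "tsum V W (t + t') b = tsum V W t b + tsum V W t' b"
    if t: "t \<in> car (tens V W)" "t' \<in> car (tens V W)" for t t'
  proof -
    have "tsum V W (t + t') b = (\<Sum>(v, w)\<leftarrow>sweedler V W t @ sweedler V W t'. b v w)"
      using sweedler[OF assms(1) t(1)] sweedler[OF assms(1) t(2)]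
      by (intro tsum_eq[OF assms]) auto
    then show ?thesis by (simp add: tsum_def)
  qed
  moreover have "tsum V W (scl (tens V W) c t) b = scl U c (tsum V W t b)"
    if t: "t \<in> car (tens V W)" for t c
  proof -
    let ?ys = "map (\<lambda>(v, w). (scl V c v, w)) (sweedler V W t)"
    have 1: "set xs \<subseteq> car V \<times> car W \<Longrightarrow>
        scl U c (\<Sum>(v, w)\<leftarrow>xs. b v w) = (\<Sum>(v, w)\<leftarrow>map (\<lambda>(v, w). (scl V c v, w)) xs. b v w)" for xs
      using assms by (induction xs) (auto simp: lin_scl[OF bilinD(1)])
    have 2: "set xs \<subseteq> car V \<times> car W \<Longrightarrow> scl (tens V W) c (\<Sum>(v, w)\<leftarrow>xs. pure V W v w) =
        (\<Sum>(v, w)\<leftarrow>map (\<lambda>(v, w). (scl V c v, w)) xs. pure V W v w)" for xs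
    proof (induction xs)
      case (Cons p xs)
      then show ?case using lin_scl[OF bilinD(1)[OF bilin_pure], of "snd p" W "fst p" V c]
        by (cases p) (simp add: split_def comp_def del: plus_fun_apply)
    qed simp
    have "tsum V W (scl (tens V W) c t) b = (\<Sum>(v, w)\<leftarrow>?ys. b v w)"
    proof (rule tsum_eq[OF assms])
      show "set ?ys \<subseteq> car V \<times> car W" using sweedler(1)[OF assms(1) t] assms(1) by auto
      show "scl (tens V W) c t = (\<Sum>(v, w)\<leftarrow>?ys. pure V W v w)"
        by (subst sweedler(2)[OF assms(1) t]) (rule 2[OF sweedler(1)[OF assms(1) t]])
    qed
    also have "\<dots> = scl U c (\<Sum>(v, w)\<leftarrow>sweedler V W t. b v w)"
      by (rule 1[OF sweedler(1)[OF assms(1) t], symmetric])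
    finally show ?thesis by (simp add: tsum_def)
  qed
  moreover have "tsum V W t b \<in> car U" if "t \<in> car (tens V W)" for t
    using assms that by (simp add: bilin_closed)
  ultimately show ?thesis unfolding lin_def by blast
qed

lemma tsum_lin_right:
  assumes "is_vs V" "t \<in> car (tens V W)" "is_vs U"
    and "\<And>v w. v \<in> car V \<Longrightarrow> w \<in> car W \<Longrightarrow> lin Z U (\<lambda>z. f z v w)"
  shows "lin Z U (\<lambda>z. tsum V W t (f z))"
proof -
  have *: "set xs \<subseteq> car V \<times> car W \<Longrightarrow> lin Z U (\<lambda>z. \<Sum>(v, w)\<leftarrow>xs. f z v w)" for xs
  proof (induction xs)
    case Nil
    then show ?case using assms(3) by (simp add: lin_def)
  next
    case (Cons x xs)
    then show ?case using assms(3) assms(4)[of "fst x" "snd x"] by (auto simp: lin_def)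
  qed
  show ?thesis unfolding tsum_def using sweedler(1)[OF assms(1,2)] by (rule *)
qed

lemma tsum_lin_apply:
  assumes "is_vs V" "t \<in> car (tens V W)" "is_vs U" "lin U U' \<phi>"
    and "\<And>v w. v \<in> car V \<Longrightarrow> w \<in> car W \<Longrightarrow> f v w \<in> car U"
  shows "\<phi> (tsum V W t f) = tsum V W t (\<lambda>v w. \<phi> (f v w))"
proof -
  have "\<phi> (\<Sum>p\<leftarrow>sweedler V W t. f (fst p) (snd p)) = (\<Sum>p\<leftarrow>sweedler V W t. \<phi> (f (fst p) (snd p)))"
    using sweedler(1)[OF assms(1,2)] assms(5) by (intro lin_sum_list[OF assms(3,4)]) auto
  then show ?thesis by (simp add: tsum_def split_def)
qed

lemma sum_list_swap: "(\<Sum>x\<leftarrow>xs. \<Sum>y\<leftarrow>ys. f x y) = (\<Sum>y\<leftarrow>ys. \<Sum>x\<leftarrow>xs. (f x y :: 'a::ab_group_add))"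
  by (induction xs) (auto simp: sum_list_addf)

lemma tsum_swap: "tsum V W t (\<lambda>a b. tsum X Y s (\<lambda>c d. f a b c d)) = tsum X Y s (\<lambda>c d. tsum V W t (\<lambda>a b. f a b c d))"
  unfolding tsum_def case_prod_beta by (rule sum_list_swap)

lemma tsum_sum: "tsum V W t (\<lambda>a b. \<Sum>i\<in>I. f i a b) = (\<Sum>i\<in>I. tsum V W t (f i))"
proof (induction I rule: infinite_finite_induct)
  case (insert x F)
  then show ?case by (simp add: tsum_def split_def sum_list_addf)
qed (simp_all add: tsum_def split_def)

lemma tens_ext:
  assumes V: "is_vs V" and W: "is_vs W" and F: "lin (tens V W) U F" and G: "lin (tens V W) U' G"
    and eq: "\<And>v w. v \<in> car V \<Longrightarrow> w \<in> car W \<Longrightarrow> F (pure V W v w) = G (pure V W v w)"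
    and t: "t \<in> car (tens V W)"
  shows "F t = G t"
proof -
  have "t = (\<Sum>p\<leftarrow>sweedler V W t. pure V W (fst p) (snd p))"
    using sweedler(2)[OF V t] by (simp add: split_def)
  moreover have "F (\<Sum>p\<leftarrow>sweedler V W t. pure V W (fst p) (snd p)) = (\<Sum>p\<leftarrow>sweedler V W t. F (pure V W (fst p) (snd p)))"
    using sweedler(1)[OF V t] by (intro lin_sum_list[OF _ F]) auto
  moreover have "G (\<Sum>p\<leftarrow>sweedler V W t. pure V W (fst p) (snd p)) = (\<Sum>p\<leftarrow>sweedler V W t. G (pure V W (fst p) (snd p)))"
    using sweedler(1)[OF V t] by (intro lin_sum_list[OF _ G]) auto
  moreover have "(\<Sum>p\<leftarrow>sweedler V W t. F (pure V W (fst p) (snd p))) = (\<Sum>p\<leftarrow>sweedler V W t. G (pure V W (fst p) (snd p)))"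
    using sweedler(1)[OF V t] by (intro arg_cong[of _ _ sum_list] map_cong) (auto intro!: eq)
  ultimately show ?thesis by simp
qed

text \<open>
  The bound tensor in the conclusion makes it a higher-order pattern, so that unification finds \<open>F\<close>
  and \<open>G\<close> when the rule is applied.
\<close>

lemma tens_ball_ext:
  assumes "is_vs V" "is_vs W" "lin (tens V W) U F" "lin (tens V W) U G"
    and "\<And>v w. v \<in> car V \<Longrightarrow> w \<in> car W \<Longrightarrow> F (pure V W v w) = G (pure V W v w)"
  shows "\<forall>t\<in>car (tens V W). F t = G t"
  using tens_ext[OF assms] by blast

lemma tsum_self: "is_vs V \<Longrightarrow> t \<in> car (tens V W) \<Longrightarrow> tsum V W t (pure V W) = t"
  using sweedler(2)[of V t W] by (simp add: tsum_def)

subsection \<open>Closure properties of linear maps\<close>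

lemma lin_ident [simp]: "lin V V (\<lambda>x. x)"
  by (simp add: lin_def)

lemma lin_comp: "lin W U g \<Longrightarrow> lin V W f \<Longrightarrow> lin V U (\<lambda>x. g (f x))"
  by (simp add: lin_def)

lemma lin_field_mult [simp]:
  "lin V field_vs f \<Longrightarrow> lin V field_vs (\<lambda>x. f x * c)" "lin V field_vs f \<Longrightarrow> lin V field_vs (\<lambda>x. c * f x)"
  by (auto simp: lin_def algebra_simps)

lemma lin_scl_left [simp]: "is_vs W \<Longrightarrow> lin V field_vs f \<Longrightarrow> w \<in> car W \<Longrightarrow> lin V W (\<lambda>x. scl W (f x) w)"
  by (auto simp: lin_def)

lemma lin_scl_right [simp]: "is_vs W \<Longrightarrow> lin V W f \<Longrightarrow> lin V W (\<lambda>x. scl W c (f x))"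
  by (auto simp: lin_def mult.commute)

lemma lin_bilin1: "bilin A B U b \<Longrightarrow> lin V A f \<Longrightarrow> c \<in> car B \<Longrightarrow> lin V U (\<lambda>x. b (f x) c)"
  by (rule lin_comp[OF bilinD(1)])

lemma lin_bilin2: "bilin A B U b \<Longrightarrow> lin V B f \<Longrightarrow> c \<in> car A \<Longrightarrow> lin V U (\<lambda>x. b c (f x))"
  by (rule lin_comp[OF bilinD(2)])

lemma lin_pure [simp]:
  "lin V A f \<Longrightarrow> c \<in> car B \<Longrightarrow> lin V (tens A B) (\<lambda>x. pure A B (f x) c)"
  "lin V B g \<Longrightarrow> d \<in> car A \<Longrightarrow> lin V (tens A B) (\<lambda>x. pure A B d (g x))"
  by (rule lin_bilin1[OF bilin_pure] lin_bilin2[OF bilin_pure]; simp)+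

lemma lin_tsum1 [simp]:
  assumes "is_vs A" "is_vs B" "is_vs U" "lin V (tens A B) f" "bilin A B U b"
  shows "lin V U (\<lambda>x. tsum A B (f x) b)"
  using lin_comp[OF tsum_lin_left assms(4)] assms by blast

lemma lin_tsum2 [simp]:
  assumes "is_vs A" "t \<in> car (tens A B)" "is_vs U"
    and "\<And>v w. v \<in> car A \<Longrightarrow> w \<in> car B \<Longrightarrow> lin V U (\<lambda>x. f x v w)"
  shows "lin V U (\<lambda>x. tsum A B t (f x))"
  using tsum_lin_right[OF assms] .

lemma lin_sum' [simp]:
  assumes "is_vs U" "\<And>i. i \<in> I \<Longrightarrow> lin V U (\<lambda>x. f x i)"
  shows "lin V U (\<lambda>x. \<Sum>i\<in>I. f x i)"
  using assms(2)
proof (induction I rule: infinite_finite_induct)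
  case (insert i F)
  then have "lin V U (\<lambda>x. f x i)" "lin V U (\<lambda>x. \<Sum>i\<in>F. f x i)" by auto
  then show ?case using insert(1,2) assms(1) by (simp add: lin_def)
qed (use assms(1) in \<open>simp_all add: lin_def\<close>)


section \<open>Coalgebras\<close>

text \<open>
  Sweedler sums can be manipulated as soon as the comultiplication is linear.  Coassociativity of a
  newly constructed coalgebra is itself proved by such manipulations, hence this weaker notion.
\<close>

definition pre_coalg :: "('f::field, 'v::ab_group_add, 'x) coalg_scheme \<Rightarrow> bool" where
  "pre_coalg C \<longleftrightarrow> is_vs C \<and> lin C (tens C C) (cop C)"

lemma pre_coalg_simps [simp]:
  assumes "pre_coalg C"
  shows "is_vs C" "c \<in> car C \<Longrightarrow> cop C c \<in> car (tens C C)" "lin C (tens C C) (cop C)"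
  using assms unfolding pre_coalg_def by (auto intro: lin_closed)

lemma is_coalg_simps [simp]:
  assumes "is_coalg C"
  shows "is_vs C" "c \<in> car C \<Longrightarrow> cop C c \<in> car (tens C C)" "lin C (tens C C) (cop C)" "lin C field_vs (cou C)"
    "pre_coalg C"
  using assms unfolding is_coalg_def pre_coalg_def by (auto intro: lin_closed)

lemma coalg_axioms:
  assumes "is_coalg C" "c \<in> car C"
  shows "sw2 C c (\<lambda>c1 c'. sw2 C c' (\<lambda>c2 c3. pure C (tens C C) c1 (pure C C c2 c3))) =
      sw2 C c (\<lambda>c' c3. sw2 C c' (\<lambda>c1 c2. pure C (tens C C) c1 (pure C C c2 c3)))"
    "sw2 C c (\<lambda>c1 c2. scl C (cou C c1) c2) = c" "sw2 C c (\<lambda>c1 c2. scl C (cou C c2) c1) = c"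
  using assms unfolding is_coalg_def by blast+

lemma lin_cop [simp]: "pre_coalg C \<Longrightarrow> lin V C f \<Longrightarrow> lin V (tens C C) (\<lambda>x. cop C (f x))"
  by (rule lin_comp[OF pre_coalg_simps(3)])

lemma lin_cou [simp]: "is_coalg C \<Longrightarrow> lin V C f \<Longrightarrow> lin V field_vs (\<lambda>x. cou C (f x))"
  by (rule lin_comp[OF is_coalg_simps(4)])

lemma sw2_cong:
  assumes "pre_coalg C" "c \<in> car C" "\<And>a b. a \<in> car C \<Longrightarrow> b \<in> car C \<Longrightarrow> f a b = g a b"
  shows "sw2 C c f = sw2 C c g"
  unfolding sw2_def using assms by (intro tsum_cong) auto

text \<open>
  The next two rules are conditional rewrite rules.  The simplifier does not simplify the premises
  under which a condition holds, so the carrier of \<open>C\<close> is brought into normal form through \<open>X\<close>.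
\<close>

lemma sw2_closed [simp]:
  assumes "pre_coalg C" "car C = X" "c \<in> X" "is_vs U" "\<And>a b. a \<in> X \<Longrightarrow> b \<in> X \<Longrightarrow> f a b \<in> car U"
  shows "sw2 C c f \<in> car U"
  unfolding sw2_def using assms(1,3,4,5) unfolding assms(2)[symmetric] by simp

lemma lin_sw2 [simp]:
  assumes "pre_coalg C" "car C = X" "is_vs U"
  shows "lin V C f \<Longrightarrow> (\<And>b. b \<in> X \<Longrightarrow> lin C U (\<lambda>a. F a b)) \<Longrightarrow> (\<And>a. a \<in> X \<Longrightarrow> lin C U (\<lambda>b. F a b)) \<Longrightarrow>
      lin V U (\<lambda>x. sw2 C (f x) F)"
    "c \<in> X \<Longrightarrow> (\<And>a b. a \<in> X \<Longrightarrow> b \<in> X \<Longrightarrow> lin V U (\<lambda>x. G x a b)) \<Longrightarrow> lin V U (\<lambda>x. sw2 C c (G x))"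
  unfolding sw2_def using assms(1,3) unfolding assms(2)[symmetric] by simp_all

lemma sw2_apply:
  assumes "pre_coalg C" "c \<in> car C" "is_vs U" "lin U U' \<phi>"
    and "\<And>a b. a \<in> car C \<Longrightarrow> b \<in> car C \<Longrightarrow> f a b \<in> car U"
  shows "\<phi> (sw2 C c f) = sw2 C c (\<lambda>a b. \<phi> (f a b))"
  unfolding sw2_def by (rule tsum_lin_apply[where U=U]) (use assms in auto)

lemma sw2_swap: "sw2 C c (\<lambda>a b. sw2 C' c' (\<lambda>a' b'. f a b a' b')) = sw2 C' c' (\<lambda>a' b'. sw2 C c (\<lambda>a b. f a b a' b'))"
  unfolding sw2_def by (rule tsum_swap)

lemma sw2_tsum_swap: "sw2 C c (\<lambda>a b. tsum V W t (\<lambda>a' b'. f a b a' b')) = tsum V W t (\<lambda>a' b'. sw2 C c (\<lambda>a b. f a b a' b'))"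
  unfolding sw2_def by (rule tsum_swap)

text \<open>
  The axiom is an identity in \<open>C \<otimes> (C \<otimes> C)\<close>; the linear map induced there by a trilinear \<open>f\<close> carries it
  over to \<open>f\<close>.
\<close>

lemma coassoc:
  assumes C: "is_coalg C" and U: "is_vs U" and c: "c \<in> car C"
    and f: "\<And>b c. b \<in> car C \<Longrightarrow> c \<in> car C \<Longrightarrow> lin C U (\<lambda>a. f a b c)"
      "\<And>a c. a \<in> car C \<Longrightarrow> c \<in> car C \<Longrightarrow> lin C U (\<lambda>b. f a b c)"
      "\<And>a b. a \<in> car C \<Longrightarrow> b \<in> car C \<Longrightarrow> lin C U (\<lambda>c. f a b c)"
  shows "sw2 C c (\<lambda>x z. sw2 C x (\<lambda>a b. f a b z)) = sw2 C c (\<lambda>a y. sw2 C y (\<lambda>b z. f a b z))"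
proof -
  let ?T = "tens C (tens C C)"
  define F where "F = (\<lambda>t. tsum C (tens C C) t (\<lambda>a s. tsum C C s (\<lambda>b c. f a b c)))"
  have b: "bilin C (tens C C) U (\<lambda>a s. tsum C C s (\<lambda>b c. f a b c))"
    using C U f by (intro bilinI) simp_all
  have F: "lin ?T U F" unfolding F_def using C U b by (intro tsum_lin_left) auto
  have Fp: "F (pure C (tens C C) a (pure C C b z)) = f a b z" if "a \<in> car C" "b \<in> car C" "z \<in> car C" for a b z
  proof -
    have "F (pure C (tens C C) a (pure C C b z)) = tsum C C (pure C C b z) (\<lambda>b c. f a b c)"
      unfolding F_def using C that by (intro tsum_pure[OF _ _ U b]) simp_all
    also have "\<dots> = f a b z" using C U that f by (intro tsum_pure[where U=U] bilinI) auto
    finally show ?thesis .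
  qed
  have Fs: "F (sw2 C z h) = sw2 C z (\<lambda>a b. F (h a b))"
    if "z \<in> car C" "\<And>a b. a \<in> car C \<Longrightarrow> b \<in> car C \<Longrightarrow> h a b \<in> car ?T" for z h
    using C that by (intro sw2_apply[where U="?T", OF _ _ _ F]) simp_all
  have "F (sw2 C c (\<lambda>a y. sw2 C y (\<lambda>b z. pure C (tens C C) a (pure C C b z)))) =
      sw2 C c (\<lambda>a y. sw2 C y (\<lambda>b z. F (pure C (tens C C) a (pure C C b z))))"
    using C c by (subst Fs) (auto intro!: sw2_cong Fs)
  also have "\<dots> = sw2 C c (\<lambda>a y. sw2 C y (\<lambda>b z. f a b z))"
    using C c by (intro sw2_cong) (auto simp: Fp)
  finally have 1: "F (sw2 C c (\<lambda>a y. sw2 C y (\<lambda>b z. pure C (tens C C) a (pure C C b z)))) = \<dots>" .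
  have "F (sw2 C c (\<lambda>x z. sw2 C x (\<lambda>a b. pure C (tens C C) a (pure C C b z)))) =
      sw2 C c (\<lambda>x z. sw2 C x (\<lambda>a b. F (pure C (tens C C) a (pure C C b z))))"
    using C c by (subst Fs) (auto intro!: sw2_cong Fs)
  also have "\<dots> = sw2 C c (\<lambda>x z. sw2 C x (\<lambda>a b. f a b z))"
    using C c by (intro sw2_cong) (auto simp: Fp)
  finally have 2: "F (sw2 C c (\<lambda>x z. sw2 C x (\<lambda>a b. pure C (tens C C) a (pure C C b z)))) = \<dots>" .
  show ?thesis using 1 2 coalg_axioms(1)[OF C c] by simp
qed

lemma counit:
  assumes C: "is_coalg C" and U: "is_vs U" and c: "c \<in> car C" and f: "lin C U f"
  shows "sw2 C c (\<lambda>a b. scl U (cou C a) (f b)) = f c" "sw2 C c (\<lambda>a b. scl U (cou C b) (f a)) = f c"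
proof -
  have "sw2 C c (\<lambda>a b. scl U (cou C a) (f b)) = f (sw2 C c (\<lambda>a b. scl C (cou C a) b))"
    using C U c f by (subst sw2_apply[where U=C, OF _ _ _ f]) (auto intro!: sw2_cong simp: lin_scl[OF f])
  then show "sw2 C c (\<lambda>a b. scl U (cou C a) (f b)) = f c" by (simp only: coalg_axioms(2)[OF C c])
  have "sw2 C c (\<lambda>a b. scl U (cou C b) (f a)) = f (sw2 C c (\<lambda>a b. scl C (cou C b) a))"
    using C U c f by (subst sw2_apply[where U=C, OF _ _ _ f]) (auto intro!: sw2_cong simp: lin_scl[OF f])
  then show "sw2 C c (\<lambda>a b. scl U (cou C b) (f a)) = f c" by (simp only: coalg_axioms(3)[OF C c])
qed

lemma is_coalgI:
  assumes "is_vs C" "lin C (tens C C) (cop C)" "lin C field_vs (cou C)"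
    and "\<And>c. c \<in> car C \<Longrightarrow> sw2 C c (\<lambda>c1 c'. sw2 C c' (\<lambda>c2 c3. pure C (tens C C) c1 (pure C C c2 c3))) =
                sw2 C c (\<lambda>c' c3. sw2 C c' (\<lambda>c1 c2. pure C (tens C C) c1 (pure C C c2 c3)))"
    and "\<And>c. c \<in> car C \<Longrightarrow> sw2 C c (\<lambda>c1 c2. scl C (cou C c1) c2) = c"
    and "\<And>c. c \<in> car C \<Longrightarrow> sw2 C c (\<lambda>c1 c2. scl C (cou C c2) c1) = c"
  shows "is_coalg C"
  using assms unfolding is_coalg_def by blast


definition cop_coalg :: "('f::field, 'v::ab_group_add, 'x) coalg_scheme \<Rightarrow> ('f, 'v) coalg" where
  "cop_coalg C = \<lparr>car = car C, scl = scl C, cop = (\<lambda>c. sw2 C c (\<lambda>a b. pure C C b a)), cou = cou C\<rparr>"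

lemma same_vs_cop_coalg: "same_vs (cop_coalg C) C"
  by (simp add: same_vs_def cop_coalg_def)
lemmas cop_coalg_cong [simp] = same_vs_cong[OF same_vs_cop_coalg]

lemma cou_cop_coalg [simp]: "cou (cop_coalg C) = cou C"
  by (simp add: cop_coalg_def)

lemma sw2_cop_coalg:
  assumes "is_coalg C" "is_vs U" "c \<in> car C"
    "\<And>b. b \<in> car C \<Longrightarrow> lin C U (\<lambda>a. f a b)" "\<And>a. a \<in> car C \<Longrightarrow> lin C U (\<lambda>b. f a b)"
  shows "sw2 (cop_coalg C) c f = sw2 C c (\<lambda>a b. f b a)"
proof -
  have l: "lin (tens C C) U (\<lambda>t. tsum C C t f)"
    using assms by (intro tsum_lin_left bilinI) auto
  have "sw2 (cop_coalg C) c f = tsum C C (sw2 C c (\<lambda>a b. pure C C b a)) f"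
    by (simp add: sw2_def[of "cop_coalg C"]) (simp add: cop_coalg_def)
  also have "\<dots> = sw2 C c (\<lambda>a b. tsum C C (pure C C b a) f)"
    using assms by (intro sw2_apply[where U="tens C C", OF _ _ _ l]) auto
  also have "\<dots> = sw2 C c (\<lambda>a b. f b a)"
    using assms by (intro sw2_cong tsum_pure[where U=U] bilinI) auto
  finally show ?thesis .
qed

lemma pre_coalg_cop_coalg [simp]: "is_coalg C \<Longrightarrow> pre_coalg (cop_coalg C)"
  unfolding pre_coalg_def by simp (simp add: cop_coalg_def)

lemma is_coalg_cop_coalg [simp]:
  assumes C: "is_coalg C"
  shows "is_coalg (cop_coalg C)"
proof (rule is_coalgI)
  show "lin (cop_coalg C) (tens (cop_coalg C) (cop_coalg C)) (cop (cop_coalg C))"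
    using C by simp (simp add: cop_coalg_def)
  fix c assume "c \<in> car (cop_coalg C)"
  then have c: "c \<in> car C" by simp
  let ?U = "tens C (tens C C)" and ?CC = "cop_coalg C"
  have "sw2 ?CC c (\<lambda>c1 c'. sw2 ?CC c' (\<lambda>c2 c3. pure C (tens C C) c1 (pure C C c2 c3))) =
     sw2 C c (\<lambda>c' c1. sw2 ?CC c' (\<lambda>c2 c3. pure C (tens C C) c1 (pure C C c2 c3)))"
    using C c by (intro sw2_cop_coalg[where U="?U"]) simp_all
  also have "\<dots> = sw2 C c (\<lambda>c' c1. sw2 C c' (\<lambda>c3 c2. pure C (tens C C) c1 (pure C C c2 c3)))"
    using C c by (intro sw2_cong sw2_cop_coalg[where U="?U"]) simp_all
  also have "\<dots> = sw2 C c (\<lambda>c3 c'. sw2 C c' (\<lambda>c2 c1. pure C (tens C C) c1 (pure C C c2 c3)))"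
    using C c by (intro coassoc[where U="?U"]) simp_all
  also have "\<dots> = sw2 C c (\<lambda>c3 c'. sw2 ?CC c' (\<lambda>c1 c2. pure C (tens C C) c1 (pure C C c2 c3)))"
    using C c by (intro sw2_cong sw2_cop_coalg[where U="?U", symmetric]) simp_all
  also have "\<dots> = sw2 ?CC c (\<lambda>c' c3. sw2 ?CC c' (\<lambda>c1 c2. pure C (tens C C) c1 (pure C C c2 c3)))"
    using C c by (intro sw2_cop_coalg[where U="?U", symmetric]) simp_all
  finally show "sw2 ?CC c (\<lambda>c1 c'. sw2 ?CC c' (\<lambda>c2 c3. pure ?CC (tens ?CC ?CC) c1 (pure ?CC ?CC c2 c3))) =
         sw2 ?CC c (\<lambda>c' c3. sw2 ?CC c' (\<lambda>c1 c2. pure ?CC (tens ?CC ?CC) c1 (pure ?CC ?CC c2 c3)))"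
    by simp
  show "sw2 ?CC c (\<lambda>c1 c2. scl ?CC (cou ?CC c1) c2) = c" "sw2 ?CC c (\<lambda>c1 c2. scl ?CC (cou ?CC c2) c1) = c"
    using C c by (simp_all add: sw2_cop_coalg[where U=C] coalg_axioms)
qed (use C in simp_all)

definition tcoalg :: "('f::field, 'v::ab_group_add, 'x) coalg_scheme \<Rightarrow>
    ('f, 'w::ab_group_add, 'y) coalg_scheme \<Rightarrow> ('f, ('f, 'v, 'w) tensor) coalg" where
  "tcoalg C E = \<lparr>car = car (tens C E), scl = scl (tens C E),
     cop = (\<lambda>t. tsum C E t (\<lambda>k h. sw2 C k (\<lambda>k1 k2. sw2 E h (\<lambda>h1 h2.
         pure (tens C E) (tens C E) (pure C E k1 h1) (pure C E k2 h2))))),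
     cou = (\<lambda>t. tsum C E t (\<lambda>k h. cou C k * cou E h))\<rparr>"

lemma same_vs_tcoalg: "same_vs (tcoalg C E) (tens C E)"
  by (simp add: same_vs_def tcoalg_def)
lemmas tcoalg_cong [simp] = same_vs_cong[OF same_vs_tcoalg]

lemma pre_coalg_tcoalg [simp]: "is_coalg C \<Longrightarrow> is_coalg E \<Longrightarrow> pre_coalg (tcoalg C E)"
  unfolding pre_coalg_def by simp (simp add: tcoalg_def)

lemma cou_tcoalg_pure [simp]:
  "is_coalg C \<Longrightarrow> is_coalg E \<Longrightarrow> k \<in> car C \<Longrightarrow> h \<in> car E \<Longrightarrow> cou (tcoalg C E) (pure C E k h) = cou C k * cou E h"
  by (simp add: tcoalg_def tsum_pure[where U=field_vs])

lemma sw2_tcoalg_pure: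
  assumes C: "is_coalg C" and E: "is_coalg E" and U: "is_vs U"
    and kh: "k \<in> car C" "h \<in> car E"
    and f: "\<And>b. b \<in> car (tens C E) \<Longrightarrow> lin (tens C E) U (\<lambda>a. f a b)"
      "\<And>a. a \<in> car (tens C E) \<Longrightarrow> lin (tens C E) U (\<lambda>b. f a b)"
  shows "sw2 (tcoalg C E) (pure C E k h) f =
    sw2 C k (\<lambda>k1 k2. sw2 E h (\<lambda>h1 h2. f (pure C E k1 h1) (pure C E k2 h2)))"
proof -
  let ?T = "tens (tens C E) (tens C E)"
  define F where "F = (\<lambda>t. tsum (tens C E) (tens C E) t f)"
  have F: "lin ?T U F" unfolding F_def using assms by (intro tsum_lin_left) simp_all
  have "sw2 (tcoalg C E) (pure C E k h) f = F (sw2 C k (\<lambda>k1 k2. sw2 E h (\<lambda>h1 h2.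
         pure (tens C E) (tens C E) (pure C E k1 h1) (pure C E k2 h2))))"
    unfolding sw2_def[of "tcoalg C E"] using assms
    by (simp add: F_def) (simp add: tcoalg_def tsum_pure[where U="?T"])
  also have "\<dots> = sw2 C k (\<lambda>k1 k2. F (sw2 E h (\<lambda>h1 h2.
         pure (tens C E) (tens C E) (pure C E k1 h1) (pure C E k2 h2))))"
    using assms by (intro sw2_apply[where U="?T", OF _ _ _ F]) simp_all
  also have "\<dots> = sw2 C k (\<lambda>k1 k2. (sw2 E h (\<lambda>h1 h2.
         F (pure (tens C E) (tens C E) (pure C E k1 h1) (pure C E k2 h2)))))"
    using assms by (intro sw2_cong sw2_apply[where U="?T", OF _ _ _ F]) simp_all
  also have "\<dots> = sw2 C k (\<lambda>k1 k2. sw2 E h (\<lambda>h1 h2. f (pure C E k1 h1) (pure C E k2 h2)))"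
    using assms by (intro sw2_cong) (simp_all add: F_def tsum_pure[where U=U])
  finally show ?thesis .
qed

lemma is_coalg_tcoalg [simp]:
  assumes C: "is_coalg C" and E: "is_coalg E"
  shows "is_coalg (tcoalg C E)"
proof (rule is_coalgI)
  let ?T = "tcoalg C E" and ?CE = "tens C E"
  let ?U = "tens ?CE (tens ?CE ?CE)"
  show "lin ?T (tens ?T ?T) (cop ?T)" "lin ?T field_vs (cou ?T)"
    using C E by simp_all (simp_all add: tcoalg_def)
  fix c assume "c \<in> car ?T"
  then have c: "c \<in> car ?CE" by simp
  note [simp] = C E
  have "\<forall>c\<in>car ?CE. sw2 ?T c (\<lambda>c1 c'. sw2 ?T c' (\<lambda>c2 c3. pure ?CE (tens ?CE ?CE) c1 (pure ?CE ?CE c2 c3))) =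
         sw2 ?T c (\<lambda>c' c3. sw2 ?T c' (\<lambda>c1 c2. pure ?CE (tens ?CE ?CE) c1 (pure ?CE ?CE c2 c3)))"
  proof (rule tens_ball_ext[where U="?U"])
    fix k h assume kh: "k \<in> car C" "h \<in> car E"
    have "sw2 ?T (pure C E k h) (\<lambda>c1 c'. sw2 ?T c' (\<lambda>c2 c3. pure ?CE (tens ?CE ?CE) c1 (pure ?CE ?CE c2 c3))) =
      sw2 C k (\<lambda>k1 k'. sw2 E h (\<lambda>h1 h'. sw2 ?T (pure C E k' h')
         (\<lambda>c2 c3. pure ?CE (tens ?CE ?CE) (pure C E k1 h1) (pure ?CE ?CE c2 c3))))"
      using kh by (intro sw2_tcoalg_pure[where U="?U"]) simp_all
    also have "\<dots> = sw2 C k (\<lambda>k1 k'. sw2 E h (\<lambda>h1 h'. sw2 C k' (\<lambda>k2 k3. sw2 E h' (\<lambda>h2 h3. pure ?CE (tens ?CE ?CE) (pure C E k1 h1) (pure ?CE ?CE (pure C E k2 h2) (pure C E k3 h3))))))"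
      using kh by (intro sw2_cong sw2_tcoalg_pure[where U="?U"]) simp_all
    also have "\<dots> = sw2 C k (\<lambda>k1 k'. sw2 C k' (\<lambda>k2 k3. sw2 E h (\<lambda>h1 h'. sw2 E h' (\<lambda>h2 h3. pure ?CE (tens ?CE ?CE) (pure C E k1 h1) (pure ?CE ?CE (pure C E k2 h2) (pure C E k3 h3))))))"
      using kh by (intro sw2_cong sw2_swap) simp_all
    also have "\<dots> = sw2 C k (\<lambda>k' k3. sw2 C k' (\<lambda>k1 k2. sw2 E h (\<lambda>h1 h'. sw2 E h' (\<lambda>h2 h3. pure ?CE (tens ?CE ?CE) (pure C E k1 h1) (pure ?CE ?CE (pure C E k2 h2) (pure C E k3 h3))))))"
      using kh by (intro coassoc[where U="?U", symmetric]) simp_all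
    also have "\<dots> = sw2 C k (\<lambda>k' k3. sw2 C k' (\<lambda>k1 k2. sw2 E h (\<lambda>h' h3. sw2 E h' (\<lambda>h1 h2. pure ?CE (tens ?CE ?CE) (pure C E k1 h1) (pure ?CE ?CE (pure C E k2 h2) (pure C E k3 h3))))))"
      using kh by (intro sw2_cong coassoc[where U="?U", symmetric]) simp_all
    also have "\<dots> = sw2 C k (\<lambda>k' k3. sw2 E h (\<lambda>h' h3. sw2 C k' (\<lambda>k1 k2. sw2 E h' (\<lambda>h1 h2. pure ?CE (tens ?CE ?CE) (pure C E k1 h1) (pure ?CE ?CE (pure C E k2 h2) (pure C E k3 h3))))))"
      using kh by (intro sw2_cong sw2_swap) simp_all
    also have "\<dots> = sw2 C k (\<lambda>k' k3. sw2 E h (\<lambda>h' h3. sw2 ?T (pure C E k' h') (\<lambda>c1 c2. pure ?CE (tens ?CE ?CE) c1 (pure ?CE ?CE c2 (pure C E k3 h3)))))"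
      using kh by (intro sw2_cong sw2_tcoalg_pure[where U="?U", symmetric]) simp_all
    also have "\<dots> = sw2 ?T (pure C E k h) (\<lambda>c' c3. sw2 ?T c' (\<lambda>c1 c2. pure ?CE (tens ?CE ?CE) c1 (pure ?CE ?CE c2 c3)))"
      using kh by (intro sw2_tcoalg_pure[where U="?U", symmetric]) simp_all
    finally show "sw2 ?T (pure C E k h) (\<lambda>c1 c'. sw2 ?T c' (\<lambda>c2 c3. pure ?CE (tens ?CE ?CE) c1 (pure ?CE ?CE c2 c3))) =
      sw2 ?T (pure C E k h) (\<lambda>c' c3. sw2 ?T c' (\<lambda>c1 c2. pure ?CE (tens ?CE ?CE) c1 (pure ?CE ?CE c2 c3)))" .
  qed simp_all
  with c show "sw2 ?T c (\<lambda>c1 c'. sw2 ?T c' (\<lambda>c2 c3. pure ?T (tens ?T ?T) c1 (pure ?T ?T c2 c3))) =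
         sw2 ?T c (\<lambda>c' c3. sw2 ?T c' (\<lambda>c1 c2. pure ?T (tens ?T ?T) c1 (pure ?T ?T c2 c3)))"
    by simp
  have l: "lin ?CE field_vs (cou ?T)" by (simp add: tcoalg_def)
  note [simp] = l lin_comp[OF l]
  have p: "scl ?CE (a * b) (pure C E x y) = pure C E (scl C a x) (scl E b y)"
    if "x \<in> car C" "y \<in> car E" for a b x y
    using that lin_scl[OF bilinD(1)[OF bilin_pure], of "scl E b y" E x C a]
      lin_scl[OF bilinD(2)[OF bilin_pure], of x C y E b] by simp
  have "\<forall>c\<in>car ?CE. sw2 ?T c (\<lambda>c1 c2. scl ?CE (cou ?T c1) c2) = c"
  proof (rule tens_ball_ext[where U="?CE"])
    fix k h assume kh: "k \<in> car C" "h \<in> car E"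
    have "sw2 ?T (pure C E k h) (\<lambda>c1 c2. scl ?CE (cou ?T c1) c2) =
      sw2 C k (\<lambda>k1 k2. sw2 E h (\<lambda>h1 h2. scl ?CE (cou ?T (pure C E k1 h1)) (pure C E k2 h2)))"
      using kh by (intro sw2_tcoalg_pure[where U="?CE"]) simp_all
    also have "\<dots> = sw2 C k (\<lambda>k1 k2. sw2 E h (\<lambda>h1 h2. scl ?CE (cou E h1) (pure C E (scl C (cou C k1) k2) h2)))"
      using kh by (intro sw2_cong) (simp_all add: p p[where b=1, simplified, symmetric] mult.commute)
    also have "\<dots> = sw2 C k (\<lambda>k1 k2. pure C E (scl C (cou C k1) k2) h)"
      using kh by (intro sw2_cong counit[where U="?CE"]) simp_all
    also have "\<dots> = sw2 C k (\<lambda>k1 k2. scl ?CE (cou C k1) (pure C E k2 h))"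
      using kh by (intro sw2_cong) (simp_all add: p[where b=1, simplified, symmetric])
    also have "\<dots> = pure C E k h"
      using kh by (intro counit[where U="?CE"]) simp_all
    finally show "sw2 ?T (pure C E k h) (\<lambda>c1 c2. scl ?CE (cou ?T c1) c2) = pure C E k h" .
  qed simp_all
  with c show "sw2 ?T c (\<lambda>c1 c2. scl ?T (cou ?T c1) c2) = c" by simp
  have "\<forall>c\<in>car ?CE. sw2 ?T c (\<lambda>c1 c2. scl ?CE (cou ?T c2) c1) = c"
  proof (rule tens_ball_ext[where U="?CE"])
    fix k h assume kh: "k \<in> car C" "h \<in> car E"
    have "sw2 ?T (pure C E k h) (\<lambda>c1 c2. scl ?CE (cou ?T c2) c1) =
      sw2 C k (\<lambda>k1 k2. sw2 E h (\<lambda>h1 h2. scl ?CE (cou ?T (pure C E k2 h2)) (pure C E k1 h1)))"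
      using kh by (intro sw2_tcoalg_pure[where U="?CE"]) simp_all
    also have "\<dots> = sw2 C k (\<lambda>k1 k2. sw2 E h (\<lambda>h1 h2. scl ?CE (cou E h2) (pure C E (scl C (cou C k2) k1) h1)))"
      using kh by (intro sw2_cong) (simp_all add: p p[where b=1, simplified, symmetric] mult.commute)
    also have "\<dots> = sw2 C k (\<lambda>k1 k2. pure C E (scl C (cou C k2) k1) h)"
      using kh by (intro sw2_cong counit[where U="?CE"]) simp_all
    also have "\<dots> = sw2 C k (\<lambda>k1 k2. scl ?CE (cou C k2) (pure C E k1 h))"
      using kh by (intro sw2_cong) (simp_all add: p[where b=1, simplified, symmetric])
    also have "\<dots> = pure C E k h"
      using kh by (intro counit[where U="?CE"]) simp_all
    finally show "sw2 ?T (pure C E k h) (\<lambda>c1 c2. scl ?CE (cou ?T c2) c1) = pure C E k h" .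
  qed simp_all
  with c show "sw2 ?T c (\<lambda>c1 c2. scl ?T (cou ?T c2) c1) = c" by simp
qed (use C E in simp_all)


section \<open>Algebras, convolution, and bialgebras\<close>

lemma is_alg_simps [simp]:
  assumes "is_alg A"
  shows "is_vs A" "uni A \<in> car A" "a \<in> car A \<Longrightarrow> mul A (uni A) a = a" "a \<in> car A \<Longrightarrow> mul A a (uni A) = a"
  using assms unfolding is_alg_def by auto

lemma bilin_mul: "is_alg A \<Longrightarrow> bilin A A A (mul A)"
  unfolding is_alg_def by blast

lemma mul_assoc: "is_alg A \<Longrightarrow> a \<in> car A \<Longrightarrow> b \<in> car A \<Longrightarrow> c \<in> car A \<Longrightarrow>
    mul A (mul A a b) c = mul A a (mul A b c)"
  unfolding is_alg_def by blast

lemma mul_closed [simp]: "is_alg A \<Longrightarrow> same_vs A W \<Longrightarrow> a \<in> car A \<Longrightarrow> b \<in> car A \<Longrightarrow> mul A a b \<in> car W"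
  unfolding same_vs_def by (auto intro: bilin_closed[OF bilin_mul])

lemma lin_mul [simp]:
  assumes "is_alg A" "same_vs A W"
  shows "lin V A f \<Longrightarrow> c \<in> car A \<Longrightarrow> lin V W (\<lambda>x. mul A (f x) c)"
    "lin V A f \<Longrightarrow> c \<in> car A \<Longrightarrow> lin V W (\<lambda>x. mul A c (f x))"
  unfolding same_vs_lin(2)[OF assms(2), symmetric]
  using lin_bilin1[OF bilin_mul[OF assms(1)]] lin_bilin2[OF bilin_mul[OF assms(1)]] by blast+

lemma mul_scl:
  assumes "is_alg A" "a \<in> car A" "b \<in> car A"
  shows "mul A (scl A c a) b = scl A c (mul A a b)" "mul A a (scl A c b) = scl A c (mul A a b)"
  using lin_scl[OF lin_mul(1)[OF assms(1) same_vs_refl lin_ident assms(3)] assms(2)]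
    lin_scl[OF lin_mul(2)[OF assms(1) same_vs_refl lin_ident assms(2)] assms(3)] by simp_all

lemma is_algI:
  assumes "is_vs A" "bilin A A A (mul A)" "uni A \<in> car A"
    "\<And>a b c. a \<in> car A \<Longrightarrow> b \<in> car A \<Longrightarrow> c \<in> car A \<Longrightarrow> mul A (mul A a b) c = mul A a (mul A b c)"
    "\<And>a. a \<in> car A \<Longrightarrow> mul A (uni A) a = a" "\<And>a. a \<in> car A \<Longrightarrow> mul A a (uni A) = a"
  shows "is_alg A"
  using assms unfolding is_alg_def by blast

text \<open>
  This is uniqueness of inverses in the monoid \<open>Hom(C, A)\<close>: evaluate \<open>g' * f * g\<close> in both ways.
\<close>

lemma conv_inverse_unique:
  assumes C: "is_coalg C" and A: "is_alg A"
    and l: "lin C A f" "lin C A g" "lin C A g'"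
    and r: "\<And>c. c \<in> car C \<Longrightarrow> sw2 C c (\<lambda>a b. mul A (f a) (g b)) = scl A (cou C c) (uni A)"
    and l': "\<And>c. c \<in> car C \<Longrightarrow> sw2 C c (\<lambda>a b. mul A (g' a) (f b)) = scl A (cou C c) (uni A)"
    and c: "c \<in> car C"
  shows "g c = g' c"
proof -
  have [simp]: "f c \<in> car A" "g c \<in> car A" "g' c \<in> car A" if "c \<in> car C" for c
    using that l by (auto intro: lin_closed)
  have [simp]: "lin V A (\<lambda>x. f (h x))" "lin V A (\<lambda>x. g (h x))" "lin V A (\<lambda>x. g' (h x))" if "lin V C h"
    for V :: "('a, 'b, 'c) coalg_scheme" and h
    using that l by (auto intro: lin_comp)
  note [simp] = C A c
  have "g c = sw2 C c (\<lambda>a b. scl A (cou C a) (g b))" using l by (intro counit(1)[symmetric]) auto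
  also have "\<dots> = sw2 C c (\<lambda>x b. mul A (sw2 C x (\<lambda>u v. mul A (g' u) (f v))) (g b))"
    by (intro sw2_cong) (auto simp: l' mul_scl)
  also have "\<dots> = sw2 C c (\<lambda>x b. sw2 C x (\<lambda>u v. mul A (mul A (g' u) (f v)) (g b)))"
    by (intro sw2_cong sw2_apply[where U=A and U'=A and \<phi>="\<lambda>z. mul A z (g _)"]) auto
  also have "\<dots> = sw2 C c (\<lambda>u x. sw2 C x (\<lambda>v b. mul A (mul A (g' u) (f v)) (g b)))"
    by (intro coassoc[where U=A]) auto
  also have "\<dots> = sw2 C c (\<lambda>u x. mul A (g' u) (sw2 C x (\<lambda>v b. mul A (f v) (g b))))"
    by (intro sw2_cong) (auto simp: mul_assoc sw2_apply[where U=A and U'=A and \<phi>="\<lambda>z. mul A (g' _) z"] intro!: sw2_cong)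
  also have "\<dots> = sw2 C c (\<lambda>u x. scl A (cou C x) (g' u))"
    by (intro sw2_cong) (auto simp: r mul_scl)
  also have "\<dots> = g' c" using l by (intro counit(2)) auto
  finally show ?thesis .
qed

lemma same_vs_talg: "same_vs (talg A B) (tens A B)"
  by (simp add: same_vs_def talg_def)
lemmas talg_cong [simp] = same_vs_cong[OF same_vs_talg]

lemma talg_simps [simp]: "uni (talg A B) = pure A B (uni A) (uni B)"
  by (simp add: talg_def)

lemma talg_lin:
  assumes [simp]: "is_alg A" "is_alg B"
  shows "s \<in> car (tens A B) \<Longrightarrow> lin (tens A B) (tens A B) (\<lambda>t. mul (talg A B) t s)"
    "s \<in> car (tens A B) \<Longrightarrow> lin (tens A B) (tens A B) (\<lambda>t. mul (talg A B) s t)"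
  by (simp_all add: talg_def)

lemma talg_pure [simp]:
  assumes [simp]: "is_alg A" "is_alg B" and [simp]: "a \<in> car A" "a' \<in> car A" "b \<in> car B" "b' \<in> car B"
  shows "mul (talg A B) (pure A B a b) (pure A B a' b') = pure A B (mul A a a') (mul B b b')"
  by (simp add: talg_def tsum_pure[where U="tens A B"])

lemma is_alg_talg [simp]:
  assumes [simp]: "is_alg A" "is_alg B"
  shows "is_alg (talg A B)"
proof (rule is_algI)
  let ?T = "tens A B" and ?m = "mul (talg A B)"
  have [simp]: "lin V ?T (\<lambda>x. ?m (f x) s)" "lin V ?T (\<lambda>x. ?m s (f x))" if "lin V ?T f" "s \<in> car ?T"
    for V :: "('a, 'x::ab_group_add, 'y) vs_scheme" and f s
    using that by (auto intro: lin_comp[OF talg_lin(1)] lin_comp[OF talg_lin(2)])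
  have [simp]: "?m s t \<in> car ?T" if "s \<in> car ?T" "t \<in> car ?T" for s t
    by (rule lin_closed[OF talg_lin(1)[OF assms that(2)] that(1)])
  show "bilin (talg A B) (talg A B) (talg A B) ?m" by simp
  have 1: "\<forall>s\<in>car ?T. ?m (?m s (pure A B a b)) (pure A B a' b') = ?m s (?m (pure A B a b) (pure A B a' b'))"
    if [simp]: "a \<in> car A" "b \<in> car B" "a' \<in> car A" "b' \<in> car B" for a a' b b'
    by (rule tens_ball_ext[where U="?T"]) (simp_all add: mul_assoc)
  have 2: "\<forall>t\<in>car ?T. ?m (?m s t) (pure A B a' b') = ?m s (?m t (pure A B a' b'))"
    if [simp]: "s \<in> car ?T" "a' \<in> car A" "b' \<in> car B" for a' b' s
    by (rule tens_ball_ext[where U="?T"]) (use 1 in simp_all)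
  have 3: "\<forall>r\<in>car ?T. ?m (?m s t) r = ?m s (?m t r)"
    if [simp]: "s \<in> car ?T" "t \<in> car ?T" for s t
    by (rule tens_ball_ext[where U="?T"]) (use 2 in simp_all)
  show "?m (?m a b) c = ?m a (?m b c)" if "a \<in> car (talg A B)" "b \<in> car (talg A B)" "c \<in> car (talg A B)" for a b c
    using that 3 by simp
  have "\<forall>r\<in>car ?T. ?m (pure A B (uni A) (uni B)) r = r" by (rule tens_ball_ext[where U="?T"]) simp_all
  then show "?m (uni (talg A B)) a = a" if "a \<in> car (talg A B)" for a using that by simp
  have "\<forall>r\<in>car ?T. ?m r (pure A B (uni A) (uni B)) = r" by (rule tens_ball_ext[where U="?T"]) simp_all
  then show "?m a (uni (talg A B)) = a" if "a \<in> car (talg A B)" for a using that by simp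
qed simp_all

lemma same_vs_coalg_of: "same_vs (coalg_of H) H"
  by (simp add: same_vs_def coalg_of_def)
lemmas coalg_of_cong [simp] = same_vs_cong[OF same_vs_coalg_of]

lemma coalg_of_simps [simp]: "cop (coalg_of H) = bcop H" "cou (coalg_of H) = bcou H"
  by (simp_all add: coalg_of_def)

lemma is_bialg_simps [simp]:
  assumes "is_bialg H"
  shows "is_alg H" "is_coalg (coalg_of H)" "bcou H (uni H) = 1"
    "bcop H (uni H) = pure H H (uni H) (uni H)"
    "a \<in> car H \<Longrightarrow> b \<in> car H \<Longrightarrow> bcou H (mul H a b) = bcou H a * bcou H b"
  using assms unfolding is_bialg_def by auto

lemma bcop_mul:
  "is_bialg H \<Longrightarrow> a \<in> car H \<Longrightarrow> b \<in> car H \<Longrightarrow> bcop H (mul H a b) = mul (talg H H) (bcop H a) (bcop H b)"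
  unfolding is_bialg_def by blast

lemma bcop_lin [simp]:
  assumes "is_coalg (coalg_of H)"
  shows "lin V H f \<Longrightarrow> lin V (tens H H) (\<lambda>x. bcop H (f x))" "lin V H f \<Longrightarrow> lin V field_vs (\<lambda>x. bcou H (f x))"
    "h \<in> car H \<Longrightarrow> bcop H h \<in> car (tens H H)" "is_vs H"
  using lin_cop[of "coalg_of H" V f] lin_cou[of "coalg_of H" V f] is_coalg_simps(2)[of "coalg_of H" h]
    is_coalg_simps(1)[of "coalg_of H"] assms by auto

lemma sw2_pure: "is_coalg (coalg_of H) \<Longrightarrow> h \<in> car H \<Longrightarrow> sw2 (coalg_of H) h (pure H H) = bcop H h"
  by (simp add: sw2_def tsum_self)

text \<open>
  A formula for the coproduct of \<open>h\<close> as a Sweedler sum over some other coalgebra is a substitution rule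
  for every bilinear expression in \<open>h\<^sub>(\<^sub>1\<^sub>)\<close> and \<open>h\<^sub>(\<^sub>2\<^sub>)\<close>.
\<close>

lemma sw2_of_bcop:
  assumes "is_coalg (coalg_of H)" "is_vs U" "bilin H H U f" "is_coalg C" "c \<in> car C"
    "bcop H h = sw2 C c (\<lambda>a b. pure H H (p a b) (q a b))"
    "\<And>a b. a \<in> car C \<Longrightarrow> b \<in> car C \<Longrightarrow> p a b \<in> car H" "\<And>a b. a \<in> car C \<Longrightarrow> b \<in> car C \<Longrightarrow> q a b \<in> car H"
  shows "sw2 (coalg_of H) h f = sw2 C c (\<lambda>a b. f (p a b) (q a b))"
proof -
  have l: "lin (tens H H) U (\<lambda>t. tsum H H t f)" using assms by (intro tsum_lin_left) auto
  have "sw2 (coalg_of H) h f = tsum H H (sw2 C c (\<lambda>a b. pure H H (p a b) (q a b))) f"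
    by (simp add: sw2_def[of "coalg_of H"] assms(6))
  also have "\<dots> = sw2 C c (\<lambda>a b. tsum H H (pure H H (p a b) (q a b)) f)"
    using assms by (intro sw2_apply[where U="tens H H", OF _ _ _ l]) auto
  also have "\<dots> = sw2 C c (\<lambda>a b. f (p a b) (q a b))"
    using assms by (intro sw2_cong tsum_pure[where U=U]) auto
  finally show ?thesis .
qed

lemma sw2_mul:
  assumes H: "is_bialg H" and U: "is_vs U" and a: "a \<in> car H" and b: "b \<in> car H" and f: "bilin H H U f"
  shows "sw2 (coalg_of H) (mul H a b) f =
    sw2 (coalg_of H) a (\<lambda>a1 a2. sw2 (coalg_of H) b (\<lambda>b1 b2. f (mul H a1 b1) (mul H a2 b2)))"
proof -
  let ?C = "coalg_of H" and ?T = "talg H H"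
  note [simp] = H U a b
  have l: "lin (tens H H) U (\<lambda>t. tsum H H t f)" using f by (intro tsum_lin_left) auto
  have 0: "bcop H (mul H a b) = sw2 ?C a (\<lambda>a1 a2. sw2 ?C b (\<lambda>b1 b2. pure H H (mul H a1 b1) (mul H a2 b2)))"
    by (simp add: bcop_mul talg_def sw2_def)
  have "sw2 ?C (mul H a b) f = tsum H H (sw2 ?C a (\<lambda>a1 a2. sw2 ?C b (\<lambda>b1 b2. pure H H (mul H a1 b1) (mul H a2 b2)))) f"
    by (simp add: sw2_def[of _ "mul H a b"] 0)
  also have "\<dots> = sw2 ?C a (\<lambda>a1 a2. tsum H H (sw2 ?C b (\<lambda>b1 b2. pure H H (mul H a1 b1) (mul H a2 b2))) f)"
    by (intro sw2_apply[where U="tens H H", OF _ _ _ l]) auto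
  also have "\<dots> = sw2 ?C a (\<lambda>a1 a2. sw2 ?C b (\<lambda>b1 b2. tsum H H (pure H H (mul H a1 b1) (mul H a2 b2)) f))"
    by (intro sw2_cong sw2_apply[where U="tens H H", OF _ _ _ l]) auto
  also have "\<dots> = sw2 ?C a (\<lambda>a1 a2. sw2 ?C b (\<lambda>b1 b2. f (mul H a1 b1) (mul H a2 b2)))"
    using f by (intro sw2_cong tsum_pure[where U=U]) auto
  finally show ?thesis .
qed

lemma sw2_uni:
  assumes "is_bialg H" "is_vs U" "bilin H H U f"
  shows "sw2 (coalg_of H) (uni H) f = f (uni H) (uni H)"
  using assms by (simp add: sw2_def tsum_pure[where U=U])

lemma is_bialgI:
  assumes "is_alg H" "is_coalg (coalg_of H)"
    "\<And>a b. a \<in> car H \<Longrightarrow> b \<in> car H \<Longrightarrow> bcop H (mul H a b) = mul (talg H H) (bcop H a) (bcop H b)"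
    "bcop H (uni H) = uni (talg H H)"
    "\<And>a b. a \<in> car H \<Longrightarrow> b \<in> car H \<Longrightarrow> bcou H (mul H a b) = bcou H a * bcou H b" "bcou H (uni H) = 1"
  shows "is_bialg H"
  using assms unfolding is_bialg_def by blast


section \<open>The antipode\<close>

lemma is_hopf_simps [simp]:
  assumes "is_hopf H"
  shows "is_bialg H" "is_antipode H (ant H)" "lin V H f \<Longrightarrow> lin V H (\<lambda>x. ant H (f x))" "h \<in> car H \<Longrightarrow> ant H h \<in> car H"
proof -
  show "is_bialg H" and *: "is_antipode H (ant H)" using assms unfolding is_hopf_def by auto
  have "lin H H (ant H)" using * unfolding is_antipode_def by auto
  then show "lin V H f \<Longrightarrow> lin V H (\<lambda>x. ant H (f x))" "h \<in> car H \<Longrightarrow> ant H h \<in> car H"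
    by (auto intro: lin_comp lin_closed)
qed

lemma antipode:
  assumes "is_antipode H S" "h \<in> car H"
  shows "sw2 (coalg_of H) h (\<lambda>a b. mul H (S a) b) = scl H (bcou H h) (uni H)"
    "sw2 (coalg_of H) h (\<lambda>a b. mul H a (S b)) = scl H (bcou H h) (uni H)"
  using assms unfolding is_antipode_def conv_def by auto

lemma antipode_unique:
  assumes "is_bialg H" "is_antipode H S" "is_antipode H S'" "h \<in> car H"
  shows "S h = S' h"
  by (rule conv_inverse_unique[where C="coalg_of H" and A=H and f="\<lambda>x. x" and g=S and g'=S' and c=h])
    (use assms in \<open>auto simp: antipode\<close>, auto simp: is_antipode_def)

lemma ant_uni [simp]:
  assumes "is_hopf H" shows "ant H (uni H) = uni H"
proof -
  have "ant H (uni H) = sw2 (coalg_of H) (uni H) (\<lambda>a b. mul H (ant H a) b)"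
    using assms by (subst sw2_uni[where U=H]) auto
  then show ?thesis using assms by (simp add: antipode)
qed

lemma bcou_ant [simp]:
  assumes "is_hopf H" "h \<in> car H" shows "bcou H (ant H h) = bcou H h"
proof -
  note [simp] = assms
  have "bcou H h = bcou H (sw2 (coalg_of H) h (\<lambda>a b. mul H (ant H a) b))"
    by (simp add: antipode[OF is_hopf_simps(2)] lin_scl[where f="bcou H" and V=H and W=field_vs])
  also have "\<dots> = sw2 (coalg_of H) h (\<lambda>a b. bcou H (mul H (ant H a) b))"
    by (intro sw2_apply[where U=H and U'=field_vs]) simp_all
  also have "\<dots> = sw2 (coalg_of H) h (\<lambda>a b. scl field_vs (bcou H b) (bcou H (ant H a)))"
    by (intro sw2_cong) simp_all
  also have "\<dots> = bcou H (ant H h)"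
    using counit(2)[of "coalg_of H" field_vs h "\<lambda>a. bcou H (ant H a)"] by simp
  finally show ?thesis by simp
qed

text \<open>
  In \<open>Hom(H \<otimes> H, H)\<close> the two maps \<open>a \<otimes> b \<mapsto> S(a b)\<close> and \<open>a \<otimes> b \<mapsto> S(b) S(a)\<close> are a left and a right
  convolution inverse of the multiplication, so they agree.
\<close>

lemma ant_mul:
  assumes H: "is_hopf H" and ab: "a \<in> car H" "b \<in> car H"
  shows "ant H (mul H a b) = mul H (ant H b) (ant H a)"
proof -
  note [simp] = H ab
  let ?C = "coalg_of H" let ?T = "tcoalg ?C ?C" and ?S = "ant H"
  define m where "m = (\<lambda>t. tsum H H t (mul H))"
  define n where "n = (\<lambda>t. tsum H H t (\<lambda>a b. mul H (?S b) (?S a)))"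
  have [simp]: "lin V H (\<lambda>x. m (f x))" "lin V H (\<lambda>x. n (f x))" if "lin V (tens H H) f"
    for V :: "('a, 'x::ab_group_add, 'y) vs_scheme" and f
    using that by (auto simp: m_def n_def)
  have [simp]: "m t \<in> car H" "n t \<in> car H" if "t \<in> car (tens H H)" for t
    using that by (auto simp: m_def n_def)
  have [simp]: "m (pure H H a b) = mul H a b" "n (pure H H a b) = mul H (?S b) (?S a)"
    if "a \<in> car H" "b \<in> car H" for a b
    using that by (simp_all add: m_def n_def tsum_pure[where U=H])
  have 1: "\<forall>t\<in>car (tens H H). sw2 ?T t (\<lambda>x y. mul H (m x) (n y)) = scl H (cou ?T t) (uni H)"
  proof (rule tens_ball_ext[where U=H])
    fix a b assume [simp]: "a \<in> car H" "b \<in> car H"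
    have "sw2 ?T (pure ?C ?C a b) (\<lambda>x y. mul H (m x) (n y)) =
       sw2 ?C a (\<lambda>a1 a2. sw2 ?C b (\<lambda>b1 b2. mul H (m (pure ?C ?C a1 b1)) (n (pure ?C ?C a2 b2))))"
      by (rule sw2_tcoalg_pure[where U=H]) simp_all
    also have "\<dots> = sw2 ?C a (\<lambda>a1 a2. sw2 ?C b (\<lambda>b1 b2. mul H a1 (mul H (mul H b1 (?S b2)) (?S a2))))"
      by (intro sw2_cong) (simp_all add: mul_assoc)
    also have "\<dots> = sw2 ?C a (\<lambda>a1 a2. mul H a1 (mul H (sw2 ?C b (\<lambda>b1 b2. mul H b1 (?S b2))) (?S a2)))"
      by (intro sw2_cong sw2_apply[where U=H and U'=H and \<phi>="\<lambda>z. mul H _ (mul H z _)", symmetric]) simp_all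
    also have "\<dots> = sw2 ?C a (\<lambda>a1 a2. scl H (bcou H b) (mul H a1 (?S a2)))"
      by (intro sw2_cong) (simp_all add: antipode[OF is_hopf_simps(2)] mul_scl)
    also have "\<dots> = scl H (bcou H b) (sw2 ?C a (\<lambda>a1 a2. mul H a1 (?S a2)))"
      by (intro sw2_apply[where U=H and U'=H, symmetric]) simp_all
    finally show "sw2 ?T (pure H H a b) (\<lambda>x y. mul H (m x) (n y)) = scl H (cou ?T (pure H H a b)) (uni H)"
      using cou_tcoalg_pure[of ?C ?C a b] by (simp add: antipode[OF is_hopf_simps(2)] mult.commute del: cou_tcoalg_pure)
  qed simp_all
  have 2: "\<forall>t\<in>car (tens H H). sw2 ?T t (\<lambda>x y. mul H (?S (m x)) (m y)) = scl H (cou ?T t) (uni H)"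
  proof (rule tens_ball_ext[where U=H])
    fix a b assume [simp]: "a \<in> car H" "b \<in> car H"
    have "sw2 ?T (pure ?C ?C a b) (\<lambda>x y. mul H (?S (m x)) (m y)) =
       sw2 ?C a (\<lambda>a1 a2. sw2 ?C b (\<lambda>b1 b2. mul H (?S (m (pure ?C ?C a1 b1))) (m (pure ?C ?C a2 b2))))"
      by (rule sw2_tcoalg_pure[where U=H]) simp_all
    also have "\<dots> = sw2 ?C a (\<lambda>a1 a2. sw2 ?C b (\<lambda>b1 b2. mul H (?S (mul H a1 b1)) (mul H a2 b2)))"
      by (intro sw2_cong) (simp_all add: mul_assoc)
    also have "\<dots> = sw2 ?C (mul H a b) (\<lambda>x y. mul H (?S x) y)"
      by (intro sw2_mul[where U=H, symmetric]) simp_all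
    finally show "sw2 ?T (pure H H a b) (\<lambda>x y. mul H (?S (m x)) (m y)) = scl H (cou ?T (pure H H a b)) (uni H)"
      using cou_tcoalg_pure[of ?C ?C a b] by (simp add: antipode[OF is_hopf_simps(2)] mult.commute del: cou_tcoalg_pure)
  qed simp_all
  have "n (pure H H a b) = ?S (m (pure H H a b))"
    by (rule conv_inverse_unique[where C="?T" and A=H and f=m and g=n and g'="\<lambda>t. ?S (m t)" and c="pure H H a b"])
      (use 1 2 in simp_all)
  then show ?thesis by simp
qed

text \<open>
  In \<open>Hom(H, H \<otimes> H)\<close> both \<open>\<Delta> \<circ> S\<close> and \<open>(S \<otimes> S) \<circ> \<tau> \<circ> \<Delta>\<close>, with \<open>\<tau>\<close> the flip, are convolution
  inverse to \<open>\<Delta>\<close>.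
\<close>

lemma bcop_ant:
  assumes H: "is_hopf H" and h: "h \<in> car H"
  shows "bcop H (ant H h) = sw2 (coalg_of H) h (\<lambda>a b. pure H H (ant H b) (ant H a))"
proof -
  note [simp] = H h
  let ?C = "coalg_of H" and ?T = "talg H H" and ?S = "ant H"
  define n where "n = (\<lambda>h. sw2 ?C h (\<lambda>a b. pure H H (?S b) (?S a)))"
  have [simp]: "lin V (tens H H) (\<lambda>x. n (f x))" if "lin V H f"
    for V :: "('a, 'x::ab_group_add, 'y) vs_scheme" and f
    using that by (auto simp: n_def)
  have [simp]: "n t \<in> car (tens H H)" if "t \<in> car H" for t
    using that by (auto simp: n_def)
  have eq: "mul ?T (bcop H a) s = sw2 ?C a (\<lambda>u v. mul ?T (pure H H u v) s)"
    if [simp]: "a \<in> car H" "s \<in> car (tens H H)" for a s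
    using sw2_apply[where C="?C" and c=a and U="tens H H" and U'="tens H H" and \<phi>="\<lambda>t. mul ?T t s" and f="pure H H"]
    by (simp add: sw2_pure)
  have 1: "sw2 ?C h (\<lambda>a b. mul ?T (bcop H a) (n b)) = scl ?T (cou ?C h) (uni ?T)" if [simp]: "h \<in> car H" for h
  proof -
    have "sw2 ?C h (\<lambda>a b. mul ?T (bcop H a) (n b)) =
       sw2 ?C h (\<lambda>a b. sw2 ?C b (\<lambda>c d. mul ?T (bcop H a) (pure H H (?S d) (?S c))))"
      unfolding n_def by (intro sw2_cong sw2_apply[where U="tens H H" and U'="tens H H"]) simp_all
    also have "\<dots> = sw2 ?C h (\<lambda>a b. sw2 ?C b (\<lambda>c d. sw2 ?C a (\<lambda>u v. mul ?T (pure H H u v) (pure H H (?S d) (?S c)))))"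
      by (intro sw2_cong eq) simp_all
    also have "\<dots> = sw2 ?C h (\<lambda>a b. sw2 ?C b (\<lambda>c d. sw2 ?C a (\<lambda>u v. pure H H (mul H u (?S d)) (mul H v (?S c)))))"
      by (intro sw2_cong) simp_all
    also have "\<dots> = sw2 ?C h (\<lambda>a b. sw2 ?C a (\<lambda>u v. sw2 ?C b (\<lambda>c d. pure H H (mul H u (?S d)) (mul H v (?S c)))))"
      by (intro sw2_cong sw2_swap) simp_all
    also have "\<dots> = sw2 ?C h (\<lambda>u b. sw2 ?C b (\<lambda>v b. sw2 ?C b (\<lambda>c d. pure H H (mul H u (?S d)) (mul H v (?S c)))))"
      by (intro coassoc[where U="tens H H"]) simp_all
    also have "\<dots> = sw2 ?C h (\<lambda>u b. sw2 ?C b (\<lambda>b d. sw2 ?C b (\<lambda>v c. pure H H (mul H u (?S d)) (mul H v (?S c)))))"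
      by (intro sw2_cong coassoc[where U="tens H H", symmetric]) simp_all
    also have "\<dots> = sw2 ?C h (\<lambda>u b. sw2 ?C b (\<lambda>b d. pure H H (mul H u (?S d)) (sw2 ?C b (\<lambda>v c. mul H v (?S c)))))"
      by (intro sw2_cong sw2_apply[where U="H" and U'="tens H H", symmetric]) simp_all
    also have "\<dots> = sw2 ?C h (\<lambda>u b. sw2 ?C b (\<lambda>b d. scl (tens H H) (bcou H b) (pure H H (mul H u (?S d)) (uni H))))"
      by (intro sw2_cong) (simp_all add: antipode[OF is_hopf_simps(2)] lin_scl[OF bilinD(2)[OF bilin_pure]])
    also have "\<dots> = sw2 ?C h (\<lambda>u b. pure H H (mul H u (?S b)) (uni H))"
      using counit(1)[of ?C "tens H H", where f="\<lambda>b. pure H H (mul H _ (?S b)) (uni H)"] by (intro sw2_cong) simp_all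
    also have "\<dots> = pure H H (sw2 ?C h (\<lambda>u b. mul H u (?S b))) (uni H)"
      by (intro sw2_apply[where U="H" and U'="tens H H" and \<phi>="\<lambda>z. pure H H z (uni H)", symmetric]) simp_all
    also have "\<dots> = scl ?T (cou ?C h) (uni ?T)"
      by (simp add: antipode[OF is_hopf_simps(2)] lin_scl[OF bilinD(1)[OF bilin_pure]])
    finally show ?thesis .
  qed
  have 2: "sw2 ?C h (\<lambda>a b. mul ?T (bcop H (?S a)) (bcop H b)) = scl ?T (cou ?C h) (uni ?T)" if [simp]: "h \<in> car H" for h
  proof -
    have "sw2 ?C h (\<lambda>a b. mul ?T (bcop H (?S a)) (bcop H b)) = sw2 ?C h (\<lambda>a b. bcop H (mul H (?S a) b))"
      by (intro sw2_cong) (simp_all add: bcop_mul)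
    also have "\<dots> = bcop H (sw2 ?C h (\<lambda>a b. mul H (?S a) b))"
      by (intro sw2_apply[where U="H" and U'="tens H H", symmetric]) simp_all
    also have "\<dots> = scl ?T (cou ?C h) (uni ?T)"
      by (simp add: antipode[OF is_hopf_simps(2)] lin_scl[where f="bcop H" and V=H and W="tens H H"])
    finally show ?thesis .
  qed
  have "n h = bcop H (?S h)"
    by (rule conv_inverse_unique[where C="?C" and A="?T" and f="bcop H" and g=n and g'="\<lambda>h. bcop H (?S h)" and c=h])
      (use 1 2 in simp_all)
  then show ?thesis by (simp add: n_def)
qed


section \<open>Coalgebra maps\<close>

lemma sw2_cop_coalg':
  assumes "is_coalg C" "car C = X" "is_vs U" "c \<in> X"
    "\<And>b. b \<in> X \<Longrightarrow> lin C U (\<lambda>a. f a b)" "\<And>a. a \<in> X \<Longrightarrow> lin C U (\<lambda>b. f a b)"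
  shows "sw2 (cop_coalg C) c f = sw2 C c (\<lambda>a b. f b a)"
  by (rule sw2_cop_coalg) (use assms in blast)+

definition coalg_map :: "('f::field, 'v::ab_group_add, 'x) coalg_scheme \<Rightarrow>
    ('f, 'w::ab_group_add, 'y) coalg_scheme \<Rightarrow> ('v \<Rightarrow> 'w) \<Rightarrow> bool" where
  "coalg_map C E f \<longleftrightarrow> lin C E f \<and>
     (\<forall>c\<in>car C. cop E (f c) = sw2 C c (\<lambda>a b. pure E E (f a) (f b)) \<and> cou E (f c) = cou C c)"

lemma coalg_mapD:
  assumes "coalg_map C E f"
  shows "lin C E f" "c \<in> car C \<Longrightarrow> f c \<in> car E" "c \<in> car C \<Longrightarrow> cou E (f c) = cou C c"
    "c \<in> car C \<Longrightarrow> cop E (f c) = sw2 C c (\<lambda>a b. pure E E (f a) (f b))"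
  using assms unfolding coalg_map_def by (auto intro: lin_closed)

lemma coalg_map_sw2:
  assumes [simp]: "is_coalg C" "is_coalg E" "is_vs U" "c \<in> car C" and f: "coalg_map C E f"
    and F: "\<And>b. b \<in> car E \<Longrightarrow> lin E U (\<lambda>a. F a b)" "\<And>a. a \<in> car E \<Longrightarrow> lin E U (\<lambda>b. F a b)"
  shows "sw2 E (f c) F = sw2 C c (\<lambda>a b. F (f a) (f b))"
proof -
  note [simp] = coalg_mapD(2)[OF f] F
  have l: "lin (tens E E) U (\<lambda>t. tsum E E t F)" by (intro tsum_lin_left) simp_all
  have "sw2 E (f c) F = tsum E E (sw2 C c (\<lambda>a b. pure E E (f a) (f b))) F"
    by (simp add: sw2_def[of E] coalg_mapD(4)[OF f])
  also have "\<dots> = sw2 C c (\<lambda>a b. tsum E E (pure E E (f a) (f b)) F)"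
    by (intro sw2_apply[where U="tens E E", OF _ _ _ l]) simp_all
  also have "\<dots> = sw2 C c (\<lambda>a b. F (f a) (f b))"
    by (intro sw2_cong tsum_pure[where U=U]) simp_all
  finally show ?thesis .
qed

lemma coalg_map_sw2':
  assumes "is_coalg C" "is_coalg E" "is_vs U" "c \<in> car C" "coalg_map C E f" "car E = X"
    "\<And>b. b \<in> X \<Longrightarrow> lin E U (\<lambda>a. F a b)" "\<And>a. a \<in> X \<Longrightarrow> lin E U (\<lambda>b. F a b)"
  shows "sw2 E (f c) F = sw2 C c (\<lambda>a b. F (f a) (f b))"
  by (rule coalg_map_sw2) (use assms in blast)+

lemma coalg_map_id: "is_coalg C \<Longrightarrow> coalg_map C C (\<lambda>x. x)"
  unfolding coalg_map_def by (simp add: sw2_def tsum_self)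

lemma coalg_map_comp:
  assumes [simp]: "is_coalg C" "is_coalg D" "is_coalg E" and f: "coalg_map C D f" and g: "coalg_map D E g"
  shows "coalg_map C E (\<lambda>x. g (f x))"
  unfolding coalg_map_def
proof (intro conjI ballI)
  show "lin C E (\<lambda>x. g (f x))" using coalg_mapD(1)[OF f] coalg_mapD(1)[OF g] by (rule lin_comp[rotated])
  fix c assume [simp]: "c \<in> car C"
  note [simp] = coalg_mapD(2)[OF f] coalg_mapD(2)[OF g] lin_comp[OF coalg_mapD(1)[OF g]]
  show "cou E (g (f c)) = cou C c" by (simp add: coalg_mapD(3)[OF f] coalg_mapD(3)[OF g])
  show "cop E (g (f c)) = sw2 C c (\<lambda>a b. pure E E (g (f a)) (g (f b)))"
    by (simp add: coalg_mapD(4)[OF g] coalg_map_sw2'[OF _ _ _ _ f, where U="tens E E"])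
qed

lemma coalg_map_cop:
  assumes [simp]: "is_coalg C" "is_coalg E" and f: "coalg_map C E f"
  shows "coalg_map (cop_coalg C) (cop_coalg E) f"
  unfolding coalg_map_def
proof (intro conjI ballI)
  show "lin (cop_coalg C) (cop_coalg E) f" using coalg_mapD(1)[OF f] by simp
  fix c assume "c \<in> car (cop_coalg C)"
  then have [simp]: "c \<in> car C" by simp
  note [simp] = coalg_mapD(2)[OF f] lin_comp[OF coalg_mapD(1)[OF f]] coalg_mapD(1)[OF f]
  show "cou (cop_coalg E) (f c) = cou (cop_coalg C) c" by (simp add: coalg_mapD(3)[OF f])
  show "cop (cop_coalg E) (f c) = sw2 (cop_coalg C) c (\<lambda>a b. pure (cop_coalg E) (cop_coalg E) (f a) (f b))"
    by (simp add: sw2_cop_coalg'[where U="tens E E"])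
      (simp add: cop_coalg_def coalg_map_sw2'[OF _ _ _ _ f, where U="tens E E"])
qed

lemma ant_coalg_map:
  assumes H: "is_hopf H"
  shows "coalg_map (cop_coalg (coalg_of H)) (coalg_of H) (ant H)"
    "coalg_map (coalg_of H) (cop_coalg (coalg_of H)) (ant H)"
proof -
  note [simp] = H
  show "coalg_map (cop_coalg (coalg_of H)) (coalg_of H) (ant H)"
    unfolding coalg_map_def by (simp add: bcop_ant sw2_cop_coalg'[where U="tens H H"])
  have "sw2 (coalg_of H) (ant H c) (\<lambda>a b. pure H H b a) = sw2 (coalg_of H) c (\<lambda>a b. pure H H (ant H a) (ant H b))"
    if "c \<in> car H" for c
    using that by (subst sw2_of_bcop[where U="tens H H" and C="coalg_of H" and c=c, OF _ _ _ _ _ bcop_ant]) simp_all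
  then show "coalg_map (coalg_of H) (cop_coalg (coalg_of H)) (ant H)"
    unfolding coalg_map_def by simp (simp add: cop_coalg_def)
qed

lemma coalg_map_ant_inverse:
  assumes [simp]: "is_coalg C" "is_hopf A" and f: "coalg_map C (coalg_of A) f" and [simp]: "c \<in> car C"
  shows "sw2 C c (\<lambda>a b. mul A (f a) (ant A (f b))) = scl A (cou C c) (uni A)"
    "sw2 C c (\<lambda>a b. mul A (ant A (f a)) (f b)) = scl A (cou C c) (uni A)"
proof -
  have [simp]: "f c \<in> car A" using coalg_mapD(2)[OF f] by simp
  have "sw2 (coalg_of A) (f c) (\<lambda>a b. mul A a (ant A b)) = scl A (cou C c) (uni A)"
     "sw2 (coalg_of A) (f c) (\<lambda>a b. mul A (ant A a) b) = scl A (cou C c) (uni A)"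
    using coalg_mapD(3)[OF f] by (simp_all add: antipode[OF is_hopf_simps(2)])
  then show "sw2 C c (\<lambda>a b. mul A (f a) (ant A (f b))) = scl A (cou C c) (uni A)"
    "sw2 C c (\<lambda>a b. mul A (ant A (f a)) (f b)) = scl A (cou C c) (uni A)"
    by (simp_all add: coalg_map_sw2'[OF _ _ _ _ f, where U="A"])
qed

text \<open>
  Injectivity of the antipode cannot be assumed at this point, but coalgebra maps can be cancelled
  against it: the composite of \<open>S\<close> with a coalgebra map is a convolution inverse of that map, and inverses
  determine each other.
\<close>

lemma ant_cancel:
  assumes C: "is_coalg C" and A: "is_hopf A" and f: "coalg_map C (coalg_of A) f" and g: "coalg_map C (coalg_of A) g"
    and eq: "\<And>c. c \<in> car C \<Longrightarrow> ant A (f c) = ant A (g c)" and c: "c \<in> car C"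
  shows "f c = g c"
proof -
  note [simp] = C A
  show ?thesis
  proof (rule conv_inverse_unique[where C=C and A=A and f="\<lambda>x. ant A (f x)" and g=f and g'=g and c=c])
    show "lin C A (\<lambda>x. ant A (f x))" "lin C A f" "lin C A g"
      using coalg_mapD(1)[OF f] coalg_mapD(1)[OF g] by simp_all
    fix x assume x: "x \<in> car C"
    show "sw2 C x (\<lambda>a b. mul A (ant A (f a)) (f b)) = scl A (cou C x) (uni A)"
      by (rule coalg_map_ant_inverse(2)[OF C A f x])
    have "sw2 C x (\<lambda>a b. mul A (g a) (ant A (f b))) = sw2 C x (\<lambda>a b. mul A (g a) (ant A (g b)))"
      using x by (intro sw2_cong) (simp_all add: eq)
    then show "sw2 C x (\<lambda>a b. mul A (g a) (ant A (f b))) = scl A (cou C x) (uni A)"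
      using coalg_map_ant_inverse(1)[OF C A g x] by simp
  qed (use c in simp_all)
qed


section \<open>Bijectivity of the antipode\<close>

lemma lin_extend:
  assumes V: "is_vs V" and W: "is_vs W" and f: "lin V W f"
  shows "\<exists>g. Vector_Spaces.linear (scl V) (scl W) g \<and> (\<forall>v\<in>car V. g v = f v)"
proof -
  interpret vector_space_pair "scl V" "scl W"
    unfolding vector_space_pair_def using is_vs_vector_space[OF V] is_vs_vector_space[OF W] by blast
  obtain B where B: "B \<subseteq> car V" "vs1.independent B" "car V \<subseteq> vs1.span B" by (rule vs1.basis_exists)
  obtain g where g: "Vector_Spaces.linear (scl V) (scl W) g" "\<forall>x\<in>B. g x = f x"
    using linear_independent_extend[OF B(2)] by blast
  interpret g: Vector_Spaces.linear "scl V" "scl W" g by fact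
  have "v \<in> car V \<and> g v = f v" if "v \<in> vs1.span B" for v
    using that
  proof (induction rule: vs1.span_induct_alt)
    case base
    then show ?case using V f by (simp add: lin_zero[OF V f] g.zero)
  next
    case (step c x y)
    then have "x \<in> car V" using B by auto
    then show ?case using step V f g(2) by (simp add: lin_add[OF f] lin_scl[OF f] g.add g.scale)
  qed
  then show ?thesis using g(1) B(3) by blast
qed

lemma fin_basis:
  assumes V: "is_vs V" and "fin_dim V"
  shows "\<exists>X. finite X \<and> is_basis V X"
proof -
  interpret vector_space "scl V" using V by (rule is_vs_vector_space)
  obtain X where X: "finite X" "span X = car V" using assms(2) unfolding fin_dim_def by blast
  obtain B where B: "B \<subseteq> X" "independent B" "X \<subseteq> span B" by (rule basis_exists)
  have "span B = car V" using B(1,3) X(2) by (metis span_mono span_span subset_antisym)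
  then show ?thesis using B X unfolding is_basis_def by (meson finite_subset)
qed

text \<open>
  The images of the elements of a basis span the whole space; by counting, they are distinct and form a
  basis again.
\<close>

lemma surj_imp_inj_on:
  assumes V: "is_vs V" and fd: "fin_dim V" and f: "lin V V f" and surj: "f ` car V = car V"
  shows "inj_on f (car V)"
proof -
  interpret p: vector_space_pair "scl V" "scl V"
    unfolding vector_space_pair_def using is_vs_vector_space[OF V] by blast
  obtain X where X: "finite X" "p.vs1.independent X" "p.vs1.span X = car V"
    using fin_basis[OF V fd] unfolding is_basis_def by blast
  obtain g where g: "Vector_Spaces.linear (scl V) (scl V) g" "\<forall>v\<in>car V. g v = f v"
    using lin_extend[OF V V f] by blast
  have "g ` car V = f ` car V" using g(2) by (intro image_cong) blast+
  then have sp: "p.vs1.span (g ` X) = car V"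
    by (simp only: p.linear_span_image[OF g(1)] X(3) surj)
  have sub: "g ` X \<subseteq> car V" using sp p.vs1.span_superset by blast
  obtain B where B: "B \<subseteq> g ` X" "p.vs1.independent B" "g ` X \<subseteq> p.vs1.span B" by (rule p.vs1.basis_exists)
  have fB: "finite B" using B(1) X(1) finite_subset by blast
  have "p.vs1.span (g ` X) \<subseteq> p.vs1.span B" using B(3) p.vs1.subspace_span by (rule p.vs1.span_minimal)
  then have "X \<subseteq> p.vs1.span B"
    unfolding sp X(3)[symmetric] using p.vs1.span_superset by blast
  then have "card X \<le> card B" using p.vs1.independent_span_bound[OF fB X(2)] by simp
  moreover have "card B \<le> card (g ` X)" using B(1) X(1) by (simp add: card_mono)
  moreover have "card (g ` X) \<le> card X" using X(1) by (rule card_image_le)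
  ultimately have c: "card (g ` X) = card X" "card B = card (g ` X)" by simp_all
  then have "B = g ` X" using B(1) X(1) by (intro card_subset_eq) simp_all
  then have "inj_on g X" "p.vs1.independent (g ` X)" using X(1) B(2) c(1) eq_card_imp_inj_on by auto
  then have "inj_on g (p.vs1.span X)" using p.linear_inj_on_span_independent_image[OF g(1)] by blast
  then show ?thesis using X(3) g(2) by (simp add: inj_on_def)
qed

lemma image_subspace:
  assumes V: "is_vs V" and f: "lin V V f"
  shows "module.subspace (scl V) (f ` car V)"
proof -
  interpret vector_space "scl V" using V by (rule is_vs_vector_space)
  show ?thesis
    unfolding subspace_def
  proof (intro conjI allI ballI)
    show "0 \<in> f ` car V" using lin_zero[OF V f] V by (metis imageI vs_closed(1))
    fix x assume "x \<in> f ` car V"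
    then obtain a where a: "x = f a" "a \<in> car V" by blast
    show "scl V c x \<in> f ` car V" for c using a V lin_scl[OF f] by (metis imageI vs_closed(3))
    fix y assume "y \<in> f ` car V"
    then obtain b where b: "y = f b" "b \<in> car V" by blast
    show "x + y \<in> f ` car V" using a b V lin_add[OF f] by (metis imageI vs_closed(2))
  qed
qed

text \<open>
  The ranges decrease, so a power whose range has least dimension has the same range as the next one.
\<close>

lemma ranges_stabilise:
  assumes V: "is_vs V" and fd: "fin_dim V" and T: "lin V V T"
  shows "\<exists>n. (T ^^ Suc n) ` car V = (T ^^ n) ` car V"
proof -
  interpret vector_space "scl V" using V by (rule is_vs_vector_space)
  obtain X where X: "finite X" "span X = car V" using fd unfolding fin_dim_def by blast
  have lT: "lin V V (T ^^ n)" for n using T by (induction n) (auto simp: lin_def)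
  define L where "L n = (T ^^ n) ` car V" for n
  have LV: "L n \<subseteq> span X" for n unfolding L_def using lin_closed[OF lT] X(2) by auto
  have Lsub: "subspace (L n)" for n unfolding L_def using image_subspace[OF V lT] .
  have dec: "L (Suc n) \<subseteq> L n" for n
  proof -
    have "(T ^^ Suc n) v = (T ^^ n) (T v)" for v by (metis comp_apply funpow_Suc_right)
    then show ?thesis unfolding L_def using lin_closed[OF T] by auto
  qed
  obtain n where "\<And>k. dim (L n) \<le> dim (L k)" using ex_has_least_nat[of "\<lambda>_. True" _ "\<lambda>n. dim (L n)"] by blast
  then have dim: "dim (L n) \<le> dim (L (Suc n))" by blast
  obtain B where B: "B \<subseteq> L (Suc n)" "independent B" "L (Suc n) \<subseteq> span B" "card B = dim (L (Suc n))" by (rule basis_exists)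
  obtain E where E: "E \<subseteq> L n" "independent E" "L n \<subseteq> span E" "card E = dim (L n)" by (rule basis_exists)
  have fE: "finite E" using independent_span_bound[OF X(1) E(2)] E(1) LV by blast
  have fB: "finite B" using independent_span_bound[OF X(1) B(2)] B(1) LV by blast
  have "L n \<subseteq> span B"
  proof
    fix v assume v: "v \<in> L n"
    show "v \<in> span B"
    proof (rule ccontr)
      assume nv: "v \<notin> span B"
      then have "independent (insert v B)" using B(2) by (simp add: independent_insert)
      moreover have "insert v B \<subseteq> span E" using v B(1) dec E(3) by blast
      ultimately have "card (insert v B) \<le> card E" using independent_span_bound[OF fE] by blast
      moreover have "v \<notin> B" using nv span_base by blast
      ultimately show False using fB B(4) E(4) dim by simp
    qed
  qed
  also have "span B \<subseteq> L (Suc n)" using B(1) Lsub by (simp add: span_minimal)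
  finally show ?thesis using dec unfolding L_def by blast
qed

lemma coalg_map_funpow:
  assumes "is_coalg C" "coalg_map C C T" shows "coalg_map C C (T ^^ n)"
proof (induction n)
  case 0
  then show ?case using coalg_map_id[OF assms(1)] by (simp add: id_def)
next
  case (Suc n)
  then show ?case using coalg_map_comp[OF assms(1,1,1) Suc assms(2)] by (simp add: comp_def)
qed

text \<open>
  The classical proof uses integrals; this one uses that \<open>S\<close> reverses coproducts.
  Let \<open>P = T\<^sup>m\<close> be a power of the coalgebra map \<open>T = S\<^sup>2\<close> whose range \<open>L\<close> is mapped onto itself by
  \<open>T\<close>, hence bijectively.  Inverting \<open>P\<close> on \<open>L\<close> turns \<open>P\<close> into a projection \<open>p\<close> onto \<open>L\<close> with
  \<open>P \<circ> p = P\<close>, which is again a coalgebra map.  Cancelling the \<open>2m\<close> antipodes in \<open>P\<close> one after the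
  other (\<open>ant_cancel\<close>) leaves \<open>p = id\<close>.  So \<open>L\<close> is everything, and \<open>S\<close> is surjective.
\<close>

lemma ant_bij:
  assumes H: "is_hopf H" and fd: "fin_dim H"
  shows "bij_betw (ant H) (car H) (car H)"
proof -
  note [simp] = H
  let ?C = "coalg_of H" and ?S = "ant H"
  define T where "T = (\<lambda>x. ?S (?S x))"
  have cT: "coalg_map ?C ?C T"
    unfolding T_def by (rule coalg_map_comp[OF _ _ _ ant_coalg_map(2,1)]) simp_all
  have lT: "lin H H T" by (simp add: T_def)
  obtain n where n: "(T ^^ Suc n) ` car H = (T ^^ n) ` car H"
    using ranges_stabilise[OF _ fd lT] by auto
  define L where "L = (T ^^ n) ` car H"
  have LH: "L \<subseteq> car H" unfolding L_def using coalg_mapD(2)[OF coalg_map_funpow[OF _ cT]] by auto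
  have TL: "T ` L = L" using n unfolding L_def by (simp add: image_comp)
  define m where "m = Suc n"
  define P where "P = T ^^ m"
  have cP: "coalg_map ?C ?C P" unfolding P_def by (rule coalg_map_funpow[OF _ cT]) simp
  have lP: "lin H H P" using coalg_mapD(1)[OF cP] by simp
  have PH: "P ` car H = L" using n by (simp add: P_def m_def L_def)
  have PL: "P ` L = L"
  proof -
    have "(T ^^ k) ` L = L" for k by (induction k) (simp, metis TL funpow.simps(2) image_comp)
    then show ?thesis by (simp add: P_def)
  qed
  let ?V = "\<lparr>car = L, scl = scl H\<rparr>"
  have vsH: "is_vs H" by simp
  have vsV: "is_vs ?V"
    unfolding is_vs_def using image_subspace[OF vsH lP] is_vs_vector_space[OF vsH] by (simp only: PH vs.simps simp_thms)
  have fdV: "fin_dim ?V"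
  proof -
    interpret p: vector_space_pair "scl H" "scl H"
      unfolding vector_space_pair_def using is_vs_vector_space[of H] by simp
    obtain X where X: "finite X" "p.vs1.span X = car H" using fd unfolding fin_dim_def by blast
    obtain g where g: "Vector_Spaces.linear (scl H) (scl H) g" "\<forall>v\<in>car H. g v = P v"
      using lin_extend[OF _ _ lP] by auto
    have "g ` car H = P ` car H" using g(2) by (intro image_cong) blast+
    then have "p.vs1.span (g ` X) = L" by (simp only: p.linear_span_image[OF g(1)] X(2) PH)
    then show ?thesis unfolding fin_dim_def using X(1) by (metis finite_imageI vs.select_convs(1) vs.select_convs(2))
  qed
  have injP: "inj_on P L"
  proof -
    have "lin ?V ?V P" using lP LH PL unfolding lin_def by (simp add: subset_iff) blast
    then show ?thesis using surj_imp_inj_on[OF vsV fdV] PL by simp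
  qed
  define p where "p = (\<lambda>h. inv_into L P (P h))"
  have pL: "p h \<in> L" and Pp: "P (p h) = P h" if "h \<in> car H" for h
  proof -
    have "P h \<in> P ` L" using that PH PL by blast
    then show "p h \<in> L" "P (p h) = P h" unfolding p_def by (auto intro: inv_into_into f_inv_into_f)
  qed
  have p_id: "p x = x" if "x \<in> L" for x unfolding p_def using injP that by simp
  have L_add: "x + y \<in> L" and L_scl: "scl H c x \<in> L" if "x \<in> L" "y \<in> L" for x y c
    using vsV that vs_closed(2,3)[OF vsV] by auto
  have P_add: "P (x + y) = P x + P y" and P_scl: "P (scl H c x) = scl H c (P x)" if "x \<in> car H" "y \<in> car H" for x y c
    using lP that by (auto simp: lin_def)
  have lp: "lin H H p"
    unfolding lin_def
  proof (intro conjI ballI allI)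
    fix x y c assume x [simp]: "x \<in> car H" and y [simp]: "y \<in> car H"
    show "p x \<in> car H" using pL LH by auto
    have [simp]: "p x \<in> car H" "p y \<in> car H" using pL LH by auto
    have "P (p (x + y)) = P (p x + p y)" by (simp add: Pp P_add)
    then show "p (x + y) = p x + p y" using injP pL L_add by (simp add: inj_on_eq_iff)
    have "P (p (scl H c x)) = P (scl H c (p x))" by (simp add: Pp P_scl[OF _ x])
    then show "p (scl H c x) = scl H c (p x)" using injP pL L_scl[OF pL[OF x] pL[OF x]] by (simp add: inj_on_eq_iff)
  qed
  \<comment> \<open>With \<open>Q\<close> the inverse of \<open>P\<close> on \<open>L\<close>, this is \<open>Q \<circ> p\<close>, a linear extension of \<open>Q\<close> to the whole space.
    It satisfies \<open>g \<circ> P = p\<close>, which lets \<open>p\<close> inherit compatibility with coproducts from \<open>P\<close>.\<close>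
  define g where "g = (\<lambda>h. inv_into L P (p h))"
  have gL: "g h \<in> L" and Pg: "P (g h) = p h" if "h \<in> car H" for h
  proof -
    have "p h \<in> P ` L" using that PL pL by blast
    then show "g h \<in> L" "P (g h) = p h" unfolding g_def by (auto intro: inv_into_into f_inv_into_f)
  qed
  have lg: "lin H H g"
    unfolding lin_def
  proof (intro conjI ballI allI)
    fix x y c assume x [simp]: "x \<in> car H" and y [simp]: "y \<in> car H"
    show "g x \<in> car H" using gL LH by auto
    have [simp]: "g x \<in> car H" "g y \<in> car H" using gL LH by auto
    have "P (g (x + y)) = P (g x + g y)" by (simp add: Pg P_add lin_add[OF lp])
    then show "g (x + y) = g x + g y" using injP gL L_add by (simp add: inj_on_eq_iff)
    have "P (g (scl H c x)) = P (scl H c (g x))" by (simp add: Pg P_scl[OF _ x] lin_scl[OF lp])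
    then show "g (scl H c x) = scl H c (g x)" using injP gL L_scl[OF gL[OF x] gL[OF x]] by (simp add: inj_on_eq_iff)
  qed
  have gP: "g (P h) = p h" if "h \<in> car H" for h
    using that p_id[of "P h"] PH unfolding g_def by (auto simp: p_def)
  note [simp] = lin_closed[OF lp] lin_closed[OF lg] lin_closed[OF lP] lin_comp[OF lp] lin_comp[OF lg] lin_comp[OF lP]
  have cp: "coalg_map ?C ?C p"
    unfolding coalg_map_def
  proof (intro conjI ballI)
    show "lin ?C ?C p" using lp by simp
    fix h assume "h \<in> car ?C"
    then have h [simp]: "h \<in> car H" by simp
    \<comment> \<open>Then \<open>P h = P (P x)\<close>, and \<open>g \<circ> P\<close> is the identity on the range of \<open>P\<close>.\<close>
    obtain x where [simp]: "x \<in> car H" and x: "p h = P x" using pL[OF h] PH by blast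
    have Ph: "P h = P (P x)" using Pp[OF h] x by simp
    show "cou ?C (p h) = cou ?C h"
      using coalg_mapD(3)[OF cP, of "p h"] coalg_mapD(3)[OF cP, of h] Pp[OF h] by simp
    have "sw2 ?C h (\<lambda>a b. pure H H (p a) (p b)) = sw2 ?C h (\<lambda>a b. pure H H (g (P a)) (g (P b)))"
      by (intro sw2_cong) (simp_all add: gP)
    also have "\<dots> = sw2 ?C (P h) (\<lambda>a b. pure H H (g a) (g b))"
      by (intro coalg_map_sw2[OF _ _ _ _ cP, symmetric, where U="tens H H"]) simp_all
    also have "\<dots> = sw2 ?C (P x) (\<lambda>a b. pure H H (g (P a)) (g (P b)))"
      unfolding Ph by (intro coalg_map_sw2[OF _ _ _ _ cP, where U="tens H H"]) simp_all
    also have "\<dots> = sw2 ?C x (\<lambda>a b. pure H H (g (P (P a))) (g (P (P b))))"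
      by (intro coalg_map_sw2[OF _ _ _ _ cP, where U="tens H H"]) simp_all
    also have "\<dots> = sw2 ?C x (\<lambda>a b. pure H H (P a) (P b))"
      using PH by (intro sw2_cong) (auto simp add: gP p_id)
    finally show "cop ?C (p h) = sw2 ?C h (\<lambda>a b. pure ?C ?C (p a) (p b))"
      using coalg_mapD(4)[OF cP, of x] x by simp
  qed
  have "\<forall>h\<in>car H. (T ^^ (m - j)) (p h) = (T ^^ (m - j)) h" if "j \<le> m" for j
    using that
  proof (induction j)
    case 0
    then show ?case using Pp by (simp add: P_def)
  next
    case (Suc j)
    define k where "k = m - Suc j"
    have k: "m - j = Suc k" using Suc.prems by (simp add: k_def)
    have 1: "?S (?S ((T ^^ k) (p h))) = ?S (?S ((T ^^ k) h))" if "h \<in> car H" for h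
      using Suc.IH Suc.prems that by (simp add: k) (simp add: T_def)
    have c: "coalg_map ?C ?C (T ^^ k)" by (rule coalg_map_funpow[OF _ cT]) simp
    have cp': "coalg_map ?C ?C (\<lambda>h. (T ^^ k) (p h))" by (rule coalg_map_comp[OF _ _ _ cp c]) simp_all
    \<comment> \<open>The two sides of \<open>1\<close> are \<open>S\<close> applied to maps that reverse coproducts, so the outer antipode is
      cancelled over the co-opposite coalgebra and the inner one over the coalgebra itself.\<close>
    have 2: "?S ((T ^^ k) (p h)) = ?S ((T ^^ k) h)" if "h \<in> car H" for h
    proof (rule ant_cancel[where C="cop_coalg ?C" and A=H and f="\<lambda>h. ?S ((T ^^ k) (p h))" and g="\<lambda>h. ?S ((T ^^ k) h)" and c=h])
      show "coalg_map (cop_coalg ?C) ?C (\<lambda>h. ?S ((T ^^ k) (p h)))"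
        by (rule coalg_map_comp[OF _ _ _ coalg_map_cop[OF _ _ cp'] ant_coalg_map(1)]) simp_all
      show "coalg_map (cop_coalg ?C) ?C (\<lambda>h. ?S ((T ^^ k) h))"
        by (rule coalg_map_comp[OF _ _ _ coalg_map_cop[OF _ _ c] ant_coalg_map(1)]) simp_all
    qed (use 1 that in simp_all)
    have "(T ^^ k) (p h) = (T ^^ k) h" if "h \<in> car H" for h
      by (rule ant_cancel[where C="?C" and A=H and f="\<lambda>h. (T ^^ k) (p h)" and g="T ^^ k" and c=h])
        (use 2 that cp' c in simp_all)
    then show ?case by (simp add: k_def)
  qed
  from this[of m] have pid: "p h = h" if "h \<in> car H" for h using that by simp
  have "car H \<subseteq> L"
  proof
    fix h assume "h \<in> car H"
    then show "h \<in> L" using pL[of h] pid[of h] by simp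
  qed
  then have L: "L = car H" using LH by simp
  have "inj_on T (car H)"
    using surj_imp_inj_on[OF _ fd lT] TL L by simp
  then have "inj_on ?S (car H)" unfolding T_def by (auto simp: inj_on_def)
  moreover have "?S ` car H = car H"
  proof
    show "?S ` car H \<subseteq> car H" by auto
    have "T ` car H = car H" using TL L by simp
    moreover have "T ` car H \<subseteq> ?S ` car H" unfolding T_def by auto
    ultimately show "car H \<subseteq> ?S ` car H" by simp
  qed
  ultimately show ?thesis by (simp add: bij_betw_def)
qed


section \<open>The inverse antipode and the opposite Hopf algebra\<close>

lemma inv_ant:
  assumes "is_hopf H" "fin_dim H" "h \<in> car H"
  shows "inv_ant H h \<in> car H" "ant H (inv_ant H h) = h" "inv_ant H (ant H h) = h"
  using ant_bij[OF assms(1,2)] assms(3) unfolding inv_ant_def bij_betw_def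
  by (metis inv_into_into, metis f_inv_into_f, metis inv_into_f_f)

lemma inv_ant_eqI:
  assumes "is_hopf H" "fin_dim H" "x \<in> car H" "ant H x = h"
  shows "inv_ant H h = x"
  using inv_ant(3)[OF assms(1,2,3)] assms(4) by simp

lemma lin_inv_ant [simp]:
  assumes H: "is_hopf H" "fin_dim H"
  shows "lin V H f \<Longrightarrow> lin V H (\<lambda>x. inv_ant H (f x))"
proof -
  note [simp] = H inv_ant[OF H]
  have l: "lin H H (ant H)" using is_hopf_simps(3)[OF H(1) lin_ident] .
  have "is_vs H" by simp
  have "lin H H (inv_ant H)"
    unfolding lin_def using lin_add[OF l] lin_scl[OF l] by (auto intro!: inv_ant_eqI[OF H])
  then show "lin V H f \<Longrightarrow> lin V H (\<lambda>x. inv_ant H (f x))" by (rule lin_comp)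
qed

lemma inv_ant_mul:
  assumes H: "is_hopf H" "fin_dim H" and "a \<in> car H" "b \<in> car H"
  shows "inv_ant H (mul H a b) = mul H (inv_ant H b) (inv_ant H a)"
  using assms by (intro inv_ant_eqI) (simp_all add: inv_ant ant_mul)

lemma inv_ant_uni [simp]: "is_hopf H \<Longrightarrow> fin_dim H \<Longrightarrow> inv_ant H (uni H) = uni H"
  by (rule inv_ant_eqI) simp_all

lemma inv_ant_coalg_map:
  assumes H: "is_hopf H" "fin_dim H"
  shows "coalg_map (coalg_of H) (cop_coalg (coalg_of H)) (inv_ant H)"
    "coalg_map (cop_coalg (coalg_of H)) (coalg_of H) (inv_ant H)"
proof -
  note [simp] = H inv_ant[OF H]
  let ?C = "coalg_of H"
  have c: "bcou H (inv_ant H h) = bcou H h" if [simp]: "h \<in> car H" for h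
    using bcou_ant[of H "inv_ant H h"] by simp
  have 1: "sw2 ?C h (\<lambda>a b. pure H H (inv_ant H b) (inv_ant H a)) = bcop H (inv_ant H h)" if [simp]: "h \<in> car H" for h
  proof -
    define x where "x = inv_ant H h"
    have [simp]: "x \<in> car H" and h: "h = ant H x" by (simp_all add: x_def)
    have "sw2 ?C h (\<lambda>a b. pure H H (inv_ant H b) (inv_ant H a)) = sw2 (cop_coalg ?C) x (\<lambda>a b. pure H H (inv_ant H (ant H b)) (inv_ant H (ant H a)))"
      unfolding h by (intro coalg_map_sw2[OF _ _ _ _ ant_coalg_map(1), where U="tens H H"]) simp_all
    also have "\<dots> = sw2 ?C x (\<lambda>a b. pure H H (inv_ant H (ant H a)) (inv_ant H (ant H b)))"
      by (intro sw2_cop_coalg[where U="tens H H"]) simp_all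
    also have "\<dots> = sw2 ?C x (pure H H)" by (intro sw2_cong) simp_all
    finally show ?thesis by (simp add: sw2_pure x_def)
  qed
  show "coalg_map (cop_coalg ?C) ?C (inv_ant H)"
    unfolding coalg_map_def by (simp add: c 1 sw2_cop_coalg'[where U="tens H H"])
  have 2: "sw2 ?C h (\<lambda>a b. pure H H (inv_ant H a) (inv_ant H b)) = sw2 ?C (inv_ant H h) (\<lambda>a b. pure H H b a)" if [simp]: "h \<in> car H" for h
    using 1[OF that, symmetric] by (subst sw2_of_bcop[where U="tens H H" and C="?C" and c=h and p="\<lambda>a b. inv_ant H b" and q="\<lambda>a b. inv_ant H a"]) simp_all
  show "coalg_map ?C (cop_coalg ?C) (inv_ant H)"
    unfolding coalg_map_def by (simp add: c 2) (simp add: cop_coalg_def)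
qed

lemma bcou_inv_ant [simp]: "is_hopf H \<Longrightarrow> fin_dim H \<Longrightarrow> h \<in> car H \<Longrightarrow> bcou H (inv_ant H h) = bcou H h"
  using coalg_mapD(3)[OF inv_ant_coalg_map(1)] by fastforce

text \<open>
  Both identities become antipode axioms after \<open>S\<close>, which reverses products, has been applied.
\<close>

lemma inv_antipode:
  assumes H: "is_hopf H" "fin_dim H" and h: "h \<in> car H"
  shows "sw2 (coalg_of H) h (\<lambda>a b. mul H b (inv_ant H a)) = scl H (bcou H h) (uni H)"
    "sw2 (coalg_of H) h (\<lambda>a b. mul H (inv_ant H b) a) = scl H (bcou H h) (uni H)"
proof -
  note [simp] = H inv_ant[OF H] h
  let ?C = "coalg_of H"
  have l: "lin H H (ant H)" using is_hopf_simps(3)[OF H(1) lin_ident] .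
  have eqI: "x = scl H (bcou H h) (uni H)" if "x \<in> car H" "ant H x = scl H (bcou H h) (uni H)" for x
    using inv_ant(3)[OF H that(1)] that(2) inv_ant(3)[OF H, of "scl H (bcou H h) (uni H)"] lin_scl[OF l, of "uni H"] by simp
  have "ant H (sw2 ?C h (\<lambda>a b. mul H b (inv_ant H a))) = sw2 ?C h (\<lambda>a b. ant H (mul H b (inv_ant H a)))"
    by (intro sw2_apply[where U=H, OF _ _ _ l]) simp_all
  also have "\<dots> = sw2 ?C h (\<lambda>a b. mul H a (ant H b))"
    by (intro sw2_cong) (simp_all add: ant_mul)
  finally show "sw2 ?C h (\<lambda>a b. mul H b (inv_ant H a)) = scl H (bcou H h) (uni H)"
    by - (rule eqI, simp_all add: antipode[OF is_hopf_simps(2)])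
  have "ant H (sw2 ?C h (\<lambda>a b. mul H (inv_ant H b) a)) = sw2 ?C h (\<lambda>a b. ant H (mul H (inv_ant H b) a))"
    by (intro sw2_apply[where U=H, OF _ _ _ l]) simp_all
  also have "\<dots> = sw2 ?C h (\<lambda>a b. mul H (ant H a) b)"
    by (intro sw2_cong) (simp_all add: ant_mul)
  finally show "sw2 ?C h (\<lambda>a b. mul H (inv_ant H b) a) = scl H (bcou H h) (uni H)"
    by - (rule eqI, simp_all add: antipode[OF is_hopf_simps(2)])
qed

lemma same_vs_op_hopf: "same_vs (op_hopf K) K"
  by (simp add: same_vs_def op_hopf_def)
lemmas op_hopf_cong [simp] = same_vs_cong[OF same_vs_op_hopf]

lemma op_hopf_simps [simp]:
  "mul (op_hopf K) x y = mul K y x" "uni (op_hopf K) = uni K" "bcop (op_hopf K) = bcop K"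
  "bcou (op_hopf K) = bcou K" "ant (op_hopf K) = inv_ant K" "coalg_of (op_hopf K) = coalg_of K"
  by (simp_all add: op_hopf_def coalg_of_def)

lemma is_antipodeI:
  assumes "lin H H S"
    "\<And>h. h \<in> car H \<Longrightarrow> sw2 (coalg_of H) h (\<lambda>a b. mul H (S a) b) = scl H (bcou H h) (uni H)"
    "\<And>h. h \<in> car H \<Longrightarrow> sw2 (coalg_of H) h (\<lambda>a b. mul H a (S b)) = scl H (bcou H h) (uni H)"
  shows "is_antipode H S"
  using assms unfolding is_antipode_def conv_def by blast

text \<open>
  With reversed products the antipode axioms are those of \<open>S\<^sup>-\<^sup>1\<close>.
\<close>

lemma is_hopf_op_hopf [simp]:
  assumes K: "is_hopf K" "fin_dim K"
  shows "is_hopf (op_hopf K)"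
proof -
  note [simp] = K inv_ant[OF K]
  have alg: "is_alg (op_hopf K)"
    by (rule is_algI) (simp_all add: mul_assoc)
  have "is_bialg (op_hopf K)"
  proof (rule is_bialgI[OF alg])
    fix a b assume "a \<in> car (op_hopf K)" "b \<in> car (op_hopf K)"
    then have [simp]: "a \<in> car K" "b \<in> car K" by simp_all
    show "bcop (op_hopf K) (mul (op_hopf K) a b) = mul (talg (op_hopf K) (op_hopf K)) (bcop (op_hopf K) a) (bcop (op_hopf K) b)"
      by (simp add: bcop_mul) (simp add: talg_def sw2_def tsum_swap[of K K "bcop K b"])
  qed simp_all
  moreover have "is_antipode (op_hopf K) (inv_ant K)"
    by (rule is_antipodeI) (simp_all add: inv_antipode)
  ultimately show ?thesis unfolding is_hopf_def by simp
qed


section \<open>Hopf algebra structures agreeing on the carrier\<close>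

text \<open>
  The operations of the structures to be compared are equal on the carrier only, so properties
  cannot simply be rewritten from one record to the other.
\<close>

lemma bialg_transfer:
  assumes D: "is_bialg D" and vs: "same_vs D' D"
    and mul: "\<And>a b. a \<in> car D \<Longrightarrow> b \<in> car D \<Longrightarrow> mul D' a b = mul D a b" and uni: "uni D' = uni D"
    and cop: "\<And>a. a \<in> car D \<Longrightarrow> bcop D' a = bcop D a" and cou: "\<And>a. a \<in> car D \<Longrightarrow> bcou D' a = bcou D a"
  shows "is_bialg D'"
proof -
  note [simp] = D same_vs_cong[OF vs] mul uni cop cou
  have sw: "sw2 (coalg_of D') a f = sw2 (coalg_of D) a f" if "a \<in> car D" for a and f :: "'b \<Rightarrow> 'b \<Rightarrow> 'z::ab_group_add"
    using that by (simp add: sw2_def)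
  show ?thesis
  proof (rule is_bialgI)
    show "is_alg D'"
    proof (rule is_algI)
      show "bilin D' D' D' (mul D')"
      proof (rule bilinI)
        show "lin D' D' (\<lambda>v. mul D' v w)" if w: "w \<in> car D'" for w
          by simp (rule lin_cong'[where f="\<lambda>v. mul D v w"], use w in simp_all)
        show "lin D' D' (\<lambda>w. mul D' v w)" if v: "v \<in> car D'" for v
          by simp (rule lin_cong'[where f="\<lambda>w. mul D v w"], use v in simp_all)
      qed
    qed (simp_all add: mul_assoc)
    show "is_coalg (coalg_of D')"
    proof (rule is_coalgI)
      let ?C = "coalg_of D" and ?C' = "coalg_of D'"
      show "lin ?C' (tens ?C' ?C') (cop ?C')" "lin ?C' field_vs (cou ?C')"
        by simp (rule lin_cong'[where f="bcop D"], simp_all, rule lin_cong'[where f="bcou D"], simp_all)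
      fix c assume "c \<in> car ?C'"
      then have c [simp]: "c \<in> car D" by simp
      have "sw2 ?C c (\<lambda>c1 c'. sw2 ?C' c' (\<lambda>c2 c3. pure D (tens D D) c1 (pure D D c2 c3))) =
          sw2 ?C c (\<lambda>c1 c'. sw2 ?C c' (\<lambda>c2 c3. pure D (tens D D) c1 (pure D D c2 c3)))"
        by (intro sw2_cong sw) simp_all
      moreover have "sw2 ?C c (\<lambda>c' c3. sw2 ?C' c' (\<lambda>c1 c2. pure D (tens D D) c1 (pure D D c2 c3))) =
          sw2 ?C c (\<lambda>c' c3. sw2 ?C c' (\<lambda>c1 c2. pure D (tens D D) c1 (pure D D c2 c3)))"
        by (intro sw2_cong sw) simp_all
      moreover have "sw2 ?C c (\<lambda>c1 c'. sw2 ?C c' (\<lambda>c2 c3. pure D (tens D D) c1 (pure D D c2 c3))) =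
          sw2 ?C c (\<lambda>c' c3. sw2 ?C c' (\<lambda>c1 c2. pure D (tens D D) c1 (pure D D c2 c3)))"
        using coalg_axioms(1)[of ?C c] by simp
      ultimately show "sw2 ?C' c (\<lambda>c1 c'. sw2 ?C' c' (\<lambda>c2 c3. pure ?C' (tens ?C' ?C') c1 (pure ?C' ?C' c2 c3))) =
          sw2 ?C' c (\<lambda>c' c3. sw2 ?C' c' (\<lambda>c1 c2. pure ?C' (tens ?C' ?C') c1 (pure ?C' ?C' c2 c3)))"
        by (simp add: sw)
      have "sw2 ?C c (\<lambda>c1 c2. scl D (bcou D' c1) c2) = sw2 ?C c (\<lambda>c1 c2. scl D (bcou D c1) c2)"
        "sw2 ?C c (\<lambda>c1 c2. scl D (bcou D' c2) c1) = sw2 ?C c (\<lambda>c1 c2. scl D (bcou D c2) c1)"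
        by (intro sw2_cong; simp)+
      then show "sw2 ?C' c (\<lambda>c1 c2. scl ?C' (cou ?C' c1) c2) = c" "sw2 ?C' c (\<lambda>c1 c2. scl ?C' (cou ?C' c2) c1) = c"
        using coalg_axioms(2,3)[of ?C c] by (simp_all add: sw)
    qed simp
    fix a b assume "a \<in> car D'" "b \<in> car D'"
    then have [simp]: "a \<in> car D" "b \<in> car D" by simp_all
    have "mul (talg D' D') s t = mul (talg D D) s t" if "s \<in> car (tens D D)" "t \<in> car (tens D D)" for s t
    proof -
      have "mul (talg D' D') s t = tsum D D s (\<lambda>a b. tsum D D t (\<lambda>a' b'. pure D D (mul D' a a') (mul D' b b')))"
        by (simp add: talg_def)
      also have "\<dots> = tsum D D s (\<lambda>a b. tsum D D t (\<lambda>a' b'. pure D D (mul D a a') (mul D b b')))"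
        using that by (intro tsum_cong) simp_all
      finally show ?thesis by (simp add: talg_def)
    qed
    then show "bcop D' (mul D' a b) = mul (talg D' D') (bcop D' a) (bcop D' b)"
      by (simp add: bcop_mul)
  qed simp_all
qed

lemma antipode_transfer:
  assumes D: "is_bialg D" and S: "is_antipode D S" and vs: "same_vs D' D"
    and mul: "\<And>a b. a \<in> car D \<Longrightarrow> b \<in> car D \<Longrightarrow> mul D' a b = mul D a b" and uni: "uni D' = uni D"
    and cop: "\<And>a. a \<in> car D \<Longrightarrow> bcop D' a = bcop D a" and cou: "\<And>a. a \<in> car D \<Longrightarrow> bcou D' a = bcou D a"
    and S': "\<And>a. a \<in> car D \<Longrightarrow> S' a = S a"
  shows "is_antipode D' S'"
proof -
  note [simp] = D same_vs_cong[OF vs] mul uni cop cou S'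
  have l: "lin D D S" using S unfolding is_antipode_def by blast
  note [simp] = lin_closed[OF l]
  have sw: "sw2 (coalg_of D') a f = sw2 (coalg_of D) a f" if "a \<in> car D" for a and f :: "'b \<Rightarrow> 'b \<Rightarrow> 'b"
    using that by (simp add: sw2_def)
  show ?thesis
  proof (rule is_antipodeI)
    show "lin D' D' S'" using lin_cong'[OF l, of S'] by simp
    fix h assume "h \<in> car D'"
    then have [simp]: "h \<in> car D" by simp
    have "sw2 (coalg_of D) h (\<lambda>a b. mul D' (S' a) b) = sw2 (coalg_of D) h (\<lambda>a b. mul D (S a) b)"
      "sw2 (coalg_of D) h (\<lambda>a b. mul D' a (S' b)) = sw2 (coalg_of D) h (\<lambda>a b. mul D a (S b))"
      by (intro sw2_cong; simp)+
    then show "sw2 (coalg_of D') h (\<lambda>a b. mul D' (S' a) b) = scl D' (bcou D' h) (uni D')"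
      "sw2 (coalg_of D') h (\<lambda>a b. mul D' a (S' b)) = scl D' (bcou D' h) (uni D')"
      using antipode[OF S] by (simp_all add: sw)
  qed
qed


section \<open>Tensor products of Hopf algebras\<close>

lemma same_vs_thopf: "same_vs (thopf K H) (tens K H)"
  by (simp add: same_vs_def thopf_def)
lemmas thopf_cong [simp] = same_vs_cong[OF same_vs_thopf]

lemma thopf_simps [simp]:
  "mul (thopf K H) = mul (talg K H)" "uni (thopf K H) = pure K H (uni K) (uni H)"
  "coalg_of (thopf K H) = tcoalg (coalg_of K) (coalg_of H)"
proof -
  show "mul (thopf K H) = mul (talg K H)" "uni (thopf K H) = pure K H (uni K) (uni H)"
    by (simp_all add: thopf_def)
  show "coalg_of (thopf K H) = tcoalg (coalg_of K) (coalg_of H)"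
    unfolding tcoalg_def coalg_of_cong coalg_of_simps by (simp add: thopf_def coalg_of_def[of "thopf K H"])
qed

lemma thopf_cop: "bcop (thopf K H) = cop (tcoalg (coalg_of K) (coalg_of H))"
  "bcou (thopf K H) = cou (tcoalg (coalg_of K) (coalg_of H))"
  using coalg_of_simps[of "thopf K H"] by simp_all

lemma is_alg_cong:
  assumes "same_vs A B" "mul A = mul B" "uni A = uni B"
  shows "is_alg A = is_alg B"
  unfolding is_alg_def assms(2,3) same_vs_basic[OF assms(1)] same_vs_bilin[OF assms(1)] ..

lemma is_alg_thopf [simp]: "is_alg K \<Longrightarrow> is_alg H \<Longrightarrow> is_alg (thopf K H)"
  by (subst is_alg_cong[of _ "talg K H"]) simp_all

lemma sw2_thopf_pure:
  assumes "is_coalg (coalg_of K)" "is_coalg (coalg_of H)" "is_vs U" "k \<in> car K" "h \<in> car H"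
    "\<And>b. b \<in> car (tens K H) \<Longrightarrow> lin (tens K H) U (\<lambda>a. f a b)"
    "\<And>a. a \<in> car (tens K H) \<Longrightarrow> lin (tens K H) U (\<lambda>b. f a b)"
  shows "sw2 (tcoalg (coalg_of K) (coalg_of H)) (pure K H k h) f =
    sw2 (coalg_of K) k (\<lambda>k1 k2. sw2 (coalg_of H) h (\<lambda>h1 h2. f (pure K H k1 h1) (pure K H k2 h2)))"
  using sw2_tcoalg_pure[of "coalg_of K" "coalg_of H" U k h f] assms by simp

lemma is_hopf_thopf [simp]:
  assumes K: "is_hopf K" and H: "is_hopf H"
  shows "is_hopf (thopf K H)"
proof -
  note [simp] = K H
  let ?A = "thopf K H" and ?T = "tens K H" and ?m = "mul (talg K H)"
  let ?CK = "coalg_of K" and ?CH = "coalg_of H"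
  let ?C = "tcoalg ?CK ?CH" and ?U = "tens (tens K H) (tens K H)"
  have alg: "is_alg ?A" by simp
  note [simp] = is_alg_talg[of K H]
  have cl: "lin V field_vs (\<lambda>x. cou ?C (f x))" if "lin V ?T f"
    for V :: "('a, 'x::ab_group_add, 'y) vs_scheme" and f
    using that lin_cou[of ?C V f] by simp
  have cp: "cou ?C (pure K H k h) = bcou K k * bcou H h" if "k \<in> car K" "h \<in> car H" for k h
    using that cou_tcoalg_pure[of ?CK ?CH k h] by simp
  note [simp] = cl cp
  have lc: "lin V ?U (\<lambda>x. cop ?C (f x))" if "lin V ?T f"
    for V :: "('a, 'x::ab_group_add, 'y) vs_scheme" and f
    using that lin_cop[of ?C V f] by simp
  note [simp] = lc
  have [simp]: "cop ?C t \<in> car ?U" if "t \<in> car ?T" for t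
    using that is_coalg_simps(2)[of ?C t] by simp
  define R where "R s t = sw2 ?C s (\<lambda>s1 s2. sw2 ?C t (\<lambda>t1 t2. pure ?T ?T (?m s1 t1) (?m s2 t2)))" for s t
  have R: "mul (talg ?A ?A) (bcop ?A s) (bcop ?A t) = R s t" for s t
    by (simp add: talg_def[of ?A] R_def sw2_def thopf_cop)
  have "cop ?C (?m (pure K H a b) (pure K H a' b')) = R (pure K H a b) (pure K H a' b')"
    if [simp]: "a \<in> car K" "b \<in> car H" "a' \<in> car K" "b' \<in> car H" for a b a' b'
  proof -
    have "cop ?C (?m (pure K H a b) (pure K H a' b')) = sw2 ?C (pure K H (mul K a a') (mul H b b')) (pure ?T ?T)"
      by (simp add: sw2_def tsum_self)
    also have "\<dots> = sw2 ?CK (mul K a a') (\<lambda>k1 k2. sw2 ?CH (mul H b b') (\<lambda>h1 h2. pure ?T ?T (pure K H k1 h1) (pure K H k2 h2)))"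
      by (rule sw2_thopf_pure[where U="?U"]) simp_all
    also have "\<dots> = sw2 ?CK a (\<lambda>a1 a2. sw2 ?CK a' (\<lambda>a1' a2'. sw2 ?CH (mul H b b') (\<lambda>h1 h2. pure ?T ?T (pure K H (mul K a1 a1') h1) (pure K H (mul K a2 a2') h2))))"
      by (rule sw2_mul[where U="?U"]) simp_all
    also have "\<dots> = sw2 ?CK a (\<lambda>a1 a2. sw2 ?CK a' (\<lambda>a1' a2'. sw2 ?CH b (\<lambda>b1 b2. sw2 ?CH b' (\<lambda>b1' b2'. pure ?T ?T (pure K H (mul K a1 a1') (mul H b1 b1')) (pure K H (mul K a2 a2') (mul H b2 b2'))))))"
      by (intro sw2_cong sw2_mul[where U="?U"]) simp_all
    also have "\<dots> = sw2 ?CK a (\<lambda>a1 a2. sw2 ?CH b (\<lambda>b1 b2. sw2 ?CK a' (\<lambda>a1' a2'. sw2 ?CH b' (\<lambda>b1' b2'. pure ?T ?T (pure K H (mul K a1 a1') (mul H b1 b1')) (pure K H (mul K a2 a2') (mul H b2 b2'))))))"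
      by (intro sw2_cong sw2_swap) simp_all
    also have "\<dots> = sw2 ?CK a (\<lambda>a1 a2. sw2 ?CH b (\<lambda>b1 b2. sw2 ?CK a' (\<lambda>a1' a2'. sw2 ?CH b' (\<lambda>b1' b2'.
        pure ?T ?T (?m (pure K H a1 b1) (pure K H a1' b1')) (?m (pure K H a2 b2) (pure K H a2' b2'))))))"
      by (intro sw2_cong) simp_all
    also have "\<dots> = sw2 ?CK a (\<lambda>a1 a2. sw2 ?CH b (\<lambda>b1 b2. sw2 ?C (pure K H a' b') (\<lambda>t1 t2. pure ?T ?T (?m (pure K H a1 b1) t1) (?m (pure K H a2 b2) t2))))"
      by (intro sw2_cong sw2_thopf_pure[where U="?U", symmetric]) simp_all
    also have "\<dots> = R (pure K H a b) (pure K H a' b')"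
      unfolding R_def by (intro sw2_thopf_pure[where U="?U", symmetric]) simp_all
    finally show ?thesis .
  qed
  then have 1: "\<forall>s\<in>car ?T. cop ?C (?m s (pure K H a' b')) = R s (pure K H a' b')"
    if [simp]: "a' \<in> car K" "b' \<in> car H" for a' b'
    by (intro tens_ball_ext[where U="?U"]) (simp_all add: R_def)
  have 2: "\<forall>t\<in>car ?T. cop ?C (?m s t) = R s t" if [simp]: "s \<in> car ?T" for s
    using 1 by (intro tens_ball_ext[where U="?U"]) (simp_all add: R_def)
  have c1: "\<forall>s\<in>car ?T. cou ?C (?m s (pure K H a' b')) = cou ?C s * cou ?C (pure K H a' b')"
    if [simp]: "a' \<in> car K" "b' \<in> car H" for a' b'
    by (intro tens_ball_ext[where U=field_vs]) (simp_all)
  have c2: "\<forall>t\<in>car ?T. cou ?C (?m s t) = cou ?C s * cou ?C t" if [simp]: "s \<in> car ?T" for s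
    using c1 by (intro tens_ball_ext[where U=field_vs]) (simp_all)
  have bi: "is_bialg ?A"
  proof (rule is_bialgI[OF alg])
    show "is_coalg (coalg_of ?A)" by simp
    fix a b assume "a \<in> car ?A" "b \<in> car ?A"
    then have ab: "a \<in> car ?T" "b \<in> car ?T" by simp_all
    show "bcop ?A (mul ?A a b) = mul (talg ?A ?A) (bcop ?A a) (bcop ?A b)"
      unfolding R using 2 ab by (simp add: thopf_cop)
    show "bcou ?A (mul ?A a b) = bcou ?A a * bcou ?A b" using c2 ab by (simp add: thopf_cop)
  next
    have "cop ?C (pure K H (uni K) (uni H)) = sw2 ?C (pure K H (uni K) (uni H)) (pure ?T ?T)"
      by (simp add: sw2_def tsum_self)
    also have "\<dots> = sw2 ?CK (uni K) (\<lambda>k1 k2. sw2 ?CH (uni H) (\<lambda>h1 h2. pure ?T ?T (pure K H k1 h1) (pure K H k2 h2)))"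
      by (rule sw2_thopf_pure[where U="?U"]) simp_all
    also have "\<dots> = pure ?T ?T (pure K H (uni K) (uni H)) (pure K H (uni K) (uni H))"
      by (simp add: sw2_uni[where U="?U"])
    finally show "bcop ?A (uni ?A) = uni (talg ?A ?A)" by (simp add: thopf_cop)
    show "bcou ?A (uni ?A) = 1" by (simp add: thopf_cop)
  qed
  define S where "S = ant ?A"
  have S: "S = (\<lambda>t. tsum K H t (\<lambda>k h. pure K H (ant K k) (ant H h)))" by (simp add: S_def thopf_def)
  have [simp]: "lin V ?T (\<lambda>x. S (f x))" if "lin V ?T f" for V :: "('a, 'x::ab_group_add, 'y) vs_scheme" and f
    using that by (simp add: S)
  have [simp]: "S t \<in> car ?T" if "t \<in> car ?T" for t using that by (simp add: S)
  have [simp]: "S (pure K H k h) = pure K H (ant K k) (ant H h)" if "k \<in> car K" "h \<in> car H" for k h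
    using that by (simp add: S tsum_pure[where U="?T"])
  have scp: "pure K H (scl K c k) (scl H d h) = scl ?T (c * d) (pure K H k h)" if "k \<in> car K" "h \<in> car H" for c d k h
    using that lin_scl[OF bilinD(1)[OF bilin_pure], of "scl H d h" H k K c]
      lin_scl[OF bilinD(2)[OF bilin_pure], of k K h H d] by simp
  have a1: "\<forall>t\<in>car ?T. sw2 ?C t (\<lambda>a b. ?m (S a) b) = scl ?T (cou ?C t) (pure K H (uni K) (uni H))"
  proof (rule tens_ball_ext[where U="?T"])
    fix k h assume [simp]: "k \<in> car K" "h \<in> car H"
    have "sw2 ?C (pure K H k h) (\<lambda>a b. ?m (S a) b) = sw2 ?CK k (\<lambda>k1 k2. sw2 ?CH h (\<lambda>h1 h2. ?m (S (pure K H k1 h1)) (pure K H k2 h2)))"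
      by (rule sw2_thopf_pure[where U="?T"]) simp_all
    also have "\<dots> = sw2 ?CK k (\<lambda>k1 k2. sw2 ?CH h (\<lambda>h1 h2. pure K H (mul K (ant K k1) k2) (mul H (ant H h1) h2)))"
      by (intro sw2_cong) simp_all
    also have "\<dots> = sw2 ?CK k (\<lambda>k1 k2. pure K H (mul K (ant K k1) k2) (sw2 ?CH h (\<lambda>h1 h2. mul H (ant H h1) h2)))"
      by (intro sw2_cong sw2_apply[where U=H and U'="?T", symmetric]) simp_all
    also have "\<dots> = pure K H (sw2 ?CK k (\<lambda>k1 k2. mul K (ant K k1) k2)) (sw2 ?CH h (\<lambda>h1 h2. mul H (ant H h1) h2))"
      by (intro sw2_apply[where U=K and U'="?T" and \<phi>="\<lambda>z. pure K H z _", symmetric]) simp_all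
    finally show "sw2 ?C (pure K H k h) (\<lambda>a b. ?m (S a) b) = scl ?T (cou ?C (pure K H k h)) (pure K H (uni K) (uni H))"
      by (simp add: antipode[OF is_hopf_simps(2)] scp)
  qed simp_all
  have a2: "\<forall>t\<in>car ?T. sw2 ?C t (\<lambda>a b. ?m a (S b)) = scl ?T (cou ?C t) (pure K H (uni K) (uni H))"
  proof (rule tens_ball_ext[where U="?T"])
    fix k h assume [simp]: "k \<in> car K" "h \<in> car H"
    have "sw2 ?C (pure K H k h) (\<lambda>a b. ?m a (S b)) = sw2 ?CK k (\<lambda>k1 k2. sw2 ?CH h (\<lambda>h1 h2. ?m (pure K H k1 h1) (S (pure K H k2 h2))))"
      by (rule sw2_thopf_pure[where U="?T"]) simp_all
    also have "\<dots> = sw2 ?CK k (\<lambda>k1 k2. sw2 ?CH h (\<lambda>h1 h2. pure K H (mul K k1 (ant K k2)) (mul H h1 (ant H h2))))"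
      by (intro sw2_cong) simp_all
    also have "\<dots> = sw2 ?CK k (\<lambda>k1 k2. pure K H (mul K k1 (ant K k2)) (sw2 ?CH h (\<lambda>h1 h2. mul H h1 (ant H h2))))"
      by (intro sw2_cong sw2_apply[where U=H and U'="?T", symmetric]) simp_all
    also have "\<dots> = pure K H (sw2 ?CK k (\<lambda>k1 k2. mul K k1 (ant K k2))) (sw2 ?CH h (\<lambda>h1 h2. mul H h1 (ant H h2)))"
      by (intro sw2_apply[where U=K and U'="?T" and \<phi>="\<lambda>z. pure K H z _", symmetric]) simp_all
    finally show "sw2 ?C (pure K H k h) (\<lambda>a b. ?m a (S b)) = scl ?T (cou ?C (pure K H k h)) (pure K H (uni K) (uni H))"
      by (simp add: antipode[OF is_hopf_simps(2)] scp)
  qed simp_all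
  have "is_antipode ?A S"
    by (rule is_antipodeI) (use a1 a2 in \<open>simp_all add: thopf_cop\<close>)
  with bi show ?thesis unfolding is_hopf_def S_def by blast
qed

text \<open>
  Pure tensors of elements of two spanning sets span, by linearity in each factor in turn.
\<close>

lemma fin_dim_tens:
  assumes V: "is_vs V" and W: "is_vs W" and fd: "fin_dim V" "fin_dim W"
  shows "fin_dim (tens V W)"
proof -
  interpret T: vector_space "scl (tens V W)" using is_vs_vector_space[OF is_vs_tens] .
  interpret V: vector_space "scl V" using is_vs_vector_space[OF V] .
  interpret W: vector_space "scl W" using is_vs_vector_space[OF W] .
  obtain X Y where X: "finite X" "V.span X = car V" and Y: "finite Y" "W.span Y = car W"
    using fd unfolding fin_dim_def by blast
  let ?P = "(\<lambda>(x, y). pure V W x y) ` (X \<times> Y)"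
  have XV: "X \<subseteq> car V" "Y \<subseteq> car W" using X Y V.span_superset W.span_superset by blast+
  have 1: "w \<in> car W \<and> pure V W x w \<in> T.span ?P" if x: "x \<in> X" and w: "w \<in> W.span Y" for x w
    using w
  proof (induction rule: W.span_induct_alt)
    case base
    have "pure V W x 0 = 0" using lin_zero[OF W bilinD(2)[OF bilin_pure]] x XV by blast
    then show ?case using T.span_zero vs_closed(1)[OF W] by metis
  next
    case (step c y w)
    have "x \<in> car V" "y \<in> car W" using x step XV by auto
    moreover have "pure V W x y \<in> T.span ?P" using x step by (intro T.span_base) auto
    moreover have "pure V W x (scl W c y + w) = scl (tens V W) c (pure V W x y) + pure V W x w"
      using calculation step W lin_add[OF bilinD(2)[OF bilin_pure], of x V "scl W c y" W w]
        lin_scl[OF bilinD(2)[OF bilin_pure], of x V y W c] by simp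
    ultimately show ?case using step W by (metis T.span_add T.span_scale vs_closed(2,3))
  qed
  have 2: "v \<in> car V \<and> pure V W v w \<in> T.span ?P" if w: "w \<in> car W" and v: "v \<in> V.span X" for v w
    using v
  proof (induction rule: V.span_induct_alt)
    case base
    have "pure V W 0 w = 0" using lin_zero[OF V bilinD(1)[OF bilin_pure]] w by blast
    then show ?case using T.span_zero vs_closed(1)[OF V] by metis
  next
    case (step c y v)
    have "y \<in> car V" using step XV by auto
    moreover have "pure V W y w \<in> T.span ?P" using 1[of y w] w Y(2) step by blast
    moreover have "pure V W (scl V c y + v) w = scl (tens V W) c (pure V W y w) + pure V W v w"
      using calculation step V w lin_add[OF bilinD(1)[OF bilin_pure], of w W "scl V c y" V v]
        lin_scl[OF bilinD(1)[OF bilin_pure], of w W y V c] by simp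
    ultimately show ?case using step V by (metis T.span_add T.span_scale vs_closed(2,3))
  qed
  have "t \<in> T.span ?P" if "t \<in> car (tens V W)" for t
  proof -
    have "(\<Sum>(v, w)\<leftarrow>xs. pure V W v w) \<in> T.span ?P" if "set xs \<subseteq> car V \<times> car W" for xs
      using that
    proof (induction xs)
      case (Cons p xs)
      obtain v w where p: "p = (v, w)" by (cases p)
      have vw: "v \<in> V.span X" "w \<in> car W" and xs: "set xs \<subseteq> car V \<times> car W"
        using Cons.prems X(2) p by auto
      have s: "(\<Sum>(v, w)\<leftarrow>p # xs. pure V W v w) = pure V W v w + (\<Sum>(v, w)\<leftarrow>xs. pure V W v w)"
        by (simp only: p list.map sum_list.Cons prod.case)
      show ?case unfolding s using 2[OF vw(2,1)] Cons.IH[OF xs] by (intro T.span_add) blast+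
    qed (simp only: list.map sum_list.Nil T.span_zero)
    then show ?thesis using sweedler[OF V that] by metis
  qed
  moreover have "T.span ?P \<subseteq> car (tens V W)"
    using is_vs_tens[of V W] XV unfolding is_vs_def by (intro T.span_minimal) (auto intro!: pure_closed)
  ultimately have sp: "T.span ?P = car (tens V W)" by blast
  have "finite ?P" using X(1) Y(1) by (intro finite_imageI finite_cartesian_product)
  with sp show ?thesis unfolding fin_dim_def by (intro exI[of _ "?P"] conjI)
qed


section \<open>Dual spaces\<close>

lemma is_vs_dual_vs [simp]:
  fixes V :: "('f::field, 'v::ab_group_add, 'x) vs_scheme"
  assumes V: "is_vs V" shows "is_vs (dual_vs V)"
proof -
  interpret vector_space "\<lambda>(c::'f) (f :: 'v \<Rightarrow> 'f) v. c * f v" by (rule vector_space_funs)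
  have "subspace (car (dual_vs V))"
    unfolding subspace_def dual_vs_def by (auto simp: lin_def algebra_simps)
  then show ?thesis by (simp add: is_vs_def dual_vs_def vector_space_axioms)
qed

lemma scl_dual_vs: "scl (dual_vs V) c f x = c * f x"
  by (simp add: dual_vs_def)

lemma dual_lin: "f \<in> car (dual_vs V) \<Longrightarrow> lin V field_vs f"
  by (simp add: dual_vs_def)

lemma dual_lin_comp: "f \<in> car (dual_vs V) \<Longrightarrow> lin W V g \<Longrightarrow> lin W field_vs (\<lambda>x. f (g x))"
  by (rule lin_comp[OF dual_lin])

lemma dual_ext: "f \<in> car (dual_vs V) \<Longrightarrow> g \<in> car (dual_vs V) \<Longrightarrow> (\<And>x. x \<in> car V \<Longrightarrow> f x = g x) \<Longrightarrow> f = g"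
  by (rule ext, rename_tac x, case_tac "x \<in> car V") (auto simp: dual_vs_def)

lemma dual_map_closed [simp]: "is_vs V \<Longrightarrow> lin V field_vs f \<Longrightarrow> dual_map V f \<in> car (dual_vs V)"
  by (simp add: dual_vs_def dual_map_def lin_def)

lemma dual_map_apply [simp]: "x \<in> car V \<Longrightarrow> dual_map V f x = f x"
  by (simp add: dual_map_def)

lemma lin_eval [simp]: "lin (dual_vs V) field_vs (\<lambda>f. f x)"
  by (simp add: lin_def dual_vs_def)

lemma lin_dual_map [simp]:
  assumes "is_vs V" "\<And>w. w \<in> car W \<Longrightarrow> lin V field_vs (F w)" "\<And>x. x \<in> car V \<Longrightarrow> lin W field_vs (\<lambda>w. F w x)"
  shows "lin W (dual_vs V) (\<lambda>w. dual_map V (F w))"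
  unfolding lin_def[of W "dual_vs V"]
proof (intro conjI ballI allI)
  fix v c assume v: "v \<in> car W"
  show "dual_map V (F v) \<in> car (dual_vs V)" using assms v by simp
  show "dual_map V (F (scl W c v)) = scl (dual_vs V) c (dual_map V (F v))"
    using lin_scl[OF assms(3)] v by (auto simp: fun_eq_iff dual_map_def scl_dual_vs)
  fix v' assume "v' \<in> car W"
  then show "dual_map V (F (v + v')) = dual_map V (F v) + dual_map V (F v')"
    using lin_add[OF assms(3)] v by (auto simp: fun_eq_iff dual_map_def)
qed

abbreviation coord :: "('f::field, 'v::ab_group_add, 'x) vs_scheme \<Rightarrow> 'v set \<Rightarrow> 'v \<Rightarrow> 'v \<Rightarrow> 'f" where
  "coord V X x v \<equiv> module.representation (scl V) X v x"

lemma basis_finite: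
  assumes V: "is_vs V" and fd: "fin_dim V" and X: "is_basis V X"
  shows "finite X"
proof -
  interpret vector_space "scl V" using V by (rule is_vs_vector_space)
  obtain Y where Y: "finite Y" "span Y = car V" using fd unfolding fin_dim_def by blast
  have "X \<subseteq> span Y" using X Y span_superset unfolding is_basis_def by blast
  then show ?thesis using independent_span_bound[OF Y(1)] X unfolding is_basis_def by blast
qed

lemma basis_car: "is_vs V \<Longrightarrow> is_basis V X \<Longrightarrow> x \<in> X \<Longrightarrow> x \<in> car V"
  unfolding is_basis_def by (metis is_vs_module module.span_base)

lemma coord_dual:
  assumes V: "is_vs V" and X: "is_basis V X"
  shows "coord V X x \<in> car (dual_vs V)"
proof -
  interpret vector_space "scl V" using V by (rule is_vs_vector_space)
  have X: "independent X" "span X = car V" using X unfolding is_basis_def by auto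
  show ?thesis unfolding dual_vs_def lin_def using X
    by (auto simp: representation_add representation_scale) (auto simp: representation_def)
qed

lemma coord_sum:
  assumes V: "is_vs V" and X: "is_basis V X" and fX: "finite X" and v: "v \<in> car V"
  shows "(\<Sum>x\<in>X. scl V (coord V X x v) x) = v"
proof -
  interpret vector_space "scl V" using V by (rule is_vs_vector_space)
  have X: "independent X" "span X = car V" using X unfolding is_basis_def by auto
  show ?thesis using X v fX by (intro sum_representation_eq) auto
qed

lemma dual_coord_sum:
  assumes V: "is_vs V" and X: "is_basis V X" and fX: "finite X" and f: "lin V field_vs f" and v: "v \<in> car V"
  shows "(\<Sum>x\<in>X. coord V X x v * f x) = f v"
proof -
  have "f v = f (\<Sum>x\<in>X. scl V (coord V X x v) x)" using coord_sum[OF V X fX v] by simp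
  also have "\<dots> = (\<Sum>x\<in>X. f (scl V (coord V X x v) x))"
    using basis_car[OF V X] V by (intro lin_sum[OF V f]) auto
  also have "\<dots> = (\<Sum>x\<in>X. coord V X x v * f x)"
    using basis_car[OF V X] lin_scl[OF f] by (intro sum.cong) auto
  finally show ?thesis by simp
qed

lemma dual_separates:
  assumes V: "is_vs V" and "fin_dim V" and v: "v \<in> car V" "w \<in> car V"
    and eq: "\<And>f. f \<in> car (dual_vs V) \<Longrightarrow> f v = f w"
  shows "v = w"
proof -
  obtain X where X: "finite X" "is_basis V X" using fin_basis[OF assms(1,2)] by blast
  have "v = (\<Sum>x\<in>X. scl V (coord V X x v) x)" using coord_sum[OF V X(2,1) v(1)] by simp
  also have "\<dots> = (\<Sum>x\<in>X. scl V (coord V X x w) x)"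
    by (intro sum.cong) (auto simp: eq[OF coord_dual[OF V X(2)]])
  also have "\<dots> = w" by (rule coord_sum[OF V X(2,1) v(2)])
  finally show ?thesis .
qed

text \<open>
  The value at \<open>x\<close> of the linear map \<open>V \<rightarrow> W\<close> that corresponds to a tensor in \<open>V\<^sup>* \<otimes> W\<close>.
\<close>

definition ev :: "('f::field, 'v::ab_group_add, 'x) vs_scheme \<Rightarrow> ('f, 'w::ab_group_add, 'y) vs_scheme \<Rightarrow>
    'v \<Rightarrow> ('f, 'v \<Rightarrow> 'f, 'w) tensor \<Rightarrow> 'w" where
  "ev V W x t = tsum (dual_vs V) W t (\<lambda>f w. scl W (f x) w)"

lemma ev_lin [simp]:
  assumes "is_vs V" "is_vs W"
  shows "lin Z (tens (dual_vs V) W) g \<Longrightarrow> lin Z W (\<lambda>z. ev V W x (g z))"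
    "t \<in> car (tens (dual_vs V) W) \<Longrightarrow> ev V W x t \<in> car W"
  unfolding ev_def using assms by simp_all

lemma ev_pure [simp]:
  "is_vs V \<Longrightarrow> is_vs W \<Longrightarrow> f \<in> car (dual_vs V) \<Longrightarrow> w \<in> car W \<Longrightarrow> ev V W x (pure (dual_vs V) W f w) = scl W (f x) w"
  unfolding ev_def by (simp add: tsum_pure[where U=W])

lemma pure_scl:
  assumes "v \<in> car V" "w \<in> car W"
  shows "pure V W (scl V c v) w = scl (tens V W) c (pure V W v w)"
    "pure V W v (scl W c w) = scl (tens V W) c (pure V W v w)"
  using lin_scl[OF bilinD(1)[OF bilin_pure]] lin_scl[OF bilinD(2)[OF bilin_pure]] assms by blast+

lemma fun_sum_apply: "(\<Sum>x\<in>X. F x) v = (\<Sum>x\<in>X. F x v :: 'a::ab_group_add)"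
  by (induction X rule: infinite_finite_induct) simp_all

lemma dual_basis_sum:
  assumes V: "is_vs V" and X: "is_basis V X" "finite X" and f: "f \<in> car (dual_vs V)"
  shows "(\<Sum>x\<in>X. scl (dual_vs V) (f x) (coord V X x)) = f"
proof (rule dual_ext[of _ V])
  show "(\<Sum>x\<in>X. scl (dual_vs V) (f x) (coord V X x)) \<in> car (dual_vs V)"
    using V coord_dual[OF V X(1)] by simp
  fix v assume v: "v \<in> car V"
  have "(\<Sum>x\<in>X. scl (dual_vs V) (f x) (coord V X x)) v = (\<Sum>x\<in>X. f x * coord V X x v)"
    by (simp add: fun_sum_apply scl_dual_vs)
  then show "(\<Sum>x\<in>X. scl (dual_vs V) (f x) (coord V X x)) v = f v"
    using dual_coord_sum[OF V X dual_lin[OF f] v] by (simp add: mult.commute)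
qed (rule f)

text \<open>
  On a pure tensor \<open>f \<otimes> w\<close> this is the expansion \<open>f = \<Sum> f(x) x\<^sup>*\<close> in the dual basis.
\<close>

lemma dual_tens_expand:
  assumes V: "is_vs V" and W: "is_vs W" and X: "is_basis V X" "finite X" and t: "t \<in> car (tens (dual_vs V) W)"
  shows "(\<Sum>x\<in>X. pure (dual_vs V) W (coord V X x) (ev V W x t)) = t"
proof -
  note [simp] = V W coord_dual[OF V X(1)]
  have "\<forall>t\<in>car (tens (dual_vs V) W). (\<Sum>x\<in>X. pure (dual_vs V) W (coord V X x) (ev V W x t)) = t"
  proof (rule tens_ball_ext[where U="tens (dual_vs V) W"])
    fix f w assume f [simp]: "f \<in> car (dual_vs V)" and [simp]: "w \<in> car W"
    have "(\<Sum>x\<in>X. pure (dual_vs V) W (coord V X x) (ev V W x (pure (dual_vs V) W f w))) =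
        (\<Sum>x\<in>X. pure (dual_vs V) W (scl (dual_vs V) (f x) (coord V X x)) w)"
      by (intro sum.cong) (simp_all add: pure_scl)
    also have "\<dots> = pure (dual_vs V) W (\<Sum>x\<in>X. scl (dual_vs V) (f x) (coord V X x)) w"
      by (rule lin_sum[OF _ bilinD(1)[OF bilin_pure], symmetric]) simp_all
    also have "(\<Sum>x\<in>X. scl (dual_vs V) (f x) (coord V X x)) = f"
      by (rule dual_basis_sum[OF V X f])
    finally show "(\<Sum>x\<in>X. pure (dual_vs V) W (coord V X x) (ev V W x (pure (dual_vs V) W f w))) = pure (dual_vs V) W f w" .
  qed simp_all
  then show ?thesis using t by blast
qed

lemma dual_tens_ext:
  assumes V: "is_vs V" and W: "is_vs W" and fd: "fin_dim V"
    and s: "s \<in> car (tens (dual_vs V) W)" and t: "t \<in> car (tens (dual_vs V) W)"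
    and eq: "\<And>x. x \<in> car V \<Longrightarrow> ev V W x s = ev V W x t"
  shows "s = t"
proof -
  obtain X where X: "finite X" "is_basis V X" using fin_basis[OF V fd] by blast
  have "s = (\<Sum>x\<in>X. pure (dual_vs V) W (coord V X x) (ev V W x s))"
    by (rule dual_tens_expand[OF V W X(2,1) s, symmetric])
  also have "\<dots> = (\<Sum>x\<in>X. pure (dual_vs V) W (coord V X x) (ev V W x t))"
    using basis_car[OF V X(2)] by (intro sum.cong) (simp_all only: eq)
  also have "\<dots> = t" by (rule dual_tens_expand[OF V W X(2,1) t])
  finally show ?thesis .
qed

lemma ev_dual_apply:
  assumes "is_vs V" "is_vs W" "t \<in> car (tens (dual_vs V) (dual_vs W))"
  shows "ev V (dual_vs W) x t y = tsum (dual_vs V) (dual_vs W) t (\<lambda>g p. g x * p y)"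
  unfolding ev_def using assms
  by (subst tsum_lin_apply[where U="dual_vs W" and U'=field_vs and \<phi>="\<lambda>p. p y", OF _ _ _ lin_eval])
    (simp_all add: scl_dual_vs)

text \<open>
  In finite dimension bilinear forms on \<open>V \<times> W\<close> are the elements of \<open>V\<^sup>* \<otimes> W\<^sup>*\<close>.  The definite
  description is the one by which the coproduct of a dual Hopf algebra and the dual of an action are
  given, so the lemma says that both exist.
\<close>

lemma form_tensor:
  assumes V: "is_vs V" and W: "is_vs W" and X: "is_basis V X" "finite X" and \<beta>: "bilin V W field_vs \<beta>"
  defines "t \<equiv> \<Sum>x\<in>X. pure (dual_vs V) (dual_vs W) (coord V X x) (dual_map W (\<beta> x))"
  shows "t \<in> car (tens (dual_vs V) (dual_vs W))"
    "x \<in> car V \<Longrightarrow> y \<in> car W \<Longrightarrow> \<beta> x y = tsum (dual_vs V) (dual_vs W) t (\<lambda>g p. g x * p y)"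
    "(THE t. t \<in> car (tens (dual_vs V) (dual_vs W)) \<and>
       (\<forall>x\<in>car V. \<forall>y\<in>car W. \<beta> x y = tsum (dual_vs V) (dual_vs W) t (\<lambda>g p. g x * p y))) = t"
proof -
  note [simp] = V W coord_dual[OF V X(1)] basis_car[OF V X(1)] bilinD[OF \<beta>]
  let ?T = "tens (dual_vs V) (dual_vs W)"
  show t: "t \<in> car ?T" unfolding t_def by simp
  have ev_t: "tsum (dual_vs V) (dual_vs W) t (\<lambda>g p. g x * p y) = \<beta> x y" if [simp]: "x \<in> car V" "y \<in> car W" for x y
  proof -
    have "tsum (dual_vs V) (dual_vs W) t (\<lambda>g p. g x * p y) =
        (\<Sum>z\<in>X. tsum (dual_vs V) (dual_vs W) (pure (dual_vs V) (dual_vs W) (coord V X z) (dual_map W (\<beta> z))) (\<lambda>g p. g x * p y))"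
      unfolding t_def by (rule lin_sum[where V="?T" and W=field_vs]) simp_all
    also have "\<dots> = (\<Sum>z\<in>X. coord V X z x * \<beta> z y)"
      by (intro sum.cong) (simp_all add: tsum_pure[where U=field_vs])
    also have "\<dots> = \<beta> x y" by (rule dual_coord_sum[OF V X, where f="\<lambda>z. \<beta> z y"]) simp_all
    finally show ?thesis .
  qed
  then show "x \<in> car V \<Longrightarrow> y \<in> car W \<Longrightarrow> \<beta> x y = tsum (dual_vs V) (dual_vs W) t (\<lambda>g p. g x * p y)" by simp
  have fd: "fin_dim V" using X unfolding fin_dim_def is_basis_def by blast
  show "(THE t. t \<in> car ?T \<and> (\<forall>x\<in>car V. \<forall>y\<in>car W. \<beta> x y = tsum (dual_vs V) (dual_vs W) t (\<lambda>g p. g x * p y))) = t"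
  proof (rule the_equality)
    show "t \<in> car ?T \<and> (\<forall>x\<in>car V. \<forall>y\<in>car W. \<beta> x y = tsum (dual_vs V) (dual_vs W) t (\<lambda>g p. g x * p y))"
      using t ev_t by simp
    fix s assume s: "s \<in> car ?T \<and> (\<forall>x\<in>car V. \<forall>y\<in>car W. \<beta> x y = tsum (dual_vs V) (dual_vs W) s (\<lambda>g p. g x * p y))"
    show "s = t"
    proof (rule dual_tens_ext[OF V _ fd])
      fix x assume [simp]: "x \<in> car V"
      show "ev V (dual_vs W) x s = ev V (dual_vs W) x t"
        by (rule dual_ext[of _ W]) (use s t in \<open>simp_all add: ev_dual_apply ev_t\<close>)
    qed (use s t in simp_all)
  qed
qed

text \<open>
  The numbers \<open>(x\<^sup>* \<otimes> y\<^sup>*)(t)\<close> are the coordinates of \<open>t\<close> in the basis \<open>{x \<otimes> y}\<close>.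
\<close>

lemma tens_separates:
  assumes V: "is_vs V" "fin_dim V" and W: "is_vs W" "fin_dim W"
    and s: "s \<in> car (tens V W)" and t: "t \<in> car (tens V W)"
    and eq: "\<And>f g. f \<in> car (dual_vs V) \<Longrightarrow> g \<in> car (dual_vs W) \<Longrightarrow>
      tsum V W s (\<lambda>a b. f a * g b) = tsum V W t (\<lambda>a b. f a * g b)"
  shows "s = t"
proof -
  obtain X where X: "finite X" "is_basis V X" using fin_basis[OF V] by blast
  obtain Y where Y: "finite Y" "is_basis W Y" using fin_basis[OF W] by blast
  note [simp] = V(1) W(1) basis_car[OF V(1) X(2)] basis_car[OF W(1) Y(2)]
    dual_lin[OF coord_dual[OF V(1) X(2)]] dual_lin[OF coord_dual[OF W(1) Y(2)]]
  define E where "E = (\<lambda>t. \<Sum>x\<in>X. \<Sum>y\<in>Y. scl (tens V W) (tsum V W t (\<lambda>a b. coord V X x a * coord W Y y b)) (pure V W x y))"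
  have l: "lin (tens V W) (tens V W) E" unfolding E_def by simp
  have "\<forall>t\<in>car (tens V W). E t = t"
  proof (rule tens_ball_ext[OF _ _ l])
    fix v w assume [simp]: "v \<in> car V" "w \<in> car W"
    have "E (pure V W v w) = (\<Sum>x\<in>X. \<Sum>y\<in>Y. pure V W (scl V (coord V X x v) x) (scl W (coord W Y y w) y))"
      unfolding E_def by (intro sum.cong) (simp_all add: tsum_pure[where U=field_vs] pure_scl mult.commute)
    also have "\<dots> = (\<Sum>x\<in>X. pure V W (scl V (coord V X x v) x) (\<Sum>y\<in>Y. scl W (coord W Y y w) y))"
      by (intro sum.cong lin_sum[OF _ bilinD(2)[OF bilin_pure], symmetric]) simp_all
    also have "\<dots> = pure V W (\<Sum>x\<in>X. scl V (coord V X x v) x) (\<Sum>y\<in>Y. scl W (coord W Y y w) y)"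
      by (intro lin_sum[OF _ bilinD(1)[OF bilin_pure], symmetric]) simp_all
    finally show "E (pure V W v w) = pure V W v w"
      using coord_sum[OF V(1) X(2,1)] coord_sum[OF W(1) Y(2,1)] by simp
  qed simp_all
  then have "s = E s" "E t = t" using s t by simp_all
  moreover have "E s = E t"
    unfolding E_def using eq coord_dual[OF V(1) X(2)] coord_dual[OF W(1) Y(2)] by simp
  ultimately show ?thesis by simp
qed


section \<open>The dual of a coalgebra and of a Hopf algebra\<close>

lemma same_vs_dual_alg: "same_vs (dual_alg C) (dual_vs C)"
  by (simp add: same_vs_def dual_alg_def)
lemmas dual_alg_cong [simp] = same_vs_cong[OF same_vs_dual_alg]

lemma same_vs_dual_hopf: "same_vs (dual_hopf K) (dual_vs K)"
  by (simp add: same_vs_def dual_hopf_def)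
lemmas dual_hopf_cong [simp] = same_vs_cong[OF same_vs_dual_hopf]

lemma dual_alg_apply:
  "x \<in> car C \<Longrightarrow> mul (dual_alg C) f g x = sw2 C x (\<lambda>a b. f a * g b)"
  "x \<in> car C \<Longrightarrow> uni (dual_alg C) x = cou C x"
  by (simp_all add: dual_alg_def)

lemma dual_hopf_simps [simp]:
  "mul (dual_hopf K) = mul (dual_alg (coalg_of K))" "uni (dual_hopf K) = uni (dual_alg (coalg_of K))"
  "bcou (dual_hopf K) f = f (uni K)" "ant (dual_hopf K) f = dual_map K (\<lambda>x. f (ant K x))"
  by (simp_all add: dual_hopf_def)

lemma is_alg_dual_alg [simp]:
  assumes C: "is_coalg C"
  shows "is_alg (dual_alg C)"
proof (rule is_algI)
  note [simp] = C
  note [simp] = dual_lin[of _ C]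
  have [simp]: "mul (dual_alg C) f g \<in> car (dual_vs C)" if "f \<in> car (dual_vs C)" "g \<in> car (dual_vs C)" for f g
    using that by (simp add: dual_alg_def)
  show "bilin (dual_alg C) (dual_alg C) (dual_alg C) (mul (dual_alg C))"
    unfolding dual_alg_cong by (simp add: dual_alg_def)
  show u: "uni (dual_alg C) \<in> car (dual_alg C)"
    unfolding dual_alg_cong by (simp add: dual_alg_def)
  fix f assume "f \<in> car (dual_alg C)"
  then have f [simp]: "f \<in> car (dual_vs C)" by simp
  have u [simp]: "uni (dual_alg C) \<in> car (dual_vs C)" using u by simp
  show "mul (dual_alg C) (uni (dual_alg C)) f = f"
  proof (rule dual_ext[of _ C])
    fix x assume [simp]: "x \<in> car C"
    have "mul (dual_alg C) (uni (dual_alg C)) f x = sw2 C x (\<lambda>a b. scl field_vs (cou C a) (f b))"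
      by (simp add: dual_alg_apply) (intro sw2_cong, simp_all add: dual_alg_apply)
    then show "mul (dual_alg C) (uni (dual_alg C)) f x = f x" using counit(1)[of C field_vs x f] dual_lin[OF f] by simp
  qed simp_all
  show "mul (dual_alg C) f (uni (dual_alg C)) = f"
  proof (rule dual_ext[of _ C])
    fix x assume [simp]: "x \<in> car C"
    have "mul (dual_alg C) f (uni (dual_alg C)) x = sw2 C x (\<lambda>a b. scl field_vs (cou C b) (f a))"
      by (simp add: dual_alg_apply) (intro sw2_cong, simp_all add: dual_alg_apply)
    then show "mul (dual_alg C) f (uni (dual_alg C)) x = f x" using counit(2)[of C field_vs x f] dual_lin[OF f] by simp
  qed simp_all
  fix g h assume "g \<in> car (dual_alg C)" "h \<in> car (dual_alg C)"
  then have [simp]: "g \<in> car (dual_vs C)" "h \<in> car (dual_vs C)" by simp_all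
  show "mul (dual_alg C) (mul (dual_alg C) f g) h = mul (dual_alg C) f (mul (dual_alg C) g h)"
  proof (rule dual_ext[of _ C])
    fix x assume [simp]: "x \<in> car C"
    have "mul (dual_alg C) (mul (dual_alg C) f g) h x = sw2 C x (\<lambda>y c. sw2 C y (\<lambda>a b. f a * g b) * h c)"
      by (simp add: dual_alg_apply) (intro sw2_cong, simp_all add: dual_alg_apply)
    also have "\<dots> = sw2 C x (\<lambda>y c. sw2 C y (\<lambda>a b. f a * g b * h c))"
      by (intro sw2_cong sw2_apply[where U=field_vs and U'=field_vs and \<phi>="\<lambda>z. z * _"]) simp_all
    also have "\<dots> = sw2 C x (\<lambda>a y. sw2 C y (\<lambda>b c. f a * g b * h c))"
      by (intro coassoc[where U=field_vs]) simp_all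
    also have "\<dots> = sw2 C x (\<lambda>a y. f a * sw2 C y (\<lambda>b c. g b * h c))"
      by (intro sw2_cong, simp_all add: mult.assoc) (intro sw2_apply[where U=field_vs and U'=field_vs, symmetric], simp_all)
    also have "\<dots> = mul (dual_alg C) f (mul (dual_alg C) g h) x"
      by (simp add: dual_alg_apply) (intro sw2_cong, simp_all add: dual_alg_apply)
    finally show "mul (dual_alg C) (mul (dual_alg C) f g) h x = mul (dual_alg C) f (mul (dual_alg C) g h) x" .
  qed simp_all
qed (use C in simp_all)

context
  fixes K :: "('f::field, 'k::ab_group_add) hopf"
  assumes alg: "is_alg K" and fd: "fin_dim K"
begin

private lemma [simp]: "is_alg K" by (rule alg)

lemma bcop_dual_hopf:
  assumes f: "f \<in> car (dual_vs K)"
  shows "bcop (dual_hopf K) f \<in> car (tens (dual_vs K) (dual_vs K))"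
    "x \<in> car K \<Longrightarrow> y \<in> car K \<Longrightarrow> tsum (dual_vs K) (dual_vs K) (bcop (dual_hopf K) f) (\<lambda>f1 f2. f1 x * f2 y) = f (mul K x y)"
proof -
  have vs: "is_vs K" by simp
  obtain X where X: "finite X" "is_basis K X" using fin_basis[OF vs fd] by blast
  have b: "bilin K K field_vs (\<lambda>x y. f (mul K x y))"
    by (intro bilinI dual_lin_comp[OF f]) simp_all
  note T = form_tensor[OF vs vs X(2,1) b]
  have e: "bcop (dual_hopf K) f = (\<Sum>x\<in>X. pure (dual_vs K) (dual_vs K) (coord K X x) (dual_map K (\<lambda>y. f (mul K x y))))"
    using T(3) by (simp add: dual_hopf_def)
  show "bcop (dual_hopf K) f \<in> car (tens (dual_vs K) (dual_vs K))" unfolding e by (rule T(1))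
  show "x \<in> car K \<Longrightarrow> y \<in> car K \<Longrightarrow> tsum (dual_vs K) (dual_vs K) (bcop (dual_hopf K) f) (\<lambda>f1 f2. f1 x * f2 y) = f (mul K x y)"
    unfolding e by (rule T(2)[symmetric])
qed

lemma dual2_ext:
  assumes "s \<in> car (tens (dual_vs K) (dual_vs K))" "t \<in> car (tens (dual_vs K) (dual_vs K))"
    and "\<And>x y. x \<in> car K \<Longrightarrow> y \<in> car K \<Longrightarrow>
      tsum (dual_vs K) (dual_vs K) s (\<lambda>f1 f2. f1 x * f2 y) = tsum (dual_vs K) (dual_vs K) t (\<lambda>f1 f2. f1 x * f2 y)"
  shows "s = t"
proof (rule dual_tens_ext[OF _ _ fd])
  fix x assume x [simp]: "x \<in> car K"
  show "ev K (dual_vs K) x s = ev K (dual_vs K) x t"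
    by (rule dual_ext[of _ K]) (use assms in \<open>simp_all add: ev_dual_apply\<close>)
qed (use assms in simp_all)

lemma pre_coalg_dual_hopf [simp]: "pre_coalg (coalg_of (dual_hopf K))"
proof -
  have sc: "scl K c (mul K x y) \<in> car K" if "x \<in> car K" "y \<in> car K" for c x y using that by simp
  have "lin (dual_vs K) (tens (dual_vs K) (dual_vs K)) (bcop (dual_hopf K))"
    unfolding lin_def
  proof (intro conjI ballI allI)
    fix f c assume f [simp]: "f \<in> car (dual_vs K)"
    let ?T = "tens (dual_vs K) (dual_vs K)"
    have l: "lin ?T field_vs (\<lambda>t. tsum (dual_vs K) (dual_vs K) t (\<lambda>f1 f2. f1 x * f2 y))" for x y by simp
    show [simp]: "bcop (dual_hopf K) f \<in> car ?T" by (simp add: bcop_dual_hopf)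
    show "bcop (dual_hopf K) (scl (dual_vs K) c f) = scl ?T c (bcop (dual_hopf K) f)"
      by (rule dual2_ext) (simp_all add: bcop_dual_hopf lin_scl[OF l] scl_dual_vs)
    fix g assume [simp]: "g \<in> car (dual_vs K)"
    show "bcop (dual_hopf K) (f + g) = bcop (dual_hopf K) f + bcop (dual_hopf K) g"
      by (rule dual2_ext) (simp_all add: bcop_dual_hopf lin_add[OF l])
  qed
  then show ?thesis unfolding pre_coalg_def by simp
qed

lemma sw2_dual_eval:
  assumes [simp]: "f \<in> car (dual_vs K)" "x \<in> car K" "y \<in> car K"
  shows "sw2 (coalg_of (dual_hopf K)) f (\<lambda>f1 f2. f1 x * f2 y) = f (mul K x y)"
  by (simp add: sw2_def bcop_dual_hopf)

text \<open>
  Evaluation at three points turns coassociativity into associativity of \<open>K\<close>.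
\<close>

lemma is_coalg_dual_hopf [simp]: "is_coalg (coalg_of (dual_hopf K))"
proof (rule is_coalgI)
  let ?C = "coalg_of (dual_hopf K)" and ?V = "dual_vs K"
  let ?U = "tens ?V (tens ?V ?V)"
  show "lin ?C (tens ?C ?C) (cop ?C)" by (rule pre_coalg_simps(3)) simp
  show "lin ?C field_vs (cou ?C)" by (simp add: lin_def dual_vs_def dual_hopf_def)
  fix f assume "f \<in> car ?C"
  then have f [simp]: "f \<in> car ?V" by simp
  have "sw2 ?C f (\<lambda>c1 c'. sw2 ?C c' (\<lambda>c2 c3. pure ?V (tens ?V ?V) c1 (pure ?V ?V c2 c3))) =
      sw2 ?C f (\<lambda>c' c3. sw2 ?C c' (\<lambda>c1 c2. pure ?V (tens ?V ?V) c1 (pure ?V ?V c2 c3)))" (is "?l = ?r")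
  proof (rule dual_tens_ext[OF _ _ fd])
    fix x assume x [simp]: "x \<in> car K"
    show "ev K (tens ?V ?V) x ?l = ev K (tens ?V ?V) x ?r"
    proof (rule dual2_ext)
      fix y z assume [simp]: "y \<in> car K" "z \<in> car K"
      define \<phi> where "\<phi> = (\<lambda>t. tsum ?V ?V (ev K (tens ?V ?V) x t) (\<lambda>f1 f2. f1 y * f2 z))"
      have l: "lin ?U field_vs \<phi>" unfolding \<phi>_def by simp
      have p: "\<phi> (pure ?V (tens ?V ?V) f1 (pure ?V ?V f2 f3)) = f1 x * (f2 y * f3 z)"
        if "f1 \<in> car ?V" "f2 \<in> car ?V" "f3 \<in> car ?V" for f1 f2 f3
        using that unfolding \<phi>_def by (simp add: tsum_pure[where U=field_vs] pure_scl(1)[symmetric] scl_dual_vs mult.assoc)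
      have "\<phi> ?l = sw2 ?C f (\<lambda>c1 c'. \<phi> (sw2 ?C c' (\<lambda>c2 c3. pure ?V (tens ?V ?V) c1 (pure ?V ?V c2 c3))))"
        by (intro sw2_apply[where U="?U", OF _ _ _ l]) simp_all
      also have "\<dots> = sw2 ?C f (\<lambda>c1 c'. sw2 ?C c' (\<lambda>c2 c3. \<phi> (pure ?V (tens ?V ?V) c1 (pure ?V ?V c2 c3))))"
        by (intro sw2_cong sw2_apply[where U="?U", OF _ _ _ l]) simp_all
      also have "\<dots> = sw2 ?C f (\<lambda>c1 c'. sw2 ?C c' (\<lambda>c2 c3. c1 x * (c2 y * c3 z)))"
        by (intro sw2_cong) (simp_all add: p)
      also have "\<dots> = sw2 ?C f (\<lambda>c1 c'. c1 x * sw2 ?C c' (\<lambda>c2 c3. c2 y * c3 z))"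
        by (intro sw2_cong sw2_apply[where U=field_vs and U'=field_vs, symmetric]) simp_all
      also have "\<dots> = sw2 ?C f (\<lambda>c1 c'. c1 x * c' (mul K y z))"
        by (intro sw2_cong) (simp_all add: sw2_dual_eval)
      also have "\<dots> = f (mul K x (mul K y z))" by (simp add: sw2_dual_eval)
      finally have L: "\<phi> ?l = f (mul K x (mul K y z))" .
      have "\<phi> ?r = sw2 ?C f (\<lambda>c' c3. \<phi> (sw2 ?C c' (\<lambda>c1 c2. pure ?V (tens ?V ?V) c1 (pure ?V ?V c2 c3))))"
        by (intro sw2_apply[where U="?U", OF _ _ _ l]) simp_all
      also have "\<dots> = sw2 ?C f (\<lambda>c' c3. sw2 ?C c' (\<lambda>c1 c2. \<phi> (pure ?V (tens ?V ?V) c1 (pure ?V ?V c2 c3))))"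
        by (intro sw2_cong sw2_apply[where U="?U", OF _ _ _ l]) simp_all
      also have "\<dots> = sw2 ?C f (\<lambda>c' c3. sw2 ?C c' (\<lambda>c1 c2. (c1 x * c2 y) * c3 z))"
        by (intro sw2_cong) (simp_all add: p)
      also have "\<dots> = sw2 ?C f (\<lambda>c' c3. sw2 ?C c' (\<lambda>c1 c2. c1 x * c2 y) * c3 z)"
        by (intro sw2_cong sw2_apply[where U=field_vs and U'=field_vs and \<phi>="\<lambda>t. t * _", symmetric]) simp_all
      also have "\<dots> = sw2 ?C f (\<lambda>c' c3. c' (mul K x y) * c3 z)"
        by (intro sw2_cong) (simp_all add: sw2_dual_eval)
      also have "\<dots> = f (mul K x (mul K y z))" by (simp add: sw2_dual_eval mul_assoc)
      finally show "tsum ?V ?V (ev K (tens ?V ?V) x ?l) (\<lambda>f1 f2. f1 y * f2 z) = tsum ?V ?V (ev K (tens ?V ?V) x ?r) (\<lambda>f1 f2. f1 y * f2 z)"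
        using L by (simp add: \<phi>_def)
    qed simp_all
  qed simp_all
  then show "sw2 ?C f (\<lambda>c1 c'. sw2 ?C c' (\<lambda>c2 c3. pure ?C (tens ?C ?C) c1 (pure ?C ?C c2 c3))) =
      sw2 ?C f (\<lambda>c' c3. sw2 ?C c' (\<lambda>c1 c2. pure ?C (tens ?C ?C) c1 (pure ?C ?C c2 c3)))" by simp
  show "sw2 ?C f (\<lambda>c1 c2. scl ?C (cou ?C c1) c2) = f"
  proof (rule dual_ext[of _ K])
    fix x assume [simp]: "x \<in> car K"
    have "sw2 ?C f (\<lambda>c1 c2. scl ?C (cou ?C c1) c2) x = sw2 ?C f (\<lambda>c1 c2. scl ?V (c1 (uni K)) c2 x)"
      by (subst sw2_apply[where U="?V" and U'=field_vs and \<phi>="\<lambda>p. p x", OF _ _ _ lin_eval]) simp_all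
    then show "sw2 ?C f (\<lambda>c1 c2. scl ?C (cou ?C c1) c2) x = f x"
      by (simp add: scl_dual_vs sw2_dual_eval)
  qed simp_all
  show "sw2 ?C f (\<lambda>c1 c2. scl ?C (cou ?C c2) c1) = f"
  proof (rule dual_ext[of _ K])
    fix x assume [simp]: "x \<in> car K"
    have "sw2 ?C f (\<lambda>c1 c2. scl ?C (cou ?C c2) c1) x = sw2 ?C f (\<lambda>c1 c2. scl ?V (c2 (uni K)) c1 x)"
      by (subst sw2_apply[where U="?V" and U'=field_vs and \<phi>="\<lambda>p. p x", OF _ _ _ lin_eval]) simp_all
    then show "sw2 ?C f (\<lambda>c1 c2. scl ?C (cou ?C c2) c1) x = f x"
      by (simp add: scl_dual_vs sw2_dual_eval mult.commute[of "_ (uni K)"])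
  qed simp_all
qed simp_all

end


section \<open>Coideal subalgebras and quotient module coalgebras\<close>

text \<open>
  Since \<open>\<iota>\<close> intertwines \<open>\<delta>\<close> with the coproduct, sums over the coaction that see the \<open>B\<close>-leg only through
  \<open>\<iota>\<close> are Sweedler sums in \<open>A\<close>.
\<close>

lemma coaction_sw2:
  assumes A: "is_bialg A" and B: "is_vs B" and \<iota>: "lin B A \<iota>"
    and \<delta>: "lin B (tens A B) \<delta>" "\<And>b. b \<in> car B \<Longrightarrow> bcop A (\<iota> b) = tsum A B (\<delta> b) (\<lambda>a b'. pure A A a (\<iota> b'))"
    and U: "is_vs U" and b: "b \<in> car B"
    and F: "\<And>y. y \<in> car A \<Longrightarrow> lin A U (\<lambda>x. F x y)" "\<And>x. x \<in> car A \<Longrightarrow> lin A U (\<lambda>y. F x y)"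
  shows "tsum A B (\<delta> b) (\<lambda>a b'. F a (\<iota> b')) = sw2 (coalg_of A) (\<iota> b) F"
proof -
  note [simp] = A B U b F lin_closed[OF \<iota>] lin_closed[OF \<delta>(1)]
  have l: "lin (tens A A) U (\<lambda>t. tsum A A t F)" by (intro tsum_lin_left) simp_all
  have "sw2 (coalg_of A) (\<iota> b) F = tsum A A (tsum A B (\<delta> b) (\<lambda>a b'. pure A A a (\<iota> b'))) F"
    by (simp add: sw2_def \<delta>(2))
  also have "\<dots> = tsum A B (\<delta> b) (\<lambda>a b'. tsum A A (pure A A a (\<iota> b')) F)"
    by (intro tsum_lin_apply[where U="tens A A", OF _ _ _ l]) simp_all
  also have "\<dots> = tsum A B (\<delta> b) (\<lambda>a b'. F a (\<iota> b'))"
    by (intro tsum_cong tsum_pure[where U=U]) simp_all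
  finally show ?thesis by simp
qed

text \<open>
  Through the retraction \<open>\<zeta>\<close> every sum over the coaction of \<open>b\<close> becomes a Sweedler sum of \<open>\<iota>(b)\<close>, and
  the axioms of a comodule algebra turn into bialgebra axioms of \<open>A\<close>.
\<close>

lemma coideal_subalgebra:
  assumes A: "is_bialg A" and B: "is_alg B"
    and \<iota>: "lin B A \<iota>" "\<And>b c. b \<in> car B \<Longrightarrow> c \<in> car B \<Longrightarrow> \<iota> (mul B b c) = mul A (\<iota> b) (\<iota> c)" "\<iota> (uni B) = uni A"
    and \<zeta>: "lin A B \<zeta>" "\<And>b. b \<in> car B \<Longrightarrow> \<zeta> (\<iota> b) = b"
    and \<delta>: "lin B (tens A B) \<delta>" "\<And>b. b \<in> car B \<Longrightarrow> bcop A (\<iota> b) = tsum A B (\<delta> b) (\<lambda>a b'. pure A A a (\<iota> b'))"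
  shows "left_comodule_algebra A B \<delta>" "comodule_algebra_injection A B \<delta> \<iota>"
proof -
  let ?C = "coalg_of A"
  have vsB: "is_vs B" using B by simp
  note sw = coaction_sw2[OF A vsB \<iota>(1) \<delta>]
  note [simp] = A B lin_closed[OF \<iota>(1)] lin_comp[OF \<iota>(1)] lin_closed[OF \<zeta>(1)] lin_comp[OF \<zeta>(1)]
    lin_closed[OF \<delta>(1)] lin_comp[OF \<delta>(1)] \<zeta>(2) \<iota>(2,3) \<iota>(1) \<zeta>(1) \<delta>(1)
  have sw': "tsum A B (\<delta> b) G = sw2 ?C (\<iota> b) (\<lambda>a c. G a (\<zeta> c))"
    if [simp]: "is_vs U" "b \<in> car B" "\<And>y. y \<in> car B \<Longrightarrow> lin A U (\<lambda>x. G x y)" "\<And>x. x \<in> car A \<Longrightarrow> lin B U (\<lambda>y. G x y)"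
    for U :: "('a, 'u::ab_group_add, 'z) vs_scheme" and b G
  proof -
    have [simp]: "lin A U (\<lambda>y. G x (\<zeta> y))" if "x \<in> car A" for x
      by (rule lin_comp[of B U "G x"]) (use that in simp_all)
    have "tsum A B (\<delta> b) G = tsum A B (\<delta> b) (\<lambda>a b'. G a (\<zeta> (\<iota> b')))"
      by (intro tsum_cong) simp_all
    also have "\<dots> = sw2 ?C (\<iota> b) (\<lambda>a c. G a (\<zeta> c))" by (rule sw[where U=U]) simp_all
    finally show ?thesis .
  qed
  have \<delta>_eq: "\<delta> b = sw2 ?C (\<iota> b) (\<lambda>a c. pure A B a (\<zeta> c))" if b [simp]: "b \<in> car B" for b
  proof -
    have "\<delta> b = tsum A B (\<delta> b) (pure A B)" by (rule tsum_self[symmetric]) simp_all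
    also have "\<dots> = sw2 ?C (\<iota> b) (\<lambda>a c. pure A B a (\<zeta> c))" by (rule sw'[of "tens A B"]) simp_all
    finally show ?thesis .
  qed
  let ?U = "tens A (tens A B)"
  show "left_comodule_algebra A B \<delta>"
    unfolding left_comodule_algebra_def
  proof (intro conjI ballI)
    fix b assume [simp]: "b \<in> car B"
    have "tsum A B (\<delta> b) (\<lambda>a b'. tsum A B (\<delta> b') (\<lambda>a' b''. pure A (tens A B) a (pure A B a' b''))) =
        tsum A B (\<delta> b) (\<lambda>a b'. sw2 ?C (\<iota> b') (\<lambda>a' c. pure A (tens A B) a (pure A B a' (\<zeta> c))))"
      by (intro tsum_cong sw'[of "?U"]) simp_all
    also have "\<dots> = sw2 ?C (\<iota> b) (\<lambda>a c. sw2 ?C c (\<lambda>a' c'. pure A (tens A B) a (pure A B a' (\<zeta> c'))))"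
      by (rule sw[where U="?U"]) simp_all
    also have "\<dots> = sw2 ?C (\<iota> b) (\<lambda>a c. sw2 ?C a (\<lambda>a1 a2. pure A (tens A B) a1 (pure A B a2 (\<zeta> c))))"
      by (rule coassoc[where U="?U", symmetric]) simp_all
    also have "\<dots> = tsum A B (\<delta> b) (\<lambda>a b'. sw2 ?C a (\<lambda>a1 a2. pure A (tens A B) a1 (pure A B a2 b')))"
      by (rule sw'[of "?U", symmetric]) simp_all
    finally show "tsum A B (\<delta> b) (\<lambda>a b'. tsum A B (\<delta> b') (\<lambda>a' b''. pure A (tens A B) a (pure A B a' b''))) =
        tsum A B (\<delta> b) (\<lambda>a b'. sw2 ?C a (\<lambda>a1 a2. pure A (tens A B) a1 (pure A B a2 b')))" .
    have "tsum A B (\<delta> b) (\<lambda>a b'. scl B (bcou A a) b') = sw2 ?C (\<iota> b) (\<lambda>a c. scl B (bcou A a) (\<zeta> c))"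
      by (rule sw'[of B]) simp_all
    then show "tsum A B (\<delta> b) (\<lambda>a b'. scl B (bcou A a) b') = b"
      using counit(1)[of ?C B "\<iota> b" \<zeta>] by simp
    fix c assume [simp]: "c \<in> car B"
    have "\<delta> (mul B b c) = sw2 ?C (mul A (\<iota> b) (\<iota> c)) (\<lambda>a c. pure A B a (\<zeta> c))" by (simp add: \<delta>_eq)
    also have "\<dots> = sw2 ?C (\<iota> b) (\<lambda>a1 a2. sw2 ?C (\<iota> c) (\<lambda>c1 c2. pure A B (mul A a1 c1) (\<zeta> (mul A a2 c2))))"
      by (rule sw2_mul[where U="tens A B"]) simp_all
    also have "\<dots> = tsum A B (\<delta> b) (\<lambda>a b'. sw2 ?C (\<iota> c) (\<lambda>c1 c2. pure A B (mul A a c1) (\<zeta> (mul A (\<iota> b') c2))))"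
      by (rule sw[where U="tens A B", symmetric]) simp_all
    also have "\<dots> = tsum A B (\<delta> b) (\<lambda>a b'. tsum A B (\<delta> c) (\<lambda>a' c'. pure A B (mul A a a') (\<zeta> (mul A (\<iota> b') (\<iota> c')))))"
      by (intro tsum_cong sw[where U="tens A B", symmetric]) simp_all
    also have "\<dots> = tsum A B (\<delta> b) (\<lambda>a b'. tsum A B (\<delta> c) (\<lambda>a' c'. pure A B (mul A a a') (mul B b' c')))"
      by (intro tsum_cong) (simp_all add: \<iota>(2)[symmetric] del: \<iota>(2))
    finally show "\<delta> (mul B b c) = mul (talg A B) (\<delta> b) (\<delta> c)" by (simp add: talg_def)
  next
    have "\<zeta> (uni A) = uni B" using \<zeta>(2)[of "uni B"] by simp
    then show "\<delta> (uni B) = uni (talg A B)" by (simp add: \<delta>_eq sw2_uni[where U="tens A B"])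
  qed simp_all
  show "comodule_algebra_injection A B \<delta> \<iota>"
    unfolding comodule_algebra_injection_def using \<delta>(2) inj_on_inverseI[of "car B" \<zeta> \<iota>] by simp
qed

text \<open>
  By surjectivity every element of \<open>C\<close> is some \<open>\<pi>(y)\<close>, and \<open>\<pi>(y) a = \<pi>(y a)\<close> reduces the axioms to those
  of the bialgebra \<open>A\<close>.
\<close>

lemma quotient_module_coalgebra:
  assumes A: "is_bialg A" and C: "is_coalg C" and \<pi>: "coalg_map (coalg_of A) C \<pi>" "\<pi> ` car A = car C"
    and act: "bilin C A C act" "\<And>a b. a \<in> car A \<Longrightarrow> b \<in> car A \<Longrightarrow> \<pi> (mul A a b) = act (\<pi> a) b"
  shows "right_module_coalgebra A C act" "module_coalgebra_surjection A C act \<pi>"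
proof -
  have l: "lin A C \<pi>" using coalg_mapD(1)[OF \<pi>(1)] by simp
  note [simp] = A C l lin_closed[OF l] lin_comp[OF l] bilin_closed[OF act(1)] lin_bilin1[OF act(1)] lin_bilin2[OF act(1)] act(1)
  have cou: "cou C (\<pi> a) = bcou A a" if "a \<in> car A" for a using coalg_mapD(3)[OF \<pi>(1)] that by simp
  show "module_coalgebra_surjection A C act \<pi>"
    unfolding module_coalgebra_surjection_def using \<pi> act coalg_mapD(3,4)[OF \<pi>(1)] by simp
  show "right_module_coalgebra A C act"
    unfolding right_module_coalgebra_def
  proof (intro conjI ballI)
    fix x assume "x \<in> car C"
    then obtain y where [simp]: "y \<in> car A" and x: "x = \<pi> y" using \<pi>(2) by blast
    show "act x (uni A) = x" using act(2)[of y "uni A"] x by simp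
    fix a assume [simp]: "a \<in> car A"
    show "act (act x a) b = act x (mul A a b)" if [simp]: "b \<in> car A" for b
      by (simp add: x act(2)[symmetric] mul_assoc)
    show "cou C (act x a) = cou C x * bcou A a" by (simp add: x act(2)[symmetric] cou)
    have "cop C (act x a) = sw2 (coalg_of A) (mul A y a) (\<lambda>u v. pure C C (\<pi> u) (\<pi> v))"
      using coalg_mapD(4)[OF \<pi>(1), of "mul A y a"] by (simp add: x act(2)[symmetric])
    also have "\<dots> = sw2 (coalg_of A) y (\<lambda>y1 y2. sw2 (coalg_of A) a (\<lambda>a1 a2. pure C C (\<pi> (mul A y1 a1)) (\<pi> (mul A y2 a2))))"
      by (rule sw2_mul[where U="tens C C"]) simp_all
    also have "\<dots> = sw2 (coalg_of A) y (\<lambda>y1 y2. sw2 (coalg_of A) a (\<lambda>a1 a2. pure C C (act (\<pi> y1) a1) (act (\<pi> y2) a2)))"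
      by (intro sw2_cong) (simp_all add: act(2))
    also have "\<dots> = sw2 C x (\<lambda>x1 x2. sw2 (coalg_of A) a (\<lambda>a1 a2. pure C C (act x1 a1) (act x2 a2)))"
      unfolding x by (rule coalg_map_sw2[OF _ _ _ _ \<pi>(1), where U="tens C C", symmetric]) simp_all
    finally show "cop C (act x a) = sw2 C x (\<lambda>x1 x2. sw2 (coalg_of A) a (\<lambda>a1 a2. pure C C (act x1 a1) (act x2 a2)))" .
  qed simp_all
qed

text \<open>
  The convolution inverse is \<open>f \<circ> S\<close>.
\<close>

lemma alg_map_conv_invertible:
  assumes A: "is_hopf A" and B: "is_alg B" and f: "lin A B f"
    "\<And>a b. a \<in> car A \<Longrightarrow> b \<in> car A \<Longrightarrow> f (mul A a b) = mul B (f a) (f b)" "f (uni A) = uni B"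
  shows "conv_invertible (coalg_of A) B f"
proof -
  note [simp] = A B lin_comp[OF f(1)] lin_closed[OF f(1)]
  let ?C = "coalg_of A"
  have "sw2 ?C a (\<lambda>x y. mul B (f x) (f (ant A y))) = scl B (bcou A a) (uni B)"
    "sw2 ?C a (\<lambda>x y. mul B (f (ant A x)) (f y)) = scl B (bcou A a) (uni B)" if [simp]: "a \<in> car A" for a
  proof -
    have "sw2 ?C a (\<lambda>x y. mul B (f x) (f (ant A y))) = sw2 ?C a (\<lambda>x y. f (mul A x (ant A y)))"
      by (intro sw2_cong) (simp_all add: f(2))
    also have "\<dots> = f (sw2 ?C a (\<lambda>x y. mul A x (ant A y)))"
      by (intro sw2_apply[where U=A, OF _ _ _ f(1), symmetric]) simp_all
    finally show "sw2 ?C a (\<lambda>x y. mul B (f x) (f (ant A y))) = scl B (bcou A a) (uni B)"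
      by (simp add: antipode[OF is_hopf_simps(2)] lin_scl[OF f(1)] f(3))
    have "sw2 ?C a (\<lambda>x y. mul B (f (ant A x)) (f y)) = sw2 ?C a (\<lambda>x y. f (mul A (ant A x) y))"
      by (intro sw2_cong) (simp_all add: f(2))
    also have "\<dots> = f (sw2 ?C a (\<lambda>x y. mul A (ant A x) y))"
      by (intro sw2_apply[where U=A, OF _ _ _ f(1), symmetric]) simp_all
    finally show "sw2 ?C a (\<lambda>x y. mul B (f (ant A x)) (f y)) = scl B (bcou A a) (uni B)"
      by (simp add: antipode[OF is_hopf_simps(2)] lin_scl[OF f(1)] f(3))
  qed
  then show ?thesis
    unfolding conv_invertible_def conv_def by (intro exI[of _ "\<lambda>a. f (ant A a)"]) simp
qed


section \<open>The Hopf algebra map induced by a pairing\<close>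

locale paired_hopf =
  fixes K :: "('f::field, 'k::ab_group_add) hopf"
    and H :: "('f, 'h::ab_group_add) hopf"
    and \<sigma> :: "('k \<Rightarrow> 'f) \<Rightarrow> 'h \<Rightarrow> 'f"
  assumes H: "is_hopf H" "fin_dim H" and K: "is_hopf K" "fin_dim K"
    and pairing: "hopf_pairing (dual_hopf K) H \<sigma>"
begin

abbreviation s where "s \<equiv> sigma_r K \<sigma>"
abbreviation CH where "CH \<equiv> coalg_of H"
abbreviation CK where "CK \<equiv> coalg_of K"
abbreviation Kd where "Kd \<equiv> dual_hopf K"
abbreviation V where "V \<equiv> dual_vs K"
abbreviation CKd where "CKd \<equiv> coalg_of Kd"

lemmas HK [simp] = H K
lemmas inv_antH [simp] = inv_ant[OF H]
lemmas inv_antK [simp] = inv_ant[OF K]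

lemma is_coalg_CKd [simp]: "is_coalg CKd"
  by (rule is_coalg_dual_hopf) simp_all

lemma pairing_simps:
  "a \<in> car V \<Longrightarrow> lin W H g \<Longrightarrow> lin W field_vs (\<lambda>x. \<sigma> a (g x))"
  "h \<in> car H \<Longrightarrow> lin W V p \<Longrightarrow> lin W field_vs (\<lambda>x. \<sigma> (p x) h)"
  "a \<in> car V \<Longrightarrow> a' \<in> car V \<Longrightarrow> h \<in> car H \<Longrightarrow> \<sigma> (mul Kd a a') h = sw2 CH h (\<lambda>h1 h2. \<sigma> a h1 * \<sigma> a' h2)"
  "a \<in> car V \<Longrightarrow> h \<in> car H \<Longrightarrow> h' \<in> car H \<Longrightarrow> \<sigma> a (mul H h h') = sw2 CKd a (\<lambda>a1 a2. \<sigma> a1 h * \<sigma> a2 h')"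
  "h \<in> car H \<Longrightarrow> \<sigma> (uni Kd) h = bcou H h" "a \<in> car V \<Longrightarrow> \<sigma> a (uni H) = a (uni K)"
proof -
  have b: "bilin V H field_vs \<sigma>" using pairing unfolding hopf_pairing_def by simp
  show "a \<in> car V \<Longrightarrow> lin W H g \<Longrightarrow> lin W field_vs (\<lambda>x. \<sigma> a (g x))" by (rule lin_bilin2[OF b])
  show "h \<in> car H \<Longrightarrow> lin W V p \<Longrightarrow> lin W field_vs (\<lambda>x. \<sigma> (p x) h)" by (rule lin_bilin1[OF b])
qed (use pairing in \<open>unfold hopf_pairing_def, auto\<close>)

text \<open>
  The element is \<open>\<Sum> \<sigma>(x\<^sup>*, h) x\<close>, the sum being over a basis of \<open>K\<close>.
\<close>

lemma s_ex: "h \<in> car H \<Longrightarrow> \<exists>k. k \<in> car K \<and> (\<forall>f\<in>car V. f k = \<sigma> f h)"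
proof -
  assume h: "h \<in> car H"
  have vs: "is_vs K" by simp
  obtain X where X: "finite X" "is_basis K X" using fin_basis[OF vs K(2)] by blast
  note [simp] = basis_car[OF vs X(2)] coord_dual[OF vs X(2)]
  have "f (\<Sum>x\<in>X. scl K (\<sigma> (coord K X x) h) x) = \<sigma> f h" if f: "f \<in> car V" for f
  proof -
    have l: "lin V field_vs (\<lambda>f. \<sigma> f h)" using h by (rule pairing_simps(2)) simp
    have "f (\<Sum>x\<in>X. scl K (\<sigma> (coord K X x) h) x) = (\<Sum>x\<in>X. f (scl K (\<sigma> (coord K X x) h) x))"
      by (rule lin_sum[OF vs dual_lin[OF f]]) simp
    also have "\<dots> = (\<Sum>x\<in>X. \<sigma> (scl V (f x) (coord K X x)) h)"
      by (intro sum.cong) (simp_all add: lin_scl[OF dual_lin[OF f]] lin_scl[OF l] mult.commute)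
    also have "\<dots> = \<sigma> (\<Sum>x\<in>X. scl V (f x) (coord K X x)) h"
      by (rule lin_sum[OF _ l, symmetric]) simp_all
    finally show ?thesis by (simp only: dual_basis_sum[OF vs X(2,1) f])
  qed
  moreover have "(\<Sum>x\<in>X. scl K (\<sigma> (coord K X x) h) x) \<in> car K" by simp
  ultimately show ?thesis by blast
qed

lemma K_eqI: "v \<in> car K \<Longrightarrow> w \<in> car K \<Longrightarrow> (\<And>f. f \<in> car V \<Longrightarrow> f v = f w) \<Longrightarrow> v = w"
  by (rule dual_separates[of K]) simp_all

lemma s_props:
  assumes "h \<in> car H" shows "s h \<in> car K" "f \<in> car V \<Longrightarrow> f (s h) = \<sigma> f h"
proof -
  have "\<exists>!k. k \<in> car K \<and> (\<forall>f\<in>car V. f k = \<sigma> f h)"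
    using s_ex[OF assms] K_eqI by (metis (no_types, lifting))
  from theI'[OF this] show "s h \<in> car K" "f \<in> car V \<Longrightarrow> f (s h) = \<sigma> f h"
    unfolding sigma_r_def by auto
qed

lemmas s_closed [simp] = s_props(1)

lemma s_lin: "lin H K s"
  unfolding lin_def
proof (intro conjI ballI allI)
  have vs: "is_vs K" "is_vs H" by simp_all
  fix v c assume v [simp]: "v \<in> car H"
  have l: "lin H field_vs (\<sigma> f)" if "f \<in> car V" for f using pairing_simps(1)[OF that, of H "\<lambda>x. x"] by simp
  show "s v \<in> car K" by simp
  show "s (scl H c v) = scl K c (s v)"
    by (rule K_eqI) (simp_all add: s_props lin_scl[OF dual_lin] lin_scl[OF l])
  fix v' assume v' [simp]: "v' \<in> car H"
  show "s (v + v') = s v + s v'"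
    by (rule K_eqI) (simp_all add: s_props lin_add[OF dual_lin] lin_add[OF l])
qed

lemmas s_lin_comp [simp] = lin_comp[OF s_lin]

lemma s_mul: "a \<in> car H \<Longrightarrow> b \<in> car H \<Longrightarrow> s (mul H a b) = mul K (s a) (s b)"
proof (rule K_eqI)
  fix f assume [simp]: "f \<in> car V" "a \<in> car H" "b \<in> car H"
  have "f (s (mul H a b)) = sw2 CKd f (\<lambda>f1 f2. \<sigma> f1 a * \<sigma> f2 b)" by (simp add: s_props pairing_simps)
  also have "\<dots> = sw2 CKd f (\<lambda>f1 f2. f1 (s a) * f2 (s b))" by (intro sw2_cong) (simp_all add: s_props)
  also have "\<dots> = f (mul K (s a) (s b))" by (rule sw2_dual_eval) simp_all
  finally show "f (s (mul H a b)) = f (mul K (s a) (s b))" .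
qed simp_all

lemma s_uni [simp]: "s (uni H) = uni K"
  by (rule K_eqI) (simp_all add: s_props pairing_simps)

lemma s_cou [simp]: "h \<in> car H \<Longrightarrow> bcou K (s h) = bcou H h"
proof -
  assume [simp]: "h \<in> car H"
  have "uni (dual_alg CK) \<in> car V" using is_alg_simps(2)[of "dual_alg CK"] by simp
  then have "uni (dual_alg CK) (s h) = bcou H h" using s_props(2)[of h "uni (dual_alg CK)"] pairing_simps(5)[of h] by simp
  then show ?thesis by (simp add: dual_alg_apply)
qed

text \<open>
  Pairing with \<open>f \<otimes> g\<close> turns the coproduct of \<open>K\<close> into the product of \<open>K\<^sup>*\<close>, where the Hopf pairing
  axiom for products of functionals applies.
\<close>

lemma s_coalg_map: "coalg_map CH CK s"
  unfolding coalg_map_def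
proof (intro conjI ballI)
  show "lin CH CK s" using s_lin by simp
  fix h assume "h \<in> car CH"
  then have [simp]: "h \<in> car H" by simp
  show "cou CK (s h) = cou CH h" by simp
  have "bcop K (s h) = sw2 CH h (\<lambda>a b. pure K K (s a) (s b))"
  proof (rule tens_separates[of K K])
    fix f g assume [simp]: "f \<in> car V" "g \<in> car V"
    note [simp] = dual_lin[of _ K]
    have fg: "mul (dual_alg CK) f g \<in> car V" by simp
    have "tsum K K (bcop K (s h)) (\<lambda>a b. f a * g b) = mul (dual_alg CK) f g (s h)"
      by (simp add: dual_alg_apply sw2_def)
    also have "\<dots> = sw2 CH h (\<lambda>a b. \<sigma> f a * \<sigma> g b)" using pairing_simps(3)[of f g h] by (simp add: s_props fg)
    also have "\<dots> = sw2 CH h (\<lambda>a b. tsum K K (pure K K (s a) (s b)) (\<lambda>a b. f a * g b))"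
      by (intro sw2_cong) (simp_all add: tsum_pure[where U=field_vs] s_props)
    also have "\<dots> = tsum K K (sw2 CH h (\<lambda>a b. pure K K (s a) (s b))) (\<lambda>a b. f a * g b)"
      by (rule sw2_apply[where U="tens K K" and U'=field_vs and \<phi>="\<lambda>t. tsum K K t (\<lambda>a b. f a * g b)", symmetric]) simp_all
    finally show "tsum K K (bcop K (s h)) (\<lambda>a b. f a * g b) = tsum K K (sw2 CH h (\<lambda>a b. pure K K (s a) (s b))) (\<lambda>a b. f a * g b)" .
  qed simp_all
  then show "cop CK (s h) = sw2 CH h (\<lambda>a b. pure CK CK (s a) (s b))" by simp
qed

text \<open>
  This is \<open>\<sigma>\<^sub>r \<circ> S\<^sup>-\<^sup>1\<close>, the map in the coaction; also \<open>\<sigma>(q, S\<^sup>-\<^sup>1(h)) = q(j(h))\<close> is the second pairing in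
  the product of the quantum double.
\<close>

definition j where "j h = s (inv_ant H h)"

lemma j_closed [simp]: "h \<in> car H \<Longrightarrow> j h \<in> car K"
  by (simp add: j_def)

lemma j_lin [simp]: "lin W H f \<Longrightarrow> lin W K (\<lambda>x. j (f x))"
  by (simp add: j_def)

lemma j_mul: "a \<in> car H \<Longrightarrow> b \<in> car H \<Longrightarrow> j (mul H a b) = mul K (j b) (j a)"
  by (simp add: j_def inv_ant_mul s_mul)

lemma j_uni [simp]: "j (uni H) = uni K"
  by (simp add: j_def)

lemma j_cou [simp]: "h \<in> car H \<Longrightarrow> bcou K (j h) = bcou H h"
  by (simp add: j_def)

lemma j_coalg_map: "coalg_map (cop_coalg CH) CK j"
  unfolding j_def by (rule coalg_map_comp[OF _ _ _ inv_ant_coalg_map(2)[OF H] s_coalg_map]) simp_all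

lemma sw2_j:
  assumes "is_vs U" "h \<in> car H" "\<And>b. b \<in> car K \<Longrightarrow> lin K U (\<lambda>a. F a b)" "\<And>a. a \<in> car K \<Longrightarrow> lin K U (\<lambda>b. F a b)"
  shows "sw2 CK (j h) F = sw2 CH h (\<lambda>a b. F (j b) (j a))"
proof -
  have [simp]: "lin W U (\<lambda>x. F (g x) b)" "lin W U (\<lambda>x. F b (g x))" if "lin W K g" "b \<in> car K" for W :: "('f, 'x::ab_group_add, 'y) vs_scheme" and g b
    using that lin_comp[OF assms(3)] lin_comp[OF assms(4)] by blast+
  have "sw2 CK (j h) F = sw2 (cop_coalg CH) h (\<lambda>a b. F (j a) (j b))"
    using assms by (intro coalg_map_sw2[OF _ _ _ _ j_coalg_map, where U=U]) simp_all
  also have "\<dots> = sw2 CH h (\<lambda>a b. F (j b) (j a))"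
    using assms by (intro sw2_cop_coalg[where U=U]) simp_all
  finally show ?thesis .
qed

text \<open>
  These are the images under \<open>s\<close> of the two identities for \<open>S\<^sup>-\<^sup>1\<close>.  The order of the factors is the one
  in which they meet when products of \<open>K\<^sup>o\<^sup>p\<close> are written in \<open>K\<close>.
\<close>

lemma s_j_cancel:
  assumes [simp]: "h \<in> car H"
  shows "sw2 CH h (\<lambda>a b. mul K (s b) (j a)) = scl K (bcou H h) (uni K)"
    "sw2 CH h (\<lambda>a b. mul K (j b) (s a)) = scl K (bcou H h) (uni K)"
proof -
  have "sw2 CH h (\<lambda>a b. mul K (s b) (j a)) = sw2 CH h (\<lambda>a b. s (mul H b (inv_ant H a)))"
    by (intro sw2_cong) (simp_all add: s_mul j_def)
  also have "\<dots> = s (sw2 CH h (\<lambda>a b. mul H b (inv_ant H a)))"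
    by (rule sw2_apply[where U=H, OF _ _ _ s_lin, symmetric]) simp_all
  finally show "sw2 CH h (\<lambda>a b. mul K (s b) (j a)) = scl K (bcou H h) (uni K)"
    by (simp add: inv_antipode[OF H] lin_scl[OF s_lin])
  have "sw2 CH h (\<lambda>a b. mul K (j b) (s a)) = sw2 CH h (\<lambda>a b. s (mul H (inv_ant H b) a))"
    by (intro sw2_cong) (simp_all add: s_mul j_def)
  also have "\<dots> = s (sw2 CH h (\<lambda>a b. mul H (inv_ant H b) a))"
    by (rule sw2_apply[where U=H, OF _ _ _ s_lin, symmetric]) simp_all
  finally show "sw2 CH h (\<lambda>a b. mul K (j b) (s a)) = scl K (bcou H h) (uni K)"
    by (simp add: inv_antipode[OF H] lin_scl[OF s_lin])
qed

end


section \<open>The mapping system is partially admissible\<close>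

context paired_hopf begin

abbreviation A where "A \<equiv> sys_A K H"
abbreviation B where "B \<equiv> sys_B H"
abbreviation CA where "CA \<equiv> tcoalg CK CH"
abbreviation T where "T \<equiv> tens K H"
abbreviation mA where "mA \<equiv> mul (talg (op_hopf K) H)"
abbreviation iota where "iota \<equiv> sys_iota K H \<sigma>"
abbreviation coact where "coact \<equiv> sys_coact K H \<sigma>"
abbreviation act where "act \<equiv> sys_act K H \<sigma>"
abbreviation proj where "proj \<equiv> sys_pi K H \<sigma>"
abbreviation zeta where "zeta \<equiv> sys_zeta K H"
abbreviation gamma where "gamma \<equiv> sys_gamma K H"

lemma same_vs_sys_A: "same_vs A T"
  by (simp add: same_vs_def sys_A_def)
lemmas sys_A_cong [simp] = same_vs_cong[OF same_vs_sys_A]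

lemma same_vs_sys_B: "same_vs B H"
  by (simp add: same_vs_def sys_B_def alg.truncate_def)
lemmas sys_B_cong [simp] = same_vs_cong[OF same_vs_sys_B]

lemma sys_simps [simp]:
  "mul A = mA" "uni A = pure K H (uni K) (uni H)" "coalg_of A = CA" "is_hopf A" "fin_dim T"
  "mul B = mul H" "uni B = uni H" "is_alg B" "sys_C K = CK"
proof -
  show "mul A = mA" "uni A = pure K H (uni K) (uni H)" "coalg_of A = CA" "is_hopf A"
    by (simp_all add: sys_A_def)
  show "fin_dim T" by (rule fin_dim_tens) simp_all
  show m: "mul B = mul H" "uni B = uni H" by (simp_all add: sys_B_def alg.truncate_def)
  show "is_alg B" by (subst is_alg_cong[of _ H]) (simp_all add: m)
  show "sys_C K = CK" by (simp add: sys_C_def)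
qed

lemma bcop_sys_A: "bcop A = cop CA" "bcou A = cou CA"
  using coalg_of_simps[of A] by simp_all

lemma cou_CA [simp]: "lin W T f \<Longrightarrow> lin W field_vs (\<lambda>x. cou CA (f x))"
  "k \<in> car K \<Longrightarrow> h \<in> car H \<Longrightarrow> cou CA (pure K H k h) = bcou K k * bcou H h"
  using lin_cou[of CA W f] cou_tcoalg_pure[of CK CH k h] by simp_all

lemma cop_CA [simp]: "lin W T f \<Longrightarrow> lin W (tens T T) (\<lambda>x. cop CA (f x))"
  "t \<in> car T \<Longrightarrow> cop CA t \<in> car (tens T T)"
  using lin_cop[of CA W f] is_coalg_simps(2)[of CA t] by simp_all

lemma mA_lin [simp]:
  "lin W T f \<Longrightarrow> t \<in> car T \<Longrightarrow> lin W T (\<lambda>x. mA (f x) t)" "lin W T f \<Longrightarrow> t \<in> car T \<Longrightarrow> lin W T (\<lambda>x. mA t (f x))"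
  using lin_mul[of A T W f t] by simp_all

lemma mA_pure [simp]:
  "k \<in> car K \<Longrightarrow> k' \<in> car K \<Longrightarrow> h \<in> car H \<Longrightarrow> h' \<in> car H \<Longrightarrow>
    mA (pure K H k h) (pure K H k' h') = pure K H (mul K k' k) (mul H h h')"
  using talg_pure[of "op_hopf K" H k k' h h'] by simp

lemma mA_uni [simp]: "t \<in> car T \<Longrightarrow> mA (pure K H (uni K) (uni H)) t = t" "t \<in> car T \<Longrightarrow> mA t (pure K H (uni K) (uni H)) = t"
  using is_alg_simps(3,4)[of A t] by simp_all

lemma iota_eq: "iota h = sw2 CH h (\<lambda>h1 h2. pure K H (j h2) h1)"
  by (simp add: sys_iota_def j_def)

lemma iota_lin [simp]: "lin W H f \<Longrightarrow> lin W T (\<lambda>x. iota (f x))" "h \<in> car H \<Longrightarrow> iota h \<in> car T"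
  by (simp_all add: iota_eq)

lemma proj_lin [simp]: "lin W T f \<Longrightarrow> lin W K (\<lambda>x. proj (f x))" "t \<in> car T \<Longrightarrow> proj t \<in> car K"
  by (simp_all add: sys_pi_def)

lemma proj_pure [simp]: "k \<in> car K \<Longrightarrow> h \<in> car H \<Longrightarrow> proj (pure K H k h) = mul K k (s h)"
  by (simp add: sys_pi_def tsum_pure[where U=K])

lemma zeta_lin [simp]: "lin W T f \<Longrightarrow> lin W H (\<lambda>x. zeta (f x))" "t \<in> car T \<Longrightarrow> zeta t \<in> car H"
  by (simp_all add: sys_zeta_def)

lemma zeta_pure [simp]: "k \<in> car K \<Longrightarrow> h \<in> car H \<Longrightarrow> zeta (pure K H k h) = scl H (bcou K k) h"
  by (simp add: sys_zeta_def tsum_pure[where U=H])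

lemma gamma_eq: "gamma k = pure K H k (uni H)"
  by (simp add: sys_gamma_def)

lemma act_lin [simp]:
  "lin W T f \<Longrightarrow> l \<in> car K \<Longrightarrow> lin W K (\<lambda>x. act l (f x))" "t \<in> car T \<Longrightarrow> lin W K g \<Longrightarrow> lin W K (\<lambda>x. act (g x) t)"
  "l \<in> car K \<Longrightarrow> t \<in> car T \<Longrightarrow> act l t \<in> car K"
  by (simp_all add: sys_act_def)

lemma act_pure [simp]: "l \<in> car K \<Longrightarrow> k \<in> car K \<Longrightarrow> h \<in> car H \<Longrightarrow> act l (pure K H k h) = mul K (mul K k l) (s h)"
  by (simp add: sys_act_def tsum_pure[where U=K])

lemma coact_eq: "coact h = sw2 CH h (\<lambda>x h3. sw2 CH x (\<lambda>h1 h2. pure T H (pure K H (j h3) h1) h2))"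
  by (simp add: sys_coact_def sw3_def j_def)

lemma coact_lin [simp]: "lin W H f \<Longrightarrow> lin W (tens T H) (\<lambda>x. coact (f x))" "h \<in> car H \<Longrightarrow> coact h \<in> car (tens T H)"
  by (simp_all add: coact_eq)

lemma tsum_coact:
  assumes U: "is_vs U" and h: "h \<in> car H"
    and F: "\<And>b. b \<in> car H \<Longrightarrow> lin T U (\<lambda>a. F a b)" "\<And>a. a \<in> car T \<Longrightarrow> lin H U (\<lambda>b. F a b)"
  shows "tsum T H (coact h) F = sw2 CH h (\<lambda>x h3. sw2 CH x (\<lambda>h1 h2. F (pure K H (j h3) h1) h2))"
proof -
  note [simp] = U h F
  have l: "lin (tens T H) U (\<lambda>t. tsum T H t F)" by (intro tsum_lin_left) simp_all
  have "tsum T H (coact h) F = sw2 CH h (\<lambda>x h3. tsum T H (sw2 CH x (\<lambda>h1 h2. pure T H (pure K H (j h3) h1) h2)) F)"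
    unfolding coact_eq by (rule sw2_apply[where U="tens T H", OF _ _ _ l]) simp_all
  also have "\<dots> = sw2 CH h (\<lambda>x h3. sw2 CH x (\<lambda>h1 h2. tsum T H (pure T H (pure K H (j h3) h1) h2) F))"
    by (intro sw2_cong sw2_apply[where U="tens T H", OF _ _ _ l]) simp_all
  also have "\<dots> = sw2 CH h (\<lambda>x h3. sw2 CH x (\<lambda>h1 h2. F (pure K H (j h3) h1) h2))"
    by (intro sw2_cong tsum_pure[where U=U]) simp_all
  finally show ?thesis .
qed

lemma iota_mul:
  assumes [simp]: "a \<in> car H" "b \<in> car H"
  shows "iota (mul H a b) = mA (iota a) (iota b)"
proof -
  have "iota (mul H a b) = sw2 CH a (\<lambda>a1 a2. sw2 CH b (\<lambda>b1 b2. pure K H (j (mul H a2 b2)) (mul H a1 b1)))"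
    unfolding iota_eq by (rule sw2_mul[where U=T]) simp_all
  also have "\<dots> = sw2 CH a (\<lambda>a1 a2. sw2 CH b (\<lambda>b1 b2. mA (pure K H (j a2) a1) (pure K H (j b2) b1)))"
    by (intro sw2_cong) (simp_all add: j_mul)
  also have "\<dots> = sw2 CH a (\<lambda>a1 a2. mA (pure K H (j a2) a1) (iota b))"
    unfolding iota_eq by (intro sw2_cong sw2_apply[where U=T and U'=T, symmetric]) simp_all
  also have "\<dots> = mA (iota a) (iota b)"
    unfolding iota_eq[of a] by (rule sw2_apply[where U=T and U'=T and \<phi>="\<lambda>t. mA t (iota b)", symmetric]) simp_all
  finally show ?thesis .
qed

lemma iota_uni [simp]: "iota (uni H) = pure K H (uni K) (uni H)"
  by (simp add: iota_eq sw2_uni[where U=T])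

lemma zeta_iota [simp]:
  assumes [simp]: "h \<in> car H" shows "zeta (iota h) = h"
proof -
  have "zeta (iota h) = sw2 CH h (\<lambda>h1 h2. zeta (pure K H (j h2) h1))"
    unfolding iota_eq by (rule sw2_apply[where U=T and U'=H]) simp_all
  also have "\<dots> = sw2 CH h (\<lambda>h1 h2. scl H (bcou H h2) h1)" by (intro sw2_cong) simp_all
  also have "\<dots> = h" using counit(2)[of CH H h "\<lambda>h. h"] by simp
  finally show ?thesis .
qed

lemma zeta_mul: "r \<in> car T \<Longrightarrow> t \<in> car T \<Longrightarrow> zeta (mA r t) = mul H (zeta r) (zeta t)"
proof -
  assume r: "r \<in> car T" and t: "t \<in> car T"
  have 1: "\<forall>r\<in>car T. zeta (mA r (pure K H k h)) = mul H (zeta r) (zeta (pure K H k h))"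
    if [simp]: "k \<in> car K" "h \<in> car H" for k h
    by (rule tens_ball_ext[where U=H]) (simp_all add: mul_scl mult.commute)
  have "\<forall>t\<in>car T. zeta (mA r t) = mul H (zeta r) (zeta t)"
    by (rule tens_ball_ext[where U=H]) (use r 1 in simp_all)
  then show ?thesis using t by blast
qed

text \<open>
  As \<open>j\<close> reverses coproducts, the coproduct of \<open>\<Sum> j(h\<^sub>(\<^sub>2\<^sub>)) \<otimes> h\<^sub>(\<^sub>1\<^sub>)\<close> is
  \<open>\<Sum> (j(h\<^sub>(\<^sub>4\<^sub>)) \<otimes> h\<^sub>(\<^sub>1\<^sub>)) \<otimes> (j(h\<^sub>(\<^sub>3\<^sub>)) \<otimes> h\<^sub>(\<^sub>2\<^sub>))\<close>, whose second leg is \<open>\<iota>\<close> of the middle part of \<open>h\<close>.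
\<close>

lemma bcop_iota:
  assumes [simp]: "h \<in> car H"
  shows "bcop A (iota h) = tsum A B (coact h) (\<lambda>a b'. pure A A a (iota b'))"
proof -
  let ?TT = "tens T T"
  let ?G = "\<lambda>u1 u2 a b. pure T T (pure K H (j b) u1) (pure K H (j a) u2)"
  have "bcop A (iota h) = sw2 CH h (\<lambda>u v. cop CA (pure K H (j v) u))"
    unfolding iota_eq bcop_sys_A by (rule sw2_apply[where U=T and U'="?TT"]) simp_all
  also have "\<dots> = sw2 CH h (\<lambda>u v. sw2 CA (pure K H (j v) u) (pure T T))"
    by (intro sw2_cong) (simp_all add: sw2_def tsum_self)
  also have "\<dots> = sw2 CH h (\<lambda>u v. sw2 CK (j v) (\<lambda>k1 k2. sw2 CH u (\<lambda>u1 u2. pure T T (pure K H k1 u1) (pure K H k2 u2))))"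
    by (intro sw2_cong sw2_thopf_pure[where U="?TT"]) simp_all
  also have "\<dots> = sw2 CH h (\<lambda>u v. sw2 CH v (\<lambda>a b. sw2 CH u (\<lambda>u1 u2. ?G u1 u2 a b)))"
    by (intro sw2_cong sw2_j[where U="?TT"]) simp_all
  also have "\<dots> = sw2 CH h (\<lambda>u v. sw2 CH u (\<lambda>u1 u2. sw2 CH v (\<lambda>a b. ?G u1 u2 a b)))"
    by (intro sw2_cong sw2_swap) simp_all
  also have "\<dots> = sw2 CH h (\<lambda>u1 w. sw2 CH w (\<lambda>u2 v. sw2 CH v (\<lambda>a b. ?G u1 u2 a b)))"
    by (rule coassoc[where U="?TT"]) simp_all
  also have "\<dots> = sw2 CH h (\<lambda>u1 w. sw2 CH w (\<lambda>x b. sw2 CH x (\<lambda>u2 a. ?G u1 u2 a b)))"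
    by (intro sw2_cong coassoc[where U="?TT", symmetric]) simp_all
  also have "\<dots> = sw2 CH h (\<lambda>y b. sw2 CH y (\<lambda>u1 x. sw2 CH x (\<lambda>u2 a. ?G u1 u2 a b)))"
    by (rule coassoc[where U="?TT", symmetric]) simp_all
  also have "\<dots> = sw2 CH h (\<lambda>y b. sw2 CH y (\<lambda>u1 x. pure T T (pure K H (j b) u1) (iota x)))"
    unfolding iota_eq by (intro sw2_cong sw2_apply[where U=T and U'="?TT", symmetric]) simp_all
  also have "\<dots> = tsum T H (coact h) (\<lambda>a b'. pure T T a (iota b'))"
    by (rule tsum_coact[where U="?TT", symmetric]) simp_all
  finally show ?thesis by simp
qed

lemma comodule_algebra: "left_comodule_algebra A B coact" "comodule_algebra_injection A B coact iota"
  by (rule coideal_subalgebra[where \<iota>=iota and \<zeta>=zeta and A=A and B=B and \<delta>=coact];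
      (simp add: iota_mul bcop_iota del: tens_ball_ext)?)+

lemma proj_coalg_map: "coalg_map CA CK proj"
  unfolding coalg_map_def
proof (intro conjI)
  show "lin CA CK proj" using proj_lin(1)[OF lin_ident] by simp
  have 1: "\<forall>t\<in>car T. bcop K (proj t) = sw2 CA t (\<lambda>a b. pure K K (proj a) (proj b))"
  proof (rule tens_ball_ext[where U="tens K K"])
    fix k h assume [simp]: "k \<in> car K" "h \<in> car H"
    have "bcop K (proj (pure K H k h)) = sw2 CK (mul K k (s h)) (pure K K)" by (simp add: sw2_pure)
    also have "\<dots> = sw2 CK k (\<lambda>k1 k2. sw2 CK (s h) (\<lambda>a b. pure K K (mul K k1 a) (mul K k2 b)))"
      by (rule sw2_mul[where U="tens K K"]) simp_all
    also have "\<dots> = sw2 CK k (\<lambda>k1 k2. sw2 CH h (\<lambda>a b. pure K K (mul K k1 (s a)) (mul K k2 (s b))))"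
      by (intro sw2_cong coalg_map_sw2[OF _ _ _ _ s_coalg_map, where U="tens K K"]) simp_all
    also have "\<dots> = sw2 CK k (\<lambda>k1 k2. sw2 CH h (\<lambda>a b. pure K K (proj (pure K H k1 a)) (proj (pure K H k2 b))))"
      by (intro sw2_cong) simp_all
    also have "\<dots> = sw2 CA (pure K H k h) (\<lambda>a b. pure K K (proj a) (proj b))"
      by (rule sw2_thopf_pure[where U="tens K K", symmetric]) simp_all
    finally show "bcop K (proj (pure K H k h)) = sw2 CA (pure K H k h) (\<lambda>a b. pure K K (proj a) (proj b))" .
  qed simp_all
  have 2: "\<forall>t\<in>car T. bcou K (proj t) = cou CA t"
    by (rule tens_ball_ext[where U=field_vs]) simp_all
  show "\<forall>c\<in>car CA. cop CK (proj c) = sw2 CA c (\<lambda>a b. pure CK CK (proj a) (proj b)) \<and> cou CK (proj c) = cou CA c"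
    using 1 2 by simp
qed

lemma proj_mul: "a \<in> car T \<Longrightarrow> b \<in> car T \<Longrightarrow> proj (mA a b) = act (proj a) b"
proof -
  assume a: "a \<in> car T" and b: "b \<in> car T"
  have 1: "\<forall>a\<in>car T. proj (mA a (pure K H k h)) = act (proj a) (pure K H k h)"
    if [simp]: "k \<in> car K" "h \<in> car H" for k h
    by (rule tens_ball_ext[where U=K]) (simp_all add: mul_assoc s_mul)
  have "\<forall>b\<in>car T. proj (mA a b) = act (proj a) b"
    by (rule tens_ball_ext[where U=K]) (use a 1 in simp_all)
  then show ?thesis using b by blast
qed

lemma module_coalgebra: "right_module_coalgebra A CK act" "module_coalgebra_surjection A CK act proj"
proof -
  have "k \<in> proj ` car T" if "k \<in> car K" for k
    using that by (intro image_eqI[of _ _ "pure K H k (uni H)"]) simp_all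
  then have surj: "proj ` car A = car CK" using proj_lin(2) by auto
  have c: "coalg_map (coalg_of A) CK proj" using proj_coalg_map by simp
  show "right_module_coalgebra A CK act" "module_coalgebra_surjection A CK act proj"
    by (rule quotient_module_coalgebra[OF _ _ c surj]; simp add: proj_mul)+
qed

lemma proj_iota [simp]:
  assumes [simp]: "h \<in> car H" shows "proj (iota h) = scl K (bcou H h) (uni K)"
proof -
  have "proj (iota h) = sw2 CH h (\<lambda>h1 h2. proj (pure K H (j h2) h1))"
    unfolding iota_eq by (rule sw2_apply[where U=T and U'=K]) simp_all
  also have "\<dots> = sw2 CH h (\<lambda>a b. mul K (j b) (s a))" by (intro sw2_cong) simp_all
  finally show ?thesis by (simp add: s_j_cancel)
qed

lemma cou_iota [simp]: "h \<in> car H \<Longrightarrow> cou CA (iota h) = bcou H h"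
  using coalg_mapD(3)[OF proj_coalg_map, of "iota h"] lin_scl[of K field_vs "bcou K" "uni K"] by simp

text \<open>
  On \<open>k \<otimes> h\<close> the convolution product is \<open>\<Sum> k s(h\<^sub>(\<^sub>3\<^sub>)) j(h\<^sub>(\<^sub>2\<^sub>)) \<otimes> h\<^sub>(\<^sub>1\<^sub>)\<close>, where the inner factors
  cancel.
\<close>

lemma iota_zeta_gamma_proj:
  assumes t: "t \<in> car T"
  shows "sw2 CA t (\<lambda>a b. mA (iota (zeta a)) (gamma (proj b))) = t"
proof -
  note [simp] = gamma_eq
  have l: "lin H T iota" using iota_lin(1)[OF lin_ident] .
  have "\<forall>t\<in>car T. sw2 CA t (\<lambda>a b. mA (iota (zeta a)) (gamma (proj b))) = t"
  proof (rule tens_ball_ext[where U=T])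
    fix k h assume [simp]: "k \<in> car K" "h \<in> car H"
    have "sw2 CA (pure K H k h) (\<lambda>a b. mA (iota (zeta a)) (gamma (proj b))) =
        sw2 CK k (\<lambda>k1 k2. sw2 CH h (\<lambda>h1 h2. mA (iota (zeta (pure K H k1 h1))) (gamma (proj (pure K H k2 h2)))))"
      by (rule sw2_thopf_pure[where U=T]) simp_all
    also have "\<dots> = sw2 CK k (\<lambda>k1 k2. sw2 CH h (\<lambda>h1 h2. scl T (bcou K k1) (mA (iota h1) (gamma (mul K k2 (s h2))))))"
      by (intro sw2_cong) (simp_all add: lin_scl[OF l] lin_scl[OF mA_lin(1)[OF lin_ident]])
    also have "\<dots> = sw2 CK k (\<lambda>k1 k2. scl T (bcou K k1) (sw2 CH h (\<lambda>h1 h2. mA (iota h1) (gamma (mul K k2 (s h2))))))"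
      by (intro sw2_cong sw2_apply[where U=T and U'=T, symmetric]) simp_all
    also have "\<dots> = sw2 CH h (\<lambda>h1 h2. mA (iota h1) (gamma (mul K k (s h2))))"
      using counit(1)[of CK T k "\<lambda>k. sw2 CH h (\<lambda>h1 h2. mA (iota h1) (gamma (mul K k (s h2))))"] by simp
    also have "\<dots> = sw2 CH h (\<lambda>h1 h2. sw2 CH h1 (\<lambda>u v. mA (pure K H (j v) u) (gamma (mul K k (s h2)))))"
      unfolding iota_eq by (intro sw2_cong sw2_apply[where U=T and U'=T and \<phi>="\<lambda>t. mA t (gamma _)"]) simp_all
    also have "\<dots> = sw2 CH h (\<lambda>h1 h2. sw2 CH h1 (\<lambda>u v. pure K H (mul K k (mul K (s h2) (j v))) u))"
      by (intro sw2_cong) (simp_all add: mul_assoc)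
    also have "\<dots> = sw2 CH h (\<lambda>u w. sw2 CH w (\<lambda>v h2. pure K H (mul K k (mul K (s h2) (j v))) u))"
      by (rule coassoc[where U=T]) simp_all
    also have "\<dots> = sw2 CH h (\<lambda>u w. pure K H (mul K k (sw2 CH w (\<lambda>v h2. mul K (s h2) (j v)))) u)"
      by (intro sw2_cong sw2_apply[where U=K and U'=T and \<phi>="\<lambda>z. pure K H (mul K k z) _", symmetric]) simp_all
    also have "\<dots> = sw2 CH h (\<lambda>u w. scl T (bcou H w) (pure K H k u))"
      by (intro sw2_cong) (simp_all add: s_j_cancel mul_scl pure_scl)
    also have "\<dots> = pure K H k h" by (rule counit(2)[where C=CH and U=T, simplified]) simp_all
    finally show "sw2 CA (pure K H k h) (\<lambda>a b. mA (iota (zeta a)) (gamma (proj b))) = pure K H k h" .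
  qed simp_all
  then show ?thesis using t by blast
qed

text \<open>
  Elements of \<open>\<iota>(H)\<close> are coinvariant because their coproduct has its second leg in \<open>\<iota>(H)\<close>, where \<open>\<pi>\<close> is
  the counit.  Conversely, the map \<open>x \<otimes> c \<mapsto> \<iota>(\<zeta>(x)) \<gamma>(c)\<close> sends \<open>\<Sum> a\<^sub>(\<^sub>1\<^sub>) \<otimes> \<pi>(a\<^sub>(\<^sub>2\<^sub>))\<close> to \<open>a\<close> and \<open>a \<otimes> 1\<close> to
  \<open>\<iota>(\<zeta>(a))\<close>.
\<close>

lemma coinvariants: "iota ` car H = right_coinvariants A CK proj"
proof
  let ?TK = "tens T K"
  show "iota ` car H \<subseteq> right_coinvariants A CK proj"
  proof
    fix t assume "t \<in> iota ` car H"
    then obtain h where [simp]: "h \<in> car H" and t: "t = iota h" by blast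
    have c: "tsum T H (coact h) (\<lambda>a b'. F a (iota b')) = sw2 CA (iota h) F"
      if "\<And>y. y \<in> car T \<Longrightarrow> lin T ?TK (\<lambda>x. F x y)" "\<And>x. x \<in> car T \<Longrightarrow> lin T ?TK (\<lambda>y. F x y)" for F
      using coaction_sw2[of A B iota coact ?TK h F] that by (simp add: bcop_iota)
    have "sw2 CA (iota h) (\<lambda>a b. pure T K a (proj b)) = tsum T H (coact h) (\<lambda>a b'. pure T K a (proj (iota b')))"
      by (rule c[symmetric]) simp_all
    also have "\<dots> = tsum T H (coact h) (\<lambda>a b'. scl ?TK (cou CA (iota b')) (pure T K a (uni K)))"
      by (intro tsum_cong) (simp_all add: pure_scl)
    also have "\<dots> = sw2 CA (iota h) (\<lambda>a b. scl ?TK (cou CA b) (pure T K a (uni K)))"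
      by (rule c) simp_all
    also have "\<dots> = pure T K (iota h) (uni K)"
      using counit(2)[of CA ?TK "iota h" "\<lambda>a. pure T K a (uni K)"] by simp
    finally show "t \<in> right_coinvariants A CK proj" unfolding right_coinvariants_def t by simp
  qed
  show "right_coinvariants A CK proj \<subseteq> iota ` car H"
  proof
    fix t assume "t \<in> right_coinvariants A CK proj"
    then have t [simp]: "t \<in> car T" and eq: "sw2 CA t (\<lambda>a b. pure T K a (proj b)) = pure T K t (uni K)"
      unfolding right_coinvariants_def by simp_all
    define G where "G = (\<lambda>z. tsum T K z (\<lambda>x c. mA (iota (zeta x)) (gamma c)))"
    have G: "lin ?TK T G" unfolding G_def by (intro tsum_lin_left) (simp_all add: gamma_eq)
    have Gp: "G (pure T K x c) = mA (iota (zeta x)) (gamma c)" if "x \<in> car T" "c \<in> car K" for x c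
      using that by (simp add: G_def tsum_pure[where U=T] gamma_eq)
    have "G (sw2 CA t (\<lambda>a b. pure T K a (proj b))) = sw2 CA t (\<lambda>a b. G (pure T K a (proj b)))"
      by (rule sw2_apply[where U="?TK", OF _ _ _ G]) simp_all
    also have "\<dots> = sw2 CA t (\<lambda>a b. mA (iota (zeta a)) (gamma (proj b)))"
      by (intro sw2_cong) (simp_all add: Gp)
    also have "\<dots> = t" by (rule iota_zeta_gamma_proj) simp
    finally have "t = iota (zeta t)" by (simp add: eq Gp) (simp add: gamma_eq)
    then show "t \<in> iota ` car H" by (rule image_eqI) simp
  qed
qed

theorem system_partially_admissible:
  "partially_admissible A B coact (sys_C K) act iota proj zeta gamma"
proof -
  have "lin K T (\<lambda>k. gamma k)" unfolding gamma_eq by simp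
  then have gl [simp]: "lin K T gamma" by simp
  have cz: "conv_invertible (coalg_of A) B zeta"
    by (rule alg_map_conv_invertible) (simp_all add: zeta_mul)
  have cg: "conv_invertible (coalg_of (op_hopf K)) A gamma"
    by (rule alg_map_conv_invertible) (simp_all add: gamma_eq)
  have zi: "zeta (mA (iota b) a) = mul H b (zeta a)" if "b \<in> car H" "a \<in> car T" for a b
    using that by (simp add: zeta_mul)
  have gc: "sw2 CA (gamma x) (\<lambda>a1 a2. pure T K a1 (proj a2)) = sw2 CK x (\<lambda>x1 x2. pure T K (gamma x1) x2)"
    if [simp]: "x \<in> car K" for x
  proof -
    have "sw2 CA (gamma x) (\<lambda>a1 a2. pure T K a1 (proj a2)) =
      sw2 CK x (\<lambda>k1 k2. sw2 CH (uni H) (\<lambda>h1 h2. pure T K (pure K H k1 h1) (proj (pure K H k2 h2))))"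
      unfolding gamma_eq by (rule sw2_thopf_pure[where U="tens T K"]) simp_all
    also have "\<dots> = sw2 CK x (\<lambda>k1 k2. pure T K (pure K H k1 (uni H)) (proj (pure K H k2 (uni H))))"
      by (intro sw2_cong sw2_uni[where U="tens T K"]) simp_all
    also have "\<dots> = sw2 CK x (\<lambda>x1 x2. pure T K (gamma x1) x2)"
      by (intro sw2_cong) (simp_all add: gamma_eq)
    finally show ?thesis .
  qed
  have ez: "\<forall>a\<in>car T. bcou H (zeta a) = cou CA a"
    by (rule tens_ball_ext[where U=field_vs]) (simp_all add: lin_scl[of H field_vs "bcou H"])
  show ?thesis
    unfolding partially_admissible_def
    using comodule_algebra module_coalgebra coinvariants cz cg zi gc ez iota_zeta_gamma_proj
    by (simp add: bcop_sys_A conv_def) (simp add: gamma_eq)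
qed

end


section \<open>Generalised smash products\<close>

text \<open>
  The trilinear form of the coassociativity axiom of a comodule, obtained like \<open>coassoc\<close> by applying the
  linear map that \<open>F\<close> induces on \<open>A \<otimes> (A \<otimes> B)\<close>.
\<close>

lemma comodule_coassoc:
  assumes A: "is_bialg A" and cm: "left_comodule_algebra A B \<delta>" and U: "is_vs U" and b: "b \<in> car B"
    and F: "\<And>y z. y \<in> car A \<Longrightarrow> z \<in> car B \<Longrightarrow> lin A U (\<lambda>x. F x y z)"
      "\<And>x z. x \<in> car A \<Longrightarrow> z \<in> car B \<Longrightarrow> lin A U (\<lambda>y. F x y z)"
      "\<And>x y. x \<in> car A \<Longrightarrow> y \<in> car A \<Longrightarrow> lin B U (\<lambda>z. F x y z)"
  shows "tsum A B (\<delta> b) (\<lambda>a b'. tsum A B (\<delta> b') (\<lambda>a' b''. F a a' b'')) =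
    tsum A B (\<delta> b) (\<lambda>a b'. sw2 (coalg_of A) a (\<lambda>a1 a2. F a1 a2 b'))"
proof -
  have B: "is_alg B" and \<delta>: "lin B (tens A B) \<delta>" and
    eq: "tsum A B (\<delta> b) (\<lambda>a b'. tsum A B (\<delta> b') (\<lambda>a' b''. pure A (tens A B) a (pure A B a' b''))) =
        tsum A B (\<delta> b) (\<lambda>a b'. sw2 (coalg_of A) a (\<lambda>a1 a2. pure A (tens A B) a1 (pure A B a2 b')))"
    using cm b unfolding left_comodule_algebra_def by blast+
  let ?T = "tens A (tens A B)"
  note [simp] = A B U b F lin_closed[OF \<delta>] lin_comp[OF \<delta>]
  define \<Phi> where "\<Phi> = (\<lambda>t. tsum A (tens A B) t (\<lambda>a s. tsum A B s (\<lambda>a' b''. F a a' b'')))"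
  have \<Phi>: "lin ?T U \<Phi>" unfolding \<Phi>_def by (intro tsum_lin_left) simp_all
  have p: "\<Phi> (pure A (tens A B) x (pure A B y z)) = F x y z" if [simp]: "x \<in> car A" "y \<in> car A" "z \<in> car B" for x y z
    by (simp add: \<Phi>_def tsum_pure[where U=U])
  have "\<Phi> (tsum A B (\<delta> b) (\<lambda>a b'. tsum A B (\<delta> b') (\<lambda>a' b''. pure A (tens A B) a (pure A B a' b'')))) =
     tsum A B (\<delta> b) (\<lambda>a b'. \<Phi> (tsum A B (\<delta> b') (\<lambda>a' b''. pure A (tens A B) a (pure A B a' b''))))"
    by (rule tsum_lin_apply[where U="?T", OF _ _ _ \<Phi>]) simp_all
  also have "\<dots> = tsum A B (\<delta> b) (\<lambda>a b'. tsum A B (\<delta> b') (\<lambda>a' b''. \<Phi> (pure A (tens A B) a (pure A B a' b''))))"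
    by (intro tsum_cong tsum_lin_apply[where U="?T", OF _ _ _ \<Phi>]) simp_all
  also have "\<dots> = tsum A B (\<delta> b) (\<lambda>a b'. tsum A B (\<delta> b') (\<lambda>a' b''. F a a' b''))"
    by (intro tsum_cong) (simp_all add: p)
  finally have 1: "\<Phi> (tsum A B (\<delta> b) (\<lambda>a b'. tsum A B (\<delta> b') (\<lambda>a' b''. pure A (tens A B) a (pure A B a' b'')))) = \<dots>" .
  have "\<Phi> (tsum A B (\<delta> b) (\<lambda>a b'. sw2 (coalg_of A) a (\<lambda>a1 a2. pure A (tens A B) a1 (pure A B a2 b')))) =
     tsum A B (\<delta> b) (\<lambda>a b'. \<Phi> (sw2 (coalg_of A) a (\<lambda>a1 a2. pure A (tens A B) a1 (pure A B a2 b'))))"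
    by (rule tsum_lin_apply[where U="?T", OF _ _ _ \<Phi>]) simp_all
  also have "\<dots> = tsum A B (\<delta> b) (\<lambda>a b'. sw2 (coalg_of A) a (\<lambda>a1 a2. \<Phi> (pure A (tens A B) a1 (pure A B a2 b'))))"
    by (intro tsum_cong sw2_apply[where U="?T", OF _ _ _ \<Phi>]) simp_all
  also have "\<dots> = tsum A B (\<delta> b) (\<lambda>a b'. sw2 (coalg_of A) a (\<lambda>a1 a2. F a1 a2 b'))"
    by (intro tsum_cong sw2_cong) (simp_all add: p)
  finally show ?thesis using 1 eq by simp
qed

lemma tsum_talg_mul:
  assumes A: "is_alg A" and B: "is_alg B" and U: "is_vs U" and st: "s \<in> car (tens A B)" "t \<in> car (tens A B)"
    and F: "\<And>y. y \<in> car B \<Longrightarrow> lin A U (\<lambda>x. F x y)" "\<And>x. x \<in> car A \<Longrightarrow> lin B U (\<lambda>y. F x y)"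
  shows "tsum A B (mul (talg A B) s t) F = tsum A B s (\<lambda>a b. tsum A B t (\<lambda>a' b'. F (mul A a a') (mul B b b')))"
proof -
  let ?T = "tens A B"
  note [simp] = A B U st F
  have l: "lin ?T U (\<lambda>t. tsum A B t F)" by (intro tsum_lin_left) simp_all
  have "tsum A B (mul (talg A B) s t) F = tsum A B s (\<lambda>a b. tsum A B (tsum A B t (\<lambda>a' b'. pure A B (mul A a a') (mul B b b'))) F)"
    unfolding talg_def alg.simps vs.simps by (rule tsum_lin_apply[where U="?T", OF _ _ _ l]) simp_all
  also have "\<dots> = tsum A B s (\<lambda>a b. tsum A B t (\<lambda>a' b'. tsum A B (pure A B (mul A a a') (mul B b b')) F))"
    by (intro tsum_cong tsum_lin_apply[where U="?T", OF _ _ _ l]) simp_all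
  also have "\<dots> = tsum A B s (\<lambda>a b. tsum A B t (\<lambda>a' b'. F (mul A a a') (mul B b b')))"
    by (intro tsum_cong tsum_pure[where U=U]) simp_all
  finally show ?thesis .
qed

text \<open>
  The product of \<open>C\<^sup>* # B\<close> is associative for every comodule algebra \<open>B\<close> and module coalgebra \<open>C\<close>.
  Finite dimension of \<open>C\<close> makes the dual coaction on \<open>C\<^sup>*\<close> exist.
\<close>

locale smash_product =
  fixes A :: "('f::field, 'a::ab_group_add) hopf" and B :: "('f, 'b::ab_group_add) alg"
    and \<delta> :: "'b \<Rightarrow> ('f, 'a, 'b) tensor" and C :: "('f, 'c::ab_group_add) coalg" and act :: "'c \<Rightarrow> 'a \<Rightarrow> 'c"
  assumes A: "is_hopf A" and comod: "left_comodule_algebra A B \<delta>"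
    and module: "right_module_coalgebra A C act" and fd: "fin_dim C"
begin

abbreviation hr where "hr \<equiv> harpoon_r A C act"
abbreviation V where "V \<equiv> dual_vs C"
abbreviation mV where "mV \<equiv> mul (dual_alg C)"
abbreviation CA where "CA \<equiv> coalg_of A"
abbreviation D where "D \<equiv> pd_alg A B \<delta> C act"

lemma comod_simps [simp]:
  "is_alg B" "lin W B f \<Longrightarrow> lin W (tens A B) (\<lambda>x. \<delta> (f x))" "b \<in> car B \<Longrightarrow> \<delta> b \<in> car (tens A B)"
  "\<delta> (uni B) = pure A B (uni A) (uni B)"
  and comod_mul: "b \<in> car B \<Longrightarrow> c \<in> car B \<Longrightarrow> \<delta> (mul B b c) = mul (talg A B) (\<delta> b) (\<delta> c)"
  and comod_counit: "b \<in> car B \<Longrightarrow> tsum A B (\<delta> b) (\<lambda>a b'. scl B (bcou A a) b') = b"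
proof -
  have l: "lin B (tens A B) \<delta>" using comod unfolding left_comodule_algebra_def by blast
  show "lin W B f \<Longrightarrow> lin W (tens A B) (\<lambda>x. \<delta> (f x))" by (rule lin_comp[OF l])
  show "b \<in> car B \<Longrightarrow> \<delta> b \<in> car (tens A B)" by (rule lin_closed[OF l])
qed (use comod in \<open>unfold left_comodule_algebra_def, auto\<close>)

lemma act_simps [simp]:
  "is_coalg C" "lin W C f \<Longrightarrow> a \<in> car A \<Longrightarrow> lin W C (\<lambda>x. act (f x) a)" "lin W A g \<Longrightarrow> x \<in> car C \<Longrightarrow> lin W C (\<lambda>z. act x (g z))"
  "x \<in> car C \<Longrightarrow> a \<in> car A \<Longrightarrow> act x a \<in> car C" "x \<in> car C \<Longrightarrow> act x (uni A) = x"
  "x \<in> car C \<Longrightarrow> a \<in> car A \<Longrightarrow> cou C (act x a) = cou C x * bcou A a"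
  and act_mul: "x \<in> car C \<Longrightarrow> a \<in> car A \<Longrightarrow> b \<in> car A \<Longrightarrow> act x (mul A a b) = act (act x a) b"
  and act_cop: "x \<in> car C \<Longrightarrow> a \<in> car A \<Longrightarrow> cop C (act x a) = sw2 C x (\<lambda>x1 x2. sw2 CA a (\<lambda>a1 a2.
          pure C C (act x1 a1) (act x2 a2)))"
proof -
  have b: "bilin C A C act" using module unfolding right_module_coalgebra_def by blast
  show "lin W C f \<Longrightarrow> a \<in> car A \<Longrightarrow> lin W C (\<lambda>x. act (f x) a)" by (rule lin_bilin1[OF b])
  show "lin W A g \<Longrightarrow> x \<in> car C \<Longrightarrow> lin W C (\<lambda>z. act x (g z))" by (rule lin_bilin2[OF b])
  show "x \<in> car C \<Longrightarrow> a \<in> car A \<Longrightarrow> act x a \<in> car C" by (rule bilin_closed[OF b])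
qed (use module in \<open>unfold right_module_coalgebra_def, auto\<close>)

lemmas [simp] = A

lemma coaction_form:
  assumes f: "f \<in> car V"
  shows "dual_coaction A C act f \<in> car (tens V (dual_vs A))"
    "x \<in> car C \<Longrightarrow> a \<in> car A \<Longrightarrow> tsum V (dual_vs A) (dual_coaction A C act f) (\<lambda>g p. g x * p a) = f (act x a)"
proof -
  have vs: "is_vs C" "is_vs A" by simp_all
  obtain X where X: "finite X" "is_basis C X" using fin_basis[OF vs(1) fd] by blast
  have b: "bilin C A field_vs (\<lambda>x a. f (act x a))"
    by (intro bilinI dual_lin_comp[OF f]) simp_all
  note t = form_tensor[OF vs X(2,1) b]
  show "dual_coaction A C act f \<in> car (tens V (dual_vs A))" unfolding dual_coaction_def t(3) by (rule t(1))
  show "x \<in> car C \<Longrightarrow> a \<in> car A \<Longrightarrow> tsum V (dual_vs A) (dual_coaction A C act f) (\<lambda>g p. g x * p a) = f (act x a)"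
    unfolding dual_coaction_def t(3) by (rule t(2)[symmetric])
qed

text \<open>
  The harpoon action is defined through the dual coaction, a definite description; contracting that
  tensor with \<open>a\<close> leaves the transpose of the action of \<open>a\<close> on \<open>C\<close>.
\<close>

lemma hr_eq:
  assumes [simp]: "f \<in> car V" "a \<in> car A"
  shows "hr a f = dual_map C (\<lambda>x. f (act x a))"
proof (rule dual_ext[of _ C])
  have c [simp]: "dual_coaction A C act f \<in> car (tens V (dual_vs A))" by (rule coaction_form) simp
  show "hr a f \<in> car V" unfolding harpoon_r_def by simp
  show "dual_map C (\<lambda>x. f (act x a)) \<in> car V"
    by (intro dual_map_closed dual_lin_comp[of f C]) simp_all
  fix x assume [simp]: "x \<in> car C"
  have "hr a f x = tsum V (dual_vs A) (dual_coaction A C act f) (\<lambda>g p. scl V (p a) g x)"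
    unfolding harpoon_r_def by (rule tsum_lin_apply[where U=V and U'=field_vs and \<phi>="\<lambda>f. f x"]) simp_all
  also have "\<dots> = f (act x a)" by (simp add: scl_dual_vs mult.commute coaction_form(2)[symmetric])
  finally show "hr a f x = dual_map C (\<lambda>x. f (act x a)) x" by simp
qed

lemma hr_apply: "f \<in> car V \<Longrightarrow> a \<in> car A \<Longrightarrow> x \<in> car C \<Longrightarrow> hr a f x = f (act x a)"
  by (simp add: hr_eq)

lemma hr_closed [simp]: "f \<in> car V \<Longrightarrow> a \<in> car A \<Longrightarrow> hr a f \<in> car V"
  unfolding harpoon_r_def using coaction_form(1) by simp

lemma hr_bilin: "bilin A V V hr"
proof (rule bilinI)
  fix f assume [simp]: "f \<in> car V"
  show "lin A V (\<lambda>a. hr a f)"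
    unfolding harpoon_r_def by (simp add: coaction_form(1) dual_lin[of _ A])
next
  fix a assume [simp]: "a \<in> car A"
  show "lin V V (\<lambda>f. hr a f)"
    unfolding lin_def[of V V]
  proof (intro conjI ballI allI)
    fix f c assume [simp]: "f \<in> car V"
    show "hr a f \<in> car V" by simp
    show "hr a (scl V c f) = scl V c (hr a f)"
      by (rule dual_ext[of _ C]) (simp_all add: hr_apply scl_dual_vs)
    fix g assume [simp]: "g \<in> car V"
    show "hr a (f + g) = hr a f + hr a g"
      by (rule dual_ext[of _ C]) (simp_all add: hr_apply)
  qed
qed

lemmas hr_lin [simp] = lin_bilin1[OF hr_bilin] lin_bilin2[OF hr_bilin]

lemma hr_mul: "f \<in> car V \<Longrightarrow> a \<in> car A \<Longrightarrow> b \<in> car A \<Longrightarrow> hr (mul A a b) f = hr a (hr b f)"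
  by (rule dual_ext[of _ C]) (simp_all add: hr_apply act_mul)

lemma hr_one [simp]: "f \<in> car V \<Longrightarrow> hr (uni A) f = f"
  by (rule dual_ext[of _ C]) (simp_all add: hr_apply)

lemma uni_closed [simp]: "uni (dual_alg C) \<in> car V"
  using is_alg_simps(2)[of "dual_alg C"] by simp

lemma hr_uni: "a \<in> car A \<Longrightarrow> hr a (uni (dual_alg C)) = scl V (bcou A a) (uni (dual_alg C))"
  by (rule dual_ext[of _ C]) (simp_all add: hr_apply scl_dual_vs dual_alg_apply mult.commute)

text \<open>
  That \<open>C\<close> is a module coalgebra means, dually, that \<open>C\<^sup>*\<close> is a module algebra.
\<close>

lemma hr_mV:
  assumes [simp]: "f \<in> car V" "g \<in> car V" "a \<in> car A"
  shows "hr a (mV f g) = sw2 CA a (\<lambda>a1 a2. mV (hr a1 f) (hr a2 g))"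
proof (rule dual_ext[of _ C])
  fix x assume [simp]: "x \<in> car C"
  have [simp]: "lin C field_vs f" "lin C field_vs g" by (rule dual_lin; simp)+
  have l: "lin (tens C C) field_vs (\<lambda>t. tsum C C t (\<lambda>u v. f u * g v))" by (intro tsum_lin_left) simp_all
  have fl: "lin W field_vs (\<lambda>x. f (h x))" "lin W field_vs (\<lambda>x. g (h x))" if "lin W C h" for W :: "('f, 'z::ab_group_add, 'y) vs_scheme" and h
    using that by (rule dual_lin_comp[rotated]; simp)+
  note [simp] = fl
  have "hr a (mV f g) x = tsum C C (sw2 C x (\<lambda>x1 x2. sw2 CA a (\<lambda>a1 a2. pure C C (act x1 a1) (act x2 a2)))) (\<lambda>u v. f u * g v)"
    by (simp add: hr_apply dual_alg_apply sw2_def[of C "act x a"] act_cop)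
  also have "\<dots> = sw2 C x (\<lambda>x1 x2. tsum C C (sw2 CA a (\<lambda>a1 a2. pure C C (act x1 a1) (act x2 a2))) (\<lambda>u v. f u * g v))"
    by (rule sw2_apply[where U="tens C C", OF _ _ _ l]) simp_all
  also have "\<dots> = sw2 C x (\<lambda>x1 x2. sw2 CA a (\<lambda>a1 a2. tsum C C (pure C C (act x1 a1) (act x2 a2)) (\<lambda>u v. f u * g v)))"
    by (intro sw2_cong sw2_apply[where U="tens C C", OF _ _ _ l]) simp_all
  also have "\<dots> = sw2 C x (\<lambda>x1 x2. sw2 CA a (\<lambda>a1 a2. hr a1 f x1 * hr a2 g x2))"
    by (intro sw2_cong) (simp_all add: tsum_pure[where U=field_vs] hr_apply)
  also have "\<dots> = sw2 CA a (\<lambda>a1 a2. sw2 C x (\<lambda>x1 x2. hr a1 f x1 * hr a2 g x2))"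
    by (rule sw2_swap)
  also have "\<dots> = sw2 CA a (\<lambda>a1 a2. mV (hr a1 f) (hr a2 g) x)"
    by (simp add: dual_alg_apply)
  also have "\<dots> = sw2 CA a (\<lambda>a1 a2. mV (hr a1 f) (hr a2 g)) x"
    by (rule sw2_apply[where U=V and U'=field_vs and \<phi>="\<lambda>f. f x", symmetric]) simp_all
  finally show "hr a (mV f g) x = sw2 CA a (\<lambda>a1 a2. mV (hr a1 f) (hr a2 g)) x" .
qed simp_all

lemma same_vs_D: "same_vs D (tens V B)"
  by (simp add: same_vs_def pd_alg_def Let_def)
lemmas D_cong [simp] = same_vs_cong[OF same_vs_D]

lemma uni_D [simp]: "uni D = pure V B (uni (dual_alg C)) (uni B)"
  by (simp add: pd_alg_def Let_def)

lemma mul_D: "mul D t u = tsum V B t (\<lambda>f b. tsum V B u (\<lambda>g c.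
        tsum A B (\<delta> b) (\<lambda>b1 b2. pure V B (mV f (hr b1 g)) (mul B b2 c))))"
  by (simp add: pd_alg_def Let_def)

lemma mul_D_lin [simp]:
  "lin W (tens V B) f \<Longrightarrow> t \<in> car (tens V B) \<Longrightarrow> lin W (tens V B) (\<lambda>x. mul D (f x) t)"
  "lin W (tens V B) f \<Longrightarrow> t \<in> car (tens V B) \<Longrightarrow> lin W (tens V B) (\<lambda>x. mul D t (f x))"
  "t \<in> car (tens V B) \<Longrightarrow> u \<in> car (tens V B) \<Longrightarrow> mul D t u \<in> car (tens V B)"
  by (simp_all add: mul_D)

lemma mul_D_pure:
  "f \<in> car V \<Longrightarrow> g \<in> car V \<Longrightarrow> b \<in> car B \<Longrightarrow> c \<in> car B \<Longrightarrow>
    mul D (pure V B f b) (pure V B g c) = tsum A B (\<delta> b) (\<lambda>b1 b2. pure V B (mV f (hr b1 g)) (mul B b2 c))"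
  by (simp add: mul_D tsum_pure[where U="tens V B"])

lemma mul_D_left:
  assumes [simp]: "f \<in> car V" "g \<in> car V" "c \<in> car B"
  shows "mul D (pure V B f (uni B)) (pure V B g c) = pure V B (mV f g) c"
  by (simp add: mul_D_pure tsum_pure[where U="tens V B"])

lemma mul_D_right:
  assumes [simp]: "f \<in> car V" "b \<in> car B" "c \<in> car B"
  shows "mul D (pure V B f b) (pure V B (uni (dual_alg C)) c) = pure V B f (mul B b c)"
proof -
  have 1: "mV f (uni (dual_alg C)) = f" using is_alg_simps(4)[of "dual_alg C" f] by simp
  have l: "lin B (tens V B) (\<lambda>b'. pure V B f (mul B b' c))" by simp
  have "mul D (pure V B f b) (pure V B (uni (dual_alg C)) c) =
      tsum A B (\<delta> b) (\<lambda>b1 b2. pure V B f (mul B (scl B (bcou A b1) b2) c))"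
    unfolding mul_D_pure[OF assms(1) uni_closed assms(2,3)]
  proof (intro tsum_cong)
    fix b1 b2 assume [simp]: "b1 \<in> car A" "b2 \<in> car B"
    have "mV f (hr b1 (uni (dual_alg C))) = scl V (bcou A b1) f"
      using mul_scl(2)[of "dual_alg C" f "uni (dual_alg C)" "bcou A b1"] by (simp add: hr_uni 1)
    then show "pure V B (mV f (hr b1 (uni (dual_alg C)))) (mul B b2 c) = pure V B f (mul B (scl B (bcou A b1) b2) c)"
      by (simp add: mul_scl pure_scl)
  qed simp_all
  also have "\<dots> = pure V B f (mul B (tsum A B (\<delta> b) (\<lambda>b1 b2. scl B (bcou A b1) b2)) c)"
    by (rule tsum_lin_apply[where U=B, OF _ _ _ l, symmetric]) simp_all
  finally show ?thesis by (simp add: comod_counit)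
qed

text \<open>
  Both sides expand to \<open>\<Sum> f (b\<^sub>(\<^sub>1\<^sub>) \<rightharpoonup> g) (b\<^sub>(\<^sub>2\<^sub>) c\<^sub>(\<^sub>1\<^sub>) \<rightharpoonup> k) # b\<^sub>(\<^sub>3\<^sub>) c\<^sub>(\<^sub>2\<^sub>) d\<close>: on the left multiplicativity of
  the coaction of \<open>B\<close> is used, on the right the module algebra property of \<open>C\<^sup>*\<close>, and coassociativity of
  the coaction matches the two.
\<close>

lemma mul_D_assoc_pure:
  assumes [simp]: "f \<in> car V" "g \<in> car V" "k \<in> car V" "b \<in> car B" "c \<in> car B" "d \<in> car B"
  shows "mul D (mul D (pure V B f b) (pure V B g c)) (pure V B k d) = mul D (pure V B f b) (mul D (pure V B g c) (pure V B k d))"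
proof -
  let ?U = "tens V B"
  have l1: "lin ?U ?U (\<lambda>t. mul D t (pure V B k d))" and l2: "lin ?U ?U (\<lambda>t. mul D (pure V B f b) t)" by simp_all
  have "mul D (mul D (pure V B f b) (pure V B g c)) (pure V B k d) =
      tsum A B (\<delta> b) (\<lambda>b1 b2. mul D (pure V B (mV f (hr b1 g)) (mul B b2 c)) (pure V B k d))"
    unfolding mul_D_pure[OF assms(1,2,4,5)] by (rule tsum_lin_apply[where U="?U", OF _ _ _ l1]) simp_all
  also have "\<dots> = tsum A B (\<delta> b) (\<lambda>b1 b2. tsum A B (mul (talg A B) (\<delta> b2) (\<delta> c)) (\<lambda>e1 e2. pure V B (mV (mV f (hr b1 g)) (hr e1 k)) (mul B e2 d)))"
    by (intro tsum_cong) (simp_all add: mul_D_pure comod_mul)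
  also have "\<dots> = tsum A B (\<delta> b) (\<lambda>b1 b2. tsum A B (\<delta> b2) (\<lambda>p q. tsum A B (\<delta> c) (\<lambda>u v.
       pure V B (mV (mV f (hr b1 g)) (hr (mul A p u) k)) (mul B (mul B q v) d))))"
    by (intro tsum_cong tsum_talg_mul[where U="?U"]) simp_all
  also have "\<dots> = tsum A B (\<delta> b) (\<lambda>a q. sw2 CA a (\<lambda>a1 a2. tsum A B (\<delta> c) (\<lambda>u v.
       pure V B (mV (mV f (hr a1 g)) (hr (mul A a2 u) k)) (mul B (mul B q v) d))))"
    by (rule comodule_coassoc[OF _ comod, where U="?U"]) simp_all
  also have "\<dots> = tsum A B (\<delta> b) (\<lambda>a q. sw2 CA a (\<lambda>a1 a2. tsum A B (\<delta> c) (\<lambda>u v.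
       pure V B (mV f (mV (hr a1 g) (hr a2 (hr u k)))) (mul B q (mul B v d)))))"
    using mul_assoc[of "dual_alg C"] by (intro tsum_cong sw2_cong) (simp_all add: hr_mul mul_assoc[of B])
  also have "\<dots> = tsum A B (\<delta> b) (\<lambda>a q. tsum A B (\<delta> c) (\<lambda>u v. sw2 CA a (\<lambda>a1 a2.
       pure V B (mV f (mV (hr a1 g) (hr a2 (hr u k)))) (mul B q (mul B v d)))))"
    by (intro tsum_cong sw2_tsum_swap) simp_all
  also have "\<dots> = tsum A B (\<delta> b) (\<lambda>a q. tsum A B (\<delta> c) (\<lambda>u v.
       pure V B (mV f (sw2 CA a (\<lambda>a1 a2. mV (hr a1 g) (hr a2 (hr u k))))) (mul B q (mul B v d))))"
    by (intro tsum_cong sw2_apply[where U=V and U'="?U" and \<phi>="\<lambda>z. pure V B (mV f z) _", symmetric]) simp_all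
  also have "\<dots> = tsum A B (\<delta> b) (\<lambda>a q. tsum A B (\<delta> c) (\<lambda>u v.
       pure V B (mV f (hr a (mV g (hr u k)))) (mul B q (mul B v d))))"
    by (intro tsum_cong) (simp_all add: hr_mV)
  also have "\<dots> = tsum A B (\<delta> c) (\<lambda>u v. tsum A B (\<delta> b) (\<lambda>a q.
       pure V B (mV f (hr a (mV g (hr u k)))) (mul B q (mul B v d))))"
    by (rule tsum_swap)
  also have "\<dots> = tsum A B (\<delta> c) (\<lambda>u v. mul D (pure V B f b) (pure V B (mV g (hr u k)) (mul B v d)))"
    by (intro tsum_cong) (simp_all add: mul_D_pure)
  also have "\<dots> = mul D (pure V B f b) (mul D (pure V B g c) (pure V B k d))"
    unfolding mul_D_pure[OF assms(2,3,5,6)] by (rule tsum_lin_apply[where U="?U", OF _ _ _ l2, symmetric]) simp_all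
  finally show ?thesis .
qed

theorem is_alg_D: "is_alg D"
proof (rule is_algI)
  let ?U = "tens V B"
  note [simp] = dual_alg_cong
  show "bilin D D D (mul D)" by (simp del: bilinI) (rule bilinI; simp)
  have 1: "\<forall>t\<in>car ?U. mul D (mul D t (pure V B g c)) (pure V B k d) = mul D t (mul D (pure V B g c) (pure V B k d))"
    if [simp]: "g \<in> car V" "k \<in> car V" "c \<in> car B" "d \<in> car B" for g k c d
    by (rule tens_ball_ext[where U="?U"]) (simp_all add: mul_D_assoc_pure)
  have 2: "\<forall>u\<in>car ?U. mul D (mul D t u) (pure V B k d) = mul D t (mul D u (pure V B k d))"
    if [simp]: "t \<in> car ?U" "k \<in> car V" "d \<in> car B" for t k d
    by (rule tens_ball_ext[where U="?U"]) (use 1 in simp_all)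
  have 3: "\<forall>v\<in>car ?U. mul D (mul D t u) v = mul D t (mul D u v)"
    if [simp]: "t \<in> car ?U" "u \<in> car ?U" for t u
    by (rule tens_ball_ext[where U="?U"]) (use 2 in simp_all)
  show "mul D (mul D a b) c = mul D a (mul D b c)" if "a \<in> car D" "b \<in> car D" "c \<in> car D" for a b c
    using that 3 by simp
  have e: "mV (uni (dual_alg C)) f = f" if "f \<in> car V" for f
    using that is_alg_simps(3)[of "dual_alg C" f] by simp
  have "\<forall>t\<in>car ?U. mul D (pure V B (uni (dual_alg C)) (uni B)) t = t"
    by (rule tens_ball_ext[where U="?U"]) (simp_all add: mul_D_left e)
  then show "mul D (uni D) a = a" if "a \<in> car D" for a using that by simp
  have "\<forall>t\<in>car ?U. mul D t (pure V B (uni (dual_alg C)) (uni B)) = t"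
    by (rule tens_ball_ext[where U="?U"]) (simp_all add: mul_D_right)
  then show "mul D a (uni D) = a" if "a \<in> car D" for a using that by simp
qed simp_all

end


section \<open>The Hopf algebra structure on \<open>K\<^sup>* \<otimes> H\<close>\<close>

context paired_hopf begin

sublocale sp: smash_product A B coact CK act
  by unfold_locales (simp_all add: comodule_algebra module_coalgebra)

text \<open>
  The product of the left partial dual is \<open>mD\<close>, and \<open>mm\<close> is the product on its tensor square.  The
  embeddings \<open>f \<mapsto> f # 1\<close> and \<open>h \<mapsto> \<epsilon> # h\<close> are \<open>iV\<close> and \<open>iH\<close>.  The coalgebra \<open>CD\<close>, the tensor
  product of \<open>K\<^sup>*\<^sup>c\<^sup>o\<^sup>p\<close> and \<open>H\<close>, is that of the quantum double.
\<close>

abbreviation mV where "mV \<equiv> mul (dual_alg CK)"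
abbreviation e where "e \<equiv> uni (dual_alg CK)"
abbreviation TD where "TD \<equiv> tens V H"
abbreviation TT where "TT \<equiv> tens TD TD"
abbreviation HH where "HH \<equiv> tens H H"
abbreviation D0 where "D0 \<equiv> pd_alg A B coact CK act"
abbreviation mD where "mD \<equiv> mul D0"
abbreviation mm where "mm \<equiv> mul (talg D0 D0)"
abbreviation iV where "iV f \<equiv> pure V H f (uni H)"
abbreviation iH where "iH h \<equiv> pure V H e h"
abbreviation CD where "CD \<equiv> tcoalg (cop_coalg CKd) CH"

text \<open>
  With \<open>l = s(h)\<close> this functional is \<open>(k \<otimes> h) \<rightharpoonup> f\<close> (\<open>hr_twist\<close>), and it also equals
  \<open>\<Sum> f\<^sub>(\<^sub>1\<^sub>)(k) f\<^sub>(\<^sub>2\<^sub>) f\<^sub>(\<^sub>3\<^sub>)(l)\<close> (\<open>sw3_twist\<close>); so it is the common form of the commutation rules in the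
  smash product and in the quantum double.
\<close>

definition twist :: "'k \<Rightarrow> 'k \<Rightarrow> ('k \<Rightarrow> 'f) \<Rightarrow> 'k \<Rightarrow> 'f" where
  "twist k l f = dual_map K (\<lambda>x. f (mul K (mul K k x) l))"

lemma same_vs_D0: "same_vs D0 TD"
  using sp.same_vs_D by simp
lemmas D0_cong [simp] = same_vs_cong[OF same_vs_D0]

lemma e_closed [simp]: "e \<in> car V"
  using is_alg_simps(2)[of "dual_alg CK"] by simp

lemma mV_simps [simp]:
  "f \<in> car V \<Longrightarrow> g \<in> car V \<Longrightarrow> mV f g \<in> car V" "f \<in> car V \<Longrightarrow> mV e f = f" "f \<in> car V \<Longrightarrow> mV f e = f"
  "lin W V p \<Longrightarrow> g \<in> car V \<Longrightarrow> lin W V (\<lambda>x. mV (p x) g)" "lin W V p \<Longrightarrow> g \<in> car V \<Longrightarrow> lin W V (\<lambda>x. mV g (p x))"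
  using is_alg_simps(3,4)[of "dual_alg CK" f] mul_closed[of "dual_alg CK" V f g]
    lin_mul[of "dual_alg CK" V W p g] by simp_all

lemma e_apply [simp]: "x \<in> car K \<Longrightarrow> e x = bcou K x"
  by (simp add: dual_alg_apply)

lemma is_alg_D0 [simp]: "is_alg D0"
  by (rule sp.is_alg_D)

lemma mD_simps [simp]:
  "t \<in> car TD \<Longrightarrow> u \<in> car TD \<Longrightarrow> mD t u \<in> car TD"
  "lin W TD p \<Longrightarrow> u \<in> car TD \<Longrightarrow> lin W TD (\<lambda>x. mD (p x) u)" "lin W TD p \<Longrightarrow> u \<in> car TD \<Longrightarrow> lin W TD (\<lambda>x. mD u (p x))"
  "t \<in> car TD \<Longrightarrow> mD (pure V H e (uni H)) t = t" "t \<in> car TD \<Longrightarrow> mD t (pure V H e (uni H)) = t"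
  using mul_closed[of D0 TD t u] lin_mul[of D0 TD W p u] is_alg_simps(3,4)[of D0 t] by simp_all

lemma mD_assoc: "t \<in> car TD \<Longrightarrow> u \<in> car TD \<Longrightarrow> v \<in> car TD \<Longrightarrow> mD (mD t u) v = mD t (mD u v)"
  using mul_assoc[of D0 t u v] by simp

lemma mm_simps [simp]:
  "t \<in> car TT \<Longrightarrow> u \<in> car TT \<Longrightarrow> mm t u \<in> car TT"
  "lin W TT p \<Longrightarrow> u \<in> car TT \<Longrightarrow> lin W TT (\<lambda>x. mm (p x) u)" "lin W TT p \<Longrightarrow> u \<in> car TT \<Longrightarrow> lin W TT (\<lambda>x. mm u (p x))"
  "a \<in> car TD \<Longrightarrow> b \<in> car TD \<Longrightarrow> c \<in> car TD \<Longrightarrow> d \<in> car TD \<Longrightarrow>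
     mm (pure TD TD a b) (pure TD TD c d) = pure TD TD (mD a c) (mD b d)"
  using mul_closed[of "talg D0 D0" TT t u] lin_mul[of "talg D0 D0" TT W p u] talg_pure[of D0 D0 a c b d] by simp_all

lemma mm_assoc: "t \<in> car TT \<Longrightarrow> u \<in> car TT \<Longrightarrow> v \<in> car TT \<Longrightarrow> mm (mm t u) v = mm t (mm u v)"
  using mul_assoc[of "talg D0 D0" t u v] by simp

lemma twist_closed [simp]: "f \<in> car V \<Longrightarrow> k \<in> car K \<Longrightarrow> l \<in> car K \<Longrightarrow> twist k l f \<in> car V"
  unfolding twist_def by (intro dual_map_closed dual_lin_comp[of f K]) simp_all

lemma twist_apply [simp]: "x \<in> car K \<Longrightarrow> twist k l f x = f (mul K (mul K k x) l)"
  by (simp add: twist_def)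

lemma twist_lin [simp]:
  "f \<in> car V \<Longrightarrow> l \<in> car K \<Longrightarrow> lin W K p \<Longrightarrow> lin W V (\<lambda>x. twist (p x) l f)"
  "f \<in> car V \<Longrightarrow> k \<in> car K \<Longrightarrow> lin W K p \<Longrightarrow> lin W V (\<lambda>x. twist k (p x) f)"
proof -
  have cl: "p w \<in> car K" if "lin W K p" "w \<in> car W" using lin_closed[OF that] .
  assume f: "f \<in> car V"
  note [simp] = dual_lin_comp[OF f]
  have c: "lin K V (\<lambda>k. twist k l f)" if "l \<in> car K" for l
    unfolding twist_def using that by (intro lin_dual_map) (simp_all add: dual_lin_comp[OF f, of K])
  have d: "lin K V (\<lambda>l. twist k l f)" if "k \<in> car K" for k
    unfolding twist_def using that by (intro lin_dual_map) (simp_all add: dual_lin_comp[OF f, of K])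
  show "l \<in> car K \<Longrightarrow> lin W K p \<Longrightarrow> lin W V (\<lambda>x. twist (p x) l f)" using lin_comp[OF c] by blast
  show "k \<in> car K \<Longrightarrow> lin W K p \<Longrightarrow> lin W V (\<lambda>x. twist k (p x) f)" using lin_comp[OF d] by blast
qed

lemma hr_twist: "f \<in> car V \<Longrightarrow> k \<in> car K \<Longrightarrow> h \<in> car H \<Longrightarrow> sp.hr (pure K H k h) f = twist k (s h) f"
  by (rule dual_ext[of _ K]) (use sp.hr_closed[of f "pure K H k h"] sp.hr_apply[of f "pure K H k h"] in simp_all)

lemma mD_pure:
  assumes [simp]: "f \<in> car V" "g \<in> car V" "h \<in> car H" "k \<in> car H"
  shows "mD (pure V H f h) (pure V H g k) =
    sw2 CH h (\<lambda>w h3. sw2 CH w (\<lambda>h1 h2. pure V H (mV f (twist (j h3) (s h1) g)) (mul H h2 k)))"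
proof -
  have hl: "lin W V (\<lambda>a. sp.hr (p a) g)" "t \<in> car T \<Longrightarrow> sp.hr t g \<in> car V" if "lin W T p" for W :: "('f, 'z::ab_group_add, 'y) vs_scheme" and p t
    using sp.hr_lin(1)[of W p g] sp.hr_closed[of g t] that by simp_all
  note [simp] = hl
  have [simp]: "t \<in> car T \<Longrightarrow> sp.hr t g \<in> car V" for t using sp.hr_closed[of g t] by simp
  have "mD (pure V H f h) (pure V H g k) = tsum T H (coact h) (\<lambda>b1 b2. pure V H (mV f (sp.hr b1 g)) (mul H b2 k))"
    using sp.mul_D_pure[of f g h k] by simp
  also have "\<dots> = sw2 CH h (\<lambda>w h3. sw2 CH w (\<lambda>h1 h2. pure V H (mV f (sp.hr (pure K H (j h3) h1) g)) (mul H h2 k)))"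
    by (rule tsum_coact[where U=TD]) simp_all
  also have "\<dots> = sw2 CH h (\<lambda>w h3. sw2 CH w (\<lambda>h1 h2. pure V H (mV f (twist (j h3) (s h1) g)) (mul H h2 k)))"
    by (intro sw2_cong) (simp_all add: hr_twist)
  finally show ?thesis .
qed

lemma mD_left [simp]: "f \<in> car V \<Longrightarrow> g \<in> car V \<Longrightarrow> h \<in> car H \<Longrightarrow> mD (iV f) (pure V H g h) = pure V H (mV f g) h"
  using sp.mul_D_left[of f g h] by simp

lemma mD_right [simp]: "f \<in> car V \<Longrightarrow> h \<in> car H \<Longrightarrow> k \<in> car H \<Longrightarrow> mD (pure V H f h) (iH k) = pure V H f (mul H h k)"
  using sp.mul_D_right[of f h k] by simp

text \<open>
  In Sweedler notation the left side is \<open>\<Sum> F(h\<^sub>(\<^sub>1\<^sub>), s(h\<^sub>(\<^sub>3\<^sub>)) j(h\<^sub>(\<^sub>2\<^sub>)), h\<^sub>(\<^sub>4\<^sub>))\<close>, bracketed so that the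
  cancelling factors come from different halves of \<open>h\<close>; coassociativity brings them together.
\<close>

lemma middle_cancel:
  assumes U: "is_vs U" and h: "h \<in> car H"
    and F: "\<And>y z. y \<in> car K \<Longrightarrow> z \<in> car H \<Longrightarrow> lin H U (\<lambda>x. F x y z)" "\<And>x z. x \<in> car H \<Longrightarrow> z \<in> car H \<Longrightarrow> lin K U (\<lambda>y. F x y z)"
      "\<And>x y. x \<in> car H \<Longrightarrow> y \<in> car K \<Longrightarrow> lin H U (\<lambda>z. F x y z)"
  shows "sw2 CH h (\<lambda>p q. sw2 CH p (\<lambda>w c. sw2 CH q (\<lambda>a r. F w (mul K (s a) (j c)) r))) = sw2 CH h (\<lambda>w r. F w (uni K) r)"
proof -
  note [simp] = U h F lin_comp[OF F(2)]
  have "sw2 CH h (\<lambda>p q. sw2 CH p (\<lambda>w c. sw2 CH q (\<lambda>a r. F w (mul K (s a) (j c)) r))) =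
     sw2 CH h (\<lambda>w x. sw2 CH x (\<lambda>c q. sw2 CH q (\<lambda>a r. F w (mul K (s a) (j c)) r)))"
    by (rule coassoc[where U=U]) simp_all
  also have "\<dots> = sw2 CH h (\<lambda>w x. sw2 CH x (\<lambda>y r. sw2 CH y (\<lambda>c a. F w (mul K (s a) (j c)) r)))"
    by (intro sw2_cong coassoc[where U=U, symmetric]) simp_all
  also have "\<dots> = sw2 CH h (\<lambda>w x. sw2 CH x (\<lambda>y r. F w (sw2 CH y (\<lambda>c a. mul K (s a) (j c))) r))"
    by (intro sw2_cong sw2_apply[where U=K and U'=U and \<phi>="\<lambda>z. F _ z _", symmetric]) simp_all
  also have "\<dots> = sw2 CH h (\<lambda>w x. sw2 CH x (\<lambda>y r. scl U (bcou H y) (F w (uni K) r)))"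
    by (intro sw2_cong) (simp_all add: s_j_cancel lin_scl[OF F(2)])
  also have "\<dots> = sw2 CH h (\<lambda>w x. F w (uni K) x)"
    by (intro sw2_cong counit(1)[where C=CH and U=U, simplified]) simp_all
  finally show ?thesis .
qed

subsection \<open>Comultiplication\<close>

lemma CD_simps [simp]:
  "lin W TD p \<Longrightarrow> lin W TT (\<lambda>x. cop CD (p x))" "t \<in> car TD \<Longrightarrow> cop CD t \<in> car TT"
  "lin W TD p \<Longrightarrow> lin W field_vs (\<lambda>x. cou CD (p x))"
  "f \<in> car V \<Longrightarrow> h \<in> car H \<Longrightarrow> cou CD (pure V H f h) = f (uni K) * bcou H h"
  using lin_cop[of CD W p] is_coalg_simps(2)[of CD t] lin_cou[of CD W p] cou_tcoalg_pure[of "cop_coalg CKd" CH f h] by simp_all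

lemma sw2_CD_pure:
  assumes "is_vs U" "f \<in> car V" "h \<in> car H" "\<And>b. b \<in> car TD \<Longrightarrow> lin TD U (\<lambda>a. F a b)" "\<And>a. a \<in> car TD \<Longrightarrow> lin TD U (\<lambda>b. F a b)"
  shows "sw2 CD (pure V H f h) F = sw2 CKd f (\<lambda>f1 f2. sw2 CH h (\<lambda>h1 h2. F (pure V H f2 h1) (pure V H f1 h2)))"
proof -
  note [simp] = assms lin_comp[OF assms(4)] lin_comp[OF assms(5)]
  have "sw2 CD (pure (cop_coalg CKd) CH f h) F = sw2 (cop_coalg CKd) f (\<lambda>f1 f2. sw2 CH h (\<lambda>h1 h2. F (pure (cop_coalg CKd) CH f1 h1) (pure (cop_coalg CKd) CH f2 h2)))"
    by (rule sw2_tcoalg_pure[where U=U]) simp_all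
  also have "\<dots> = sw2 CKd f (\<lambda>f1 f2. sw2 CH h (\<lambda>h1 h2. F (pure V H f2 h1) (pure V H f1 h2)))"
    by (simp add: sw2_cop_coalg'[where U=U])
  finally show ?thesis by simp
qed

lemma cop_CD_pure:
  assumes [simp]: "f \<in> car V" "h \<in> car H"
  shows "cop CD (pure V H f h) = sw2 CKd f (\<lambda>f1 f2. sw2 CH h (\<lambda>h1 h2. pure TD TD (pure V H f2 h1) (pure V H f1 h2)))"
proof -
  have "cop CD (pure V H f h) = sw2 CD (pure V H f h) (pure TD TD)" by (simp add: sw2_def tsum_self)
  also have "\<dots> = sw2 CKd f (\<lambda>f1 f2. sw2 CH h (\<lambda>h1 h2. pure TD TD (pure V H f2 h1) (pure V H f1 h2)))"
    by (rule sw2_CD_pure[where U=TT]) simp_all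
  finally show ?thesis .
qed

text \<open>
  \<open>L f\<close> and \<open>R h\<close> are the coproducts of \<open>f # 1\<close> and \<open>\<epsilon> # h\<close>.  \<open>N\<close> is the coproduct of \<open>K\<^sup>*\<^sup>c\<^sup>o\<^sup>p\<close>, and
  \<open>\<Theta>\<close> is the map \<open>K\<^sup>* \<otimes> K\<^sup>* \<rightarrow> D \<otimes> D\<close> induced by the embedding of \<open>K\<^sup>*\<close>; so \<open>L = \<Theta> \<circ> N\<close>, and
  identities for \<open>L\<close> can be checked in \<open>K\<^sup>* \<otimes> K\<^sup>*\<close> by evaluation.
\<close>

definition L where "L f = sw2 CKd f (\<lambda>f1 f2. pure TD TD (iV f2) (iV f1))"
definition R where "R h = sw2 CH h (\<lambda>h1 h2. pure TD TD (iH h1) (iH h2))"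
definition N where "N f = sw2 CKd f (\<lambda>f1 f2. pure V V f2 f1)"
definition \<Theta> where "\<Theta> t = tsum V V t (\<lambda>u v. pure TD TD (iV u) (iV v))"

lemma LRN_simps [simp]:
  "f \<in> car V \<Longrightarrow> L f \<in> car TT" "h \<in> car H \<Longrightarrow> R h \<in> car TT" "f \<in> car V \<Longrightarrow> N f \<in> car (tens V V)"
  "t \<in> car (tens V V) \<Longrightarrow> \<Theta> t \<in> car TT" "lin W (tens V V) p \<Longrightarrow> lin W TT (\<lambda>x. \<Theta> (p x))"
  by (simp_all add: L_def R_def N_def \<Theta>_def)

lemma \<Theta>_lin: "lin (tens V V) TT \<Theta>"
  using LRN_simps(5)[OF lin_ident] .

lemma \<Theta>_pure [simp]: "u \<in> car V \<Longrightarrow> v \<in> car V \<Longrightarrow> \<Theta> (pure V V u v) = pure TD TD (iV u) (iV v)"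
  by (simp add: \<Theta>_def tsum_pure[where U=TT])

lemma L_eq: "f \<in> car V \<Longrightarrow> L f = \<Theta> (N f)"
proof -
  assume [simp]: "f \<in> car V"
  have "\<Theta> (N f) = sw2 CKd f (\<lambda>f1 f2. \<Theta> (pure V V f2 f1))"
    unfolding N_def by (rule sw2_apply[where U="tens V V", OF _ _ _ \<Theta>_lin]) simp_all
  also have "\<dots> = L f" unfolding L_def by (intro sw2_cong) simp_all
  finally show ?thesis by simp
qed

lemma sw2_Kd_eval [simp]:
  "f \<in> car V \<Longrightarrow> x \<in> car K \<Longrightarrow> y \<in> car K \<Longrightarrow> sw2 CKd f (\<lambda>f1 f2. f1 x * f2 y) = f (mul K x y)"
  "f \<in> car V \<Longrightarrow> x \<in> car K \<Longrightarrow> y \<in> car K \<Longrightarrow> sw2 CKd f (\<lambda>f1 f2. f2 y * f1 x) = f (mul K x y)"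
  using sw2_dual_eval[of K f x y] by (simp_all add: mult.commute)

lemma N_eval:
  assumes [simp]: "f \<in> car V" "x \<in> car K" "y \<in> car K"
  shows "tsum V V (N f) (\<lambda>u v. u x * v y) = f (mul K y x)"
proof -
  have "tsum V V (N f) (\<lambda>u v. u x * v y) = sw2 CKd f (\<lambda>f1 f2. tsum V V (pure V V f2 f1) (\<lambda>u v. u x * v y))"
    unfolding N_def by (rule sw2_apply[where U="tens V V" and U'=field_vs and \<phi>="\<lambda>t. tsum V V t (\<lambda>u v. u x * v y)"]) simp_all
  also have "\<dots> = sw2 CKd f (\<lambda>f1 f2. f2 x * f1 y)" by (intro sw2_cong tsum_pure[where U=field_vs]) simp_all
  finally show ?thesis by simp
qed

lemma V2_ext:
  assumes "r \<in> car (tens V V)" "t \<in> car (tens V V)"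
    and "\<And>x y. x \<in> car K \<Longrightarrow> y \<in> car K \<Longrightarrow> tsum V V r (\<lambda>u v. u x * v y) = tsum V V t (\<lambda>u v. u x * v y)"
  shows "r = t"
  by (rule dual2_ext[of K]) (use assms in simp_all)

text \<open>
  Evaluated at \<open>x \<otimes> y\<close>, multiplicativity of \<open>N\<close> reads
  \<open>(f g)(y x) = \<Sum> f(y\<^sub>(\<^sub>1\<^sub>) x\<^sub>(\<^sub>1\<^sub>)) g(y\<^sub>(\<^sub>2\<^sub>) x\<^sub>(\<^sub>2\<^sub>))\<close>, which is multiplicativity of the coproduct of \<open>K\<close>.
\<close>

lemma L_mul:
  assumes [simp]: "f \<in> car V" "g \<in> car V"
  shows "L (mV f g) = mm (L f) (L g)"
proof -
  let ?VV = "tens V V"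
  define M where "M = sw2 CKd f (\<lambda>f1 f2. sw2 CKd g (\<lambda>g1 g2. pure V V (mV f2 g2) (mV f1 g1)))"
  have M [simp]: "M \<in> car ?VV" by (simp add: M_def)
  have fl: "lin W field_vs (\<lambda>x. f (h x))" "lin W field_vs (\<lambda>x. g (h x))" if "lin W K h" for W :: "('f, 'z::ab_group_add, 'y) vs_scheme" and h
    using that by (rule dual_lin_comp[rotated]; simp)+
  have "N (mV f g) = M"
  proof (rule V2_ext)
    fix x y assume [simp]: "x \<in> car K" "y \<in> car K"
    let ?\<phi> = "\<lambda>t. tsum V V t (\<lambda>u v. u x * v y)"
    have l: "lin ?VV field_vs ?\<phi>" by simp
    have cl: "lin CK field_vs f" if "f \<in> car V" for f using dual_lin[OF that] by simp
    have pull: "sw2 CKd g (\<lambda>g1 g2. u a * g2 b * (v c * g1 d)) = u a * v c * sw2 CKd g (\<lambda>g1 g2. g2 b * g1 d)"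
      if "b \<in> car K" "d \<in> car K" for u v :: "'k \<Rightarrow> 'f" and a b c d
    proof -
      have "u a * v c * sw2 CKd g (\<lambda>g1 g2. g2 b * g1 d) = sw2 CKd g (\<lambda>g1 g2. u a * v c * (g2 b * g1 d))"
        by (rule sw2_apply[where U=field_vs and U'=field_vs and \<phi>="\<lambda>z. u a * v c * z"]) simp_all
      then show ?thesis by (simp only: ac_simps)
    qed
    have "?\<phi> M = sw2 CKd f (\<lambda>f1 f2. sw2 CKd g (\<lambda>g1 g2. ?\<phi> (pure V V (mV f2 g2) (mV f1 g1))))"
      unfolding M_def by (subst sw2_apply[where U="?VV", OF _ _ _ l]) (simp_all, intro sw2_cong sw2_apply[where U="?VV", OF _ _ _ l], simp_all)
    also have "\<dots> = sw2 CKd f (\<lambda>f1 f2. sw2 CKd g (\<lambda>g1 g2. sw2 CK x (\<lambda>a b. f2 a * g2 b) * sw2 CK y (\<lambda>c d. f1 c * g1 d)))"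
      by (intro sw2_cong) (simp_all add: tsum_pure[where U=field_vs] dual_alg_apply)
    also have "\<dots> = sw2 CKd f (\<lambda>f1 f2. sw2 CKd g (\<lambda>g1 g2. sw2 CK x (\<lambda>a b. f2 a * g2 b * sw2 CK y (\<lambda>c d. f1 c * g1 d))))"
      by (intro sw2_cong sw2_apply[where U=field_vs and U'=field_vs and \<phi>="\<lambda>z. z * _"]) simp_all
    also have "\<dots> = sw2 CKd f (\<lambda>f1 f2. sw2 CKd g (\<lambda>g1 g2. sw2 CK x (\<lambda>a b. sw2 CK y (\<lambda>c d. f2 a * g2 b * (f1 c * g1 d)))))"
      by (intro sw2_cong sw2_apply[where U=field_vs and U'=field_vs and \<phi>="\<lambda>z. _ * z"]) simp_all
    also have "\<dots> = sw2 CKd f (\<lambda>f1 f2. sw2 CK x (\<lambda>a b. sw2 CKd g (\<lambda>g1 g2. sw2 CK y (\<lambda>c d. f2 a * g2 b * (f1 c * g1 d)))))"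
      by (intro sw2_cong sw2_swap) simp_all
    also have "\<dots> = sw2 CKd f (\<lambda>f1 f2. sw2 CK x (\<lambda>a b. sw2 CK y (\<lambda>c d. sw2 CKd g (\<lambda>g1 g2. f2 a * g2 b * (f1 c * g1 d)))))"
      by (intro sw2_cong sw2_swap) simp_all
    also have "\<dots> = sw2 CKd f (\<lambda>f1 f2. sw2 CK x (\<lambda>a b. sw2 CK y (\<lambda>c d. f2 a * f1 c * sw2 CKd g (\<lambda>g1 g2. g2 b * g1 d))))"
      by (intro sw2_cong pull) simp_all
    also have "\<dots> = sw2 CKd f (\<lambda>f1 f2. sw2 CK x (\<lambda>a b. sw2 CK y (\<lambda>c d. f2 a * f1 c * g (mul K d b))))"
      by (intro sw2_cong) simp_all
    also have "\<dots> = sw2 CK x (\<lambda>a b. sw2 CKd f (\<lambda>f1 f2. sw2 CK y (\<lambda>c d. f2 a * f1 c * g (mul K d b))))"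
      by (rule sw2_swap)
    also have "\<dots> = sw2 CK x (\<lambda>a b. sw2 CK y (\<lambda>c d. sw2 CKd f (\<lambda>f1 f2. f2 a * f1 c * g (mul K d b))))"
      by (intro sw2_cong sw2_swap) simp_all
    also have "\<dots> = sw2 CK x (\<lambda>a b. sw2 CK y (\<lambda>c d. sw2 CKd f (\<lambda>f1 f2. f2 a * f1 c) * g (mul K d b)))"
      by (intro sw2_cong sw2_apply[where U=field_vs and U'=field_vs and \<phi>="\<lambda>z. z * _", symmetric]) simp_all
    also have "\<dots> = sw2 CK x (\<lambda>a b. sw2 CK y (\<lambda>c d. f (mul K c a) * g (mul K d b)))"
      by (intro sw2_cong) simp_all
    also have "\<dots> = sw2 CK y (\<lambda>c d. sw2 CK x (\<lambda>a b. f (mul K c a) * g (mul K d b)))"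
      by (rule sw2_swap)
    also have "\<dots> = sw2 CK (mul K y x) (\<lambda>a b. f a * g b)"
      by (rule sw2_mul[where U=field_vs, symmetric]) (simp_all add: fl dual_lin)
    also have "\<dots> = ?\<phi> (N (mV f g))" by (simp add: N_eval dual_alg_apply)
    finally show "?\<phi> (N (mV f g)) = ?\<phi> M" by simp
  qed simp_all
  then have "L (mV f g) = \<Theta> M" by (simp add: L_eq)
  also have "\<dots> = sw2 CKd f (\<lambda>f1 f2. \<Theta> (sw2 CKd g (\<lambda>g1 g2. pure V V (mV f2 g2) (mV f1 g1))))"
    unfolding M_def by (rule sw2_apply[where U="?VV", OF _ _ _ \<Theta>_lin]) simp_all
  also have "\<dots> = sw2 CKd f (\<lambda>f1 f2. sw2 CKd g (\<lambda>g1 g2. \<Theta> (pure V V (mV f2 g2) (mV f1 g1))))"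
    by (intro sw2_cong sw2_apply[where U="?VV", OF _ _ _ \<Theta>_lin]) simp_all
  also have "\<dots> = sw2 CKd f (\<lambda>f1 f2. sw2 CKd g (\<lambda>g1 g2. mm (pure TD TD (iV f2) (iV f1)) (pure TD TD (iV g2) (iV g1))))"
    by (intro sw2_cong) simp_all
  also have "\<dots> = sw2 CKd f (\<lambda>f1 f2. mm (pure TD TD (iV f2) (iV f1)) (L g))"
    unfolding L_def by (intro sw2_cong sw2_apply[where U=TT and U'=TT and \<phi>="\<lambda>z. mm _ z", symmetric]) simp_all
  also have "\<dots> = mm (L f) (L g)"
    unfolding L_def[of f] by (rule sw2_apply[where U=TT and U'=TT and \<phi>="\<lambda>t. mm t (L g)", symmetric]) simp_all
  finally show ?thesis .
qed

lemma R_mul: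
  assumes [simp]: "h \<in> car H" "k \<in> car H"
  shows "R (mul H h k) = mm (R h) (R k)"
proof -
  have "R (mul H h k) = sw2 CH h (\<lambda>h1 h2. sw2 CH k (\<lambda>k1 k2. pure TD TD (iH (mul H h1 k1)) (iH (mul H h2 k2))))"
    unfolding R_def by (rule sw2_mul[where U=TT]) simp_all
  also have "\<dots> = sw2 CH h (\<lambda>h1 h2. sw2 CH k (\<lambda>k1 k2. mm (pure TD TD (iH h1) (iH h2)) (pure TD TD (iH k1) (iH k2))))"
    by (intro sw2_cong) simp_all
  also have "\<dots> = sw2 CH h (\<lambda>h1 h2. mm (pure TD TD (iH h1) (iH h2)) (R k))"
    unfolding R_def by (intro sw2_cong sw2_apply[where U=TT and U'=TT and \<phi>="\<lambda>z. mm _ z", symmetric]) simp_all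
  also have "\<dots> = mm (R h) (R k)"
    unfolding R_def[of h] by (rule sw2_apply[where U=TT and U'=TT and \<phi>="\<lambda>t. mm t (R k)", symmetric]) simp_all
  finally show ?thesis .
qed

lemma L_R:
  assumes [simp]: "f \<in> car V" "h \<in> car H"
  shows "mm (L f) (R h) = cop CD (pure V H f h)"
proof -
  have "cop CD (pure V H f h) = sw2 CKd f (\<lambda>f1 f2. sw2 CH h (\<lambda>h1 h2. mm (pure TD TD (iV f2) (iV f1)) (pure TD TD (iH h1) (iH h2))))"
    unfolding cop_CD_pure[OF assms] by (intro sw2_cong) simp_all
  also have "\<dots> = sw2 CKd f (\<lambda>f1 f2. mm (pure TD TD (iV f2) (iV f1)) (R h))"
    unfolding R_def by (intro sw2_cong sw2_apply[where U=TT and U'=TT and \<phi>="\<lambda>z. mm _ z", symmetric]) simp_all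
  also have "\<dots> = mm (L f) (R h)"
    unfolding L_def by (rule sw2_apply[where U=TT and U'=TT and \<phi>="\<lambda>t. mm t (R h)", symmetric]) simp_all
  finally show ?thesis by simp
qed


subsection \<open>The commutation relation is compatible with the comultiplication\<close>

text \<open>
  For varying \<open>x\<close> and \<open>y\<close> these maps separate the elements of \<open>(K\<^sup>* \<otimes> H) \<otimes> (K\<^sup>* \<otimes> H)\<close>
  (\<open>E_ext\<close>), so identities there can be checked in \<open>H \<otimes> H\<close>.
\<close>

definition E where "E x y t = tsum TD TD t (\<lambda>a b. pure H H (ev K H x a) (ev K H y b))"

lemma E_simps [simp]:
  "t \<in> car TT \<Longrightarrow> E x y t \<in> car HH" "lin W TT p \<Longrightarrow> lin W HH (\<lambda>z. E x y (p z))"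
  "a \<in> car TD \<Longrightarrow> b \<in> car TD \<Longrightarrow> E x y (pure TD TD a b) = pure H H (ev K H x a) (ev K H y b)"
  by (simp_all add: E_def tsum_pure[where U=HH])

lemma E_lin: "lin TT HH (E x y)"
  using E_simps(2)[OF lin_ident] .

lemma E_ext:
  assumes r: "r \<in> car TT" and t: "t \<in> car TT" and eq: "\<And>x y. x \<in> car K \<Longrightarrow> y \<in> car K \<Longrightarrow> E x y r = E x y t"
  shows "r = t"
proof -
  have vs: "is_vs K" "is_vs H" by simp_all
  obtain X where X: "finite X" "is_basis K X" using fin_basis[OF vs(1) K(2)] by blast
  note [simp] = basis_car[OF vs(1) X(2)] coord_dual[OF vs(1) X(2)]
  define G where "G = (\<lambda>t. \<Sum>x\<in>X. \<Sum>y\<in>X. tsum H H (E x y t) (\<lambda>a b. pure TD TD (pure V H (coord K X x) a) (pure V H (coord K X y) b)))"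
  have "\<forall>t\<in>car TT. G t = t"
  proof (rule tens_ball_ext[where U=TT])
    show "lin TT TT G" unfolding G_def by simp
    fix p q assume [simp]: "p \<in> car TD" "q \<in> car TD"
    have "G (pure TD TD p q) = (\<Sum>x\<in>X. \<Sum>y\<in>X. pure TD TD (pure V H (coord K X x) (ev K H x p)) (pure V H (coord K X y) (ev K H y q)))"
      unfolding G_def by (intro sum.cong) (simp_all add: tsum_pure[where U=TT])
    also have "\<dots> = (\<Sum>x\<in>X. pure TD TD (pure V H (coord K X x) (ev K H x p)) (\<Sum>y\<in>X. pure V H (coord K X y) (ev K H y q)))"
      by (intro sum.cong lin_sum[OF _ bilinD(2)[OF bilin_pure], symmetric]) simp_all
    also have "\<dots> = pure TD TD (\<Sum>x\<in>X. pure V H (coord K X x) (ev K H x p)) (\<Sum>y\<in>X. pure V H (coord K X y) (ev K H y q))"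
      by (intro lin_sum[OF _ bilinD(1)[OF bilin_pure], symmetric]) simp_all
    finally show "G (pure TD TD p q) = pure TD TD p q"
      using dual_tens_expand[OF vs X(2,1)] by simp
  qed simp_all
  then have "r = G r" "G t = t" using r t by simp_all
  moreover have "G r = G t" unfolding G_def using eq by simp
  ultimately show ?thesis by simp
qed

lemma iH_iV:
  assumes [simp]: "h \<in> car H" "g \<in> car V"
  shows "mD (iH h) (iV g) = sw2 CH h (\<lambda>w h3. sw2 CH w (\<lambda>h1 h2. pure V H (twist (j h3) (s h1) g) h2))"
proof -
  have u: "uni H \<in> car H" by simp
  show ?thesis
    unfolding mD_pure[OF e_closed assms(2,1) u] by (intro sw2_cong) simp_all
qed

lemma ev_iH_iV:
  assumes [simp]: "h \<in> car H" "g \<in> car V" "x \<in> car K"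
  shows "ev K H x (mD (iH h) (iV g)) = sw2 CH h (\<lambda>w c. sw2 CH w (\<lambda>a b. scl H (g (mul K (mul K (j c) x) (s a))) b))"
proof -
  have l: "lin TD H (ev K H x)" by simp
  have "ev K H x (mD (iH h) (iV g)) = sw2 CH h (\<lambda>w h3. ev K H x (sw2 CH w (\<lambda>h1 h2. pure V H (twist (j h3) (s h1) g) h2)))"
    unfolding iH_iV[OF assms(1,2)] by (rule sw2_apply[where U=TD, OF _ _ _ l]) simp_all
  also have "\<dots> = sw2 CH h (\<lambda>w h3. sw2 CH w (\<lambda>h1 h2. ev K H x (pure V H (twist (j h3) (s h1) g) h2)))"
    by (intro sw2_cong sw2_apply[where U=TD, OF _ _ _ l]) simp_all
  also have "\<dots> = sw2 CH h (\<lambda>w c. sw2 CH w (\<lambda>a b. scl H (g (mul K (mul K (j c) x) (s a))) b))"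
    by (intro sw2_cong) simp_all
  finally show ?thesis .
qed

text \<open>
  By \<open>E_ext\<close> the \<open>K\<^sup>*\<close>-legs may be evaluated at \<open>x\<close> and \<open>y\<close>.  The left side becomes
  \<open>\<Sum> g(j(h\<^sub>(\<^sub>4\<^sub>)) y x s(h\<^sub>(\<^sub>1\<^sub>))) h\<^sub>(\<^sub>2\<^sub>) \<otimes> h\<^sub>(\<^sub>3\<^sub>)\<close>.  On the right each factor \<open>\<epsilon> # h\<^sub>(\<^sub>i\<^sub>)\<close> passes its own part of \<open>g\<close>,
  which gives \<open>\<Sum> g(j(h\<^sub>(\<^sub>6\<^sub>)) y s(h\<^sub>(\<^sub>4\<^sub>)) j(h\<^sub>(\<^sub>3\<^sub>)) x s(h\<^sub>(\<^sub>1\<^sub>))) h\<^sub>(\<^sub>2\<^sub>) \<otimes> h\<^sub>(\<^sub>5\<^sub>)\<close>, and the middle factors cancel.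
\<close>

lemma cop_commutation:
  assumes h [simp]: "h \<in> car H" and g [simp]: "g \<in> car V"
  shows "cop CD (mD (iH h) (iV g)) = mm (R h) (L g)"
proof (rule E_ext)
  fix x y assume [simp]: "x \<in> car K" "y \<in> car K"
  have gl: "lin W field_vs (\<lambda>z. g (p z))" if "lin W K p" for W :: "('f, 'z::ab_group_add, 'y) vs_scheme" and p
    using that by (rule dual_lin_comp[rotated]) simp
  note [simp] = gl
  \<comment> \<open>Common shape of the two sides; \<open>m\<close> is the middle factor, to be specialised to \<open>1\<close> on the left and to
    \<open>s(h\<^sub>(\<^sub>4\<^sub>)) j(h\<^sub>(\<^sub>3\<^sub>))\<close> on the right.\<close>
  define \<Psi> where "\<Psi> a m c b b' = scl HH (g (mul K (mul K (mul K (mul K (j c) y) m) x) (s a))) (pure H H b b')" for a m c b b'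
  have \<Psi>l: "lin W H p \<Longrightarrow> m \<in> car K \<Longrightarrow> c \<in> car H \<Longrightarrow> b \<in> car H \<Longrightarrow> b' \<in> car H \<Longrightarrow> lin W HH (\<lambda>z. \<Psi> (p z) m c b b')"
    "lin W K q \<Longrightarrow> a \<in> car H \<Longrightarrow> c \<in> car H \<Longrightarrow> b \<in> car H \<Longrightarrow> b' \<in> car H \<Longrightarrow> lin W HH (\<lambda>z. \<Psi> a (q z) c b b')"
    "lin W H p \<Longrightarrow> a \<in> car H \<Longrightarrow> m \<in> car K \<Longrightarrow> b \<in> car H \<Longrightarrow> b' \<in> car H \<Longrightarrow> lin W HH (\<lambda>z. \<Psi> a m (p z) b b')"
    "lin W H p \<Longrightarrow> a \<in> car H \<Longrightarrow> m \<in> car K \<Longrightarrow> c \<in> car H \<Longrightarrow> b' \<in> car H \<Longrightarrow> lin W HH (\<lambda>z. \<Psi> a m c (p z) b')"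
    "lin W H p \<Longrightarrow> a \<in> car H \<Longrightarrow> m \<in> car K \<Longrightarrow> c \<in> car H \<Longrightarrow> b \<in> car H \<Longrightarrow> lin W HH (\<lambda>z. \<Psi> a m c b (p z))"
    for W :: "('f, 'z::ab_group_add, 'y) vs_scheme" and p q a m c b b'
    unfolding \<Psi>_def by simp_all
  have \<Psi>c: "a \<in> car H \<Longrightarrow> m \<in> car K \<Longrightarrow> c \<in> car H \<Longrightarrow> b \<in> car H \<Longrightarrow> b' \<in> car H \<Longrightarrow> \<Psi> a m c b b' \<in> car HH" for a m c b b'
    unfolding \<Psi>_def by simp
  note [simp] = \<Psi>l \<Psi>c
  have "E x y (cop CD (mD (iH h) (iV g))) =
      sw2 CH h (\<lambda>w h3. E x y (cop CD (sw2 CH w (\<lambda>h1 h2. pure V H (twist (j h3) (s h1) g) h2))))"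
    unfolding iH_iV[OF assms] by (rule sw2_apply[where U=TD and U'=HH and \<phi>="\<lambda>t. E x y (cop CD t)"]) simp_all
  also have "\<dots> = sw2 CH h (\<lambda>w h3. sw2 CH w (\<lambda>h1 h2. E x y (cop CD (pure V H (twist (j h3) (s h1) g) h2))))"
    by (intro sw2_cong sw2_apply[where U=TD and U'=HH and \<phi>="\<lambda>t. E x y (cop CD t)"]) simp_all
  also have "\<dots> = sw2 CH h (\<lambda>w h3. sw2 CH w (\<lambda>h1 h2. sw2 CH h2 (\<lambda>u v. \<Psi> h1 (uni K) h3 u v)))"
  proof (intro sw2_cong)
    fix w h3 h1 h2 assume [simp]: "w \<in> car CH" "h3 \<in> car CH" "h1 \<in> car CH" "h2 \<in> car CH"
    have [simp]: "h3 \<in> car H" "h1 \<in> car H" "h2 \<in> car H" using \<open>h3 \<in> car CH\<close> \<open>h1 \<in> car CH\<close> \<open>h2 \<in> car CH\<close> by simp_all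
    let ?q = "twist (j h3) (s h1) g"
    have q: "?q \<in> car V" by simp
    have "E x y (cop CD (pure V H ?q h2)) = sw2 CKd ?q (\<lambda>f1 f2. E x y (sw2 CH h2 (\<lambda>u v. pure TD TD (pure V H f2 u) (pure V H f1 v))))"
      unfolding cop_CD_pure[OF q \<open>h2 \<in> car H\<close>]
      by (rule sw2_apply[where U=TT, OF _ _ _ E_lin]) simp_all
    also have "\<dots> = sw2 CKd ?q (\<lambda>f1 f2. sw2 CH h2 (\<lambda>u v. E x y (pure TD TD (pure V H f2 u) (pure V H f1 v))))"
      by (intro sw2_cong sw2_apply[where U=TT, OF _ _ _ E_lin]) simp_all
    also have "\<dots> = sw2 CKd ?q (\<lambda>f1 f2. sw2 CH h2 (\<lambda>u v. scl HH (f1 y * f2 x) (pure H H u v)))"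
      by (intro sw2_cong) (simp_all add: pure_scl mult.commute)
    also have "\<dots> = sw2 CH h2 (\<lambda>u v. sw2 CKd ?q (\<lambda>f1 f2. scl HH (f1 y * f2 x) (pure H H u v)))"
      by (rule sw2_swap)
    also have "\<dots> = sw2 CH h2 (\<lambda>u v. scl HH (sw2 CKd ?q (\<lambda>f1 f2. f1 y * f2 x)) (pure H H u v))"
      by (intro sw2_cong sw2_apply[where U=field_vs and U'=HH and \<phi>="\<lambda>z. scl HH z (pure H H _ _)", symmetric]) simp_all
    also have "\<dots> = sw2 CH h2 (\<lambda>u v. \<Psi> h1 (uni K) h3 u v)"
      by (intro sw2_cong) (simp_all add: \<Psi>_def mul_assoc)
    finally show "E x y (cop CD (pure V H ?q h2)) = sw2 CH h2 (\<lambda>u v. \<Psi> h1 (uni K) h3 u v)" .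
  qed simp_all
  also have "\<dots> = sw2 CH h (\<lambda>w h3. sw2 CH w (\<lambda>z v. sw2 CH z (\<lambda>h1 u. \<Psi> h1 (uni K) h3 u v)))"
    by (intro sw2_cong coassoc[where U=HH, symmetric]) simp_all
  also have "\<dots> = sw2 CH h (\<lambda>z r. sw2 CH r (\<lambda>v h3. sw2 CH z (\<lambda>h1 u. \<Psi> h1 (uni K) h3 u v)))"
    by (rule coassoc[where U=HH]) simp_all
  \<comment> \<open>The four parts of \<open>h\<close> are grouped as \<open>(h\<^sub>(\<^sub>1\<^sub>), h\<^sub>(\<^sub>2\<^sub>))\<close> and \<open>(h\<^sub>(\<^sub>3\<^sub>), h\<^sub>(\<^sub>4\<^sub>))\<close>, as the right side will be.\<close>
  finally have lhs: "E x y (cop CD (mD (iH h) (iV g))) = \<dots>" .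
  have "mm (R h) (L g) = sw2 CH h (\<lambda>p q. mm (pure TD TD (iH p) (iH q)) (L g))"
    unfolding R_def by (rule sw2_apply[where U=TT and U'=TT and \<phi>="\<lambda>t. mm t (L g)"]) simp_all
  also have "\<dots> = sw2 CH h (\<lambda>p q. sw2 CKd g (\<lambda>g1 g2. mm (pure TD TD (iH p) (iH q)) (pure TD TD (iV g2) (iV g1))))"
    unfolding L_def by (intro sw2_cong sw2_apply[where U=TT and U'=TT and \<phi>="\<lambda>z. mm _ z"]) simp_all
  finally have "E x y (mm (R h) (L g)) =
      E x y (sw2 CH h (\<lambda>p q. sw2 CKd g (\<lambda>g1 g2. mm (pure TD TD (iH p) (iH q)) (pure TD TD (iV g2) (iV g1)))))" by simp
  also have "\<dots> = sw2 CH h (\<lambda>p q. E x y (sw2 CKd g (\<lambda>g1 g2. mm (pure TD TD (iH p) (iH q)) (pure TD TD (iV g2) (iV g1)))))"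
    by (rule sw2_apply[where U=TT, OF _ _ _ E_lin]) simp_all
  also have "\<dots> = sw2 CH h (\<lambda>p q. sw2 CKd g (\<lambda>g1 g2. E x y (mm (pure TD TD (iH p) (iH q)) (pure TD TD (iV g2) (iV g1)))))"
    by (intro sw2_cong sw2_apply[where U=TT, OF _ _ _ E_lin]) simp_all
  also have "\<dots> = sw2 CH h (\<lambda>p q. sw2 CKd g (\<lambda>g1 g2. pure H H (sw2 CH p (\<lambda>w c. sw2 CH w (\<lambda>a b. scl H (g2 (mul K (mul K (j c) x) (s a))) b)))
      (sw2 CH q (\<lambda>w c. sw2 CH w (\<lambda>a b. scl H (g1 (mul K (mul K (j c) y) (s a))) b)))))"
    by (intro sw2_cong) (simp_all add: ev_iH_iV)
  also have "\<dots> = sw2 CH h (\<lambda>p q. sw2 CH p (\<lambda>w c. sw2 CH w (\<lambda>a b. sw2 CH q (\<lambda>w' c'. sw2 CH w' (\<lambda>a' b'.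
      \<Psi> a (mul K (s a') (j c)) c' b b')))))"
  proof (rule sw2_cong)
    fix p q assume "p \<in> car CH" "q \<in> car CH"
    then have [simp]: "p \<in> car H" "q \<in> car H" by simp_all
    let ?P = "\<lambda>f. sw2 CH p (\<lambda>w c. sw2 CH w (\<lambda>a b. scl H (f (mul K (mul K (j c) x) (s a))) b))"
    let ?Q = "\<lambda>f. sw2 CH q (\<lambda>w c. sw2 CH w (\<lambda>a b. scl H (f (mul K (mul K (j c) y) (s a))) b))"
    have fl: "lin W field_vs (\<lambda>z. f (p z))" if "f \<in> car V" "lin W K p" for W :: "('f, 'z::ab_group_add, 'y) vs_scheme" and p f
      using that by (rule dual_lin_comp)
    have [simp]: "?P f \<in> car H" "?Q f \<in> car H" if "f \<in> car V" for f using that by (simp_all add: fl)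
    have "sw2 CKd g (\<lambda>g1 g2. pure H H (?P g2) (?Q g1)) =
       sw2 CKd g (\<lambda>g1 g2. sw2 CH p (\<lambda>w c. pure H H (sw2 CH w (\<lambda>a b. scl H (g2 (mul K (mul K (j c) x) (s a))) b)) (?Q g1)))"
      by (intro sw2_cong sw2_apply[where U=H and U'=HH and \<phi>="\<lambda>z. pure H H z _"]) (simp_all add: fl)
    also have "\<dots> = sw2 CKd g (\<lambda>g1 g2. sw2 CH p (\<lambda>w c. sw2 CH w (\<lambda>a b. pure H H (scl H (g2 (mul K (mul K (j c) x) (s a))) b) (?Q g1))))"
      by (intro sw2_cong sw2_apply[where U=H and U'=HH and \<phi>="\<lambda>z. pure H H z _"]) (simp_all add: fl)
    also have "\<dots> = sw2 CKd g (\<lambda>g1 g2. sw2 CH p (\<lambda>w c. sw2 CH w (\<lambda>a b. sw2 CH q (\<lambda>w' c'. pure H H (scl H (g2 (mul K (mul K (j c) x) (s a))) b)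
         (sw2 CH w' (\<lambda>a' b'. scl H (g1 (mul K (mul K (j c') y) (s a'))) b'))))))"
      by (intro sw2_cong sw2_apply[where U=H and U'=HH and \<phi>="\<lambda>z. pure H H _ z"]) (simp_all add: fl)
    also have "\<dots> = sw2 CKd g (\<lambda>g1 g2. sw2 CH p (\<lambda>w c. sw2 CH w (\<lambda>a b. sw2 CH q (\<lambda>w' c'. sw2 CH w' (\<lambda>a' b'.
        pure H H (scl H (g2 (mul K (mul K (j c) x) (s a))) b) (scl H (g1 (mul K (mul K (j c') y) (s a'))) b'))))))"
      by (intro sw2_cong sw2_apply[where U=H and U'=HH and \<phi>="\<lambda>z. pure H H _ z"]) (simp_all add: fl)
    also have "\<dots> = sw2 CH p (\<lambda>w c. sw2 CKd g (\<lambda>g1 g2. sw2 CH w (\<lambda>a b. sw2 CH q (\<lambda>w' c'. sw2 CH w' (\<lambda>a' b'.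
        pure H H (scl H (g2 (mul K (mul K (j c) x) (s a))) b) (scl H (g1 (mul K (mul K (j c') y) (s a'))) b'))))))"
      by (rule sw2_swap)
    also have "\<dots> = sw2 CH p (\<lambda>w c. sw2 CH w (\<lambda>a b. sw2 CKd g (\<lambda>g1 g2. sw2 CH q (\<lambda>w' c'. sw2 CH w' (\<lambda>a' b'.
        pure H H (scl H (g2 (mul K (mul K (j c) x) (s a))) b) (scl H (g1 (mul K (mul K (j c') y) (s a'))) b'))))))"
      by (intro sw2_cong sw2_swap) simp_all
    also have "\<dots> = sw2 CH p (\<lambda>w c. sw2 CH w (\<lambda>a b. sw2 CH q (\<lambda>w' c'. sw2 CKd g (\<lambda>g1 g2. sw2 CH w' (\<lambda>a' b'.
        pure H H (scl H (g2 (mul K (mul K (j c) x) (s a))) b) (scl H (g1 (mul K (mul K (j c') y) (s a'))) b'))))))"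
      by (intro sw2_cong sw2_swap) simp_all
    also have "\<dots> = sw2 CH p (\<lambda>w c. sw2 CH w (\<lambda>a b. sw2 CH q (\<lambda>w' c'. sw2 CH w' (\<lambda>a' b'. sw2 CKd g (\<lambda>g1 g2.
        pure H H (scl H (g2 (mul K (mul K (j c) x) (s a))) b) (scl H (g1 (mul K (mul K (j c') y) (s a'))) b'))))))"
      by (intro sw2_cong sw2_swap) simp_all
    also have "\<dots> = sw2 CH p (\<lambda>w c. sw2 CH w (\<lambda>a b. sw2 CH q (\<lambda>w' c'. sw2 CH w' (\<lambda>a' b'. scl HH (sw2 CKd g (\<lambda>g1 g2.
        g1 (mul K (mul K (j c') y) (s a')) * g2 (mul K (mul K (j c) x) (s a)))) (pure H H b b')))))"
    proof (intro sw2_cong)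
      fix w c a b w' c' a' b' assume "w \<in> car CH" "c \<in> car CH" "a \<in> car CH" "b \<in> car CH" "w' \<in> car CH" "c' \<in> car CH" "a' \<in> car CH" "b' \<in> car CH"
      then have [simp]: "c \<in> car H" "a \<in> car H" "b \<in> car H" "c' \<in> car H" "a' \<in> car H" "b' \<in> car H" by simp_all
      have "sw2 CKd g (\<lambda>g1 g2. pure H H (scl H (g2 (mul K (mul K (j c) x) (s a))) b) (scl H (g1 (mul K (mul K (j c') y) (s a'))) b')) =
         sw2 CKd g (\<lambda>g1 g2. scl HH (g1 (mul K (mul K (j c') y) (s a')) * g2 (mul K (mul K (j c) x) (s a))) (pure H H b b'))"
        by (intro sw2_cong) (simp_all add: pure_scl)
      also have "\<dots> = scl HH (sw2 CKd g (\<lambda>g1 g2. g1 (mul K (mul K (j c') y) (s a')) * g2 (mul K (mul K (j c) x) (s a)))) (pure H H b b')"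
        by (rule sw2_apply[where U=field_vs and U'=HH and \<phi>="\<lambda>z. scl HH z (pure H H b b')", symmetric]) simp_all
      finally show "sw2 CKd g (\<lambda>g1 g2. pure H H (scl H (g2 (mul K (mul K (j c) x) (s a))) b) (scl H (g1 (mul K (mul K (j c') y) (s a'))) b')) = \<dots>" .
    qed simp_all
    also have "\<dots> = sw2 CH p (\<lambda>w c. sw2 CH w (\<lambda>a b. sw2 CH q (\<lambda>w' c'. sw2 CH w' (\<lambda>a' b'. \<Psi> a (mul K (s a') (j c)) c' b b'))))"
      by (intro sw2_cong) (simp_all add: \<Psi>_def mul_assoc)
    finally show "sw2 CKd g (\<lambda>g1 g2. pure H H (?P g2) (?Q g1)) = \<dots>" .
  qed simp_all
  also have "\<dots> = sw2 CH h (\<lambda>p q. sw2 CH p (\<lambda>w c. sw2 CH w (\<lambda>a b. sw2 CH q (\<lambda>a' r. sw2 CH r (\<lambda>b' c'.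
      \<Psi> a (mul K (s a') (j c)) c' b b')))))"
    by (intro sw2_cong coassoc[where U=HH]) simp_all
  also have "\<dots> = sw2 CH h (\<lambda>p q. sw2 CH p (\<lambda>w c. sw2 CH q (\<lambda>a' r. sw2 CH w (\<lambda>a b. sw2 CH r (\<lambda>b' c'.
      \<Psi> a (mul K (s a') (j c)) c' b b')))))"
    by (intro sw2_cong sw2_swap) simp_all
  also have "\<dots> = sw2 CH h (\<lambda>w r. sw2 CH w (\<lambda>a b. sw2 CH r (\<lambda>b' c'. \<Psi> a (uni K) c' b b')))"
    by (rule middle_cancel[where U=HH and F="\<lambda>w m r. sw2 CH w (\<lambda>a b. sw2 CH r (\<lambda>b' c'. \<Psi> a m c' b b'))"]) simp_all
  also have "\<dots> = sw2 CH h (\<lambda>w r. sw2 CH r (\<lambda>b' c'. sw2 CH w (\<lambda>a b. \<Psi> a (uni K) c' b b')))"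
    by (intro sw2_cong sw2_swap) simp_all
  finally show "E x y (cop CD (mD (iH h) (iV g))) = E x y (mm (R h) (L g))" using lhs by simp
qed simp_all


lemma cop_iV: "f \<in> car V \<Longrightarrow> t \<in> car TD \<Longrightarrow> cop CD (mD (iV f) t) = mm (L f) (cop CD t)"
proof -
  assume f [simp]: "f \<in> car V" and t: "t \<in> car TD"
  have "\<forall>t\<in>car TD. cop CD (mD (iV f) t) = mm (L f) (cop CD t)"
  proof (rule tens_ball_ext[where U=TT])
    fix g h assume [simp]: "g \<in> car V" "h \<in> car H"
    show "cop CD (mD (iV f) (pure V H g h)) = mm (L f) (cop CD (pure V H g h))"
      by (simp add: L_R[symmetric] L_mul mm_assoc)
  qed simp_all
  then show ?thesis using t by blast
qed

lemma cop_iH: "k \<in> car H \<Longrightarrow> t \<in> car TD \<Longrightarrow> cop CD (mD t (iH k)) = mm (cop CD t) (R k)"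
proof -
  assume k [simp]: "k \<in> car H" and t: "t \<in> car TD"
  have "\<forall>t\<in>car TD. cop CD (mD t (iH k)) = mm (cop CD t) (R k)"
  proof (rule tens_ball_ext[where U=TT])
    fix g h assume [simp]: "g \<in> car V" "h \<in> car H"
    show "cop CD (mD (pure V H g h) (iH k)) = mm (cop CD (pure V H g h)) (R k)"
      by (simp add: L_R[symmetric] R_mul mm_assoc)
  qed simp_all
  then show ?thesis using t by blast
qed

text \<open>
  Write \<open>(f # h)(g # k)\<close> as \<open>(f # 1) (\<epsilon> # h) (g # 1) (\<epsilon> # k)\<close>.  The outer factors are handled by
  \<open>cop_iV\<close> and \<open>cop_iH\<close>, the inner product by \<open>cop_commutation\<close>.
\<close>

lemma cop_mul:
  assumes t: "t \<in> car TD" and u: "u \<in> car TD"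
  shows "cop CD (mD t u) = mm (cop CD t) (cop CD u)"
proof -
  have 0: "cop CD (mD (pure V H f h) (pure V H g k)) = mm (cop CD (pure V H f h)) (cop CD (pure V H g k))"
    if [simp]: "f \<in> car V" "h \<in> car H" "g \<in> car V" "k \<in> car H" for f h g k
  proof -
    have "mD (pure V H f h) (pure V H g k) = mD (mD (iV f) (iH h)) (mD (iV g) (iH k))" by simp
    also have "\<dots> = mD (iV f) (mD (mD (iH h) (iV g)) (iH k))"
      by (simp add: mD_assoc del: mD_left mD_right)
    finally have "mD (pure V H f h) (pure V H g k) = mD (iV f) (mD (mD (iH h) (iV g)) (iH k))" .
    then show ?thesis
      by (simp add: cop_iV cop_iH cop_commutation mm_assoc L_R[symmetric] del: mD_left mD_right)
  qed
  have 1: "\<forall>t\<in>car TD. cop CD (mD t (pure V H g k)) = mm (cop CD t) (cop CD (pure V H g k))"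
    if [simp]: "g \<in> car V" "k \<in> car H" for g k
    by (rule tens_ball_ext[where U=TT]) (use 0 in simp_all)
  have "\<forall>u\<in>car TD. cop CD (mD t u) = mm (cop CD t) (cop CD u)"
    by (rule tens_ball_ext[where U=TT]) (use t 1 in simp_all)
  then show ?thesis using u by blast
qed

lemma cou_mul:
  assumes t: "t \<in> car TD" and u: "u \<in> car TD"
  shows "cou CD (mD t u) = cou CD t * cou CD u"
proof -
  have l: "lin TD field_vs (cou CD)" by simp
  have 0: "cou CD (mD (pure V H f h) (pure V H g k)) = cou CD (pure V H f h) * cou CD (pure V H g k)"
    if [simp]: "f \<in> car V" "h \<in> car H" "g \<in> car V" "k \<in> car H" for f h g k
  proof -
    have gl: "lin W field_vs (\<lambda>z. g (p z))" if "lin W K p" for W :: "('f, 'z::ab_group_add, 'y) vs_scheme" and p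
      using that by (rule dual_lin_comp[rotated]) simp
    have fe: "mV f q (uni K) = f (uni K) * q (uni K)" if "q \<in> car V" for q
      using that by (simp add: dual_alg_apply sw2_uni[where U=field_vs] dual_lin)
    have "cou CD (mD (pure V H f h) (pure V H g k)) =
        sw2 CH h (\<lambda>w h3. cou CD (sw2 CH w (\<lambda>h1 h2. pure V H (mV f (twist (j h3) (s h1) g)) (mul H h2 k))))"
      unfolding mD_pure[OF that(1,3,2,4)] by (rule sw2_apply[where U=TD, OF _ _ _ l]) simp_all
    also have "\<dots> = sw2 CH h (\<lambda>w h3. sw2 CH w (\<lambda>h1 h2. cou CD (pure V H (mV f (twist (j h3) (s h1) g)) (mul H h2 k))))"
      by (intro sw2_cong sw2_apply[where U=TD, OF _ _ _ l]) simp_all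
    also have "\<dots> = sw2 CH h (\<lambda>w h3. sw2 CH w (\<lambda>h1 h2. scl field_vs (bcou H h2) (f (uni K) * g (mul K (j h3) (s h1)) * bcou H k)))"
      by (intro sw2_cong) (simp_all add: fe)
    also have "\<dots> = sw2 CH h (\<lambda>w h3. f (uni K) * g (mul K (j h3) (s w)) * bcou H k)"
      by (intro sw2_cong counit(2)[where C=CH and U=field_vs, unfolded coalg_of_simps]) (simp_all add: gl)
    also have "\<dots> = f (uni K) * g (sw2 CH h (\<lambda>w h3. mul K (j h3) (s w))) * bcou H k"
      by (rule sw2_apply[where U=K and U'=field_vs and \<phi>="\<lambda>z. f (uni K) * g z * bcou H k", symmetric]) (simp_all add: gl dual_lin)
    also have "\<dots> = cou CD (pure V H f h) * cou CD (pure V H g k)"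
      by (simp add: s_j_cancel lin_scl[OF dual_lin[of g K]])
    finally show ?thesis .
  qed
  have 1: "\<forall>t\<in>car TD. cou CD (mD t (pure V H g k)) = cou CD t * cou CD (pure V H g k)"
    if [simp]: "g \<in> car V" "k \<in> car H" for g k
    by (rule tens_ball_ext[where U=field_vs]) (use 0 in simp_all)
  have "\<forall>u\<in>car TD. cou CD (mD t u) = cou CD t * cou CD u"
    by (rule tens_ball_ext[where U=field_vs]) (use t 1 in simp_all)
  then show ?thesis using u by blast
qed

subsection \<open>The antipode of \<open>K\<^sup>* \<otimes> H\<close>\<close>

text \<open>
  The inverse of the antipode of \<open>K\<^sup>*\<close> (see \<open>inv_ant_Kd\<close>), which is the antipode of \<open>K\<^sup>*\<^sup>c\<^sup>o\<^sup>p\<close>.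
\<close>

definition \<nu> where "\<nu> f = dual_map K (\<lambda>x. f (inv_ant K x))"

lemma \<nu>_simps [simp]: "f \<in> car V \<Longrightarrow> \<nu> f \<in> car V" "x \<in> car K \<Longrightarrow> \<nu> f x = f (inv_ant K x)"
  unfolding \<nu>_def by (auto intro!: dual_map_closed dual_lin_comp[of f K])

lemma \<nu>_lin [simp]: "lin W V p \<Longrightarrow> lin W V (\<lambda>x. \<nu> (p x))"
proof -
  have "lin V V \<nu>"
    unfolding lin_def[of V V]
  proof (intro conjI ballI allI)
    fix f c assume [simp]: "f \<in> car V"
    show "\<nu> f \<in> car V" by simp
    show "\<nu> (scl V c f) = scl V c (\<nu> f)" by (rule dual_ext[of _ K]) (simp_all add: scl_dual_vs)
    fix g assume [simp]: "g \<in> car V"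
    show "\<nu> (f + g) = \<nu> f + \<nu> g" by (rule dual_ext[of _ K]) simp_all
  qed
  then show "lin W V p \<Longrightarrow> lin W V (\<lambda>x. \<nu> (p x))" by (rule lin_comp)
qed

lemma inv_ant_Kd:
  assumes f [simp]: "f \<in> car V" shows "inv_ant Kd f = \<nu> f"
proof -
  have a: "ant Kd g x = g (ant K x)" if "x \<in> car K" for g x using that by simp
  have ac: "ant Kd g \<in> car V" if "g \<in> car V" for g
    using dual_map_closed[of K "\<lambda>x. g (ant K x)"] dual_lin_comp[OF that, of K "\<lambda>x. ant K x"] by simp
  have "inj_on (ant Kd) (car Kd)"
  proof (rule inj_onI)
    fix g g' assume "g \<in> car Kd" "g' \<in> car Kd" and eq: "ant Kd g = ant Kd g'"
    then have [simp]: "g \<in> car V" "g' \<in> car V" by simp_all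
    show "g = g'"
    proof (rule dual_ext[of _ K])
      fix x assume [simp]: "x \<in> car K"
      show "g x = g' x" using fun_cong[OF eq, of "inv_ant K x"] a[of "inv_ant K x" g] a[of "inv_ant K x" g'] by simp
    qed simp_all
  qed
  moreover have "ant Kd (\<nu> f) = f"
  proof (rule dual_ext[of _ K])
    show "ant Kd (\<nu> f) \<in> car V" by (rule ac) simp
    fix x assume "x \<in> car K"
    then show "ant Kd (\<nu> f) x = f x" using a[of x "\<nu> f"] by simp
  qed simp
  ultimately show ?thesis unfolding inv_ant_def by (intro inv_into_f_eq) simp_all
qed

definition Sd where "Sd t = tsum V H t (\<lambda>f h. mD (iH (ant H h)) (iV (\<nu> f)))"

lemma Sd_simps [simp]:
  "lin W TD p \<Longrightarrow> lin W TD (\<lambda>x. Sd (p x))" "t \<in> car TD \<Longrightarrow> Sd t \<in> car TD"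
  "f \<in> car V \<Longrightarrow> h \<in> car H \<Longrightarrow> Sd (pure V H f h) = mD (iH (ant H h)) (iV (\<nu> f))"
  by (simp_all add: Sd_def tsum_pure[where U=TD])

lemma \<nu>_antipode:
  assumes f [simp]: "f \<in> car V"
  shows "sw2 CKd f (\<lambda>f1 f2. mV (\<nu> f2) f1) = scl V (f (uni K)) e" "sw2 CKd f (\<lambda>f1 f2. mV f2 (\<nu> f1)) = scl V (f (uni K)) e"
proof -
  have fl: "lin W field_vs (\<lambda>z. f (p z))" if "lin W K p" for W :: "('f, 'z::ab_group_add, 'y) vs_scheme" and p
    using that by (rule dual_lin_comp[rotated]) simp
  have ft: "sw2 CK x (\<lambda>a b. f (p a b)) = f (sw2 CK x p)" if "x \<in> car K" "\<And>a b. a \<in> car K \<Longrightarrow> b \<in> car K \<Longrightarrow> p a b \<in> car K" for x p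
    using that by (intro sw2_apply[where U=K, OF _ _ _ dual_lin[OF f], symmetric]) simp_all
  show "sw2 CKd f (\<lambda>f1 f2. mV (\<nu> f2) f1) = scl V (f (uni K)) e"
  proof (rule dual_ext[of _ K])
    fix x assume [simp]: "x \<in> car K"
    have "sw2 CKd f (\<lambda>f1 f2. mV (\<nu> f2) f1) x = sw2 CKd f (\<lambda>f1 f2. mV (\<nu> f2) f1 x)"
      by (rule sw2_apply[where U=V and U'=field_vs and \<phi>="\<lambda>f. f x"]) simp_all
    also have "\<dots> = sw2 CKd f (\<lambda>f1 f2. sw2 CK x (\<lambda>a b. f1 b * f2 (inv_ant K a)))"
      by (intro sw2_cong, simp_all add: dual_alg_apply) (intro sw2_cong, simp_all)
    also have "\<dots> = sw2 CK x (\<lambda>a b. sw2 CKd f (\<lambda>f1 f2. f1 b * f2 (inv_ant K a)))" by (rule sw2_swap)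
    also have "\<dots> = sw2 CK x (\<lambda>a b. f (mul K b (inv_ant K a)))" by (intro sw2_cong) simp_all
    also have "\<dots> = f (sw2 CK x (\<lambda>a b. mul K b (inv_ant K a)))" by (rule ft) simp_all
    finally show "sw2 CKd f (\<lambda>f1 f2. mV (\<nu> f2) f1) x = scl V (f (uni K)) e x"
      by (simp add: inv_antipode[OF K] lin_scl[OF dual_lin[OF f]] scl_dual_vs mult.commute)
  qed simp_all
  show "sw2 CKd f (\<lambda>f1 f2. mV f2 (\<nu> f1)) = scl V (f (uni K)) e"
  proof (rule dual_ext[of _ K])
    fix x assume [simp]: "x \<in> car K"
    have "sw2 CKd f (\<lambda>f1 f2. mV f2 (\<nu> f1)) x = sw2 CKd f (\<lambda>f1 f2. mV f2 (\<nu> f1) x)"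
      by (rule sw2_apply[where U=V and U'=field_vs and \<phi>="\<lambda>f. f x"]) simp_all
    also have "\<dots> = sw2 CKd f (\<lambda>f1 f2. sw2 CK x (\<lambda>a b. f1 (inv_ant K b) * f2 a))"
      by (intro sw2_cong, simp_all add: dual_alg_apply) (intro sw2_cong, simp_all)
    also have "\<dots> = sw2 CK x (\<lambda>a b. sw2 CKd f (\<lambda>f1 f2. f1 (inv_ant K b) * f2 a))" by (rule sw2_swap)
    also have "\<dots> = sw2 CK x (\<lambda>a b. f (mul K (inv_ant K b) a))" by (intro sw2_cong) simp_all
    also have "\<dots> = f (sw2 CK x (\<lambda>a b. mul K (inv_ant K b) a))" by (rule ft) simp_all
    finally show "sw2 CKd f (\<lambda>f1 f2. mV f2 (\<nu> f1)) x = scl V (f (uni K)) e x"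
      by (simp add: inv_antipode[OF K] lin_scl[OF dual_lin[OF f]] scl_dual_vs mult.commute)
  qed simp_all
qed

lemma mD_scl: "t \<in> car TD \<Longrightarrow> u \<in> car TD \<Longrightarrow> mD (scl TD c t) u = scl TD c (mD t u)"
  "t \<in> car TD \<Longrightarrow> u \<in> car TD \<Longrightarrow> mD t (scl TD c u) = scl TD c (mD t u)"
  using mul_scl[of D0 t u c] by simp_all

text \<open>
  By associativity the product is \<open>\<Sum> (\<epsilon> # S(h\<^sub>(\<^sub>1\<^sub>))) (\<nu>(f\<^sub>(\<^sub>2\<^sub>)) f\<^sub>(\<^sub>1\<^sub>) # h\<^sub>(\<^sub>2\<^sub>))\<close>; the functionals
  collapse to a multiple of \<open>\<epsilon>\<close>, which leaves \<open>\<Sum> S(h\<^sub>(\<^sub>1\<^sub>)) h\<^sub>(\<^sub>2\<^sub>)\<close>.  In \<open>Sd_right\<close> the elements of \<open>H\<close>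
  meet first and the functionals second.
\<close>

lemma Sd_left:
  assumes t: "t \<in> car TD"
  shows "sw2 CD t (\<lambda>a b. mD (Sd a) b) = scl TD (cou CD t) (pure V H e (uni H))"
proof -
  have "\<forall>t\<in>car TD. sw2 CD t (\<lambda>a b. mD (Sd a) b) = scl TD (cou CD t) (pure V H e (uni H))"
  proof (rule tens_ball_ext[where U=TD])
    fix f h assume [simp]: "f \<in> car V" "h \<in> car H"
    have "sw2 CD (pure V H f h) (\<lambda>a b. mD (Sd a) b) =
        sw2 CKd f (\<lambda>f1 f2. sw2 CH h (\<lambda>h1 h2. mD (Sd (pure V H f2 h1)) (pure V H f1 h2)))"
      by (rule sw2_CD_pure[where U=TD]) simp_all
    also have "\<dots> = sw2 CKd f (\<lambda>f1 f2. sw2 CH h (\<lambda>h1 h2. mD (iH (ant H h1)) (pure V H (mV (\<nu> f2) f1) h2)))"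
      by (intro sw2_cong) (simp_all add: mD_assoc)
    also have "\<dots> = sw2 CH h (\<lambda>h1 h2. sw2 CKd f (\<lambda>f1 f2. mD (iH (ant H h1)) (pure V H (mV (\<nu> f2) f1) h2)))"
      by (rule sw2_swap)
    also have "\<dots> = sw2 CH h (\<lambda>h1 h2. mD (iH (ant H h1)) (pure V H (sw2 CKd f (\<lambda>f1 f2. mV (\<nu> f2) f1)) h2))"
      by (intro sw2_cong sw2_apply[where U=V and U'=TD and \<phi>="\<lambda>z. mD (iH _) (pure V H z _)", symmetric]) simp_all
    also have "\<dots> = sw2 CH h (\<lambda>h1 h2. pure V H (scl V (f (uni K)) e) (mul H (ant H h1) h2))"
      by (intro sw2_cong) (simp_all add: \<nu>_antipode pure_scl mD_scl)
    also have "\<dots> = pure V H (scl V (f (uni K)) e) (sw2 CH h (\<lambda>h1 h2. mul H (ant H h1) h2))"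
      by (rule sw2_apply[where U=H and U'=TD, symmetric]) simp_all
    finally show "sw2 CD (pure V H f h) (\<lambda>a b. mD (Sd a) b) = scl TD (cou CD (pure V H f h)) (pure V H e (uni H))"
      by (simp add: antipode[OF is_hopf_simps(2)] pure_scl mult.commute)
  qed simp_all
  then show ?thesis using t by blast
qed

lemma Sd_right:
  assumes t: "t \<in> car TD"
  shows "sw2 CD t (\<lambda>a b. mD a (Sd b)) = scl TD (cou CD t) (pure V H e (uni H))"
proof -
  have "\<forall>t\<in>car TD. sw2 CD t (\<lambda>a b. mD a (Sd b)) = scl TD (cou CD t) (pure V H e (uni H))"
  proof (rule tens_ball_ext[where U=TD])
    fix f h assume [simp]: "f \<in> car V" "h \<in> car H"
    have "sw2 CD (pure V H f h) (\<lambda>a b. mD a (Sd b)) =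
        sw2 CKd f (\<lambda>f1 f2. sw2 CH h (\<lambda>h1 h2. mD (pure V H f2 h1) (Sd (pure V H f1 h2))))"
      by (rule sw2_CD_pure[where U=TD]) simp_all
    also have "\<dots> = sw2 CKd f (\<lambda>f1 f2. sw2 CH h (\<lambda>h1 h2. mD (pure V H f2 (mul H h1 (ant H h2))) (iV (\<nu> f1))))"
      by (intro sw2_cong) (simp_all add: mD_assoc[symmetric])
    also have "\<dots> = sw2 CKd f (\<lambda>f1 f2. mD (pure V H f2 (sw2 CH h (\<lambda>h1 h2. mul H h1 (ant H h2)))) (iV (\<nu> f1)))"
      by (intro sw2_cong sw2_apply[where U=H and U'=TD and \<phi>="\<lambda>z. mD (pure V H _ z) (iV (\<nu> _))", symmetric]) simp_all
    also have "\<dots> = sw2 CKd f (\<lambda>f1 f2. pure V H (mV f2 (\<nu> f1)) (scl H (bcou H h) (uni H)))"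
      by (intro sw2_cong) (simp_all add: antipode[OF is_hopf_simps(2)] pure_scl mD_scl)
    also have "\<dots> = pure V H (sw2 CKd f (\<lambda>f1 f2. mV f2 (\<nu> f1))) (scl H (bcou H h) (uni H))"
      by (rule sw2_apply[where U=V and U'=TD and \<phi>="\<lambda>z. pure V H z (scl H (bcou H h) (uni H))", symmetric]) simp_all
    finally show "sw2 CD (pure V H f h) (\<lambda>a b. mD a (Sd b)) = scl TD (cou CD (pure V H f h)) (pure V H e (uni H))"
      by (simp add: \<nu>_antipode pure_scl mult.commute)
  qed simp_all
  then show ?thesis using t by blast
qed

text \<open>
  The operations of the left partial dual agree with these on the carrier, though their defining
  formulas differ.  So the Hopf algebra axioms, proved here, carry over to it.
\<close>

definition DD :: "('f, ('f, 'k \<Rightarrow> 'f, 'h) tensor) hopf" where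
  "DD = \<lparr>car = car TD, scl = scl TD, mul = mD, uni = pure V H e (uni H), bcop = cop CD, bcou = cou CD, ant = Sd\<rparr>"

lemma same_vs_DD: "same_vs DD TD"
  by (simp add: same_vs_def DD_def)
lemmas DD_cong [simp] = same_vs_cong[OF same_vs_DD]

lemma DD_simps [simp]: "mul DD = mD" "uni DD = pure V H e (uni H)" "bcop DD = cop CD" "bcou DD = cou CD" "ant DD = Sd"
  by (simp_all add: DD_def)

lemma coalg_of_DD [simp]: "coalg_of DD = CD"
  by (rule coalg.equality) simp_all

lemma DD_bialg: "is_bialg DD" and DD_antipode: "is_antipode DD Sd"
proof -
  have alg: "is_alg DD" by (subst is_alg_cong[of _ D0]) simp_all
  have tm: "mul (talg DD DD) = mm" by (simp add: talg_def fun_eq_iff)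
  show "is_bialg DD"
  proof (rule is_bialgI[OF alg])
    fix a b assume "a \<in> car DD" "b \<in> car DD"
    then have "a \<in> car TD" "b \<in> car TD" by simp_all
    then show "bcop DD (mul DD a b) = mul (talg DD DD) (bcop DD a) (bcop DD b)"
      "bcou DD (mul DD a b) = bcou DD a * bcou DD b" by (simp_all add: tm cop_mul cou_mul)
  next
    show "is_coalg (coalg_of DD)" by simp
    have eu: "e (uni K) = 1" by simp
    have "sw2 CKd e (\<lambda>f1 f2. pure V V f2 f1) = pure V V e e"
    proof (rule V2_ext)
      have "N e = sw2 CKd e (\<lambda>f1 f2. pure V V f2 f1)" by (simp add: N_def)
      then show "sw2 CKd e (\<lambda>f1 f2. pure V V f2 f1) \<in> car (tens V V)" by simp
      fix x y assume [simp]: "x \<in> car K" "y \<in> car K"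
      show "tsum V V (sw2 CKd e (\<lambda>f1 f2. pure V V f2 f1)) (\<lambda>u v. u x * v y) = tsum V V (pure V V e e) (\<lambda>u v. u x * v y)"
        using N_eval[of e x y] by (simp add: N_def tsum_pure[where U=field_vs] mult.commute)
    qed simp
    then have "L e = pure TD TD (iV e) (iV e)" using L_eq[of e] by (simp add: N_def)
    moreover have "R (uni H) = pure TD TD (iH (uni H)) (iH (uni H))" by (simp add: R_def sw2_uni[where U=TT])
    ultimately show "bcop DD (uni DD) = uni (talg DD DD)"
      using L_R[of e "uni H"] by simp
    show "bcou DD (uni DD) = 1" by simp
  qed
  show "is_antipode DD Sd"
    by (rule is_antipodeI) (simp_all add: Sd_left Sd_right)
qed


section \<open>Comultiplication and associator of the left partial dual\<close>

lemma gamma_simps [simp]: "x \<in> car K \<Longrightarrow> gamma x \<in> car T" "lin W K p \<Longrightarrow> lin W T (\<lambda>x. gamma (p x))"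
  unfolding gamma_eq by simp_all

lemma sw2_gamma:
  assumes "is_vs U" "x \<in> car K" "\<And>b. b \<in> car T \<Longrightarrow> lin T U (\<lambda>a. F a b)" "\<And>a. a \<in> car T \<Longrightarrow> lin T U (\<lambda>b. F a b)"
  shows "sw2 CA (gamma x) F = sw2 CK x (\<lambda>x1 x2. F (gamma x1) (gamma x2))"
proof -
  note [simp] = assms lin_comp[OF assms(3)] lin_comp[OF assms(4)]
  have "sw2 CA (gamma x) F = sw2 CK x (\<lambda>k1 k2. sw2 CH (uni H) (\<lambda>h1 h2. F (pure K H k1 h1) (pure K H k2 h2)))"
    unfolding gamma_eq by (rule sw2_thopf_pure[where U=U]) simp_all
  also have "\<dots> = sw2 CK x (\<lambda>x1 x2. F (gamma x1) (gamma x2))"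
    unfolding gamma_eq by (intro sw2_cong sw2_uni[where U=U]) simp_all
  finally show ?thesis .
qed

lemma zeta_gamma [simp]: "x \<in> car K \<Longrightarrow> zeta (gamma x) = scl H (bcou K x) (uni H)"
  by (simp add: gamma_eq)

text \<open>
  In \<open>\<zeta>(\<gamma>(x) \<leftharpoonup> p) = \<Sum> p(\<gamma>(x\<^sub>(\<^sub>1\<^sub>))) \<zeta>(\<gamma>(x\<^sub>(\<^sub>2\<^sub>)))\<close> the composite \<open>\<zeta> \<circ> \<gamma>\<close> is the counit.
\<close>

lemma zeta_harpoon:
  assumes [simp]: "x \<in> car K" and p: "p \<in> car (dual_vs T)"
  shows "zeta (harpoon_l A (gamma x) p) = scl H (p (gamma x)) (uni H)"
proof -
  have pl: "lin W field_vs (\<lambda>z. p (f z))" if "lin W T f" for W :: "('f, 'z::ab_group_add, 'y) vs_scheme" and f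
    by (rule dual_lin_comp[OF p that])
  note [simp] = pl dual_lin[OF p]
  have "zeta (harpoon_l A (gamma x) p) = zeta (sw2 CK x (\<lambda>x1 x2. scl T (p (gamma x1)) (gamma x2)))"
    unfolding harpoon_l_def by (simp add: sw2_gamma[where U=T])
  also have "\<dots> = sw2 CK x (\<lambda>x1 x2. zeta (scl T (p (gamma x1)) (gamma x2)))"
    by (rule sw2_apply[where U=T and U'=H]) simp_all
  also have "\<dots> = sw2 CK x (\<lambda>x1 x2. scl H (bcou K x2) (scl H (p (gamma x1)) (uni H)))"
    by (intro sw2_cong) (simp_all add: lin_scl[OF zeta_lin(1)[OF lin_ident]] mult.commute)
  also have "\<dots> = scl H (p (gamma x)) (uni H)"
    by (rule counit(2)[where C=CK and U=H, simplified]) simp_all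
  finally show ?thesis .
qed

context
  fixes X :: "'k set"
  assumes X: "is_basis K X"
begin

lemma finX [simp]: "finite X"
  using basis_finite[OF _ K(2) X] by simp

lemma X_car [simp]: "x \<in> X \<Longrightarrow> x \<in> car K"
  using basis_car[OF _ X] by simp

lemma coord_V [simp]: "coord K X x \<in> car V"
  using coord_dual[OF _ X] by simp

lemma sum_counit_coord: "(\<Sum>x\<in>X. scl V (bcou K x) (coord K X x)) = e"
proof -
  have "(\<Sum>x\<in>X. scl V (bcou K x) (coord K X x)) = (\<Sum>x\<in>X. scl V (e x) (coord K X x))"
    by (intro sum.cong) simp_all
  then show ?thesis using dual_basis_sum[OF _ X finX, of e] by simp
qed

text \<open>
  By \<open>zeta_harpoon\<close> the sum is \<open>\<Sum> p(\<gamma>(x)) g \<otimes> x\<^sup>*\<close> over the basis and the dual coaction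
  \<open>\<Sum> g \<otimes> p\<close> of \<open>f\<close>.  Its value at \<open>u \<otimes> v\<close> is \<open>\<Sum> f(u \<triangleleft> \<gamma>(x)) x\<^sup>*(v) = f(v u)\<close>, since \<open>\<gamma>(x)\<close> acts by
  left multiplication with \<open>x\<close>.  The reversed order of \<open>u\<close> and \<open>v\<close> is the origin of the co-opposite.
\<close>

lemma copL:
  assumes f [simp]: "f \<in> car V"
  shows "tsum V (dual_vs T) (dual_coaction A CK act f) (\<lambda>g p. \<Sum>x\<in>X.
      pure TD TD (pure V H g (zeta (harpoon_l A (gamma x) p))) (pure V H (coord K X x) (uni H))) = L f"
proof -
  let ?W = "dual_vs T" and ?VV = "tens V V"
  have c [simp]: "dual_coaction A CK act f \<in> car (tens V ?W)"
    using sp.coaction_form(1)[of f] by simp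
  have ce: "tsum V ?W (dual_coaction A CK act f) (\<lambda>g p. g x * p a) = f (act x a)" if "x \<in> car K" "a \<in> car T" for x a
    using sp.coaction_form(2)[of f x a] that by simp
  define M where "M = tsum V ?W (dual_coaction A CK act f) (\<lambda>g p. \<Sum>x\<in>X. pure V V (scl V (p (gamma x)) g) (coord K X x))"
  have pl [simp]: "lin ?W field_vs (\<lambda>p. p a)" for a by (rule lin_eval)
  have M [simp]: "M \<in> car ?VV" unfolding M_def by simp
  have "tsum V ?W (dual_coaction A CK act f) (\<lambda>g p. \<Sum>x\<in>X.
      pure TD TD (pure V H g (zeta (harpoon_l A (gamma x) p))) (pure V H (coord K X x) (uni H))) =
    tsum V ?W (dual_coaction A CK act f) (\<lambda>g p. \<Theta> (\<Sum>x\<in>X. pure V V (scl V (p (gamma x)) g) (coord K X x)))"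
    by (intro tsum_cong) (simp_all add: lin_sum[OF _ \<Theta>_lin] lin_scl[OF \<Theta>_lin] zeta_harpoon pure_scl)
  also have "\<dots> = \<Theta> M"
    unfolding M_def by (rule tsum_lin_apply[where U="?VV", OF _ _ _ \<Theta>_lin, symmetric]) simp_all
  also have "\<Theta> M = \<Theta> (N f)"
  proof (rule arg_cong[where f=\<Theta>], rule V2_ext)
    fix u v assume [simp]: "u \<in> car K" "v \<in> car K"
    let ?\<phi> = "\<lambda>t. tsum V V t (\<lambda>a b. a u * b v)"
    have l: "lin ?VV field_vs ?\<phi>" by simp
    have "?\<phi> M = tsum V ?W (dual_coaction A CK act f) (\<lambda>g p. ?\<phi> (\<Sum>x\<in>X. pure V V (scl V (p (gamma x)) g) (coord K X x)))"
      unfolding M_def by (rule tsum_lin_apply[where U="?VV", OF _ _ _ l]) simp_all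
    also have "\<dots> = tsum V ?W (dual_coaction A CK act f) (\<lambda>g p. \<Sum>x\<in>X. coord K X x v * (g u * p (gamma x)))"
      by (intro tsum_cong) (simp_all add: lin_sum[OF _ l] tsum_pure[where U=field_vs] scl_dual_vs ac_simps)
    also have "\<dots> = (\<Sum>x\<in>X. tsum V ?W (dual_coaction A CK act f) (\<lambda>g p. coord K X x v * (g u * p (gamma x))))"
      by (rule tsum_sum)
    also have "\<dots> = (\<Sum>x\<in>X. coord K X x v * tsum V ?W (dual_coaction A CK act f) (\<lambda>g p. g u * p (gamma x)))"
      by (intro sum.cong tsum_lin_apply[where U=field_vs and U'=field_vs and \<phi>="\<lambda>z. _ * z", symmetric]) simp_all
    also have "\<dots> = (\<Sum>x\<in>X. coord K X x v * f (mul K x u))"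
      by (intro sum.cong) (simp_all add: ce, simp add: gamma_eq)
    also have "\<dots> = f (mul K v u)"
      using dual_coord_sum[OF _ X finX, of "\<lambda>x. f (mul K x u)" v] dual_lin_comp[OF f, of K "\<lambda>x. mul K x u"] by simp
    finally show "?\<phi> M = ?\<phi> (N f)" by (simp add: N_eval)
  qed simp_all
  finally show ?thesis by (simp add: L_eq)
qed

text \<open>
  Here \<open>\<zeta>(\<gamma>(x) (j(h\<^sub>(\<^sub>3\<^sub>)) \<otimes> h\<^sub>(\<^sub>1\<^sub>))) = \<epsilon>(x) \<epsilon>(h\<^sub>(\<^sub>3\<^sub>)) h\<^sub>(\<^sub>1\<^sub>)\<close>, and \<open>\<Sum> \<epsilon>(x) x\<^sup>* = \<epsilon>\<close>.
\<close>

lemma copR: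
  assumes h [simp]: "h \<in> car H"
  shows "tsum T H (coact h) (\<lambda>b1 b2. \<Sum>x\<in>X.
      pure TD TD (iH (zeta (mA (gamma x) b1))) (pure V H (coord K X x) b2)) = R h"
proof -
  have "tsum T H (coact h) (\<lambda>b1 b2. \<Sum>x\<in>X. pure TD TD (iH (zeta (mA (gamma x) b1))) (pure V H (coord K X x) b2)) =
     sw2 CH h (\<lambda>w h3. sw2 CH w (\<lambda>h1 h2. \<Sum>x\<in>X. pure TD TD (iH (zeta (mA (gamma x) (pure K H (j h3) h1)))) (pure V H (coord K X x) h2)))"
    by (rule tsum_coact[where U=TT]) simp_all
  also have "\<dots> = sw2 CH h (\<lambda>w h3. sw2 CH w (\<lambda>h1 h2. scl TT (bcou H h3) (pure TD TD (iH h1) (iH h2))))"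
  proof (intro sw2_cong)
    fix w h3 h1 h2 assume "h3 \<in> car CH" "h1 \<in> car CH" "h2 \<in> car CH"
    then have [simp]: "h3 \<in> car H" "h1 \<in> car H" "h2 \<in> car H" by simp_all
    let ?g = "\<lambda>z. scl TT (bcou H h3) (pure TD TD (iH h1) (pure V H z h2))"
    have l: "lin V TT ?g" by simp
    have "(\<Sum>x\<in>X. pure TD TD (iH (zeta (mA (gamma x) (pure K H (j h3) h1)))) (pure V H (coord K X x) h2)) =
        (\<Sum>x\<in>X. ?g (scl V (bcou K x) (coord K X x)))"
      by (intro sum.cong) (simp_all add: zeta_mul mul_scl pure_scl mult.commute)
    also have "\<dots> = ?g (\<Sum>x\<in>X. scl V (bcou K x) (coord K X x))"
      by (rule lin_sum[OF _ l, symmetric]) simp_all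
    finally show "(\<Sum>x\<in>X. pure TD TD (iH (zeta (mA (gamma x) (pure K H (j h3) h1)))) (pure V H (coord K X x) h2)) =
        scl TT (bcou H h3) (pure TD TD (iH h1) (iH h2))" by (simp only: sum_counit_coord)
  qed simp_all
  also have "\<dots> = sw2 CH h (\<lambda>w h3. scl TT (bcou H h3) (R w))"
    unfolding R_def by (intro sw2_cong sw2_apply[where U=TT and U'=TT, symmetric]) simp_all
  also have "\<dots> = R h"
  proof -
    have "lin H TT (\<lambda>w. R w)" unfolding R_def by simp
    then show ?thesis using counit(2)[of CH TT h R] by simp
  qed
  finally show ?thesis .
qed

abbreviation T3 where "T3 \<equiv> tens TD TT"

text \<open>
  The sum is the inverse of the associator.  Since \<open>\<zeta>\<close> is multiplicative and \<open>\<zeta> \<circ> \<gamma> = \<epsilon>\<close>, only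
  \<open>\<Sum> \<epsilon>(x) x\<^sup>* = \<epsilon>\<close> remains in each variable.
\<close>

lemma Phi_one:
  "(\<Sum>x\<in>X. \<Sum>y\<in>X. sw2 CA (gamma y) (\<lambda>a1 a2. pure TD TT (iH (zeta (mA (gamma x) a1)))
      (pure TD TD (pure V H (coord K X x) (zeta a2)) (pure V H (coord K X y) (uni H))))) =
    pure TD TT (iV e) (pure TD TD (iV e) (iV e))"
proof -
  let ?P = "\<lambda>u v. pure TD TT (iV e) (pure TD TD (iV u) (iV v))"
  have 1: "sw2 CA (gamma y) (\<lambda>a1 a2. pure TD TT (iH (zeta (mA (gamma x) a1)))
      (pure TD TD (pure V H (coord K X x) (zeta a2)) (pure V H (coord K X y) (uni H)))) =
     ?P (scl V (bcou K x) (coord K X x)) (scl V (bcou K y) (coord K X y))"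
    if xy [simp]: "x \<in> X" "y \<in> X" for x y
  proof -
    have "sw2 CA (gamma y) (\<lambda>a1 a2. pure TD TT (iH (zeta (mA (gamma x) a1)))
        (pure TD TD (pure V H (coord K X x) (zeta a2)) (pure V H (coord K X y) (uni H)))) =
      sw2 CK y (\<lambda>y1 y2. pure TD TT (iH (zeta (mA (gamma x) (gamma y1))))
        (pure TD TD (pure V H (coord K X x) (zeta (gamma y2))) (pure V H (coord K X y) (uni H))))"
      by (rule sw2_gamma[where U=T3]) simp_all
    also have "\<dots> = sw2 CK y (\<lambda>y1 y2. scl T3 (bcou K y1) (scl T3 (bcou K y2 * bcou K x) (?P (coord K X x) (coord K X y))))"
      by (intro sw2_cong) (simp_all add: zeta_mul mul_scl pure_scl ac_simps)
    also have "\<dots> = scl T3 (bcou K y * bcou K x) (?P (coord K X x) (coord K X y))"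
      by (rule counit(1)[where C=CK and U=T3, simplified]) simp_all
    finally show ?thesis by (simp add: pure_scl mult.commute)
  qed
  have l1: "lin V T3 (\<lambda>v. ?P u v)" if "u \<in> car V" for u using that by simp
  have l2: "lin V T3 (\<lambda>u. ?P u e)" by simp
  have "(\<Sum>x\<in>X. \<Sum>y\<in>X. ?P (scl V (bcou K x) (coord K X x)) (scl V (bcou K y) (coord K X y))) =
      (\<Sum>x\<in>X. ?P (scl V (bcou K x) (coord K X x)) (\<Sum>y\<in>X. scl V (bcou K y) (coord K X y)))"
    by (intro sum.cong lin_sum[OF _ l1, symmetric]) simp_all
  also have "\<dots> = (\<Sum>x\<in>X. ?P (scl V (bcou K x) (coord K X x)) e)"
    by (simp only: sum_counit_coord)
  also have "\<dots> = ?P (\<Sum>x\<in>X. scl V (bcou K x) (coord K X x)) e"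
    by (rule lin_sum[OF _ l2, symmetric]) simp_all
  finally show ?thesis using 1 by (simp add: sum_counit_coord)
qed

abbreviation Dq where "Dq \<equiv> left_partial_dual A B coact CK act iota proj zeta gamma X"

lemma same_vs_Dq: "same_vs Dq TD"
  by (simp add: same_vs_def left_partial_dual_def Let_def)
lemmas Dq_cong [simp] = same_vs_cong[OF same_vs_Dq]

lemma Dq_simps: "mul Dq = mD" "uni Dq = pure V H e (uni H)"
  by (simp_all add: left_partial_dual_def Let_def)

lemma bcop_Dq: "t \<in> car TD \<Longrightarrow> bcop Dq t = cop CD t"
proof -
  assume t: "t \<in> car TD"
  have "bcop Dq t = tsum V H t (\<lambda>f h. mm
      (tsum V (dual_vs T) (dual_coaction A CK act f) (\<lambda>g p. \<Sum>x\<in>X.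
        pure TD TD (pure V H g (zeta (harpoon_l A (gamma x) p))) (pure V H (coord K X x) (uni H))))
      (tsum T H (coact h) (\<lambda>b1 b2. \<Sum>x\<in>X.
        pure TD TD (iH (zeta (mA (gamma x) b1))) (pure V H (coord K X x) b2))))"
    by (simp add: left_partial_dual_def Let_def)
  also have "\<dots> = tsum V H t (\<lambda>f h. cop CD (pure V H f h))"
    using t by (intro tsum_cong) (simp_all add: copL copR L_R)
  also have "\<dots> = cop CD (tsum V H t (pure V H))"
    using t by (intro tsum_lin_apply[where U=TD and U'=TT, symmetric]) simp_all
  finally show ?thesis using t by (simp add: tsum_self)
qed

lemma bcou_Dq: "t \<in> car TD \<Longrightarrow> bcou Dq t = cou CD t"
proof -
  assume t: "t \<in> car TD"
  have "bcou Dq t = tsum V H t (\<lambda>f h. f (proj (pure K H (uni K) (uni H))) * bcou A (iota h))"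
    by (simp add: left_partial_dual_def Let_def)
  also have "\<dots> = tsum V H t (\<lambda>f h. cou CD (pure V H f h))"
    using t by (intro tsum_cong) (simp_all add: bcop_sys_A)
  also have "\<dots> = cou CD (tsum V H t (pure V H))"
    using t by (intro tsum_lin_apply[where U=TD and U'=field_vs, symmetric]) simp_all
  finally show ?thesis using t by (simp add: tsum_self)
qed

lemma talg_Dq: "talg Dq Z = talg D0 Z" "talg Z Dq = talg Z D0"
  by (simp_all add: talg_def Dq_simps)

lemma assoc_Dq: "trivial_associator Dq"
proof -
  let ?D3 = "talg D0 (talg D0 D0)"
  define u where "u = pure TD TT (iV e) (pure TD TD (iV e) (iV e))"
  have u: "u = uni ?D3" "u \<in> car T3" by (simp_all add: u_def)
  have "associator Dq = (THE \<Psi>. \<Psi> \<in> car ?D3 \<and> mul ?D3 u \<Psi> = uni ?D3 \<and> mul ?D3 \<Psi> u = uni ?D3)"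
    unfolding u_def Phi_one[symmetric] by (simp add: left_partial_dual_def Let_def)
  also have "\<dots> = u"
  proof (rule the_equality)
    have A: "is_alg ?D3" by simp
    show "u \<in> car ?D3 \<and> mul ?D3 u u = uni ?D3 \<and> mul ?D3 u u = uni ?D3"
      using is_alg_simps(2,3)[OF A] u by simp
    fix \<Psi> assume "\<Psi> \<in> car ?D3 \<and> mul ?D3 u \<Psi> = uni ?D3 \<and> mul ?D3 \<Psi> u = uni ?D3"
    then show "\<Psi> = u" using is_alg_simps(3)[OF A, of \<Psi>] u(1) by simp
  qed
  finally show ?thesis unfolding trivial_associator_def talg_Dq using u by simp
qed

lemma Dq_bialg: "is_bialg Dq"
  by (rule bialg_transfer[OF DD_bialg]) (simp_all add: Dq_simps bcop_Dq bcou_Dq)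

text \<open>
  The antipode of the partial dual is the unique one that vanishes outside the carrier.
\<close>

definition Sn where "Sn t = (if t \<in> car TD then Sd t else 0)"

lemma Dq_antipode: "is_antipode Dq Sn"
  by (rule antipode_transfer[OF DD_bialg DD_antipode]) (simp_all add: Dq_simps bcop_Dq bcou_Dq Sn_def)

abbreviation Dh where "Dh \<equiv> hopf_of_quasi Dq"

lemma Dh_simps: "mul Dh = mD" "uni Dh = pure V H e (uni H)" "bcop Dh = bcop Dq" "bcou Dh = bcou Dq" "ant Dh = Sn"
proof -
  have "(THE S. is_antipode Dq S \<and> (\<forall>x. x \<notin> car Dq \<longrightarrow> S x = 0)) = Sn"
  proof (rule the_equality)
    show "is_antipode Dq Sn \<and> (\<forall>x. x \<notin> car Dq \<longrightarrow> Sn x = 0)" using Dq_antipode by (simp add: Sn_def)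
    fix S assume S: "is_antipode Dq S \<and> (\<forall>x. x \<notin> car Dq \<longrightarrow> S x = 0)"
    show "S = Sn"
    proof
      fix x show "S x = Sn x"
        using antipode_unique[OF Dq_bialg, of S Sn x] S Dq_antipode by (cases "x \<in> car TD") (simp_all add: Sn_def)
    qed
  qed
  then show "ant Dh = Sn" by (simp add: hopf_of_quasi_def)
qed (simp_all add: hopf_of_quasi_def Dq_simps)

lemma same_vs_Dh: "same_vs Dh TD"
proof -
  have "same_vs Dh Dq" by (simp add: same_vs_def hopf_of_quasi_def)
  then show ?thesis using same_vs_Dq by (simp add: same_vs_def)
qed
lemmas Dh_cong [simp] = same_vs_cong[OF same_vs_Dh]

lemma Dh_hopf: "is_hopf Dh"
proof -
  have "is_bialg Dh"
    by (rule bialg_transfer[OF DD_bialg]) (simp_all add: Dh_simps bcop_Dq bcou_Dq)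
  moreover have "is_antipode Dh Sn"
    by (rule antipode_transfer[OF DD_bialg DD_antipode]) (simp_all add: Dh_simps bcop_Dq bcou_Dq Sn_def)
  ultimately show ?thesis unfolding is_hopf_def Dh_simps by simp
qed


section \<open>Comparison with the quantum double\<close>

text \<open>
  Evaluated at \<open>x\<close>, the sum is \<open>\<Sum> q\<^sub>(\<^sub>1\<^sub>)(a) q\<^sub>(\<^sub>2\<^sub>)(x) q\<^sub>(\<^sub>3\<^sub>)(b) = q(a x b)\<close>.
\<close>

lemma sw3_twist:
  assumes [simp]: "q \<in> car V" "a \<in> car K" "b \<in> car K"
  shows "sw2 CKd q (\<lambda>r q3. sw2 CKd r (\<lambda>q1 q2. scl V (q3 b * q1 a) q2)) = twist a b q"
proof (rule dual_ext[of _ K])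
  fix x assume [simp]: "x \<in> car K"
  have "sw2 CKd q (\<lambda>r q3. sw2 CKd r (\<lambda>q1 q2. scl V (q3 b * q1 a) q2)) x =
      sw2 CKd q (\<lambda>r q3. sw2 CKd r (\<lambda>q1 q2. scl V (q3 b * q1 a) q2) x)"
    by (rule sw2_apply[where U=V and U'=field_vs and \<phi>="\<lambda>f. f x"]) simp_all
  also have "\<dots> = sw2 CKd q (\<lambda>r q3. sw2 CKd r (\<lambda>q1 q2. scl V (q3 b * q1 a) q2 x))"
    by (intro sw2_cong sw2_apply[where U=V and U'=field_vs and \<phi>="\<lambda>f. f x"]) simp_all
  also have "\<dots> = sw2 CKd q (\<lambda>r q3. sw2 CKd r (\<lambda>q1 q2. q3 b * (q1 a * q2 x)))"
    by (intro sw2_cong) (simp_all add: scl_dual_vs)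
  also have "\<dots> = sw2 CKd q (\<lambda>r q3. q3 b * sw2 CKd r (\<lambda>q1 q2. q1 a * q2 x))"
    by (intro sw2_cong sw2_apply[where U=field_vs and U'=field_vs and \<phi>="\<lambda>z. _ * z", symmetric]) simp_all
  also have "\<dots> = sw2 CKd q (\<lambda>r q3. q3 b * r (mul K a x))" by (intro sw2_cong) simp_all
  also have "\<dots> = twist a b q x" by simp
  finally show "sw2 CKd q (\<lambda>r q3. sw2 CKd r (\<lambda>q1 q2. scl V (q3 b * q1 a) q2)) x = twist a b q x" .
qed simp_all

text \<open>
  The pairings are \<open>\<sigma>(q\<^sub>(\<^sub>3\<^sub>), h\<^sub>(\<^sub>1\<^sub>)) = q\<^sub>(\<^sub>3\<^sub>)(s(h\<^sub>(\<^sub>1\<^sub>)))\<close> and \<open>\<sigma>(q\<^sub>(\<^sub>1\<^sub>), S\<^sup>-\<^sup>1(h\<^sub>(\<^sub>3\<^sub>))) = q\<^sub>(\<^sub>1\<^sub>)(j(h\<^sub>(\<^sub>3\<^sub>)))\<close>.  Once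
  the sum over \<open>h\<close> is outermost, \<open>sw3_twist\<close> recombines \<open>q\<close> into the functional that appears in the
  smash product.
\<close>

lemma double_mul_pure:
  assumes [simp]: "p \<in> car V" "q \<in> car V" "h \<in> car H" "k \<in> car H"
  shows "sw3 CKd q (\<lambda>q1 q2 q3. sw3 CH h (\<lambda>h1 h2 h3. scl TD (\<sigma> q3 h1 * \<sigma> q1 (inv_ant H h3))
           (pure V H (mV p q2) (mul H h2 k)))) = mD (pure V H p h) (pure V H q k)"
proof -
  have "sw3 CKd q (\<lambda>q1 q2 q3. sw3 CH h (\<lambda>h1 h2 h3. scl TD (\<sigma> q3 h1 * \<sigma> q1 (inv_ant H h3))
           (pure V H (mV p q2) (mul H h2 k)))) =
      sw2 CKd q (\<lambda>r q3. sw2 CKd r (\<lambda>q1 q2. sw2 CH h (\<lambda>w h3. sw2 CH w (\<lambda>h1 h2.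
         pure V H (mV p (scl V (q3 (s h1) * q1 (j h3)) q2)) (mul H h2 k)))))"
    unfolding sw3_def
  proof (intro sw2_cong)
    fix r q3 q1 q2 w h3 h1 h2
    assume "q3 \<in> car CKd" "q1 \<in> car CKd" "q2 \<in> car CKd" "h3 \<in> car CH" "h1 \<in> car CH" "h2 \<in> car CH"
    then have [simp]: "q3 \<in> car V" "q1 \<in> car V" "q2 \<in> car V" "h3 \<in> car H" "h1 \<in> car H" "h2 \<in> car H" by simp_all
    have "mV p (scl V c q2) = scl V c (mV p q2)" for c using mul_scl(2)[of "dual_alg CK" p q2 c] by simp
    then show "scl TD (\<sigma> q3 h1 * \<sigma> q1 (inv_ant H h3)) (pure V H (mV p q2) (mul H h2 k)) =
        pure V H (mV p (scl V (q3 (s h1) * q1 (j h3)) q2)) (mul H h2 k)"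
      by (simp add: pure_scl s_props j_def)
  qed simp_all
  also have "\<dots> = sw2 CKd q (\<lambda>r q3. sw2 CH h (\<lambda>w h3. sw2 CKd r (\<lambda>q1 q2. sw2 CH w (\<lambda>h1 h2.
         pure V H (mV p (scl V (q3 (s h1) * q1 (j h3)) q2)) (mul H h2 k)))))"
    by (intro sw2_cong sw2_swap) simp_all
  also have "\<dots> = sw2 CKd q (\<lambda>r q3. sw2 CH h (\<lambda>w h3. sw2 CH w (\<lambda>h1 h2. sw2 CKd r (\<lambda>q1 q2.
         pure V H (mV p (scl V (q3 (s h1) * q1 (j h3)) q2)) (mul H h2 k)))))"
    by (intro sw2_cong sw2_swap) simp_all
  also have "\<dots> = sw2 CH h (\<lambda>w h3. sw2 CKd q (\<lambda>r q3. sw2 CH w (\<lambda>h1 h2. sw2 CKd r (\<lambda>q1 q2.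
         pure V H (mV p (scl V (q3 (s h1) * q1 (j h3)) q2)) (mul H h2 k)))))"
    by (rule sw2_swap)
  also have "\<dots> = sw2 CH h (\<lambda>w h3. sw2 CH w (\<lambda>h1 h2. sw2 CKd q (\<lambda>r q3. sw2 CKd r (\<lambda>q1 q2.
         pure V H (mV p (scl V (q3 (s h1) * q1 (j h3)) q2)) (mul H h2 k)))))"
    by (intro sw2_cong sw2_swap) simp_all
  also have "\<dots> = sw2 CH h (\<lambda>w h3. sw2 CH w (\<lambda>h1 h2. sw2 CKd q (\<lambda>r q3.
         pure V H (mV p (sw2 CKd r (\<lambda>q1 q2. scl V (q3 (s h1) * q1 (j h3)) q2))) (mul H h2 k))))"
    by (intro sw2_cong sw2_apply[where U=V and U'=TD and \<phi>="\<lambda>z. pure V H (mV p z) _", symmetric]) simp_all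
  also have "\<dots> = sw2 CH h (\<lambda>w h3. sw2 CH w (\<lambda>h1 h2.
         pure V H (mV p (sw2 CKd q (\<lambda>r q3. sw2 CKd r (\<lambda>q1 q2. scl V (q3 (s h1) * q1 (j h3)) q2)))) (mul H h2 k)))"
    by (intro sw2_cong sw2_apply[where U=V and U'=TD and \<phi>="\<lambda>z. pure V H (mV p z) _", symmetric]) simp_all
  also have "\<dots> = mD (pure V H p h) (pure V H q k)"
    unfolding mD_pure[OF assms] by (intro sw2_cong) (simp_all add: sw3_twist)
  finally show ?thesis .
qed

lemma double_mul_eq:
  assumes [simp]: "t \<in> car TD" "u \<in> car TD"
  shows "double_mul K H \<sigma> t u = mD t u"
proof -
  have "double_mul K H \<sigma> t u = tsum V H t (\<lambda>p h. tsum V H u (\<lambda>q k. mD (pure V H p h) (pure V H q k)))"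
    unfolding double_mul_def Let_def by (simp add: double_mul_pure cong: tsum_cong) (intro tsum_cong double_mul_pure; simp)
  also have "\<dots> = tsum V H t (\<lambda>p h. mD (pure V H p h) (tsum V H u (pure V H)))"
    by (intro tsum_cong tsum_lin_apply[where U=TD and U'=TD, symmetric]) simp_all
  also have "\<dots> = mD (tsum V H t (pure V H)) (tsum V H u (pure V H))"
    by (rule tsum_lin_apply[where U=TD and U'=TD and \<phi>="\<lambda>z. mD z (tsum V H u (pure V H))", symmetric]) simp_all
  finally show ?thesis by (simp add: tsum_self)
qed

lemma Dh_double: "same_hopf Dh (quantum_double K H \<sigma>)"
  unfolding same_hopf_def
proof (intro conjI ballI allI)
  let ?Q = "quantum_double K H \<sigma>"
  show "car Dh = car ?Q" "scl Dh c x = scl ?Q c x" "uni Dh = uni ?Q" for c x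
    by (simp_all add: quantum_double_def Let_def Dh_simps)
  fix t assume "t \<in> car Dh"
  then have t [simp]: "t \<in> car TD" by simp
  show "mul Dh t u = mul ?Q t u" if "u \<in> car Dh" for u
    using that by (simp add: quantum_double_def Let_def Dh_simps double_mul_eq)
  have "bcop ?Q t = tsum V H t (\<lambda>p h. sw2 CKd p (\<lambda>p1 p2. sw2 CH h (\<lambda>h1 h2. pure TD TD (pure V H p2 h1) (pure V H p1 h2))))"
    by (simp add: quantum_double_def Let_def)
  also have "\<dots> = tsum V H t (\<lambda>f h. cop CD (pure V H f h))"
    by (intro tsum_cong cop_CD_pure[symmetric]) simp_all
  also have "\<dots> = cop CD (tsum V H t (pure V H))"
    by (intro tsum_lin_apply[where U=TD and U'=TT, symmetric]) simp_all
  finally show "bcop Dh t = bcop ?Q t" by (simp add: Dh_simps bcop_Dq tsum_self)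
  have "bcou ?Q t = tsum V H t (\<lambda>p h. p (uni K) * bcou H h)"
    by (simp add: quantum_double_def Let_def)
  also have "\<dots> = tsum V H t (\<lambda>f h. cou CD (pure V H f h))"
    by (intro tsum_cong) simp_all
  also have "\<dots> = cou CD (tsum V H t (pure V H))"
    by (intro tsum_lin_apply[where U=TD and U'=field_vs, symmetric]) simp_all
  finally show "bcou Dh t = bcou ?Q t" by (simp add: Dh_simps bcou_Dq tsum_self)
  have "ant ?Q t = tsum V H t (\<lambda>p h. double_mul K H \<sigma> (pure V H e (ant H h)) (pure V H (inv_ant Kd p) (uni H)))"
    by (simp add: quantum_double_def Let_def)
  also have "\<dots> = tsum V H t (\<lambda>p h. mD (iH (ant H h)) (iV (\<nu> p)))"
    by (intro tsum_cong) (simp_all add: inv_ant_Kd double_mul_eq)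
  finally show "ant Dh t = ant ?Q t" by (simp add: Dh_simps Sn_def Sd_def)
qed

end

end

theorem theorem3p3:
  fixes H :: "('f::field, 'h::ab_group_add) hopf"
    and K :: "('f, 'k::ab_group_add) hopf"
    and \<sigma> :: "('k \<Rightarrow> 'f) \<Rightarrow> 'h \<Rightarrow> 'f"
    and X :: "'k set"
  assumes "is_hopf H" and "fin_dim H" and "is_hopf K" and "fin_dim K"
    and "hopf_pairing (dual_hopf K) H \<sigma>"
    and "is_basis (sys_C K) X"
  shows
    "partially_admissible (sys_A K H) (sys_B H) (sys_coact K H \<sigma>) (sys_C K) (sys_act K H \<sigma>)
       (sys_iota K H \<sigma>) (sys_pi K H \<sigma>) (sys_zeta K H) (sys_gamma K H) \<and>
     (let D = left_partial_dual (sys_A K H) (sys_B H) (sys_coact K H \<sigma>) (sys_C K) (sys_act K H \<sigma>)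
                (sys_iota K H \<sigma>) (sys_pi K H \<sigma>) (sys_zeta K H) (sys_gamma K H) X
      in trivial_associator D \<and> is_hopf (hopf_of_quasi D) \<and>
         same_hopf (hopf_of_quasi D) (quantum_double K H \<sigma>))"
proof -
  interpret paired_hopf K H \<sigma> by unfold_locales (fact assms)+
  have C: "sys_C K = coalg_of K" by simp
  have X: "is_basis K X" using assms(6) by (simp add: C)
  show ?thesis
    unfolding Let_def C
    using system_partially_admissible[unfolded C] assoc_Dq[OF X] Dh_hopf[OF X] Dh_double[OF X] by blast
qed

end
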